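(* Let $d\ge2$ and $\epsilon\in\,]0,\frac12[$. There exists a constant $C>0$ such that for all $u_0\in L^2(\mathbb{R}^d)$, $$\Big\|\frac1{\langle x\rangle^{1/2-\epsilon}}\,\sqrt H^{\,1/2-2\epsilon}e^{itH}u_0\Big\|_{L^2([-\pi,\pi]\times\mathbb{R}^d)}\le C\|u_0\|_{L^2(\mathbb{R}^d)},$$ and for all $u_0\in\mathcal{H}^{\frac{d-1}2}(\mathbb{R}^d)$, $$\Big\|\frac1{\langle x\rangle^{1/2-\epsilon}}\,\sqrt{-\Delta}^{\,d/2-2\epsilon}e^{itH}u_0\Big\|_{L^2([-\pi,\pi]\times\mathbb{R}^d)}\le C\|u_0\|_{\mathcal{H}^{\frac{d-1}2}(\mathbb{R}^d)}.$$
   Context: $H=-\Delta+|x|^2$ is the harmonic oscillator on $\mathbb{R}^d$; $\sqrt H^{\,a}=H^{a/2}$ and $\sqrt{-\Delta}^{\,a}=(-\Delta)^{a/2}$. $\langle x\rangle=\sqrt{1+|x|^2}$. $\mathcal{H}^s(\mathbb{R}^d)$ is the harmonic Sobolev space with norm $\|u\|_{\mathcal{H}^s}=\|H^{s/2}u\|_{L^2}$. *)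

theory Defs
  imports "HOL-Analysis.Analysis"
begin

definition japanese_bracket :: "'a::real_normed_vector \<Rightarrow> real"
  where "japanese_bracket x = sqrt (1 + (norm x)\<^sup>2)"

text \<open>
  The value is infinite exactly when \<open>f\<close> is not in \<open>L\<^sup>2\<close>, so that finiteness
  of the norm expresses membership.
\<close>
definition L2_norm :: "'b measure \<Rightarrow> ('b \<Rightarrow> complex) \<Rightarrow> ennreal"
  where "L2_norm M f =
    (if f \<in> borel_measurable M \<and> integrable M (\<lambda>x. (cmod (f x))\<^sup>2)
     then ennreal (sqrt (\<integral>x. (cmod (f x))\<^sup>2 \<partial>M)) else \<infinity>)"

definition L2 :: "('a::euclidean_space \<Rightarrow> complex) set"
  where "L2 = {u. L2_norm lborel u < \<infinity>}"


definition partial_deriv ::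
    "'a::euclidean_space \<Rightarrow> ('a \<Rightarrow> complex) \<Rightarrow> 'a \<Rightarrow> complex"
  where "partial_deriv b f x = frechet_derivative f (at x) b"

definition iter_partial ::
    "'a::euclidean_space list \<Rightarrow> ('a \<Rightarrow> complex) \<Rightarrow> 'a \<Rightarrow> complex"
  where "iter_partial bs f = foldr partial_deriv bs f"

definition schwartz :: "('a::euclidean_space \<Rightarrow> complex) set"
  where "schwartz = {f. \<forall>bs. set bs \<subseteq> Basis \<longrightarrow>
    (\<forall>x. iter_partial bs f differentiable (at x)) \<and>
    (\<forall>k::nat. bounded (range (\<lambda>x. of_real (norm x ^ k) * iter_partial bs f x)))}"

definition laplacian :: "('a::euclidean_space \<Rightarrow> complex) \<Rightarrow> 'a \<Rightarrow> complex"
  where "laplacian f x = (\<Sum>b\<in>Basis. partial_deriv b (partial_deriv b f) x)"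


text \<open>
  Tempered distributions are functionals on complex functions of which only the
  values on \<^const>\<open>schwartz\<close> matter. The pairing is bilinear (no conjugation).
\<close>
type_synonym 'a distr = "('a \<Rightarrow> complex) \<Rightarrow> complex"

definition distr_of :: "('a::euclidean_space \<Rightarrow> complex) \<Rightarrow> 'a distr"
  where "distr_of u \<phi> = (\<integral>x. u x * \<phi> x \<partial>lborel)"

definition represents :: "('a::euclidean_space \<Rightarrow> complex) \<Rightarrow> 'a distr \<Rightarrow> bool"
  where "represents g T \<longleftrightarrow> g \<in> borel_measurable lborel \<and>
    (\<forall>\<phi>\<in>schwartz. integrable lborel (\<lambda>x. g x * \<phi> x) \<and> T \<phi> = distr_of g \<phi>)"

definition distr_mult :: "('a \<Rightarrow> real) \<Rightarrow> 'a distr \<Rightarrow> 'a distr"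
  where "distr_mult w T \<phi> = T (\<lambda>x. of_real (w x) * \<phi> x)"

text \<open>
  Representing functions are unique almost everywhere, so the infima below are
  over a single value, or are infinite if the distribution is not a function.
\<close>
definition distr_L2_norm :: "'a::euclidean_space distr \<Rightarrow> ennreal"
  where "distr_L2_norm T = Inf {L2_norm lborel g | g. represents g T}"

definition spacetime_L2_norm ::
    "real set \<Rightarrow> (real \<Rightarrow> 'a::euclidean_space distr) \<Rightarrow> ennreal"
  where "spacetime_L2_norm I T =
    Inf {L2_norm (restrict_space lborel I \<Otimes>\<^sub>M lborel) g | g.
      g \<in> borel_measurable (restrict_space lborel I \<Otimes>\<^sub>M lborel) \<and>
      (AE t in restrict_space lborel I. represents (\<lambda>x. g (t, x)) (T t))}"


definition harmonic_oscillator :: "('a::euclidean_space \<Rightarrow> complex) \<Rightarrow> 'a \<Rightarrow> complex"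
  where "harmonic_oscillator f x = - laplacian f x + of_real ((norm x)\<^sup>2) * f x"

definition H_eigenspace :: "real \<Rightarrow> ('a::euclidean_space \<Rightarrow> complex) set"
  where "H_eigenspace l =
    {f\<in>schwartz. \<forall>x. harmonic_oscillator f x = of_real l * f x}"

definition H_spectrum :: "'a::euclidean_space itself \<Rightarrow> real set"
  where "H_spectrum _ =
    {l. \<exists>f\<in>(H_eigenspace l :: ('a \<Rightarrow> complex) set). \<exists>x. f x \<noteq> 0}"

definition H_proj ::
    "real \<Rightarrow> ('a::euclidean_space \<Rightarrow> complex) \<Rightarrow> 'a \<Rightarrow> complex"
  where "H_proj l f = (THE p. p \<in> H_eigenspace l \<and>
    (\<forall>q\<in>H_eigenspace l. (\<integral>x. (f x - p x) * cnj (q x) \<partial>lborel) = 0))"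

text \<open>
  The self-adjoint realization of \<open>H = -\<Delta> + |x|\<^sup>2\<close> has compact resolvent, its
  eigenvalues are positive and its eigenfunctions are Schwartz functions. Its
  spectral theorem is therefore \<open>F(H) = \<Sum>\<^sub>\<lambda> F(\<lambda>) P\<^sub>\<lambda>\<close>, where \<open>P\<^sub>\<lambda>\<close> projects
  orthogonally onto the eigenspace. On Schwartz functions, and for \<open>F\<close> of
  polynomial growth, the sum converges absolutely at every point to a Schwartz
  function. As \<open>F(H)\<close> is its own transpose for the bilinear pairing (also for
  complex \<open>F\<close>), it extends to tempered distributions by duality.
\<close>
definition H_fun ::
    "(real \<Rightarrow> complex) \<Rightarrow> ('a::euclidean_space \<Rightarrow> complex) \<Rightarrow> 'a \<Rightarrow> complex"
  where "H_fun F \<phi> x = (\<Sum>\<^sub>\<infinity>l\<in>H_spectrum TYPE('a). F l * H_proj l \<phi> x)"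

definition H_fun_distr ::
    "(real \<Rightarrow> complex) \<Rightarrow> 'a::euclidean_space distr \<Rightarrow> 'a distr"
  where "H_fun_distr F T \<phi> = T (H_fun F \<phi>)"

text \<open>\<open>(\<surd>H)\<^sup>a = H\<^sup>a\<^sup>/\<^sup>2\<close>\<close>
definition sqrt_H_pow :: "real \<Rightarrow> 'a::euclidean_space distr \<Rightarrow> 'a distr"
  where "sqrt_H_pow a = H_fun_distr (\<lambda>l. of_real (l powr (a / 2)))"

text \<open>\<open>e\<^sup>i\<^sup>t\<^sup>H\<close>\<close>
definition exp_itH :: "real \<Rightarrow> 'a::euclidean_space distr \<Rightarrow> 'a distr"
  where "exp_itH t = H_fun_distr (\<lambda>l. exp (\<i> * of_real (t * l)))"

definition harmonic_sobolev_norm ::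
    "real \<Rightarrow> ('a::euclidean_space \<Rightarrow> complex) \<Rightarrow> ennreal"
  where "harmonic_sobolev_norm s u = distr_L2_norm (sqrt_H_pow s (distr_of u))"

text \<open>
  Intended for \<open>s \<ge> 0\<close>, where every element is an \<open>L\<^sup>2\<close> function.
\<close>
definition harmonic_sobolev :: "real \<Rightarrow> ('a::euclidean_space \<Rightarrow> complex) set"
  where "harmonic_sobolev s = {u\<in>L2. harmonic_sobolev_norm s u < \<infinity>}"


definition fourier :: "('a::euclidean_space \<Rightarrow> complex) \<Rightarrow> 'a \<Rightarrow> complex"
  where "fourier \<phi> \<xi> = (\<integral>x. exp (- \<i> * of_real (x \<bullet> \<xi>)) * \<phi> x \<partial>lborel)"

definition inv_fourier :: "('a::euclidean_space \<Rightarrow> complex) \<Rightarrow> 'a \<Rightarrow> complex"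
  where "inv_fourier \<phi> x =
    (\<integral>\<xi>. exp (\<i> * of_real (x \<bullet> \<xi>)) * \<phi> \<xi> \<partial>lborel) / of_real ((2 * pi) ^ DIM('a))"

definition fourier_distr :: "'a::euclidean_space distr \<Rightarrow> 'a distr"
  where "fourier_distr T \<phi> = T (fourier \<phi>)"

definition inv_fourier_distr :: "'a::euclidean_space distr \<Rightarrow> 'a distr"
  where "inv_fourier_distr T \<phi> = T (inv_fourier \<phi>)"

text \<open>
  \<open>(\<surd>-\<Delta>)\<^sup>a = (-\<Delta>)\<^sup>a\<^sup>/\<^sup>2\<close> as the Fourier multiplier \<open>|\<xi>|\<^sup>a\<close>. The symbol is not smooth at
  the origin, so it acts on those tempered distributions whose Fourier transform
  is a function; for \<open>a \<ge> 0\<close> this includes all of \<open>L\<^sup>2\<close>. The choice of the function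
  is immaterial, since it is unique almost everywhere.
\<close>
definition sqrt_neg_laplacian_pow :: "real \<Rightarrow> 'a::euclidean_space distr \<Rightarrow> 'a distr"
  where "sqrt_neg_laplacian_pow a T =
    (let m = (SOME m. represents m (fourier_distr T))
     in inv_fourier_distr (distr_of (\<lambda>\<xi>. of_real (norm \<xi> powr a) * m \<xi>)))"

end

theory Submission imports Defs
begin

text \<open>
  The eigenvalues of \<open>H\<close> are the numbers \<open>d + 2n\<close>. They differ by even integers, so
  the functions \<open>e\<^sup>i\<^sup>t\<^sup>\<lambda>\<close> are orthogonal on \<open>[-\<pi>,\<pi>]\<close>, and the squared space-time norm of
  \<open>\<Sum> e\<^sup>i\<^sup>t\<^sup>\<lambda> \<psi>\<^sub>\<lambda>\<close> is \<open>2\<pi> \<Sum> \<parallel>\<psi>\<^sub>\<lambda>\<parallel>\<^sup>2\<close>, whatever the functions \<open>\<psi>\<^sub>\<lambda>\<close> of \<open>x\<close> are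
  (lemma \<open>spacetime_series\<close>). Taking \<open>\<psi>\<^sub>\<lambda> = \<langle>x\<rangle>\<^sup>-\<^sup>p\<^sup>/\<^sup>2 A P\<^sub>\<lambda> u\<close> with \<open>p = 1 - 2\<epsilon>\<close> and \<open>A\<close> the operator
  in front of \<open>e\<^sup>i\<^sup>t\<^sup>H\<close>, both estimates reduce to a bound for a single eigenfunction \<open>f\<close> with
  eigenvalue \<open>\<lambda>\<close>, uniform in \<open>\<lambda>\<close>.

  For the first estimate the bound is \<open>\<integral> \<langle>x\<rangle>\<^sup>-\<^sup>p |f|\<^sup>2 \<le> C \<lambda>\<^sup>-\<^sup>p\<^sup>/\<^sup>2 \<parallel>f\<parallel>\<^sup>2\<close> (lemma \<open>eigen_weighted_bound\<close>):
  the mass of \<open>f\<close> spreads over the ball of radius \<open>\<surd>\<lambda>\<close> like a classical orbit of energy \<open>\<lambda>\<close>.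
  It follows from a virial identity, in which the eigenvalue equation is paired with
  \<open>\<langle>x\<rangle>\<^sup>-\<^sup>p (x \<cdot> \<nabla>) f\<close>; the assumption \<open>p < 1\<close> leaves a positive multiple \<open>2(1-p)\<lambda>\<close> of the weighted
  mass. Multiplying by \<open>\<lambda>\<^sup>1\<^sup>/\<^sup>2\<^sup>-\<^sup>2\<^sup>\<epsilon>\<close>, the square of the factor from \<open>\<surd>H\<close>, leaves \<open>\<lambda>\<^sup>-\<^sup>\<epsilon> \<le> 1\<close>.

  For the second estimate the Fourier transform maps each eigenspace to itself and acts on it
  as a scalar (lemma \<open>FT_eigen\<close>), so one has to bound the Fourier integral of
  \<open>|\<xi>|\<^sup>a f(\<xi>)\<close>, \<open>a = d/2 - 2\<epsilon>\<close>, for an eigenfunction \<open>f\<close>. With \<open>\<beta> = N - a/2\<close>,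
  \<open>\<Gamma>(\<beta>) |\<xi>|\<^sup>a = \<integral> s\<^sup>\<beta>\<^sup>-\<^sup>1 |\<xi>|\<^sup>2\<^sup>N e\<^sup>-\<^sup>s\<^sup>|\<^sup>\<xi>\<^sup>|\<^sup>2 ds\<close>. For \<open>s \<le> 1\<close> the multiplier is convolution
  with a dilated Schwartz kernel, which is bounded in the weighted space by Peetre's inequality,
  and \<open>|\<xi>|\<^sup>2\<^sup>N f\<close> is a sum of eigenfunctions with eigenvalues comparable to \<open>\<lambda>\<close>, because
  coordinates are combinations of ladder operators. So the piece at \<open>s\<close> has weighted norm at
  most a constant times \<open>min(\<lambda>\<^sup>N, s\<^sup>-\<^sup>N) \<lambda>\<^sup>-\<^sup>p\<^sup>/\<^sup>4\<close>, and for \<open>s \<ge> 1\<close> it is at most a constant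
  times \<open>s\<^sup>-\<^sup>N\<close>. Integrating in \<open>s\<close>, with the crossover at \<open>s = 1/\<lambda>\<close>, gives the bound
  \<open>C (\<lambda>\<^sup>a\<^sup>/\<^sup>2\<^sup>-\<^sup>p\<^sup>/\<^sup>4 + 1) \<parallel>f\<parallel>\<close> (lemma \<open>fractional_laplacian_bound\<close>), and
  \<open>a/2 - p/4 = (d-1)/4 - \<epsilon>/2\<close>, so the square is controlled by \<open>\<lambda>\<^sup>(\<^sup>d\<^sup>-\<^sup>1\<^sup>)\<^sup>/\<^sup>2 \<parallel>f\<parallel>\<^sup>2\<close>.

  The spectral theory rests on the ladder operators \<open>x\<^sub>b \<plusminus> \<partial>\<^sub>b\<close>. They move between neighbouring
  eigenspaces, show that every eigenvalue is of the form \<open>d + 2n\<close>, and give the orthogonal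
  projections by recursion from the gaussian (lemma \<open>eigen_riesz\<close>). Bessel's inequality, the
  symmetry of the projections for the bilinear pairing and the rapid decay of the projections of
  a Schwartz function then turn the pairing of an \<open>L\<^sup>2\<close> function with \<open>F(H) \<phi>\<close> into a convergent
  series (lemma \<open>H_fun_series\<close>). The Fourier multiplier is applied to a function chosen as a
  representative of a distribution; that all representatives agree almost everywhere is the
  uniqueness theorem for Fourier integrals (lemma \<open>test_function_uniqueness\<close>).
\<close>

section \<open>Schwartz functions\<close>

lemma power_le_fact_exp: "(y::real) \<ge> 0 \<Longrightarrow> y ^ n \<le> fact n * exp y"
proof -
  assume y: "y \<ge> 0"
  have "(\<Sum>i\<in>{n}. y^i / fact i) \<le> (\<Sum>i. y^i / fact i)"
    using y summable_exp_generic[of y]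
    by (intro sum_le_suminf) (auto simp: divide_inverse mult.commute)
  then have "y^n / fact n \<le> exp y" by (simp add: exp_def divide_inverse mult.commute)
  then show ?thesis by (simp add: divide_le_eq mult.commute)
qed

lemma japanese_bracket_ge_1: "japanese_bracket x \<ge> 1"
  by (simp add: japanese_bracket_def)

lemma japanese_bracket_pos [simp]: "japanese_bracket x > 0"
  using japanese_bracket_ge_1[of x] by linarith

lemma japanese_bracket_nonneg [simp]: "0 \<le> japanese_bracket x"
  by (simp add: less_imp_le)

lemma japanese_bracket_sq: "(japanese_bracket x)\<^sup>2 = 1 + (norm x)\<^sup>2"
  by (simp add: japanese_bracket_def add_nonneg_nonneg)

lemma japanese_bracket_le: "japanese_bracket x \<le> 1 + norm x"
  by (rule power2_le_imp_le) (simp_all add: japanese_bracket_sq power2_sum)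

lemma norm_le_japanese_bracket: "norm x \<le> japanese_bracket x"
  by (rule power2_le_imp_le) (auto simp: japanese_bracket_sq)

lemma japanese_bracket_powr_le: "japanese_bracket x powr t \<le> (1 + norm x) ^ nat \<lceil>\<bar>t\<bar>\<rceil>"
proof -
  have "japanese_bracket x powr t \<le> japanese_bracket x powr real (nat \<lceil>\<bar>t\<bar>\<rceil>)"
    by (rule powr_mono) (use japanese_bracket_ge_1[of x] in linarith)+
  also have "\<dots> = japanese_bracket x ^ nat \<lceil>\<bar>t\<bar>\<rceil>" by (rule powr_realpow) simp
  also have "\<dots> \<le> (1 + norm x) ^ nat \<lceil>\<bar>t\<bar>\<rceil>"
    by (intro power_mono japanese_bracket_le) (simp add: less_imp_le)
  finally show ?thesis .
qed

lemma has_derivative_japanese_powr: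
  "((\<lambda>x. japanese_bracket x powr t) has_derivative (\<lambda>h. t * (x \<bullet> h) * japanese_bracket x powr (t - 2))) (at x)"
proof -
  have eq: "japanese_bracket = (\<lambda>x::'a. sqrt (1 + x \<bullet> x))"
    by (auto simp: japanese_bracket_def power2_norm_eq_inner)
  have pos: "1 + x \<bullet> x > 0" by (simp add: add_pos_nonneg)
  have p2: "sqrt (1 + x \<bullet> x) powr (t - 2) = sqrt (1 + x \<bullet> x) powr t / (1 + x \<bullet> x)"
    using pos by (simp add: powr_diff )
  show ?thesis
    unfolding eq using pos
    by (auto intro!: derivative_eq_intros simp: p2 inner_commute field_simps fun_eq_iff)
qed

text \<open>
  Powers of \<open>1 + |x|\<close> dominate every polynomial weight and are nonzero at the origin, so one
  inequality expresses both boundedness and decay.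
\<close>
definition rapidly_decreasing :: "('a::euclidean_space \<Rightarrow> complex) \<Rightarrow> bool" where
  "rapidly_decreasing f \<longleftrightarrow> (\<forall>k. \<exists>C. \<forall>x. (1 + norm x) ^ k * cmod (f x) \<le> C)"

lemma rapidly_decreasingD:
  assumes "rapidly_decreasing f"
  obtains C where "C \<ge> 0" "\<And>x. (1 + norm x) ^ k * cmod (f x) \<le> C"
proof -
  obtain C where C: "\<And>x. (1 + norm x) ^ k * cmod (f x) \<le> C"
    using assms unfolding rapidly_decreasing_def by blast
  have "0 \<le> C" by (rule order_trans[OF _ C[of 0]]) simp
  then show ?thesis using C that by blast
qed

lemma rapidly_decreasing_iff:
  "rapidly_decreasing f \<longleftrightarrow> (\<forall>k::nat. bounded (range (\<lambda>x. of_real (norm x ^ k) * f x)))"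
proof
  assume r: "rapidly_decreasing f"
  show "\<forall>k::nat. bounded (range (\<lambda>x. of_real (norm x ^ k) * f x))"
  proof
    fix k
    obtain C where C: "\<And>x. (1 + norm x) ^ k * cmod (f x) \<le> C"
      using rapidly_decreasingD[OF r] by metis
    have "norm (of_real (norm x ^ k) * f x) \<le> C" for x
    proof -
      have "norm x ^ k * cmod (f x) \<le> (1 + norm x) ^ k * cmod (f x)"
        by (intro mult_right_mono power_mono) auto
      then show ?thesis using C[of x] by (simp add: norm_mult norm_power)
    qed
    then show "bounded (range (\<lambda>x. of_real (norm x ^ k) * f x))"
      by (auto simp: bounded_iff)
  qed
next
  assume b: "\<forall>k::nat. bounded (range (\<lambda>x. of_real (norm x ^ k) * f x))"
  show "rapidly_decreasing f" unfolding rapidly_decreasing_def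
  proof
    fix k
    obtain A where A: "\<And>x. cmod (f x) \<le> A"
      using b[rule_format, of 0] by (auto simp: bounded_iff)
    obtain B where B: "\<And>x. norm x ^ k * cmod (f x) \<le> B"
      using b[rule_format, of k] by (auto simp: bounded_iff norm_mult norm_power)
    have "(1 + norm x) ^ k * cmod (f x) \<le> 2 ^ k * (A + B)" for x
    proof -
      have "(1 + norm x) ^ k \<le> 2 ^ k * (1 + norm x ^ k)"
      proof (cases "norm x \<le> 1")
        case True
        then have "(1 + norm x) ^ k \<le> 2 ^ k" by (intro power_mono) auto
        then show ?thesis by (simp add: algebra_simps add_increasing2)
      next
        case False
        then have "(1 + norm x) ^ k \<le> (2 * norm x) ^ k" by (intro power_mono) auto
        then show ?thesis by (simp add: algebra_simps power_mult_distrib add_increasing)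
      qed
      then have "(1 + norm x) ^ k * cmod (f x) \<le> 2 ^ k * (1 + norm x ^ k) * cmod (f x)"
        by (rule mult_right_mono) simp
      also have "\<dots> = 2 ^ k * (cmod (f x) + norm x ^ k * cmod (f x))" by (simp add: algebra_simps)
      also have "\<dots> \<le> 2 ^ k * (A + B)" by (intro mult_left_mono add_mono A B) auto
      finally show ?thesis .
    qed
    then show "\<exists>C. \<forall>x. (1 + norm x) ^ k * cmod (f x) \<le> C" by blast
  qed
qed

lemma rapidly_decreasing_mult_poly:
  assumes f: "rapidly_decreasing f" and g: "\<And>x. cmod (g x) \<le> A * (1 + norm x) ^ m"
  shows "rapidly_decreasing (\<lambda>x. g x * f x)"
  unfolding rapidly_decreasing_def
proof
  fix k
  obtain C where C: "\<And>x. (1 + norm x) ^ (k + m) * cmod (f x) \<le> C"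
    using rapidly_decreasingD[OF f] by metis
  have A: "A \<ge> 0" using g[of 0] by simp (metis norm_ge_zero order_trans)
  have "(1 + norm x) ^ k * cmod (g x * f x) \<le> A * C" for x
  proof -
    have "(1 + norm x) ^ k * cmod (g x * f x) \<le> (1 + norm x) ^ k * (A * (1 + norm x) ^ m * cmod (f x))"
      unfolding norm_mult by (intro mult_left_mono mult_right_mono g) auto
    also have "\<dots> = A * ((1 + norm x) ^ (k + m) * cmod (f x))" by (simp add: power_add algebra_simps)
    also have "\<dots> \<le> A * C" by (intro mult_left_mono C A)
    finally show ?thesis .
  qed
  then show "\<exists>C. \<forall>x. (1 + norm x) ^ k * cmod (g x * f x) \<le> C" by blast
qed

lemma rapidly_decreasing_add:
  assumes f: "rapidly_decreasing f" and g: "rapidly_decreasing g"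
  shows "rapidly_decreasing (\<lambda>x. f x + g x)"
  unfolding rapidly_decreasing_def
proof
  fix k
  obtain C where C: "\<And>x. (1 + norm x) ^ k * cmod (f x) \<le> C"
    using rapidly_decreasingD[OF f] by metis
  obtain D where D: "\<And>x. (1 + norm x) ^ k * cmod (g x) \<le> D"
    using rapidly_decreasingD[OF g] by metis
  have "(1 + norm x) ^ k * cmod (f x + g x) \<le> C + D" for x
  proof -
    have "(1 + norm x) ^ k * cmod (f x + g x) \<le> (1 + norm x) ^ k * (cmod (f x) + cmod (g x))"
      by (intro mult_left_mono norm_triangle_ineq) auto
    then show ?thesis using C[of x] D[of x] by (simp add: algebra_simps)
  qed
  then show "\<exists>C. \<forall>x. (1 + norm x) ^ k * cmod (f x + g x) \<le> C" by blast
qed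

text \<open>
  For \<open>s > 0\<close> the exponential series gives \<open>(s (1 + |x|\<^sup>2))\<^sup>k \<le> k! e\<^sup>s e\<^sup>s\<^sup>|\<^sup>x\<^sup>|\<^sup>2\<close>.
\<close>
lemma rapidly_decreasing_gauss:
  assumes "s > 0"
  shows "rapidly_decreasing (\<lambda>x::'a::euclidean_space. of_real (exp (- s * (norm x)\<^sup>2)))"
  unfolding rapidly_decreasing_def
proof
  fix k
  have "(1 + norm x) ^ k * cmod (of_real (exp (- s * (norm x)\<^sup>2))) \<le> (2 / s) ^ k * (fact k * exp s)" for x :: 'a
  proof -
    have "(1 + norm x) ^ k \<le> (1 + norm x) ^ (2 * k)" by (intro power_increasing) auto
    also have "\<dots> = ((1 + norm x)\<^sup>2) ^ k" by (simp add: power_mult)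
    also have "\<dots> \<le> (2 * (1 + (norm x)\<^sup>2)) ^ k"
      using sum_squares_bound[of 1 "norm x"]
      by (intro power_mono) (auto simp: power2_eq_square algebra_simps)
    also have "\<dots> = (2 / s) ^ k * (s * (1 + (norm x)\<^sup>2)) ^ k"
      using assms by (simp add: power_mult_distrib[symmetric])
    also have "\<dots> \<le> (2 / s) ^ k * (fact k * exp (s * (1 + (norm x)\<^sup>2)))"
      using assms by (intro mult_left_mono power_le_fact_exp) auto
    finally have "(1 + norm x) ^ k * exp (- s * (norm x)\<^sup>2) \<le>
        (2 / s) ^ k * (fact k * exp (s * (1 + (norm x)\<^sup>2))) * exp (- s * (norm x)\<^sup>2)"
      by (rule mult_right_mono) simp
    also have "\<dots> = (2 / s) ^ k * (fact k * (exp (s * (1 + (norm x)\<^sup>2)) * exp (- s * (norm x)\<^sup>2)))"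
      by (simp only: mult.assoc)
    also have "\<dots> = (2 / s) ^ k * (fact k * exp s)"
      by (simp add: exp_add[symmetric] algebra_simps)
    finally show ?thesis by simp
  qed
  then show "\<exists>C. \<forall>x::'a. (1 + norm x) ^ k * cmod (of_real (exp (- s * (norm x)\<^sup>2))) \<le> C" by blast
qed

lemma partial_deriv_eq: "(f has_derivative D) (at x) \<Longrightarrow> partial_deriv b f x = D b"
  unfolding partial_deriv_def using frechet_derivative_at by metis

text \<open>
  The closure of the Schwartz space under the operations that are needed below. All its members
  are rapidly decreasing and it is stable under partial derivatives, so it equals the
  Schwartz space; this yields all closure properties at once, without Leibniz formulas for
  iterated derivatives.
\<close>
inductive_set schwartz_closure :: "('a::euclidean_space \<Rightarrow> complex) set" where
  incl: "f \<in> schwartz \<Longrightarrow> f \<in> schwartz_closure"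
| gauss: "s > 0 \<Longrightarrow> (\<lambda>x. of_real (exp (- s * (norm x)\<^sup>2))) \<in> schwartz_closure"
| add: "f \<in> schwartz_closure \<Longrightarrow> g \<in> schwartz_closure \<Longrightarrow> (\<lambda>x. f x + g x) \<in> schwartz_closure"
| mult: "f \<in> schwartz_closure \<Longrightarrow> g \<in> schwartz_closure \<Longrightarrow> (\<lambda>x. f x * g x) \<in> schwartz_closure"
| scale: "f \<in> schwartz_closure \<Longrightarrow> (\<lambda>x. c * f x) \<in> schwartz_closure"
| cnj: "f \<in> schwartz_closure \<Longrightarrow> (\<lambda>x. cnj (f x)) \<in> schwartz_closure"
| coord: "f \<in> schwartz_closure \<Longrightarrow> (\<lambda>x. of_real (x \<bullet> v) * f x) \<in> schwartz_closure"
| bracket: "f \<in> schwartz_closure \<Longrightarrow> (\<lambda>x. of_real (japanese_bracket x powr t) * f x) \<in> schwartz_closure"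
| char: "f \<in> schwartz_closure \<Longrightarrow> (\<lambda>x. exp (\<i> * of_real (x \<bullet> v)) * f x) \<in> schwartz_closure"

lemma schwartz_differentiable: "f \<in> schwartz \<Longrightarrow> f differentiable (at x)"
  unfolding schwartz_def iter_partial_def by (auto dest: spec[of _ "[]"])

lemma schwartz_has_derivative:
  "f \<in> schwartz \<Longrightarrow> (f has_derivative (\<lambda>h. partial_deriv h f x)) (at x)"
  unfolding partial_deriv_def using schwartz_differentiable frechet_derivative_works by (metis eta_contract_eq)

lemma schwartz_rapid: "f \<in> schwartz \<Longrightarrow> rapidly_decreasing f"
  unfolding schwartz_def iter_partial_def rapidly_decreasing_iff by (auto dest: spec[of _ "[]"])

lemma schwartz_partial_deriv: "f \<in> schwartz \<Longrightarrow> b \<in> Basis \<Longrightarrow> partial_deriv b f \<in> schwartz"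
proof -
  assume f: "f \<in> schwartz" and b: "b \<in> Basis"
  have "iter_partial bs (partial_deriv b f) = iter_partial (bs @ [b]) f" for bs
    by (simp add: iter_partial_def)
  then show ?thesis using f b unfolding schwartz_def by auto
qed

lemma has_derivative_cnj: "(f has_derivative D) F \<Longrightarrow> ((\<lambda>x. cnj (f x)) has_derivative (\<lambda>x. cnj (D x))) F"
  by (rule bounded_linear.has_derivative[OF bounded_linear_cnj])

text \<open>
  The third conjunct alone would not be inductive for iterated derivatives: the derivatives have
  to stay in the class, which is what the second conjunct provides.
\<close>
lemma schwartz_closure_step:
  fixes f :: "'a::euclidean_space \<Rightarrow> complex"
  assumes "f \<in> schwartz_closure"
  shows "\<exists>f'. (\<forall>x. (f has_derivative (\<lambda>h. f' h x)) (at x)) \<and> (\<forall>b\<in>Basis. f' b \<in> schwartz_closure)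
    \<and> rapidly_decreasing f"
  using assms
proof induction
  case (incl f)
  then show ?case
    by (intro exI[of _ "\<lambda>h. partial_deriv h f"])
      (auto simp: schwartz_has_derivative schwartz_partial_deriv schwartz_rapid schwartz_closure.incl)
next
  case (gauss s)
  let ?g = "\<lambda>x::'a. complex_of_real (exp (- s * (norm x)\<^sup>2))"
  have "(?g has_derivative (\<lambda>h. of_real (x \<bullet> h) * (of_real (- 2 * s) * ?g x))) (at x)" for x
  proof -
    have "((\<lambda>x::'a. exp (- s * (x \<bullet> x))) has_derivative (\<lambda>h. (x \<bullet> h) * ((- 2 * s) * exp (- s * (x \<bullet> x))))) (at x)"
      by (auto intro!: derivative_eq_intros simp: inner_commute algebra_simps fun_eq_iff)
    from has_derivative_of_real[OF this] show ?thesis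
      by (simp add: power2_norm_eq_inner)
  qed
  then show ?case
    by (intro exI[of _ "\<lambda>h x. of_real (x \<bullet> h) * (of_real (- 2 * s) * ?g x)"] conjI allI ballI
        schwartz_closure.coord schwartz_closure.scale schwartz_closure.gauss rapidly_decreasing_gauss gauss)
next
  case (add f g)
  then obtain f' g' where
    "\<forall>x. (f has_derivative (\<lambda>h. f' h x)) (at x)" "\<forall>b\<in>Basis. f' b \<in> schwartz_closure" "rapidly_decreasing f"
    "\<forall>x. (g has_derivative (\<lambda>h. g' h x)) (at x)" "\<forall>b\<in>Basis. g' b \<in> schwartz_closure" "rapidly_decreasing g"
    by blast
  then show ?case
    by (intro exI[of _ "\<lambda>h x. f' h x + g' h x"])
      (auto intro!: schwartz_closure.add rapidly_decreasing_add derivative_eq_intros)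
next
  case (mult f g)
  then obtain f' g' where fg:
    "\<forall>x. (f has_derivative (\<lambda>h. f' h x)) (at x)" "\<forall>b\<in>Basis. f' b \<in> schwartz_closure" "rapidly_decreasing f"
    "\<forall>x. (g has_derivative (\<lambda>h. g' h x)) (at x)" "\<forall>b\<in>Basis. g' b \<in> schwartz_closure" "rapidly_decreasing g"
    by blast
  obtain C where "\<And>x. (1 + norm x) ^ 0 * cmod (f x) \<le> C"
    using rapidly_decreasingD[OF fg(3)] by metis
  then have "rapidly_decreasing (\<lambda>x. f x * g x)"
    by (intro rapidly_decreasing_mult_poly[OF fg(6), of _ C 0]) auto
  then show ?case using fg mult
    by (intro exI[of _ "\<lambda>h x. f x * g' h x + f' h x * g x"])
      (auto intro!: schwartz_closure.add schwartz_closure.mult derivative_eq_intros)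
next
  case (scale f c)
  then obtain f' where f:
    "\<forall>x. (f has_derivative (\<lambda>h. f' h x)) (at x)" "\<forall>b\<in>Basis. f' b \<in> schwartz_closure" "rapidly_decreasing f"
    by blast
  have "rapidly_decreasing (\<lambda>x. c * f x)"
    by (rule rapidly_decreasing_mult_poly[OF f(3), of _ "cmod c" 0]) auto
  then show ?case using f
    by (intro exI[of _ "\<lambda>h x. c * f' h x"])
      (auto intro!: schwartz_closure.scale derivative_eq_intros)
next
  case (cnj f)
  then obtain f' where f:
    "\<forall>x. (f has_derivative (\<lambda>h. f' h x)) (at x)" "\<forall>b\<in>Basis. f' b \<in> schwartz_closure" "rapidly_decreasing f"
    by blast
  then have "rapidly_decreasing (\<lambda>x. cnj (f x))"
    by (simp add: rapidly_decreasing_def)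
  then show ?case using f
    by (intro exI[of _ "\<lambda>h x. cnj (f' h x)"])
      (auto intro!: schwartz_closure.cnj has_derivative_cnj)
next
  case (coord f v)
  then obtain f' where f:
    "\<forall>x. (f has_derivative (\<lambda>h. f' h x)) (at x)" "\<forall>b\<in>Basis. f' b \<in> schwartz_closure" "rapidly_decreasing f"
    by blast
  have bd: "\<bar>x \<bullet> v\<bar> \<le> norm v * (1 + norm x) ^ 1" for x
    using Cauchy_Schwarz_ineq2[of x v] by (simp add: algebra_simps add_increasing)
  have "rapidly_decreasing (\<lambda>x. of_real (x \<bullet> v) * f x)"
    by (rule rapidly_decreasing_mult_poly[OF f(3), of _ "norm v" 1]) (use bd in auto)
  moreover have "((\<lambda>x. of_real (x \<bullet> v) * f x) has_derivative
      (\<lambda>h. of_real (x \<bullet> v) * f' h x + of_real (h \<bullet> v) * f x)) (at x)" for x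
    using f(1) by (auto intro!: derivative_eq_intros)
  ultimately show ?case using f coord
    by (intro exI[of _ "\<lambda>h x. of_real (x \<bullet> v) * f' h x + of_real (h \<bullet> v) * f x"])
      (auto intro!: schwartz_closure.add schwartz_closure.coord schwartz_closure.scale)
next
  case (bracket f t)
  then obtain f' where f:
    "\<forall>x. (f has_derivative (\<lambda>h. f' h x)) (at x)" "\<forall>b\<in>Basis. f' b \<in> schwartz_closure" "rapidly_decreasing f"
    by blast
  have "rapidly_decreasing (\<lambda>x. of_real (japanese_bracket x powr t) * f x)"
    using japanese_bracket_powr_le
    by (intro rapidly_decreasing_mult_poly[OF f(3), of _ 1 "nat \<lceil>\<bar>t\<bar>\<rceil>"]) auto
  moreover have "((\<lambda>x. of_real (japanese_bracket x powr t) * f x) has_derivative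
      (\<lambda>h. of_real (japanese_bracket x powr t) * f' h x +
           of_real t * (of_real (japanese_bracket x powr (t - 2)) * (of_real (x \<bullet> h) * f x)))) (at x)" for x
    by (rule has_derivative_eq_rhs[OF has_derivative_mult[OF has_derivative_of_real[OF has_derivative_japanese_powr] f(1)[rule_format]]])
      (simp add: algebra_simps)
  ultimately show ?case using f bracket
    by (intro exI[of _ "\<lambda>h x. of_real (japanese_bracket x powr t) * f' h x +
           of_real t * (of_real (japanese_bracket x powr (t - 2)) * (of_real (x \<bullet> h) * f x))"])
      (auto intro!: schwartz_closure.add schwartz_closure.coord schwartz_closure.scale schwartz_closure.bracket)
next
  case (char f v)
  then obtain f' where f:
    "\<forall>x. (f has_derivative (\<lambda>h. f' h x)) (at x)" "\<forall>b\<in>Basis. f' b \<in> schwartz_closure" "rapidly_decreasing f"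
    by blast
  have "rapidly_decreasing (\<lambda>x. exp (\<i> * of_real (x \<bullet> v)) * f x)"
    by (rule rapidly_decreasing_mult_poly[OF f(3), of _ 1 0]) auto
  moreover have "((\<lambda>x. exp (\<i> * of_real (x \<bullet> v)) * f x) has_derivative
      (\<lambda>h. exp (\<i> * of_real (x \<bullet> v)) * f' h x +
           (\<i> * of_real (h \<bullet> v)) * (exp (\<i> * of_real (x \<bullet> v)) * f x))) (at x)" for x
  proof -
    have "((\<lambda>x. exp (\<i> * of_real (x \<bullet> v))) has_derivative
       (\<lambda>h. \<i> * of_real (h \<bullet> v) * exp (\<i> * of_real (x \<bullet> v)))) (at x)"
    proof -
      have i: "((\<lambda>x. \<i> * complex_of_real (x \<bullet> v)) has_derivative (\<lambda>h. \<i> * complex_of_real (h \<bullet> v))) (at x)"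
        by (auto intro!: derivative_eq_intros)
      have "(exp has_derivative (*) (exp (\<i> * complex_of_real (x \<bullet> v)))) (at (\<i> * complex_of_real (x \<bullet> v)))"
        using DERIV_exp unfolding has_field_derivative_def .
      from has_derivative_compose[OF i this] show ?thesis by (simp add: mult.commute)
    qed
    from has_derivative_mult[OF this f(1)[rule_format]] show ?thesis
      by (rule has_derivative_eq_rhs) (simp add: algebra_simps)
  qed
  ultimately show ?case using f char
    by (intro exI[of _ "\<lambda>h x. exp (\<i> * of_real (x \<bullet> v)) * f' h x +
           (\<i> * of_real (h \<bullet> v)) * (exp (\<i> * of_real (x \<bullet> v)) * f x)"])
      (auto intro!: schwartz_closure.add schwartz_closure.char schwartz_closure.scale)
qed

lemma schwartz_closure_partial:
  assumes "f \<in> schwartz_closure" "b \<in> Basis"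
  shows "partial_deriv b f \<in> schwartz_closure"
proof -
  obtain f' where f: "\<forall>x. (f has_derivative (\<lambda>h. f' h x)) (at x)" "\<forall>b\<in>Basis. f' b \<in> schwartz_closure"
    using schwartz_closure_step[OF assms(1)] by blast
  have "partial_deriv b f = f' b"
    using partial_deriv_eq f(1) by blast
  then show ?thesis using f assms by auto
qed

lemma schwartz_closure_eq: "schwartz_closure = schwartz"
proof
  show "schwartz_closure \<subseteq> (schwartz :: ('a \<Rightarrow> complex) set)"
  proof
    fix f :: "'a \<Rightarrow> complex" assume f: "f \<in> schwartz_closure"
    have it: "iter_partial bs f \<in> schwartz_closure" if "set bs \<subseteq> Basis" for bs
      using that f by (induction bs) (auto simp: iter_partial_def schwartz_closure_partial)
    show "f \<in> schwartz"
      unfolding schwartz_def rapidly_decreasing_iff[symmetric]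
      using schwartz_closure_step[OF it] unfolding differentiable_def by blast
  qed
qed (auto intro: schwartz_closure.incl)

lemmas schwartz_gauss = schwartz_closure.gauss[unfolded schwartz_closure_eq]
lemmas schwartz_add = schwartz_closure.add[unfolded schwartz_closure_eq]
lemmas schwartz_mult = schwartz_closure.mult[unfolded schwartz_closure_eq]
lemmas schwartz_scale = schwartz_closure.scale[unfolded schwartz_closure_eq]
lemmas schwartz_cnj = schwartz_closure.cnj[unfolded schwartz_closure_eq]
lemmas schwartz_coord = schwartz_closure.coord[unfolded schwartz_closure_eq]
lemmas schwartz_bracket = schwartz_closure.bracket[unfolded schwartz_closure_eq]
lemmas schwartz_char = schwartz_closure.char[unfolded schwartz_closure_eq]

section \<open>Integration by parts\<close>

lemma integrable_inverse_1_plus_sq: "(\<integral>\<^sup>+x. ennreal (1 / (1 + x\<^sup>2)) \<partial>(lborel::real measure)) < \<infinity>"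
proof -
  have pos: "1 + x\<^sup>2 > 0" for x :: real by (simp add: add_pos_nonneg)
  have half: "(\<integral>\<^sup>+x. ennreal (1 / (1 + x\<^sup>2)) * indicator {0..} x \<partial>(lborel::real measure)) = ennreal (pi/2 - arctan 0)"
    by (rule nn_integral_FTC_atLeast[where F=arctan])
      (use pos tendsto_arctan_at_top in \<open>auto intro!: derivative_eq_intros simp: less_imp_le field_simps\<close>)
  have "(\<integral>\<^sup>+x. ennreal (1 / (1 + x\<^sup>2)) * indicator {..0} x \<partial>(lborel::real measure)) =
     (\<integral>\<^sup>+x. ennreal (1 / (1 + x\<^sup>2)) * indicator {0..} x \<partial>(lborel::real measure))"
    by (subst nn_integral_real_affine[of _ "-1" 0])
      (auto intro!: nn_integral_cong simp: indicator_def)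
  then have other: "(\<integral>\<^sup>+x. ennreal (1 / (1 + x\<^sup>2)) * indicator {..0} x \<partial>(lborel::real measure)) = ennreal (pi/2)"
    using half by simp
  have "(\<integral>\<^sup>+x. ennreal (1 / (1 + x\<^sup>2)) \<partial>(lborel::real measure)) \<le>
    (\<integral>\<^sup>+x. ennreal (1 / (1 + x\<^sup>2)) * indicator {..0} x + ennreal (1 / (1 + x\<^sup>2)) * indicator {0..} x \<partial>(lborel::real measure))"
    by (intro nn_integral_mono) (auto simp: indicator_def)
  also have "\<dots> = ennreal (pi/2) + ennreal (pi/2 - arctan 0)"
    by (subst nn_integral_add) (auto simp: half other)
  also have "\<dots> < \<infinity>" by simp
  finally show ?thesis .
qed

text \<open>
  Since \<open>1 + x\<^sub>b\<^sup>2 \<le> (1 + |x|)\<^sup>2\<close> for each coordinate, \<open>(1 + |x|)\<^sup>-\<^sup>2\<^sup>d\<close> is dominated by a product of \<open>d\<close>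
  integrable functions of one variable.
\<close>
lemma integrable_decay:
  "integrable lborel (\<lambda>x::'a::euclidean_space. inverse ((1 + norm x) ^ (2 * DIM('a))))"
proof -
  have le: "inverse ((1 + norm x) ^ (2 * DIM('a))) \<le> (\<Prod>b\<in>Basis. 1 / (1 + (x \<bullet> b)\<^sup>2))" for x :: 'a
  proof -
    have "1 + (x \<bullet> b)\<^sup>2 \<le> (1 + norm x)\<^sup>2" if "b \<in> Basis" for b
    proof -
      have "\<bar>x \<bullet> b\<bar>\<^sup>2 \<le> (norm x)\<^sup>2" using Basis_le_norm[OF that] by (intro power_mono) auto
      then show ?thesis using norm_ge_zero[of x] by (simp add: power2_sum add_increasing2)
    qed
    then have "(\<Prod>b\<in>Basis. 1 + (x \<bullet> b)\<^sup>2) \<le> (\<Prod>b\<in>(Basis::'a set). (1 + norm x)\<^sup>2)"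
      by (intro prod_mono) auto
    also have "\<dots> = (1 + norm x) ^ (2 * DIM('a))"
      by (simp add: power_mult)
    finally have "inverse ((1 + norm x) ^ (2 * DIM('a))) \<le> inverse (\<Prod>b\<in>Basis. 1 + (x \<bullet> b)\<^sup>2)"
      by (intro le_imp_inverse_le prod_pos) (auto intro: add_pos_nonneg)
    also have "\<dots> = (\<Prod>b\<in>Basis. 1 / (1 + (x \<bullet> b)\<^sup>2))" by (simp add: prod_dividef inverse_eq_divide)
    finally show ?thesis .
  qed
  have "(\<integral>\<^sup>+x. ennreal (inverse ((1 + norm x) ^ (2 * DIM('a)))) \<partial>(lborel::'a measure)) \<le>
     (\<integral>\<^sup>+x. (\<Prod>b\<in>Basis. ennreal (1 / (1 + (x \<bullet> b)\<^sup>2))) \<partial>(lborel::'a measure))"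
    by (intro nn_integral_mono) (use le in \<open>auto simp: prod_ennreal add_nonneg_nonneg intro!: ennreal_leI\<close>)
  also have "\<dots> = (\<Prod>b\<in>(Basis::'a set). (\<integral>\<^sup>+x. ennreal (1 / (1 + x\<^sup>2)) \<partial>lborel))"
    by (rule nn_integral_lborel_prod) auto
  also have "\<dots> < \<infinity>"
    using integrable_inverse_1_plus_sq by (auto simp: power_less_top_ennreal)
  finally show ?thesis
    by (intro integrableI_bounded) auto
qed

lemma rapidly_decreasing_integrable:
  fixes f :: "'a::euclidean_space \<Rightarrow> complex"
  assumes "rapidly_decreasing f" "f \<in> borel_measurable borel"
  shows "integrable lborel f"
proof -
  obtain C where C: "\<And>x. (1 + norm x) ^ (2 * DIM('a)) * cmod (f x) \<le> C"
    using rapidly_decreasingD[OF assms(1)] by metis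
  show ?thesis
  proof (rule Bochner_Integration.integrable_bound)
    show "integrable lborel (\<lambda>x::'a. C * inverse ((1 + norm x) ^ (2 * DIM('a))))"
      using integrable_decay[where 'a='a] by simp
    show "AE x in lborel. norm (f x) \<le> norm (C * inverse ((1 + norm x) ^ (2 * DIM('a))))"
    proof (rule AE_I2)
      fix x :: 'a
      have p: "(1 + norm x) ^ (2 * DIM('a)) > 0" by (intro zero_less_power) (simp add: add_pos_nonneg)
      then have "cmod (f x) \<le> C * inverse ((1 + norm x) ^ (2 * DIM('a)))"
        using C[of x] by (simp add: field_simps)
      then show "norm (f x) \<le> norm (C * inverse ((1 + norm x) ^ (2 * DIM('a))))" by simp
    qed
  qed (use assms in auto)
qed

lemma schwartz_continuous: "f \<in> schwartz \<Longrightarrow> continuous_on UNIV f"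
  by (meson schwartz_differentiable differentiable_imp_continuous_on differentiable_at_imp_differentiable_on)

lemma schwartz_measurable: "f \<in> schwartz \<Longrightarrow> f \<in> borel_measurable borel"
  by (intro borel_measurable_continuous_onI schwartz_continuous)

lemma schwartz_integrable: "f \<in> schwartz \<Longrightarrow> integrable lborel f"
  by (intro rapidly_decreasing_integrable schwartz_rapid schwartz_measurable)

lemma lborel_integral_translate:
  fixes f :: "'a::euclidean_space \<Rightarrow> 'b::{banach, second_countable_topology}"
  assumes [measurable]: "f \<in> borel_measurable borel"
  shows "(\<integral>x. f (x + c) \<partial>lborel) = (\<integral>x. f x \<partial>lborel)"
proof -
  have "(\<integral>x. f x \<partial>lborel) = (\<integral>x. f x \<partial>(distr lborel borel ((+) c)))"
    by (simp add: lborel_distr_plus)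
  also have "\<dots> = (\<integral>x. f (c + x) \<partial>lborel)"
    by (intro integral_distr) auto
  finally show ?thesis by (simp add: add.commute)
qed

lemma lborel_nn_integral_translate:
  fixes f :: "'a::euclidean_space \<Rightarrow> ennreal"
  assumes [measurable]: "f \<in> borel_measurable borel"
  shows "(\<integral>\<^sup>+x. f (x + c) \<partial>lborel) = (\<integral>\<^sup>+x. f x \<partial>lborel)"
proof -
  have "(\<integral>\<^sup>+x. f x \<partial>lborel) = (\<integral>\<^sup>+x. f x \<partial>(distr lborel borel ((+) c)))"
    by (simp add: lborel_distr_plus)
  also have "\<dots> = (\<integral>\<^sup>+x. f (c + x) \<partial>lborel)"
    by (intro nn_integral_distr) auto
  finally show ?thesis by (simp add: add.commute)
qed

lemma directional_derivative_LIMSEQ: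
  fixes f :: "'a::euclidean_space \<Rightarrow> complex"
  assumes "(f has_derivative D) (at x)" "b \<noteq> 0"
  shows "(\<lambda>n. (f (x + (1 / real (Suc n)) *\<^sub>R b) - f x) / of_real (1 / real (Suc n))) \<longlonglongrightarrow> D b"
proof -
  interpret D: bounded_linear D using assms(1) by (rule has_derivative_bounded_linear)
  let ?h = "\<lambda>n. 1 / real (Suc n)"
  have h: "?h \<longlonglongrightarrow> 0" using LIMSEQ_inverse_real_of_nat by (simp add: inverse_eq_divide)
  have lim: "((\<lambda>h. norm (f (x + h) - f x - D h) / norm h) \<longlongrightarrow> 0) (at 0)"
    using assms(1) unfolding has_derivative_at by auto
  have "filterlim (\<lambda>n. ?h n *\<^sub>R b) (at 0) sequentially"
    using tendsto_scaleR[OF h tendsto_const[of b]] assms(2)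
    by (auto simp: filterlim_at)
  from filterlim_compose[OF lim this]
  have "(\<lambda>n. norm (f (x + ?h n *\<^sub>R b) - f x - D (?h n *\<^sub>R b)) / norm (?h n *\<^sub>R b)) \<longlonglongrightarrow> 0" .
  then have "(\<lambda>n. norm b * (norm (f (x + ?h n *\<^sub>R b) - f x - D (?h n *\<^sub>R b)) / norm (?h n *\<^sub>R b))) \<longlonglongrightarrow> norm b * 0"
    by (intro tendsto_mult tendsto_const)
  moreover have "norm b * (norm (f (x + ?h n *\<^sub>R b) - f x - D (?h n *\<^sub>R b)) / norm (?h n *\<^sub>R b)) =
      norm ((f (x + ?h n *\<^sub>R b) - f x) / of_real (?h n) - D b)" for n
  proof -
    have "norm b * (norm (f (x + h *\<^sub>R b) - f x - D (h *\<^sub>R b)) / norm (h *\<^sub>R b)) =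
      norm ((f (x + h *\<^sub>R b) - f x) / of_real h - D b)" if "h > 0" for h
    proof -
      have "(f (x + h *\<^sub>R b) - f x) / of_real h - D b = (f (x + h *\<^sub>R b) - f x - D (h *\<^sub>R b)) / of_real h"
        using that by (simp add: D.scaleR scaleR_conv_of_real field_simps)
      then show ?thesis using assms(2) that by (simp add: norm_divide)
    qed
    from this[of "?h n"] show ?thesis by (simp only: zero_less_divide_1_iff of_nat_0_less_iff zero_less_Suc)
  qed
  ultimately have "(\<lambda>n. norm ((f (x + ?h n *\<^sub>R b) - f x) / of_real (?h n) - D b)) \<longlonglongrightarrow> 0" by simp
  then show ?thesis by (simp add: tendsto_norm_zero_iff LIM_zero_cancel)
qed

text \<open>
  The difference quotients have integral zero by translation invariance. By the mean value
  inequality and the decay of the derivative an integrable function dominates them all.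
\<close>
lemma integral_partial_deriv_zero:
  fixes f :: "'a::euclidean_space \<Rightarrow> complex"
  assumes f: "f \<in> schwartz" and b: "b \<in> Basis"
  shows "(\<integral>x. partial_deriv b f x \<partial>lborel) = 0"
proof -
  let ?h = "\<lambda>n. 1 / real (Suc n)"
  let ?d = "\<lambda>n x. (f (x + ?h n *\<^sub>R b) - f x) / of_real (?h n)"
  note [measurable] = schwartz_measurable[OF f] schwartz_measurable[OF schwartz_partial_deriv[OF f b]]
  obtain C where C: "\<And>x. (1 + norm x) ^ (2 * DIM('a)) * cmod (partial_deriv b f x) \<le> C" and C0: "C \<ge> 0"
    using rapidly_decreasingD[OF schwartz_rapid[OF schwartz_partial_deriv[OF f b]]] by metis
  have p: "(1 + norm x) ^ (2 * DIM('a)) > 0" for x :: 'a by (intro zero_less_power) (simp add: add_pos_nonneg)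
  \<comment> \<open>The factor \<open>2\<^sup>2\<^sup>d\<close> pays for moving the base point by at most \<open>1\<close>.\<close>
  have bd: "cmod (?d n x) \<le> C * 2 ^ (2 * DIM('a)) * inverse ((1 + norm x) ^ (2 * DIM('a)))" for n x
  proof -
    let ?g = "\<lambda>t. f (x + t *\<^sub>R b)"
    have der: "(?g has_derivative (\<lambda>t. partial_deriv (t *\<^sub>R b) f (x + u *\<^sub>R b))) (at u)" for u
      by (rule has_derivative_compose[OF _ schwartz_has_derivative[OF f], of "\<lambda>t. x + t *\<^sub>R b"])
        (auto intro!: derivative_eq_intros)
    have "\<exists>u\<in>{0<..<?h n}. norm (?g (?h n) - ?g 0) \<le> norm (partial_deriv ((?h n - 0) *\<^sub>R b) f (x + u *\<^sub>R b))"
      by (rule mvt_general) (auto intro!: der continuous_at_imp_continuous_on has_derivative_continuous[OF der])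
    then obtain u where u: "0 < u" "u < ?h n" "cmod (?g (?h n) - ?g 0) \<le> cmod (partial_deriv (?h n *\<^sub>R b) f (x + u *\<^sub>R b))"
      by auto
    interpret D: bounded_linear "\<lambda>h. partial_deriv h f (x + u *\<^sub>R b)"
      by (rule has_derivative_bounded_linear[OF schwartz_has_derivative[OF f]])
    have "cmod (?d n x) = cmod (?g (?h n) - ?g 0) / ?h n"
      by (simp only: norm_divide norm_of_real) simp
    also have "\<dots> \<le> cmod (partial_deriv (?h n *\<^sub>R b) f (x + u *\<^sub>R b)) / ?h n"
      by (intro divide_right_mono u) auto
    also have "\<dots> = cmod (partial_deriv b f (x + u *\<^sub>R b))" by (simp add: D.scaleR del: of_nat_Suc)
    also have "\<dots> \<le> C * inverse ((1 + norm (x + u *\<^sub>R b)) ^ (2 * DIM('a)))"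
      using C[of "x + u *\<^sub>R b"] p[of "x + u *\<^sub>R b"] by (simp add: field_simps)
    also have "\<dots> \<le> C * (2 ^ (2 * DIM('a)) * inverse ((1 + norm x) ^ (2 * DIM('a))))"
    proof (rule mult_left_mono[OF _ C0])
      have "?h n \<le> 1" by simp
      then have "u \<le> 1" using u by linarith
      have "norm x = norm ((x + u *\<^sub>R b) - u *\<^sub>R b)" by simp
      also have "\<dots> \<le> norm (x + u *\<^sub>R b) + norm (u *\<^sub>R b)" by (rule norm_triangle_ineq4)
      also have "\<dots> \<le> norm (x + u *\<^sub>R b) + 1" using u \<open>u \<le> 1\<close> b by simp
      finally have le1: "norm x \<le> norm (x + u *\<^sub>R b) + 1" .
      have "p \<le> q + 1 \<Longrightarrow> 0 \<le> q \<Longrightarrow> 1 + p \<le> 2 * (1 + q)" for p q :: real by argo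
      from this[OF le1 norm_ge_zero] have "1 + norm x \<le> 2 * (1 + norm (x + u *\<^sub>R b))" .
      then have "(1 + norm x) ^ (2 * DIM('a)) \<le> (2 * (1 + norm (x + u *\<^sub>R b))) ^ (2 * DIM('a))"
        by (intro power_mono) auto
      then have "(1 + norm x) ^ (2 * DIM('a)) \<le> 2 ^ (2 * DIM('a)) * (1 + norm (x + u *\<^sub>R b)) ^ (2 * DIM('a))"
        by (simp only: power_mult_distrib)
      then show "inverse ((1 + norm (x + u *\<^sub>R b)) ^ (2 * DIM('a))) \<le> 2 ^ (2 * DIM('a)) * inverse ((1 + norm x) ^ (2 * DIM('a)))"
        using p[of x] p[of "x + u *\<^sub>R b"] by (simp add: field_simps)
    qed
    finally show ?thesis by (simp add: mult.assoc)
  qed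
  have "(\<lambda>n. \<integral>x. ?d n x \<partial>lborel) \<longlonglongrightarrow> (\<integral>x. partial_deriv b f x \<partial>lborel)"
  proof (rule integral_dominated_convergence[where w="\<lambda>x. C * 2 ^ (2 * DIM('a)) * inverse ((1 + norm x) ^ (2 * DIM('a)))"])
    show "integrable lborel (\<lambda>x::'a. C * 2 ^ (2 * DIM('a)) * inverse ((1 + norm x) ^ (2 * DIM('a))))"
      using integrable_decay[where 'a='a] by simp
    show "AE x in lborel. (\<lambda>n. ?d n x) \<longlonglongrightarrow> partial_deriv b f x"
      using b by (intro AE_I2 directional_derivative_LIMSEQ schwartz_has_derivative f) auto
  qed (use bd in auto)
  moreover have "(\<integral>x. ?d n x \<partial>lborel) = 0" for n
  proof -
    have i: "integrable lborel (\<lambda>x. f (x + c))" for c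
    proof -
      have "integrable (distr lborel borel ((+) c)) f" using schwartz_integrable[OF f] by (simp add: lborel_distr_plus)
      then show ?thesis by (subst (asm) integrable_distr_eq) (auto simp: add.commute)
    qed
    have "(\<integral>x. ?d n x \<partial>lborel) = ((\<integral>x. f (x + ?h n *\<^sub>R b) \<partial>lborel) - (\<integral>x. f x \<partial>lborel)) / of_real (?h n)"
      using i schwartz_integrable[OF f] by (simp del: of_nat_Suc)
    also have "\<dots> = 0" by (simp add: lborel_integral_translate)
    finally show ?thesis .
  qed
  ultimately have "(\<lambda>n::nat. 0) \<longlonglongrightarrow> (\<integral>x. partial_deriv b f x \<partial>lborel)" by (simp only:)
  then show ?thesis by (simp add: LIMSEQ_const_iff)
qed

lemma partial_deriv_mult:
  assumes "f \<in> schwartz" "g \<in> schwartz"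
  shows "partial_deriv b (\<lambda>x. f x * g x) x = f x * partial_deriv b g x + partial_deriv b f x * g x"
  by (rule partial_deriv_eq[OF has_derivative_mult[OF schwartz_has_derivative schwartz_has_derivative]]) fact+

lemma integration_by_parts:
  fixes f g :: "'a::euclidean_space \<Rightarrow> complex"
  assumes f: "f \<in> schwartz" and g: "g \<in> schwartz" and b: "b \<in> Basis"
  shows "(\<integral>x. partial_deriv b f x * g x \<partial>lborel) = - (\<integral>x. f x * partial_deriv b g x \<partial>lborel)"
proof -
  have "0 = (\<integral>x. partial_deriv b (\<lambda>x. f x * g x) x \<partial>lborel)"
    using integral_partial_deriv_zero[OF schwartz_mult[OF f g] b] by simp
  also have "\<dots> = (\<integral>x. f x * partial_deriv b g x + partial_deriv b f x * g x \<partial>lborel)"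
    by (simp add: partial_deriv_mult f g)
  also have "\<dots> = (\<integral>x. f x * partial_deriv b g x \<partial>lborel) + (\<integral>x. partial_deriv b f x * g x \<partial>lborel)"
    by (intro Bochner_Integration.integral_add schwartz_integrable schwartz_mult schwartz_partial_deriv f g b)
  finally show ?thesis by (simp add: add_eq_0_iff)
qed

section \<open>Fourier integrals\<close>

text \<open>
  The sign of the inverse transform, without its normalising factor. The two Fourier transforms of
  the statement are a reflection and a multiple of it.
\<close>
definition FT :: "('a::euclidean_space \<Rightarrow> complex) \<Rightarrow> 'a \<Rightarrow> complex" where
  "FT f v = (\<integral>x. exp (\<i> * of_real (x \<bullet> v)) * f x \<partial>lborel)"

lemma fourier_eq_FT: "fourier f v = FT f (- v)"
  by (simp add: fourier_def FT_def)

lemma inv_fourier_eq_FT: "inv_fourier (f::'a::euclidean_space \<Rightarrow> complex) v = FT f v / of_real ((2 * pi) ^ DIM('a))"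
  by (simp add: inv_fourier_def FT_def inner_commute)

lemma norm_char [simp]: "cmod (exp (\<i> * of_real t)) = 1"
  by simp

lemma integrable_char_mult:
  fixes f :: "'a::euclidean_space \<Rightarrow> complex"
  assumes "integrable lborel f"
  shows "integrable lborel (\<lambda>x. exp (\<i> * of_real (x \<bullet> v)) * f x)"
proof -
  have [measurable]: "f \<in> borel_measurable borel" using assms by auto
  show ?thesis by (rule Bochner_Integration.integrable_bound[OF assms]) (auto simp: norm_mult)
qed

lemma norm_exp_minus_1_le: "cmod (exp (\<i> * of_real t) - 1) \<le> \<bar>t\<bar>"
  using abs_sin_x_le_abs_x[of "t/2"] by (simp add: dist_exp_i_1)

text \<open>
  Differentiation under the integral along a line: the difference quotients of the exponential
  are bounded by \<open>|x \<cdot> v|\<close>, and \<open>(x \<cdot> v) f\<close> is integrable.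
\<close>
lemma FT_has_vector_derivative:
  fixes f :: "'a::euclidean_space \<Rightarrow> complex"
  assumes f: "f \<in> schwartz"
  shows "((\<lambda>t. FT f (w + t *\<^sub>R v)) has_vector_derivative
           FT (\<lambda>x. \<i> * of_real (x \<bullet> v) * f x) (w + t *\<^sub>R v)) (at t)"
proof -
  let ?D = "FT (\<lambda>x. \<i> * of_real (x \<bullet> v) * f x) (w + t *\<^sub>R v)"
  let ?e = "\<lambda>s x. exp (\<i> * of_real (s * (x \<bullet> v)))"
  let ?u = "w + t *\<^sub>R v"
  note [measurable] = schwartz_measurable[OF f]
  have int1: "integrable lborel (\<lambda>x. of_real (x \<bullet> v) * f x)"
    by (intro schwartz_integrable schwartz_coord f)
  have int2: "integrable lborel (\<lambda>x. exp (\<i> * of_real (x \<bullet> v)) * f x)" for v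
    by (intro integrable_char_mult schwartz_integrable f)
  have "((\<lambda>h. (FT f (w + (t + h) *\<^sub>R v) - FT f ?u) / of_real h - ?D) \<longlongrightarrow> 0) (at 0)"
    unfolding tendsto_at_iff_sequentially
  proof (intro allI impI)
    fix X :: "nat \<Rightarrow> real" assume X: "\<forall>i. X i \<in> UNIV - {0}" "X \<longlonglongrightarrow> 0"
    have Xn: "X n \<noteq> 0" for n using X by auto
    have eq: "(FT f (w + (t + X n) *\<^sub>R v) - FT f ?u) / of_real (X n) =
       (\<integral>x. exp (\<i> * of_real (x \<bullet> ?u)) * ((?e (X n) x - 1) / of_real (X n)) * f x \<partial>lborel)" for n
    proof -
      have "FT f (w + (t + X n) *\<^sub>R v) - FT f ?u =
         (\<integral>x. exp (\<i> * of_real (x \<bullet> (w + (t + X n) *\<^sub>R v))) * f x - exp (\<i> * of_real (x \<bullet> ?u)) * f x \<partial>lborel)"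
        unfolding FT_def by (intro Bochner_Integration.integral_diff[symmetric] int2)
      also have "\<dots> = (\<integral>x. (exp (\<i> * of_real (x \<bullet> ?u)) * ((?e (X n) x - 1) / of_real (X n)) * f x) * of_real (X n) \<partial>lborel)"
        by (intro Bochner_Integration.integral_cong refl)
          (use Xn[of n] in \<open>simp add: inner_simps exp_add field_simps\<close>)
      also have "\<dots> = (\<integral>x. exp (\<i> * of_real (x \<bullet> ?u)) * ((?e (X n) x - 1) / of_real (X n)) * f x \<partial>lborel) * of_real (X n)"
        by (rule integral_mult_left_zero)
      finally show ?thesis using Xn[of n] by simp
    qed
    have "(\<lambda>n. \<integral>x. exp (\<i> * of_real (x \<bullet> ?u)) * ((?e (X n) x - 1) / of_real (X n)) * f x \<partial>lborel)
       \<longlonglongrightarrow> (\<integral>x. exp (\<i> * of_real (x \<bullet> ?u)) * (\<i> * of_real (x \<bullet> v) * f x) \<partial>lborel)"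
    proof (rule integral_dominated_convergence[where w="\<lambda>x. cmod (of_real (x \<bullet> v) * f x)"])
      show "AE x in lborel. (\<lambda>n. exp (\<i> * of_real (x \<bullet> ?u)) * ((?e (X n) x - 1) / of_real (X n)) * f x)
        \<longlonglongrightarrow> exp (\<i> * of_real (x \<bullet> ?u)) * (\<i> * of_real (x \<bullet> v) * f x)"
      proof (rule AE_I2)
        fix x :: 'a
        have "((\<lambda>s. exp (\<i> * of_real (x \<bullet> v) * s)) has_field_derivative (\<i> * of_real (x \<bullet> v))) (at 0)"
          by (auto intro!: derivative_eq_intros)
        then have l: "((\<lambda>s. (exp (\<i> * of_real (x \<bullet> v) * s) - 1) / s) \<longlongrightarrow> \<i> * of_real (x \<bullet> v)) (at 0)"
          unfolding has_field_derivative_iff by simp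
        have "filterlim (\<lambda>n. complex_of_real (X n)) (at 0) sequentially"
          using tendsto_of_real[OF X(2), where 'a=complex] Xn by (auto simp: filterlim_at)
        from filterlim_compose[OF l this]
        have "(\<lambda>n. (?e (X n) x - 1) / of_real (X n)) \<longlonglongrightarrow> \<i> * of_real (x \<bullet> v)"
          by (simp add: mult_ac)
        then have "(\<lambda>n. exp (\<i> * of_real (x \<bullet> ?u)) * ((?e (X n) x - 1) / of_real (X n)) * f x)
           \<longlonglongrightarrow> exp (\<i> * of_real (x \<bullet> ?u)) * (\<i> * of_real (x \<bullet> v)) * f x"
          by (intro tendsto_mult tendsto_const)
        then show "(\<lambda>n. exp (\<i> * of_real (x \<bullet> ?u)) * ((?e (X n) x - 1) / of_real (X n)) * f x)
        \<longlonglongrightarrow> exp (\<i> * of_real (x \<bullet> ?u)) * (\<i> * of_real (x \<bullet> v) * f x)" by (simp only: mult.assoc)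
      qed
      show "AE x in lborel. cmod (exp (\<i> * of_real (x \<bullet> ?u)) * ((?e (X n) x - 1) / of_real (X n)) * f x) \<le> cmod (of_real (x \<bullet> v) * f x)" for n
      proof (rule AE_I2)
        fix x :: 'a
        have "cmod (?e (X n) x - 1) / \<bar>X n\<bar> \<le> \<bar>X n * (x \<bullet> v)\<bar> / \<bar>X n\<bar>"
          by (intro divide_right_mono norm_exp_minus_1_le) auto
        then have "cmod (?e (X n) x - 1) / \<bar>X n\<bar> * cmod (f x) \<le> \<bar>x \<bullet> v\<bar> * cmod (f x)"
          using Xn[of n] by (intro mult_right_mono) (auto simp: abs_mult)
        then show "cmod (exp (\<i> * of_real (x \<bullet> ?u)) * ((?e (X n) x - 1) / of_real (X n)) * f x) \<le> cmod (of_real (x \<bullet> v) * f x)"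
          by (simp only: norm_mult norm_divide norm_char norm_of_real mult_1)
      qed
    qed (use int1 in auto)
    then have "(\<lambda>n. (FT f (w + (t + X n) *\<^sub>R v) - FT f ?u) / of_real (X n)) \<longlonglongrightarrow> ?D"
      by (subst FT_def[of "\<lambda>x. \<i> * of_real (x \<bullet> v) * f x"]) (simp only: eq)
    then show "((\<lambda>h. (FT f (w + (t + h) *\<^sub>R v) - FT f ?u) / of_real h - ?D) \<circ> X) \<longlonglongrightarrow> 0"
      unfolding o_def by (rule LIM_zero)
  qed
  from tendsto_norm_zero[OF this]
  have "((\<lambda>h. cmod ((FT f (w + (t + h) *\<^sub>R v) - FT f ?u) / of_real h - ?D)) \<longlongrightarrow> 0) (at 0)" .
  then have "((\<lambda>h. cmod (FT f (w + (t + h) *\<^sub>R v) - FT f ?u - h *\<^sub>R ?D) / norm h) \<longlongrightarrow> 0) (at 0)"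
  proof (rule tendsto_cong[THEN iffD1, rotated])
    have "cmod ((FT f (w + (t + h) *\<^sub>R v) - FT f ?u) / of_real h - ?D) = cmod (FT f (w + (t + h) *\<^sub>R v) - FT f ?u - h *\<^sub>R ?D) / norm h"
      if "h \<noteq> 0" for h :: real
    proof -
      have "(FT f (w + (t + h) *\<^sub>R v) - FT f ?u) / of_real h - ?D = (FT f (w + (t + h) *\<^sub>R v) - FT f ?u - h *\<^sub>R ?D) / of_real h"
        using that by (simp add: scaleR_conv_of_real diff_divide_distrib)
      then show ?thesis by (simp add: norm_divide)
    qed
    then show "\<forall>\<^sub>F h in at 0. cmod ((FT f (w + (t + h) *\<^sub>R v) - FT f ?u) / of_real h - ?D) = cmod (FT f (w + (t + h) *\<^sub>R v) - FT f ?u - h *\<^sub>R ?D) / norm h"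
      by (auto simp: eventually_at_filter)
  qed
  then show ?thesis
    unfolding has_vector_derivative_def has_derivative_at by (simp add: bounded_linear_scaleR_left)
qed

lemma FT_add:
  assumes "f \<in> schwartz" "g \<in> schwartz"
  shows "FT (\<lambda>x. f x + g x) v = FT f v + FT g v"
  unfolding FT_def
  by (simp add: distrib_left Bochner_Integration.integral_add integrable_char_mult schwartz_integrable assms)

lemma FT_scale: "FT (\<lambda>x. c * f x) v = c * FT f v"
  unfolding FT_def by (simp add: mult.left_commute)

lemma FT_partial_deriv:
  fixes f :: "'a::euclidean_space \<Rightarrow> complex"
  assumes f: "f \<in> schwartz" and b: "b \<in> Basis"
  shows "FT (partial_deriv b f) v = - (\<i> * of_real (v \<bullet> b) * FT f v)"
proof -
  have "((\<lambda>x. exp (\<i> * of_real (x \<bullet> v))) has_derivative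
       (\<lambda>h. \<i> * of_real (h \<bullet> v) * exp (\<i> * of_real (x \<bullet> v)))) (at x)" for x
  proof -
      have i: "((\<lambda>x. \<i> * complex_of_real (x \<bullet> v)) has_derivative (\<lambda>h. \<i> * complex_of_real (h \<bullet> v))) (at x)"
        by (auto intro!: derivative_eq_intros)
      have "(exp has_derivative (*) (exp (\<i> * complex_of_real (x \<bullet> v)))) (at (\<i> * complex_of_real (x \<bullet> v)))"
        using DERIV_exp unfolding has_field_derivative_def .
      from has_derivative_compose[OF i this] show ?thesis by (simp add: mult.commute)
  qed
  note der = this
  have eq: "partial_deriv b (\<lambda>x. exp (\<i> * of_real (x \<bullet> v)) * f x) x =
      exp (\<i> * of_real (x \<bullet> v)) * partial_deriv b f x + \<i> * of_real (v \<bullet> b) * (exp (\<i> * of_real (x \<bullet> v)) * f x)" for x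
    using partial_deriv_eq[OF has_derivative_mult[OF der[of x] schwartz_has_derivative[OF f, of x]], of b]
    by (simp add: inner_commute mult.assoc)
  have "0 = (\<integral>x. partial_deriv b (\<lambda>x. exp (\<i> * of_real (x \<bullet> v)) * f x) x \<partial>lborel)"
    by (intro integral_partial_deriv_zero[symmetric] schwartz_char f b)
  also have "\<dots> = FT (partial_deriv b f) v + \<i> * of_real (v \<bullet> b) * FT f v"
    unfolding eq FT_def
    using integrable_char_mult[OF schwartz_integrable[OF schwartz_partial_deriv[OF f b]], of v]
      integrable_char_mult[OF schwartz_integrable[OF f], of v]
    by (simp add: mult.assoc)
  finally show ?thesis by (simp add: eq_neg_iff_add_eq_0)
qed

definition gaussian :: "'a::euclidean_space \<Rightarrow> complex" where
  "gaussian x = of_real (exp (- (norm x)\<^sup>2 / 2))"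

lemma gaussian_schwartz: "gaussian \<in> schwartz"
  using schwartz_gauss[of "1/2"] by (simp add: gaussian_def[abs_def])

lemma gaussian_has_derivative:
  "(gaussian has_derivative (\<lambda>h. - of_real (x \<bullet> h) * gaussian x)) (at x)"
proof -
  have "((\<lambda>x::'a. exp (- (x \<bullet> x) / 2)) has_derivative (\<lambda>h. - (x \<bullet> h) * exp (- (x \<bullet> x) / 2))) (at x)"
    by (auto intro!: derivative_eq_intros simp: inner_commute algebra_simps fun_eq_iff)
  from has_derivative_of_real[OF this] show ?thesis
    by (simp add: power2_norm_eq_inner gaussian_def[abs_def])
qed

lemma partial_deriv_gaussian: "partial_deriv b gaussian x = - (of_real (x \<bullet> b) * gaussian x)"
  using partial_deriv_eq[OF gaussian_has_derivative] by simp

text \<open>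
  The eigenvalue \<open>(2\<pi>)\<^sup>d\<^sup>/\<^sup>2\<close> of the gaussian under the Fourier integral.
\<close>
definition gaussian_mass :: "'a::euclidean_space itself \<Rightarrow> real" where
  "gaussian_mass _ = (\<integral>x. exp (- (norm (x::'a))\<^sup>2 / 2) \<partial>lborel)"

lemma integral_gaussian: "(\<integral>x. gaussian (x::'a::euclidean_space) \<partial>lborel) = of_real (gaussian_mass TYPE('a))"
  unfolding gaussian_def gaussian_mass_def by simp

lemma integral_pos_continuous:
  fixes f :: "'a::euclidean_space \<Rightarrow> real"
  assumes f: "continuous_on UNIV f" "integrable lborel f" "\<And>x. f x \<ge> 0" "f a \<noteq> 0"
  shows "(\<integral>x. f x \<partial>lborel) > 0"
proof -
  have "(\<integral>x. f x \<partial>lborel) \<noteq> 0"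
  proof
    assume "(\<integral>x. f x \<partial>lborel) = 0"
    then have "AE x in lborel. f x = 0"
      using integral_nonneg_eq_0_iff_AE[OF f(2)] f(3) by simp
    have op: "open {x. f x \<noteq> 0}"
      using f(1) by (intro open_Collect_neq continuous_on_const)
    have "{x. f x \<noteq> 0} \<in> null_sets lborel"
      using op by (subst AE_iff_null_sets) (use \<open>AE x in lborel. f x = 0\<close> in auto)
    then have "negligible {x. f x \<noteq> 0}"
      by (simp add: negligible_iff_null_sets null_sets_completionI)
    then show False using open_not_negligible[OF op] f(4) by blast
  qed
  then show ?thesis using Bochner_Integration.integral_nonneg[of lborel f] f(3) by (simp add: order_less_le)
qed

lemma gaussian_mass_pos: "gaussian_mass TYPE('a::euclidean_space) > 0"
  unfolding gaussian_mass_def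
proof (rule integral_pos_continuous)
  show "integrable lborel (\<lambda>x::'a. exp (- (norm x)\<^sup>2 / 2))"
    using schwartz_integrable[OF gaussian_schwartz] unfolding gaussian_def[abs_def] by (simp add: complex_of_real_integrable_eq)
qed (auto intro!: continuous_intros)

text \<open>
  Along the ray through \<open>v\<close> the function \<open>y(t) = FT gaussian (t v)\<close> solves \<open>y' = - t |v|\<^sup>2 y\<close>, and its
  value at \<open>t = 0\<close> is the total mass.
\<close>
lemma FT_gaussian: "FT gaussian (v::'a::euclidean_space) = of_real (gaussian_mass TYPE('a)) * gaussian v"
proof -
  let ?g = "\<lambda>t. FT gaussian (t *\<^sub>R v)"
  have lin: "FT (\<lambda>x. of_real (x \<bullet> v) * gaussian x) u = \<i> * of_real (v \<bullet> u) * FT gaussian u" for u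
  proof -
    have i: "integrable lborel (\<lambda>x::'a. exp (\<i> * of_real (x \<bullet> u)) * (of_real (x \<bullet> b) * gaussian x))" for b
      by (intro integrable_char_mult schwartz_integrable schwartz_coord gaussian_schwartz)
    have 1: "FT (\<lambda>x. of_real (x \<bullet> b) * gaussian x) u = \<i> * of_real (u \<bullet> b) * FT gaussian u" if "b \<in> Basis" for b
    proof -
      have "(\<lambda>x. of_real (x \<bullet> b) * gaussian x) = (\<lambda>x. (-1) * partial_deriv b gaussian x)"
        by (simp add: partial_deriv_gaussian)
      then have "FT (\<lambda>x. of_real (x \<bullet> b) * gaussian x) u = (-1) * FT (partial_deriv b gaussian) u"
        by (simp only: FT_scale)
      then show ?thesis using FT_partial_deriv[OF gaussian_schwartz that, of u] by simp
    qed
    have "FT (\<lambda>x. of_real (x \<bullet> v) * gaussian x) u =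
       (\<integral>x. (\<Sum>b\<in>Basis. of_real (v \<bullet> b) * (exp (\<i> * of_real (x \<bullet> u)) * (of_real (x \<bullet> b) * gaussian x))) \<partial>lborel)"
      unfolding FT_def
    proof (intro Bochner_Integration.integral_cong refl)
      fix x :: 'a
      have "complex_of_real (x \<bullet> v) = (\<Sum>b\<in>Basis. of_real (x \<bullet> b) * of_real (v \<bullet> b))"
        by (subst euclidean_inner) simp
      then show "exp (\<i> * of_real (x \<bullet> u)) * (of_real (x \<bullet> v) * gaussian x) =
        (\<Sum>b\<in>Basis. of_real (v \<bullet> b) * (exp (\<i> * of_real (x \<bullet> u)) * (of_real (x \<bullet> b) * gaussian x)))"
        by (simp add: sum_distrib_left sum_distrib_right mult_ac)
    qed
    also have "\<dots> = (\<Sum>b\<in>Basis. of_real (v \<bullet> b) * FT (\<lambda>x. of_real (x \<bullet> b) * gaussian x) u)"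
      unfolding FT_def by (subst Bochner_Integration.integral_sum) (auto intro!: i integrable_mult_right)
    also have "\<dots> = (\<Sum>b\<in>Basis. of_real (v \<bullet> b) * (\<i> * of_real (u \<bullet> b) * FT gaussian u))"
      by (simp add: 1)
    also have "\<dots> = \<i> * (\<Sum>b\<in>Basis. of_real (v \<bullet> b) * of_real (u \<bullet> b)) * FT gaussian u"
      by (simp add: sum_distrib_left sum_distrib_right mult_ac)
    also have "(\<Sum>b\<in>Basis. of_real (v \<bullet> b) * of_real (u \<bullet> b)) = complex_of_real (v \<bullet> u)"
      by (subst (3) euclidean_inner) simp
    finally show ?thesis .
  qed
  have d1: "(?g has_vector_derivative - of_real (t * (norm v)\<^sup>2) * ?g t) (at t)" for t
  proof -
    have "(?g has_vector_derivative FT (\<lambda>x. \<i> * (of_real (x \<bullet> v) * gaussian x)) (t *\<^sub>R v)) (at t)"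
      using FT_has_vector_derivative[OF gaussian_schwartz, of 0 v t] by (simp add: mult.assoc)
    moreover have "\<i> * (\<i> * of_real (v \<bullet> (t *\<^sub>R v)) * ?g t) = - of_real (t * (norm v)\<^sup>2) * ?g t"
      by (simp add: power2_norm_eq_inner mult.assoc[symmetric])
    ultimately show ?thesis unfolding FT_scale lin by (simp only:)
  qed
  have d2: "((\<lambda>t. of_real (exp (t\<^sup>2 * (norm v)\<^sup>2 / 2))) has_vector_derivative of_real (t * (norm v)\<^sup>2 * exp (t\<^sup>2 * (norm v)\<^sup>2 / 2))) (at t)"
    for t :: real
  proof -
    have "((\<lambda>t. exp (t\<^sup>2 * (norm v)\<^sup>2 / 2)) has_real_derivative t * (norm v)\<^sup>2 * exp (t\<^sup>2 * (norm v)\<^sup>2 / 2)) (at t)"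
      by (auto intro!: derivative_eq_intros)
    from has_vector_derivative_of_real[OF this] show ?thesis .
  qed
  have "((\<lambda>t. ?g t * of_real (exp (t\<^sup>2 * (norm v)\<^sup>2 / 2))) has_vector_derivative 0) (at t)" for t
    using has_vector_derivative_mult[OF d1 d2, of t] by (simp add: algebra_simps)
  then obtain c where c: "\<And>t. ?g t * of_real (exp (t\<^sup>2 * (norm v)\<^sup>2 / 2)) = c"
    using has_vector_derivative_zero_constant[of UNIV "\<lambda>t. ?g t * of_real (exp (t\<^sup>2 * (norm v)\<^sup>2 / 2))"] by auto
  have "FT gaussian (0::'a) = (of_real (gaussian_mass TYPE('a)) :: complex)"
    using integral_gaussian[where 'a='a] by (simp add: FT_def)
  then have "FT gaussian v * of_real (exp ((norm v)\<^sup>2 / 2)) = of_real (gaussian_mass TYPE('a))"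
    using c[of 0] c[of 1] by simp
  then have "FT gaussian v * of_real (exp ((norm v)\<^sup>2 / 2) * exp (- (norm v)\<^sup>2 / 2)) = of_real (gaussian_mass TYPE('a)) * gaussian v"
    unfolding gaussian_def by (simp add: mult.assoc[symmetric])
  then show ?thesis by (simp add: exp_add[symmetric])
qed

section \<open>Functions are determined by their Fourier integrals\<close>

lemma integrable_pair_mult:
  fixes f :: "'a::euclidean_space \<Rightarrow> complex" and g :: "'b::euclidean_space \<Rightarrow> complex"
  assumes f: "integrable lborel f" and g: "integrable lborel g"
  shows "integrable (lborel \<Otimes>\<^sub>M lborel) (\<lambda>(x, y). f x * g y)"
proof -
  have [measurable]: "f \<in> borel_measurable borel" "g \<in> borel_measurable borel" using f g by auto
  show ?thesis
    by (rule lborel_pair.Fubini_integrable) (use f g in \<open>auto simp: norm_mult\<close>)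
qed

lemma integrable_pair_bound:
  fixes f :: "'a::euclidean_space \<Rightarrow> complex" and g :: "'b::euclidean_space \<Rightarrow> complex"
  assumes f: "integrable lborel f" and g: "integrable lborel g"
    and m: "(\<lambda>(x, y). m x y) \<in> borel_measurable (lborel \<Otimes>\<^sub>M lborel)"
    and le: "\<And>x y. cmod (m x y) \<le> cmod (f x) * cmod (g y)"
  shows "integrable (lborel \<Otimes>\<^sub>M lborel) (\<lambda>(x, y). m x y :: complex)"
  by (rule Bochner_Integration.integrable_bound[OF integrable_pair_mult[OF f g] m])
    (use le in \<open>auto simp: norm_mult\<close>)

lemma Fubini_bound:
  fixes f :: "'a::euclidean_space \<Rightarrow> complex" and g :: "'b::euclidean_space \<Rightarrow> complex"
  assumes f: "integrable lborel f" and g: "integrable lborel g"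
    and m: "(\<lambda>(x, y). m x y) \<in> borel_measurable (lborel \<Otimes>\<^sub>M lborel)"
    and le: "\<And>x y. cmod (m x y) \<le> cmod (f x) * cmod (g y)"
  shows "(\<integral>x. \<integral>y. m x y \<partial>lborel \<partial>lborel) = (\<integral>y. \<integral>x. (m x y :: complex) \<partial>lborel \<partial>lborel)"
proof -
  show ?thesis using lborel_pair.Fubini_integral[OF integrable_pair_bound[OF assms]] by simp
qed

lemma gaussian_measurable [measurable]: "gaussian \<in> borel_measurable borel"
  by (rule schwartz_measurable[OF gaussian_schwartz])

lemma gaussian_even: "gaussian (- x) = gaussian x" by (simp add: gaussian_def)

text \<open>
  A gaussian is a multiple of its own Fourier integral, so convolving \<open>k\<close> with a dilated gaussian
  averages values of \<open>FT k\<close>.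
\<close>
lemma FT_vanish_imp_gaussian_conv:
  fixes k :: "'a::euclidean_space \<Rightarrow> complex"
  assumes k: "integrable lborel k" and z: "\<And>v. FT k v = 0"
  shows "(\<integral>x. k x * gaussian (s *\<^sub>R (x - y)) \<partial>lborel) = 0"
proof -
  have [measurable]: "k \<in> borel_measurable borel" using k by auto
  let ?m = "gaussian_mass TYPE('a)"
  have m: "?m > 0" by (rule gaussian_mass_pos)
  have "of_real ?m * (\<integral>x. k x * gaussian (s *\<^sub>R (x - y)) \<partial>lborel) =
      (\<integral>x. k x * FT gaussian (s *\<^sub>R (x - y)) \<partial>lborel)"
    unfolding FT_gaussian by (subst integral_mult_right_zero[symmetric]) (simp add: mult_ac)
  also have "\<dots> = (\<integral>x. (\<integral>z. k x * (exp (\<i> * of_real (z \<bullet> (s *\<^sub>R (x - y)))) * gaussian z) \<partial>lborel) \<partial>lborel)"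
    unfolding FT_def by simp
  also have "\<dots> = (\<integral>z. (\<integral>x. k x * (exp (\<i> * of_real (z \<bullet> (s *\<^sub>R (x - y)))) * gaussian z) \<partial>lborel) \<partial>lborel)"
    by (rule Fubini_bound[OF k schwartz_integrable[OF gaussian_schwartz]]) (auto simp: norm_mult)
  also have "\<dots> = (\<integral>z. (exp (- (\<i> * of_real (s * (z \<bullet> y)))) * gaussian z) * FT k (s *\<^sub>R z) \<partial>lborel)"
    unfolding FT_def
    by (intro Bochner_Integration.integral_cong refl, subst integral_mult_right_zero[symmetric],
       intro Bochner_Integration.integral_cong refl)
      (simp add: inner_simps right_diff_distrib exp_diff exp_minus field_simps inner_commute)
  also have "\<dots> = 0" by (simp add: z)
  finally show ?thesis using m by simp
qed

lemma lborel_integral_affine: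
  fixes f :: "'a::euclidean_space \<Rightarrow> 'b::{banach, second_countable_topology}"
  assumes [measurable]: "f \<in> borel_measurable borel" and c: "c \<noteq> 0"
  shows "(\<integral>x. f x \<partial>lborel) = \<bar>c\<bar> ^ DIM('a) *\<^sub>R (\<integral>x. f (t + c *\<^sub>R x) \<partial>lborel)"
  by (subst lborel_affine[OF c, of t])
    (simp add: integral_density integral_distr)

text \<open>
  Averaging a bounded continuous function \<open>c\<close> against gaussians of width \<open>1/n\<close> gives a multiple of
  \<open>c\<close> in the limit, and each of these averages pairs to zero with \<open>k\<close>.
\<close>
lemma FT_vanish_imp_continuous_zero:
  fixes k c :: "'a::euclidean_space \<Rightarrow> complex"
  assumes k: "integrable lborel k" and z: "\<And>v. FT k v = 0"
    and c: "continuous_on UNIV c" "integrable lborel c" "\<And>x. cmod (c x) \<le> B"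
  shows "(\<integral>x. k x * c x \<partial>lborel) = 0"
proof -
  have [measurable]: "k \<in> borel_measurable borel" using k by auto
  have [measurable]: "c \<in> borel_measurable borel" using c by auto
  let ?G = "\<lambda>n x. \<integral>z. gaussian z * c (x + (1 / real (Suc n)) *\<^sub>R z) \<partial>lborel"
  have B: "B \<ge> 0" using c(3)[of 0] norm_ge_zero order_trans by blast
  have gi: "integrable lborel (\<lambda>z::'a. gaussian z)" by (rule schwartz_integrable[OF gaussian_schwartz])
  have zero: "(\<integral>x. k x * ?G n x \<partial>lborel) = 0" for n
  proof -
    let ?s = "real (Suc n)"
    have "(\<integral>x. k x * (\<integral>y. gaussian (?s *\<^sub>R (x - y)) * c y \<partial>lborel) \<partial>lborel) =
       (\<integral>x. (\<integral>y. k x * (gaussian (?s *\<^sub>R (x - y)) * c y) \<partial>lborel) \<partial>lborel)"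
      by simp
    also have "\<dots> = (\<integral>y. (\<integral>x. k x * (gaussian (?s *\<^sub>R (x - y)) * c y) \<partial>lborel) \<partial>lborel)"
    proof (rule Fubini_bound[OF k c(2)])
      fix x y :: 'a
      have "cmod (gaussian (?s *\<^sub>R (x - y))) \<le> 1" by (simp add: gaussian_def)
      then show "cmod (k x * (gaussian (?s *\<^sub>R (x - y)) * c y)) \<le> cmod (k x) * cmod (c y)"
        unfolding norm_mult by (intro mult_left_mono mult_left_le_one_le) auto
    qed measurable
    also have "\<dots> = (\<integral>y. c y * (\<integral>x. k x * gaussian (?s *\<^sub>R (x - y)) \<partial>lborel) \<partial>lborel)"
      by (intro Bochner_Integration.integral_cong refl, subst integral_mult_right_zero[symmetric]) (simp add: mult_ac)
    also have "\<dots> = 0" using FT_vanish_imp_gaussian_conv[OF k z, of "?s"] by (simp del: of_nat_Suc)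
    finally have "(\<integral>x. k x * (\<integral>y. gaussian (?s *\<^sub>R (x - y)) * c y \<partial>lborel) \<partial>lborel) = 0" .
    moreover have "(\<integral>y. gaussian (?s *\<^sub>R (x - y)) * c y \<partial>lborel) = (1 / ?s) ^ DIM('a) *\<^sub>R ?G n x" for x
    proof -
      have "(\<integral>y. gaussian (?s *\<^sub>R (x - y)) * c y \<partial>lborel) =
        \<bar>1 / ?s\<bar> ^ DIM('a) *\<^sub>R (\<integral>z. gaussian (?s *\<^sub>R (x - (x + (1 / ?s) *\<^sub>R z))) * c (x + (1 / ?s) *\<^sub>R z) \<partial>lborel)"
        by (rule lborel_integral_affine) (auto simp del: of_nat_Suc)
      moreover have "?s *\<^sub>R (x - (x + (1 / ?s) *\<^sub>R z)) = - z" for z by (simp del: of_nat_Suc)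
      ultimately show ?thesis by (simp add: gaussian_even del: of_nat_Suc)
    qed
    ultimately have "(\<integral>x. (k x * ?G n x) * of_real ((1 / ?s) ^ DIM('a)) \<partial>lborel) = 0"
      by (simp add: scaleR_conv_of_real mult_ac del: of_nat_Suc)
    then show ?thesis by (subst (asm) integral_mult_left_zero) (simp del: of_nat_Suc)
  qed
  have Gbd: "cmod (?G n x) \<le> (\<integral>z. cmod (gaussian (z::'a)) \<partial>lborel) * B" for n x
  proof -
    have "cmod (?G n x) \<le> (\<integral>z. cmod (gaussian (z::'a)) * B \<partial>lborel)"
    proof (rule Bochner_Integration.integral_norm_bound_integral)
      show "integrable lborel (\<lambda>z. gaussian z * c (x + (1 / real (Suc n)) *\<^sub>R z))"
        by (rule Bochner_Integration.integrable_bound[of lborel "\<lambda>z. gaussian z * of_real B"])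
          (use gi c(3) B in \<open>auto simp: norm_mult intro!: mult_left_mono\<close>)
    qed (use gi c(3) in \<open>auto simp: norm_mult intro!: mult_left_mono\<close>)
    then show ?thesis by simp
  qed
  have Glim: "(\<lambda>n. ?G n x) \<longlonglongrightarrow> of_real (gaussian_mass TYPE('a)) * c x" for x
  proof -
    have "(\<lambda>n. ?G n x) \<longlonglongrightarrow> (\<integral>z. gaussian (z::'a) * c x \<partial>lborel)"
    proof (rule integral_dominated_convergence[where w="\<lambda>z::'a. cmod (gaussian z) * B"])
      show "AE z in lborel. (\<lambda>n. gaussian z * c (x + (1 / real (Suc n)) *\<^sub>R z)) \<longlonglongrightarrow> gaussian z * c x"
      proof (rule AE_I2)
        fix z :: 'a
        have "(\<lambda>n. 1 / real (Suc n)) \<longlonglongrightarrow> 0" using LIMSEQ_inverse_real_of_nat by (simp add: inverse_eq_divide)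
        then have "(\<lambda>n. x + (1 / real (Suc n)) *\<^sub>R z) \<longlonglongrightarrow> x + 0 *\<^sub>R z"
          by (intro tendsto_intros)
        then have "(\<lambda>n. c (x + (1 / real (Suc n)) *\<^sub>R z)) \<longlonglongrightarrow> c x"
          using c(1) by (intro isCont_tendsto_compose[of x c]) (auto simp: continuous_on_eq_continuous_at)
        then show "(\<lambda>n. gaussian z * c (x + (1 / real (Suc n)) *\<^sub>R z)) \<longlonglongrightarrow> gaussian z * c x"
          by (intro tendsto_mult tendsto_const)
      qed
    qed (use gi c(3) in \<open>auto simp: norm_mult intro!: mult_left_mono\<close>)
    then show ?thesis by (simp add: integral_gaussian)
  qed
  have "(\<lambda>n. \<integral>x. k x * ?G n x \<partial>lborel) \<longlonglongrightarrow> (\<integral>x. k x * (of_real (gaussian_mass TYPE('a)) * c x) \<partial>lborel)"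
  proof (rule integral_dominated_convergence[where w="\<lambda>x. cmod (k x) * ((\<integral>z. cmod (gaussian (z::'a)) \<partial>lborel) * B)"])
    show "AE x in lborel. (\<lambda>n. k x * ?G n x) \<longlonglongrightarrow> k x * (of_real (gaussian_mass TYPE('a)) * c x)"
      by (intro AE_I2 tendsto_mult tendsto_const Glim)
    show "AE x in lborel. cmod (k x * ?G n x) \<le> cmod (k x) * ((\<integral>z. cmod (gaussian (z::'a)) \<partial>lborel) * B)" for n
      unfolding norm_mult by (intro AE_I2 mult_left_mono Gbd) auto
  qed (use k in auto)
  then have "(\<integral>x. k x * (of_real (gaussian_mass TYPE('a)) * c x) \<partial>lborel) = 0"
    by (simp only: zero LIMSEQ_const_iff)
  then have "of_real (gaussian_mass TYPE('a)) * (\<integral>x. k x * c x \<partial>lborel) = 0"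
    by (subst integral_mult_right_zero[symmetric]) (simp add: mult_ac)
  then show ?thesis using gaussian_mass_pos[where 'a='a] by simp
qed

text \<open>
  The indicator function of a box is the limit of the continuous functions
  \<open>min 1 (j dist(x, complement))\<close>, so the integral of \<open>k\<close> over every box vanishes; boxes form an
  intersection-stable generator of the Borel sets.
\<close>
lemma FT_vanish_imp_AE_zero:
  fixes k :: "'a::euclidean_space \<Rightarrow> complex"
  assumes k: "integrable lborel k" and z: "\<And>v. FT k v = 0"
  shows "AE x in lborel. k x = 0"
proof -
  have [measurable]: "k \<in> borel_measurable borel" using k by auto
  have box: "(\<integral>x. indicator (box a b) x *\<^sub>R k x \<partial>lborel) = 0" for a b :: 'a
  proof (cases "box a b = {}")
    case False
    let ?B = "box a b"
    let ?c = "\<lambda>j x. complex_of_real (min 1 (real j * infdist x (- ?B)))"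
    have ne: "- ?B \<noteq> {}" by (metis Compl_eq_Compl_iff Compl_UNIV_eq bounded_box not_bounded_UNIV)
    have cl: "closed (- ?B)" by (simp add: open_box closed_Compl)
    have supp: "?c j x = 0" if "x \<notin> ?B" for j x using that by simp
    have bdd: "cmod (?c j x) \<le> 1" for j x by (simp add: infdist_nonneg)
    have ci: "integrable lborel (?c j)" for j
    proof (rule Bochner_Integration.integrable_bound[of lborel "indicat_real ?B"])
      show "integrable lborel (indicat_real ?B)"
        by (rule integrable_real_indicator) (use emeasure_lborel_box_finite[of a b] in auto)
      show "AE x in lborel. norm (?c j x) \<le> norm (indicat_real ?B x)"
      proof (rule AE_I2)
        fix x show "norm (?c j x) \<le> norm (indicat_real ?B x)"
          using bdd[of j x] supp[of x j] by (cases "x \<in> ?B") auto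
      qed
      show "?c j \<in> borel_measurable lborel"
        by (auto intro!: borel_measurable_continuous_onI continuous_intros)
    qed
    have "(\<lambda>j. \<integral>x. k x * ?c j x \<partial>lborel) \<longlonglongrightarrow> (\<integral>x. indicator ?B x *\<^sub>R k x \<partial>lborel)"
    proof (rule integral_dominated_convergence[where w="\<lambda>x. cmod (k x)"])
      show "AE x in lborel. (\<lambda>j. k x * ?c j x) \<longlonglongrightarrow> indicator ?B x *\<^sub>R k x"
      proof (rule AE_I2)
        fix x
        show "(\<lambda>j. k x * ?c j x) \<longlonglongrightarrow> indicator ?B x *\<^sub>R k x"
        proof (cases "x \<in> ?B")
          case True
          then have "infdist x (- ?B) > 0"
            using in_closed_iff_infdist_zero[OF cl ne, of x] infdist_nonneg[of x "- ?B"] by auto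
          then obtain N where N: "1 < real N * infdist x (- ?B)" using reals_Archimedean3 by blast
          have "?c j x = 1" if "j \<ge> N" for j
          proof -
            have "1 < real j * infdist x (- ?B)"
              using N that by (smt (verit) infdist_nonneg mult_right_mono of_nat_mono)
            then show ?thesis by simp
          qed
          then have "eventually (\<lambda>j. k x * ?c j x = k x) sequentially"
            unfolding eventually_sequentially by force
          then show ?thesis using True by (auto intro: tendsto_eventually)
        qed (simp add: supp)
      qed
      show "AE x in lborel. norm (k x * ?c j x) \<le> cmod (k x)" for j
        using bdd by (auto simp: norm_mult intro!: mult_left_le AE_I2)
      show "(\<lambda>x. k x * ?c j x) \<in> borel_measurable lborel" for j
        using ci[of j] by (auto intro!: borel_measurable_times dest: borel_measurable_integrable simp del: of_real_mult)
    qed (use k in auto)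
    moreover have "(\<integral>x. k x * ?c j x \<partial>lborel) = 0" for j
      by (rule FT_vanish_imp_continuous_zero[OF k z _ ci bdd]) (auto intro!: continuous_intros)
    ultimately show ?thesis by (simp add: LIMSEQ_const_iff del: of_real_mult)
  qed simp
  have full: "(\<integral>x. k x \<partial>lborel) = 0" using z[of 0] by (simp add: FT_def)
  have borel: "sets (borel :: 'a measure) = sigma_sets UNIV (range (\<lambda>(a, b). box a b))"
    by (subst borel_eq_box) (rule sets_measure_of, simp)
  have si: "set_integrable lborel A k" if "A \<in> sets borel" for A
    unfolding set_integrable_def using integrable_mult_indicator[OF _ k, of A] that by simp
  show ?thesis
  proof (rule sigma_finite_measure.density_zero[OF sigma_finite_lborel k])
    fix A assume "A \<in> sets (lborel :: 'a measure)"
    then have A: "A \<in> sigma_sets UNIV (range (\<lambda>(a, b). box a b :: 'a set))" using borel by simp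
    have Int: "Int_stable (range (\<lambda>(a, b). box a b :: 'a set))"
      by (auto simp: Int_stable_def box_Int_box)
    have sub: "range (\<lambda>(a, b). box a b :: 'a set) \<subseteq> Pow UNIV" by simp
    show "set_lebesgue_integral lborel A k = 0"
      using Int sub A
    proof (induction rule: sigma_sets_induct_disjoint)
      case (basic A)
      then show ?case using box by (auto simp: set_lebesgue_integral_def)
    next
      case (compl A)
      then have A: "A \<in> sets borel" using borel by simp
      have "(\<integral>x. k x \<partial>lborel) - (\<integral>x. indicator A x *\<^sub>R k x \<partial>lborel) = (\<integral>x. k x - indicator A x *\<^sub>R k x \<partial>lborel)"
        using si[OF A] by (intro Bochner_Integration.integral_diff[symmetric] k) (simp add: set_integrable_def)
      also have "(\<lambda>x. k x - indicator A x *\<^sub>R k x) = (\<lambda>x. indicator (UNIV - A) x *\<^sub>R k x)"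
        by (auto simp: indicator_def)
      finally show ?case using compl full by (simp add: set_lebesgue_integral_def)
    next
      case (union A)
      then have A: "A i \<in> sets borel" for i using borel by auto
      have "(LINT x:(\<Union>i. A i)|lborel. k x) = (\<Sum>i. (LINT x:(A i)|lborel. k x))"
        by (rule lebesgue_integral_countable_add) (use A si union in \<open>auto simp: disjoint_family_on_def\<close>)
      then show ?case using union by simp
    qed (simp add: set_lebesgue_integral_def)
  qed
qed

text \<open>
  Multiplication by a gaussian, which has no zeros, makes a function of moderate growth integrable
  and so brings it under the uniqueness theorem for Fourier integrals. The modulated gaussians
  are Schwartz functions, so this separates tempered distributions that are functions.
\<close>
lemma test_function_uniqueness:
  fixes h :: "'a::euclidean_space \<Rightarrow> complex"
  assumes [measurable]: "h \<in> borel_measurable borel"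
    and i: "integrable lborel (\<lambda>x. h x * gaussian x)"
    and z: "\<And>v. (\<integral>x. h x * (exp (\<i> * of_real (x \<bullet> v)) * gaussian x) \<partial>lborel) = 0"
  shows "AE x in lborel. h x = 0"
proof -
  have "FT (\<lambda>x. h x * gaussian x) v = 0" for v
    using z[of v] by (simp add: FT_def mult_ac)
  from FT_vanish_imp_AE_zero[OF i this] show ?thesis
    by (auto simp: gaussian_def)
qed

section \<open>Ladder operators and eigenspaces\<close>

lemma continuous_AE_zero:
  fixes f :: "'a::euclidean_space \<Rightarrow> complex"
  assumes f: "continuous_on UNIV f" and ae: "AE x in lborel. f x = 0"
  shows "f x = 0"
proof -
  have op: "open {x. f x \<noteq> 0}"
    using f by (intro open_Collect_neq continuous_on_const)
  have "{x. f x \<noteq> 0} \<in> null_sets lborel"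
    using op by (subst AE_iff_null_sets) (use ae in auto)
  then have "negligible {x. f x \<noteq> 0}"
    by (simp add: negligible_iff_null_sets null_sets_completionI)
  then show ?thesis using open_not_negligible[OF op] by blast
qed

lemma partial_deriv_add:
  assumes "f \<in> schwartz" "g \<in> schwartz"
  shows "partial_deriv b (\<lambda>x. f x + g x) x = partial_deriv b f x + partial_deriv b g x"
  by (rule partial_deriv_eq[OF has_derivative_add[OF schwartz_has_derivative schwartz_has_derivative]]) fact+

lemma partial_deriv_scale:
  assumes "f \<in> schwartz"
  shows "partial_deriv b (\<lambda>x. c * f x) x = c * partial_deriv b f x"
  by (rule partial_deriv_eq[OF has_derivative_mult_right[OF schwartz_has_derivative]]) fact

lemma partial_deriv_cnj:
  assumes "f \<in> schwartz"
  shows "partial_deriv b (\<lambda>x. cnj (f x)) x = cnj (partial_deriv b f x)"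
  by (rule partial_deriv_eq[OF has_derivative_cnj[OF schwartz_has_derivative]]) fact

lemma partial_deriv_coord:
  assumes "f \<in> schwartz"
  shows "partial_deriv b (\<lambda>x. of_real (x \<bullet> c) * f x) x = of_real (x \<bullet> c) * partial_deriv b f x + of_real (b \<bullet> c) * f x"
proof -
  have "((\<lambda>x. complex_of_real (x \<bullet> c)) has_derivative (\<lambda>h. of_real (h \<bullet> c))) (at x)"
    by (auto intro!: derivative_eq_intros)
  from partial_deriv_eq[OF has_derivative_mult[OF this schwartz_has_derivative[OF assms]]]
  show ?thesis by simp
qed

lemma schwartz_zero: "(\<lambda>x. 0) \<in> schwartz"
  using schwartz_scale[OF gaussian_schwartz, of 0] by simp

lemma schwartz_uminus: "f \<in> schwartz \<Longrightarrow> (\<lambda>x. - f x) \<in> schwartz"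
  using schwartz_scale[of f "-1"] by simp

lemma schwartz_diff: "f \<in> schwartz \<Longrightarrow> g \<in> schwartz \<Longrightarrow> (\<lambda>x. f x - g x) \<in> schwartz"
  using schwartz_add[OF _ schwartz_uminus, of f g] by simp

lemma schwartz_sum: "(\<And>i. i \<in> I \<Longrightarrow> f i \<in> schwartz) \<Longrightarrow> (\<lambda>x. \<Sum>i\<in>I. f i x) \<in> schwartz"
  by (induction I rule: infinite_finite_induct) (auto simp: schwartz_zero schwartz_add)

lemma partial_deriv_zero: "partial_deriv b (\<lambda>x. 0) x = 0"
  by (rule partial_deriv_eq[of _ "\<lambda>_. 0"]) simp

lemma partial_deriv_sum: "(\<And>i. i \<in> I \<Longrightarrow> f i \<in> schwartz) \<Longrightarrow>
    partial_deriv b (\<lambda>x. \<Sum>i\<in>I. f i x) x = (\<Sum>i\<in>I. partial_deriv b (f i) x)"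
  by (induction I rule: infinite_finite_induct) (auto simp: partial_deriv_zero partial_deriv_add schwartz_sum)

lemma partial_deriv_diff:
  assumes "f \<in> schwartz" "g \<in> schwartz"
  shows "partial_deriv b (\<lambda>x. f x - g x) x = partial_deriv b f x - partial_deriv b g x"
  by (rule partial_deriv_eq[OF has_derivative_diff[OF schwartz_has_derivative schwartz_has_derivative]]) fact+

lemma partial_deriv_modulated_gaussian:
  "partial_deriv b (\<lambda>x. exp (\<i> * of_real (x \<bullet> v)) * gaussian x) =
    (\<lambda>x. (\<i> * of_real (v \<bullet> b) - of_real (x \<bullet> b)) * (exp (\<i> * of_real (x \<bullet> v)) * gaussian x))"
proof
  fix x
  have i: "((\<lambda>x. \<i> * complex_of_real (x \<bullet> v)) has_derivative (\<lambda>h. \<i> * complex_of_real (h \<bullet> v))) (at x)"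
    by (auto intro!: derivative_eq_intros)
  have "(exp has_derivative (*) (exp (\<i> * complex_of_real (x \<bullet> v)))) (at (\<i> * complex_of_real (x \<bullet> v)))"
    using DERIV_exp unfolding has_field_derivative_def .
  from has_derivative_compose[OF i this]
  have der: "((\<lambda>x. exp (\<i> * of_real (x \<bullet> v))) has_derivative (\<lambda>h. exp (\<i> * of_real (x \<bullet> v)) * (\<i> * of_real (h \<bullet> v)))) (at x)" .
  show "partial_deriv b (\<lambda>x. exp (\<i> * of_real (x \<bullet> v)) * gaussian x) x =
    (\<i> * of_real (v \<bullet> b) - of_real (x \<bullet> b)) * (exp (\<i> * of_real (x \<bullet> v)) * gaussian x)"
    using partial_deriv_eq[OF has_derivative_mult[OF der gaussian_has_derivative]]
    by (simp add: algebra_simps inner_commute)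
qed

text \<open>
  Second partial derivatives of a modulated gaussian \<open>E\<close> are explicit and visibly symmetric.
  Integrating by parts twice, the difference of the two mixed derivatives of \<open>f\<close> pairs to zero
  with every \<open>E\<close>, hence vanishes.
\<close>
lemma partial_deriv_commute:
  fixes f :: "'a::euclidean_space \<Rightarrow> complex"
  assumes f: "f \<in> schwartz" and b: "b \<in> Basis" and c: "c \<in> Basis"
  shows "partial_deriv b (partial_deriv c f) x = partial_deriv c (partial_deriv b f) x"
proof -
  let ?h = "\<lambda>x. partial_deriv b (partial_deriv c f) x - partial_deriv c (partial_deriv b f) x"
  have h: "?h \<in> schwartz" by (intro schwartz_diff schwartz_partial_deriv f b c)
  have "AE x in lborel. ?h x = 0"
  proof (rule test_function_uniqueness)
    show "?h \<in> borel_measurable borel" by (rule schwartz_measurable[OF h])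
    show "integrable lborel (\<lambda>x. ?h x * gaussian x)"
      by (intro schwartz_integrable schwartz_mult h gaussian_schwartz)
    fix v :: 'a
    let ?E = "\<lambda>x. exp (\<i> * of_real (x \<bullet> v)) * gaussian x"
    have E: "?E \<in> schwartz" by (intro schwartz_char gaussian_schwartz)
    have two: "partial_deriv c (partial_deriv b ?E) x =
       (\<i> * of_real (v \<bullet> b) - of_real (x \<bullet> b)) * ((\<i> * of_real (v \<bullet> c) - of_real (x \<bullet> c)) * ?E x) - of_real (b \<bullet> c) * ?E x" for b c x
    proof -
      have "partial_deriv c (partial_deriv b ?E) x = partial_deriv c (\<lambda>x. \<i> * of_real (v \<bullet> b) * ?E x - of_real (x \<bullet> b) * ?E x) x"
        unfolding partial_deriv_modulated_gaussian by (simp add: algebra_simps)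
      also have "\<dots> = \<i> * of_real (v \<bullet> b) * partial_deriv c ?E x - (of_real (x \<bullet> b) * partial_deriv c ?E x + of_real (c \<bullet> b) * ?E x)"
        by (subst partial_deriv_diff)
          (simp_all only: partial_deriv_scale[OF E] partial_deriv_coord[OF E] schwartz_scale[OF E] schwartz_coord[OF E])
      finally show ?thesis unfolding partial_deriv_modulated_gaussian by (simp add: algebra_simps inner_commute)
    qed
    have ibp: "(\<integral>x. partial_deriv b (partial_deriv c f) x * ?E x \<partial>lborel) = (\<integral>x. f x * partial_deriv c (partial_deriv b ?E) x \<partial>lborel)"
      if "b \<in> Basis" "c \<in> Basis" for b c
      using that by (simp add: integration_by_parts schwartz_partial_deriv f E)
    have "(\<integral>x. ?h x * ?E x \<partial>lborel) = (\<integral>x. partial_deriv b (partial_deriv c f) x * ?E x \<partial>lborel) - (\<integral>x. partial_deriv c (partial_deriv b f) x * ?E x \<partial>lborel)"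
      unfolding left_diff_distrib
      by (intro Bochner_Integration.integral_diff schwartz_integrable schwartz_mult E schwartz_partial_deriv f b c)
    also have "\<dots> = 0" by (simp only: ibp b c two) (simp add: mult_ac inner_commute)
    finally show "(\<integral>x. ?h x * ?E x \<partial>lborel) = 0" .
  qed
  from continuous_AE_zero[OF schwartz_continuous[OF h] this, of x] show ?thesis by simp
qed

text \<open>
  The annihilation operator in direction \<open>b\<close>.
\<close>
definition lower :: "'a::euclidean_space \<Rightarrow> ('a \<Rightarrow> complex) \<Rightarrow> 'a \<Rightarrow> complex" where
  "lower b f x = of_real (x \<bullet> b) * f x + partial_deriv b f x"

text \<open>
  The creation operator in direction \<open>b\<close>, the adjoint of the annihilation operator.
\<close>
definition raise :: "'a::euclidean_space \<Rightarrow> ('a \<Rightarrow> complex) \<Rightarrow> 'a \<Rightarrow> complex" where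
  "raise b f x = of_real (x \<bullet> b) * f x - partial_deriv b f x"

definition ip :: "('a::euclidean_space \<Rightarrow> complex) \<Rightarrow> ('a \<Rightarrow> complex) \<Rightarrow> complex" where
  "ip f g = (\<integral>x. f x * cnj (g x) \<partial>lborel)"

definition nsq :: "('a::euclidean_space \<Rightarrow> complex) \<Rightarrow> real" where
  "nsq f = (\<integral>x. (cmod (f x))\<^sup>2 \<partial>lborel)"

lemma schwartz_lower: "f \<in> schwartz \<Longrightarrow> b \<in> Basis \<Longrightarrow> lower b f \<in> schwartz"
  unfolding lower_def[abs_def] by (intro schwartz_add schwartz_coord schwartz_partial_deriv)

lemma schwartz_raise: "f \<in> schwartz \<Longrightarrow> b \<in> Basis \<Longrightarrow> raise b f \<in> schwartz"
  unfolding raise_def[abs_def] by (intro schwartz_diff schwartz_coord schwartz_partial_deriv)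

lemma schwartz_ip_integrable: "f \<in> schwartz \<Longrightarrow> g \<in> schwartz \<Longrightarrow> integrable lborel (\<lambda>x. f x * cnj (g x))"
  by (intro schwartz_integrable schwartz_mult schwartz_cnj)

lemma ip_add_left: "f \<in> schwartz \<Longrightarrow> g \<in> schwartz \<Longrightarrow> h \<in> schwartz \<Longrightarrow> ip (\<lambda>x. f x + g x) h = ip f h + ip g h"
  unfolding ip_def by (simp add: distrib_right schwartz_ip_integrable)

lemma ip_scale_left: "ip (\<lambda>x. c * f x) h = c * ip f h"
  unfolding ip_def by (simp add: mult.assoc)

lemma ip_commute: "ip g f = cnj (ip f g)"
  unfolding ip_def by (subst Bochner_Integration.integral_cnj[symmetric]) (simp add: mult.commute)

lemma ip_scale_right: "ip h (\<lambda>x. c * f x) = cnj c * ip h f"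
  using ip_scale_left[of c f h] by (metis complex_cnj_mult ip_commute)

lemma ip_sum_left: "(\<And>i. i \<in> I \<Longrightarrow> f i \<in> schwartz) \<Longrightarrow> h \<in> schwartz \<Longrightarrow> ip (\<lambda>x. \<Sum>i\<in>I. f i x) h = (\<Sum>i\<in>I. ip (f i) h)"
proof (induction I rule: infinite_finite_induct)
  case (insert i I)
  then show ?case by (simp add: ip_add_left schwartz_sum)
qed (auto simp: ip_def)

lemma ip_self: "ip f f = of_real (nsq f)"
proof -
  have "f x * cnj (f x) = of_real ((cmod (f x))\<^sup>2)" for x using complex_norm_square[of "f x"] by simp
  then show ?thesis unfolding ip_def nsq_def by (simp only: integral_complex_of_real)
qed

lemma nsq_nonneg [simp]: "nsq f \<ge> 0" unfolding nsq_def by simp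

lemma schwartz_sq_integrable: "f \<in> schwartz \<Longrightarrow> integrable lborel (\<lambda>x. (cmod (f x))\<^sup>2)"
proof -
  assume f: "f \<in> schwartz"
  have "integrable lborel (\<lambda>x. cmod (f x * cnj (f x)))" by (intro integrable_norm schwartz_ip_integrable f)
  then show ?thesis by (simp add: norm_mult power2_eq_square)
qed

lemma nsq_eq_0:
  assumes f: "f \<in> schwartz" and z: "nsq f = 0"
  shows "f x = 0"
proof (rule continuous_AE_zero[OF schwartz_continuous[OF f]])
  show "AE x in lborel. f x = 0"
    using integral_nonneg_eq_0_iff_AE[OF schwartz_sq_integrable[OF f]] z unfolding nsq_def by simp
qed

lemma ip_lower_left:
  assumes "f \<in> schwartz" "g \<in> schwartz" "b \<in> Basis"
  shows "ip (lower b f) g = ip f (raise b g)"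
proof -
  have "ip (lower b f) g = (\<integral>x. of_real (x \<bullet> b) * f x * cnj (g x) + partial_deriv b f x * cnj (g x) \<partial>lborel)"
    unfolding ip_def lower_def by (simp add: distrib_right)
  also have "\<dots> = (\<integral>x. of_real (x \<bullet> b) * f x * cnj (g x) \<partial>lborel) + (\<integral>x. partial_deriv b f x * cnj (g x) \<partial>lborel)"
    by (intro Bochner_Integration.integral_add schwartz_integrable schwartz_mult schwartz_coord schwartz_cnj schwartz_partial_deriv assms)
  also have "(\<integral>x. partial_deriv b f x * cnj (g x) \<partial>lborel) = - (\<integral>x. f x * cnj (partial_deriv b g x) \<partial>lborel)"
    using integration_by_parts[OF assms(1) schwartz_cnj[OF assms(2)] assms(3)] partial_deriv_cnj[OF assms(2)] by simp
  also have "(\<integral>x. of_real (x \<bullet> b) * f x * cnj (g x) \<partial>lborel) + - (\<integral>x. f x * cnj (partial_deriv b g x) \<partial>lborel)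
     = (\<integral>x. of_real (x \<bullet> b) * f x * cnj (g x) - f x * cnj (partial_deriv b g x) \<partial>lborel)"
    by (subst Bochner_Integration.integral_diff)
      (auto intro!: schwartz_integrable schwartz_mult schwartz_coord schwartz_cnj schwartz_partial_deriv assms)
  also have "\<dots> = ip f (raise b g)"
    unfolding ip_def raise_def by (simp add: algebra_simps)
  finally show ?thesis .
qed

lemma ip_raise_left:
  assumes "f \<in> schwartz" "g \<in> schwartz" "b \<in> Basis"
  shows "ip (raise b f) g = ip f (lower b g)"
  using ip_lower_left[OF assms(2,1,3)] by (metis ip_commute)

lemma lower_add: "f \<in> schwartz \<Longrightarrow> g \<in> schwartz \<Longrightarrow> lower b (\<lambda>x. f x + g x) = (\<lambda>x. lower b f x + lower b g x)"
  by (auto simp: lower_def partial_deriv_add algebra_simps)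

lemma lower_scale: "f \<in> schwartz \<Longrightarrow> lower b (\<lambda>x. c * f x) = (\<lambda>x. c * lower b f x)"
  by (auto simp: lower_def partial_deriv_scale algebra_simps)

lemma raise_add: "f \<in> schwartz \<Longrightarrow> g \<in> schwartz \<Longrightarrow> raise b (\<lambda>x. f x + g x) = (\<lambda>x. raise b f x + raise b g x)"
  by (auto simp: raise_def partial_deriv_add algebra_simps)

lemma raise_scale: "f \<in> schwartz \<Longrightarrow> raise b (\<lambda>x. c * f x) = (\<lambda>x. c * raise b f x)"
  by (auto simp: raise_def partial_deriv_scale algebra_simps)

lemma lower_sum: "(\<And>i. i \<in> I \<Longrightarrow> f i \<in> schwartz) \<Longrightarrow> lower b (\<lambda>x. \<Sum>i\<in>I. f i x) = (\<lambda>x. \<Sum>i\<in>I. lower b (f i) x)"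
  by (auto simp: lower_def partial_deriv_sum sum_distrib_left sum.distrib)

lemma raise_sum: "(\<And>i. i \<in> I \<Longrightarrow> f i \<in> schwartz) \<Longrightarrow> raise b (\<lambda>x. \<Sum>i\<in>I. f i x) = (\<lambda>x. \<Sum>i\<in>I. raise b (f i) x)"
  by (auto simp: raise_def partial_deriv_sum sum_distrib_left sum_subtractf)

lemma raise_lower_expand:
  assumes f: "f \<in> schwartz" and b: "b \<in> Basis" "c \<in> Basis"
  shows "raise c (lower b f) x = of_real (x \<bullet> c) * (of_real (x \<bullet> b) * f x) + of_real (x \<bullet> c) * partial_deriv b f x
     - of_real (b \<bullet> c) * f x - of_real (x \<bullet> b) * partial_deriv c f x - partial_deriv c (partial_deriv b f) x"
  unfolding raise_def
  by (simp add: lower_def[abs_def] partial_deriv_add partial_deriv_coord schwartz_coord schwartz_partial_deriv assms)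
    (simp add: algebra_simps inner_commute)

lemma lower_raise_expand:
  assumes f: "f \<in> schwartz" and b: "b \<in> Basis" "c \<in> Basis"
  shows "lower b (raise c f) x = of_real (x \<bullet> c) * (of_real (x \<bullet> b) * f x) + of_real (x \<bullet> c) * partial_deriv b f x
     + of_real (b \<bullet> c) * f x - of_real (x \<bullet> b) * partial_deriv c f x - partial_deriv c (partial_deriv b f) x"
  unfolding lower_def
  by (simp add: raise_def[abs_def] partial_deriv_diff partial_deriv_coord schwartz_coord schwartz_partial_deriv assms
      partial_deriv_commute[OF f b]) (simp add: algebra_simps inner_commute)

lemma lower_raise_commute:
  assumes "f \<in> schwartz" "b \<in> Basis" "c \<in> Basis"
  shows "lower b (raise c f) = (\<lambda>x. raise c (lower b f) x + 2 * of_real (b \<bullet> c) * f x)"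
  by (auto simp: lower_raise_expand raise_lower_expand assms algebra_simps)

lemma lower_lower_commute:
  assumes "f \<in> schwartz" "b \<in> Basis" "c \<in> Basis"
  shows "lower b (lower c f) = lower c (lower b f)"
proof
  fix x
  show "lower b (lower c f) x = lower c (lower b f) x"
    unfolding lower_def[of b "lower c f"] lower_def[of c "lower b f"]
    by (simp add: lower_def[abs_def] partial_deriv_add partial_deriv_coord schwartz_coord schwartz_partial_deriv assms
      partial_deriv_commute[OF assms]) (simp add: algebra_simps inner_commute)
qed

text \<open>
  In one direction \<open>(x - \<partial>) (x + \<partial>) = x\<^sup>2 - \<partial>\<^sup>2 - 1\<close>; the constants add up to the dimension.
\<close>
lemma harmonic_oscillator_raise_lower:
  fixes f :: "'a::euclidean_space \<Rightarrow> complex"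
  assumes f: "f \<in> schwartz"
  shows "harmonic_oscillator f x = (\<Sum>b\<in>Basis. raise b (lower b f) x) + of_nat DIM('a) * f x"
proof -
  have n: "complex_of_real ((norm x)\<^sup>2) = (\<Sum>b\<in>Basis. of_real (x \<bullet> b) * of_real (x \<bullet> b))"
    unfolding power2_norm_eq_inner by (subst euclidean_inner) simp
  have "(\<Sum>b\<in>Basis. raise b (lower b f) x) = (\<Sum>b\<in>Basis. of_real (x \<bullet> b) * (of_real (x \<bullet> b) * f x) - f x - partial_deriv b (partial_deriv b f) x)"
    by (intro sum.cong refl) (simp add: raise_lower_expand f inner_Basis)
  also have "\<dots> = harmonic_oscillator f x - of_nat DIM('a) * f x"
    unfolding harmonic_oscillator_def laplacian_def n
    by (simp add: sum_subtractf sum_distrib_right mult.assoc)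
  finally show ?thesis by simp
qed

lemma schwartz_harmonic_oscillator:
  fixes f :: "'a::euclidean_space \<Rightarrow> complex"
  assumes f: "f \<in> schwartz"
  shows "harmonic_oscillator f \<in> schwartz"
proof -
  have "(\<lambda>x. (\<Sum>b\<in>Basis. raise b (lower b f) x) + of_nat DIM('a) * f x) \<in> schwartz"
    by (intro schwartz_add schwartz_sum schwartz_scale schwartz_raise schwartz_lower f)
  moreover have "harmonic_oscillator f = (\<lambda>x. (\<Sum>b\<in>Basis. raise b (lower b f) x) + of_nat DIM('a) * f x)"
    by (auto simp: harmonic_oscillator_raise_lower f)
  ultimately show ?thesis by simp
qed

lemma ip_harmonic_oscillator:
  fixes f g :: "'a::euclidean_space \<Rightarrow> complex"
  assumes f: "f \<in> schwartz" and g: "g \<in> schwartz"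
  shows "ip (harmonic_oscillator f) g = (\<Sum>b\<in>Basis. ip (lower b f) (lower b g)) + of_nat DIM('a) * ip f g"
proof -
  have "harmonic_oscillator f = (\<lambda>x. (\<Sum>b\<in>Basis. raise b (lower b f) x) + of_nat DIM('a) * f x)"
    by (auto simp: harmonic_oscillator_raise_lower f)
  then show ?thesis
    by (simp add: ip_add_left ip_scale_left ip_sum_left ip_raise_left schwartz_sum schwartz_scale schwartz_raise schwartz_lower f g)
qed

lemma ip_harmonic_oscillator_right:
  fixes f g :: "'a::euclidean_space \<Rightarrow> complex"
  assumes f: "f \<in> schwartz" and g: "g \<in> schwartz"
  shows "ip (harmonic_oscillator f) g = ip f (harmonic_oscillator g)"
proof -
  have "ip f (harmonic_oscillator g) = cnj (ip (harmonic_oscillator g) f)" by (rule ip_commute)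
  also have "\<dots> = (\<Sum>b\<in>Basis. cnj (ip (lower b g) (lower b f))) + of_nat DIM('a) * cnj (ip g f)"
    by (simp add: ip_harmonic_oscillator f g)
  also have "\<dots> = ip (harmonic_oscillator f) g"
    by (simp add: ip_harmonic_oscillator f g ip_commute[symmetric])
  finally show ?thesis by simp
qed

lemma eigenspaceD:
  assumes "f \<in> H_eigenspace l"
  shows "f \<in> schwartz" "harmonic_oscillator f = (\<lambda>x. of_real l * f x)"
  using assms by (auto simp: H_eigenspace_def)

lemma eigenspaceI: "f \<in> schwartz \<Longrightarrow> harmonic_oscillator f = (\<lambda>x. of_real l * f x) \<Longrightarrow> f \<in> H_eigenspace l"
  by (auto simp: H_eigenspace_def)

lemma harmonic_oscillator_add: "f \<in> schwartz \<Longrightarrow> g \<in> schwartz \<Longrightarrow>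
  harmonic_oscillator (\<lambda>x. f x + g x) x = harmonic_oscillator f x + harmonic_oscillator g x"
  by (simp add: harmonic_oscillator_raise_lower schwartz_add lower_add raise_add schwartz_lower sum.distrib algebra_simps)

lemma harmonic_oscillator_scale: "f \<in> schwartz \<Longrightarrow>
  harmonic_oscillator (\<lambda>x. c * f x) x = c * harmonic_oscillator f x"
  by (simp add: harmonic_oscillator_raise_lower schwartz_scale lower_scale raise_scale schwartz_lower sum_distrib_left algebra_simps)

lemma eigenspace_add: "f \<in> H_eigenspace l \<Longrightarrow> g \<in> H_eigenspace l \<Longrightarrow> (\<lambda>x. f x + g x) \<in> H_eigenspace l"
  by (auto simp: H_eigenspace_def schwartz_add harmonic_oscillator_add algebra_simps)

lemma eigenspace_scale: "f \<in> H_eigenspace l \<Longrightarrow> (\<lambda>x. c * f x) \<in> H_eigenspace l"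
  by (auto simp: H_eigenspace_def schwartz_scale harmonic_oscillator_scale algebra_simps)

lemma eigenspace_zero: "(\<lambda>x. 0) \<in> H_eigenspace l"
proof -
  have "partial_deriv b (\<lambda>x. 0) = (\<lambda>x. 0)" for b :: 'a by (rule ext) (rule partial_deriv_zero)
  then show ?thesis
    by (intro eigenspaceI[OF schwartz_zero]) (auto simp: harmonic_oscillator_def laplacian_def)
qed

lemma eigenspace_sum: "(\<And>i. i \<in> I \<Longrightarrow> f i \<in> H_eigenspace l) \<Longrightarrow> (\<lambda>x. \<Sum>i\<in>I. f i x) \<in> H_eigenspace l"
  by (induction I rule: infinite_finite_induct) (auto simp: eigenspace_zero eigenspace_add)

lemma eigenspace_cnj: "f \<in> H_eigenspace l \<Longrightarrow> (\<lambda>x. cnj (f x)) \<in> H_eigenspace l"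
proof -
  assume f: "f \<in> H_eigenspace l"
  note S = eigenspaceD(1)[OF f]
  have 1: "partial_deriv b (\<lambda>x. cnj (f x)) = (\<lambda>x. cnj (partial_deriv b f x))" for b
    by (auto simp: partial_deriv_cnj S)
  have "harmonic_oscillator (\<lambda>x. cnj (f x)) x = cnj (harmonic_oscillator f x)" for x
    unfolding harmonic_oscillator_def laplacian_def 1
    by (simp add: partial_deriv_cnj schwartz_partial_deriv S)
  then show ?thesis using S eigenspaceD(2)[OF f] by (intro eigenspaceI) (auto simp: schwartz_cnj)
qed

text \<open>
  The commutator of \<open>H\<close> with the annihilation operator is \<open>-2\<close> times the latter, by the
  factorisation of \<open>H\<close> and the canonical commutation relations.
\<close>
lemma eigenspace_lower:
  fixes f :: "'a::euclidean_space \<Rightarrow> complex"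
  assumes f: "f \<in> H_eigenspace l" and b: "b \<in> Basis"
  shows "lower b f \<in> H_eigenspace (l - 2)"
proof -
  note S = eigenspaceD(1)[OF f]
  have comm: "lower b (raise c (lower c f)) x = raise c (lower c (lower b f)) x + 2 * of_real (b \<bullet> c) * lower c f x"
    if "c \<in> Basis" for c x
    using lower_raise_commute[OF schwartz_lower[OF S that] b that] lower_lower_commute[OF S b that] by simp
  have "harmonic_oscillator f = (\<lambda>x. (\<Sum>c\<in>Basis. raise c (lower c f) x) + of_nat DIM('a) * f x)"
    by (auto simp: harmonic_oscillator_raise_lower S)
  then have e1: "lower b (harmonic_oscillator f) x = (\<Sum>c\<in>Basis. lower b (raise c (lower c f)) x) + of_nat DIM('a) * lower b f x" for x
    by (simp add: lower_add lower_scale lower_sum schwartz_sum schwartz_scale schwartz_raise schwartz_lower S)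
  have e2: "(\<Sum>c\<in>Basis. lower b (raise c (lower c f)) x) = (\<Sum>c\<in>Basis. raise c (lower c (lower b f)) x) + 2 * lower b f x" for x
  proof -
    have "(\<Sum>c\<in>Basis. lower b (raise c (lower c f)) x) =
      (\<Sum>c\<in>Basis. raise c (lower c (lower b f)) x) + (\<Sum>c\<in>Basis. 2 * of_real (b \<bullet> c) * lower c f x)"
      by (simp add: comm sum.distrib)
    also have "(\<Sum>c\<in>Basis. 2 * of_real (b \<bullet> c) * lower c f x) = (\<Sum>c\<in>Basis. if c = b then 2 * lower b f x else 0)"
      using b by (intro sum.cong refl) (auto simp: inner_Basis)
    finally show ?thesis using b by simp
  qed
  have "lower b (harmonic_oscillator f) x = harmonic_oscillator (lower b f) x + 2 * lower b f x" for x
    unfolding e1 e2 by (simp add: harmonic_oscillator_raise_lower schwartz_lower S b)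
  moreover have "lower b (harmonic_oscillator f) x = of_real l * lower b f x" for x
    unfolding eigenspaceD(2)[OF f] by (simp add: lower_scale S)
  ultimately have "harmonic_oscillator (lower b f) x = of_real (l - 2) * lower b f x" for x
    by (metis add_diff_cancel_right' left_diff_distrib of_real_diff of_real_numeral)
  then show ?thesis by (intro eigenspaceI schwartz_lower S b) auto
qed

lemma eigenspace_raise:
  fixes f :: "'a::euclidean_space \<Rightarrow> complex"
  assumes f: "f \<in> H_eigenspace l" and b: "b \<in> Basis"
  shows "raise b f \<in> H_eigenspace (l + 2)"
proof -
  note S = eigenspaceD(1)[OF f]
  note R = schwartz_raise[OF S b]
  have comm: "raise c (lower c (raise b f)) x = raise c (raise b (lower c f)) x + 2 * of_real (c \<bullet> b) * raise c f x"
    if "c \<in> Basis" for c x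
    unfolding lower_raise_commute[OF S that b]
    using that by (simp add: raise_add raise_scale schwartz_scale schwartz_raise schwartz_lower S b)
  have rr: "raise c (raise b g) x = raise b (raise c g) x" if g: "g \<in> schwartz" and c: "c \<in> Basis" for c g x
    unfolding raise_def[of c "raise b g"] raise_def[of b "raise c g"]
    by (simp add: raise_def[abs_def] partial_deriv_diff partial_deriv_coord schwartz_coord schwartz_partial_deriv g b c
      partial_deriv_commute[OF g b c]) (simp add: algebra_simps inner_commute)
  have "harmonic_oscillator f = (\<lambda>x. (\<Sum>c\<in>Basis. raise c (lower c f) x) + of_nat DIM('a) * f x)"
    by (auto simp: harmonic_oscillator_raise_lower S)
  then have e1: "raise b (harmonic_oscillator f) x = (\<Sum>c\<in>Basis. raise b (raise c (lower c f)) x) + of_nat DIM('a) * raise b f x" for x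
    by (simp add: raise_add raise_scale raise_sum schwartz_sum schwartz_scale schwartz_raise schwartz_lower S)
  have e2: "(\<Sum>c\<in>Basis. raise c (lower c (raise b f)) x) = (\<Sum>c\<in>Basis. raise b (raise c (lower c f)) x) + 2 * raise b f x" for x
  proof -
    have "(\<Sum>c\<in>Basis. raise c (lower c (raise b f)) x) =
      (\<Sum>c\<in>Basis. raise b (raise c (lower c f)) x) + (\<Sum>c\<in>Basis. 2 * of_real (c \<bullet> b) * raise c f x)"
      by (simp add: comm sum.distrib rr schwartz_lower S)
    also have "(\<Sum>c\<in>Basis. 2 * of_real (c \<bullet> b) * raise c f x) = (\<Sum>c\<in>Basis. if c = b then 2 * raise b f x else 0)"
      using b by (intro sum.cong refl) (auto simp: inner_Basis)
    finally show ?thesis using b by simp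
  qed
  have "harmonic_oscillator (raise b f) x = raise b (harmonic_oscillator f) x + 2 * raise b f x" for x
    unfolding e1 by (simp add: harmonic_oscillator_raise_lower R e2)
  then have "harmonic_oscillator (raise b f) x = of_real (l + 2) * raise b f x" for x
    unfolding eigenspaceD(2)[OF f] by (simp add: raise_scale S algebra_simps)
  then show ?thesis by (intro eigenspaceI R) auto
qed

lemma eigenspace_ip:
  assumes f: "f \<in> H_eigenspace l" and g: "g \<in> schwartz"
  shows "ip f (harmonic_oscillator g) = of_real l * ip f g"
  using ip_harmonic_oscillator_right[OF eigenspaceD(1)[OF f] g] eigenspaceD(2)[OF f] by (simp add: ip_scale_left)

lemma eigenspace_orthogonal:
  assumes f: "f \<in> H_eigenspace l" and g: "g \<in> H_eigenspace m" and ne: "l \<noteq> m"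
  shows "ip f g = 0"
proof -
  have "of_real l * ip f g = of_real m * ip f g"
    using eigenspace_ip[OF f eigenspaceD(1)[OF g]] unfolding eigenspaceD(2)[OF g] ip_scale_right by auto
  then show ?thesis using ne by auto
qed

text \<open>
  Pair the factorisation \<open>H = \<Sum> raise b (lower b) + d\<close> with \<open>f\<close>. Nonnegativity of the left-hand
  side bounds the eigenvalues below by \<open>d\<close>.
\<close>
lemma eigenspace_nsq_lower:
  fixes f :: "'a::euclidean_space \<Rightarrow> complex"
  assumes f: "f \<in> H_eigenspace l"
  shows "(\<Sum>b\<in>Basis. nsq (lower b f)) = (l - DIM('a)) * nsq f"
proof -
  note S = eigenspaceD(1)[OF f]
  have "of_real l * ip f f = (\<Sum>b\<in>Basis. ip (lower b f) (lower b f)) + of_nat DIM('a) * ip f f"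
    using ip_harmonic_oscillator[OF S S] eigenspaceD(2)[OF f] by (simp add: ip_scale_left)
  then have "of_real (l * nsq f) = (of_real ((\<Sum>b\<in>Basis. nsq (lower b f)) + DIM('a) * nsq f) :: complex)"
    by (simp add: ip_self)
  then have "l * nsq f = (\<Sum>b\<in>Basis. nsq (lower b f)) + DIM('a) * nsq f"
    by (simp only: of_real_eq_iff)
  then show ?thesis by (simp add: algebra_simps)
qed

lemma nsq_raise:
  assumes f: "f \<in> schwartz" and b: "b \<in> Basis"
  shows "nsq (raise b f) = nsq (lower b f) + 2 * nsq f"
proof -
  have "ip (raise b f) (raise b f) = ip (lower b (raise b f)) f"
    using ip_lower_left[OF schwartz_raise[OF f b] f b] by simp
  also have "lower b (raise b f) = (\<lambda>x. raise b (lower b f) x + 2 * f x)"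
    using lower_raise_commute[OF f b b] b by (simp add: inner_Basis)
  also have "ip \<dots> f = ip (lower b f) (lower b f) + 2 * ip f f"
    by (simp add: ip_add_left ip_scale_left ip_raise_left schwartz_raise schwartz_lower schwartz_scale f b)
  finally have "(of_real (nsq (raise b f)) :: complex) = of_real (nsq (lower b f) + 2 * nsq f)"
    by (simp add: ip_self)
  then show ?thesis by (simp only: of_real_eq_iff)
qed

lemma eigenspace_below:
  fixes f :: "'a::euclidean_space \<Rightarrow> complex"
  assumes f: "f \<in> H_eigenspace l" and l: "l < DIM('a)"
  shows "f = (\<lambda>x. 0)"
proof -
  have "0 \<le> (l - DIM('a)) * nsq f"
    using eigenspace_nsq_lower[OF f] by (metis nsq_nonneg sum_nonneg)
  then have "nsq f = 0" using l nsq_nonneg[of f] by (simp add: zero_le_mult_iff)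
  then show ?thesis using nsq_eq_0 eigenspaceD(1)[OF f] by blast
qed

text \<open>
  Each annihilation operator decreases the eigenvalue by \<open>2\<close>, and below \<open>d\<close> there are no
  eigenfunctions, so finitely many steps annihilate everything. Going back up, the norm identity
  \<open>eigenspace_nsq_lower\<close> shows that a function all of whose lowered versions vanish is zero unless
  its eigenvalue is \<open>d\<close>, which is excluded at every step.
\<close>
lemma eigenspace_trivial:
  fixes f :: "'a::euclidean_space \<Rightarrow> complex"
  assumes "f \<in> H_eigenspace l" and "\<forall>n::nat. l \<noteq> DIM('a) + 2 * n"
  shows "f = (\<lambda>x. 0)"
proof -
  obtain k :: nat where "l < k" using reals_Archimedean2 by blast
  then have "l < DIM('a) + 2 * k" by simp
  then show ?thesis using assms
  proof (induction k arbitrary: l f)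
    case 0
    then show ?case by (intro eigenspace_below) auto
  next
    case (Suc k)
    have "lower b f = (\<lambda>x. 0)" if b: "b \<in> Basis" for b
    proof (rule Suc.IH[of "l - 2"])
      show "\<forall>n::nat. l - 2 \<noteq> DIM('a) + 2 * n"
      proof
        fix n :: nat show "l - 2 \<noteq> DIM('a) + 2 * n"
          using Suc.prems(3)[rule_format, of "Suc n"] by (simp add: algebra_simps)
      qed
    qed (use Suc.prems eigenspace_lower b in auto)
    then have "(l - DIM('a)) * nsq f = 0"
      using eigenspace_nsq_lower[OF Suc.prems(2)] by (simp add: nsq_def)
    moreover have "l \<noteq> DIM('a)" using Suc.prems(3)[rule_format, of 0] by simp
    ultimately have "nsq f = 0" by simp
    then show ?case using nsq_eq_0 eigenspaceD(1)[OF Suc.prems(2)] by blast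
  qed
qed

lemma partial_deriv_inner_sum:
  fixes f :: "'a::euclidean_space \<Rightarrow> complex"
  assumes f: "f \<in> schwartz"
  shows "partial_deriv h f x = (\<Sum>b\<in>Basis. of_real (h \<bullet> b) * partial_deriv b f x)"
proof -
  interpret D: bounded_linear "\<lambda>h. partial_deriv h f x"
    by (rule has_derivative_bounded_linear[OF schwartz_has_derivative[OF f]])
  have "partial_deriv h f x = partial_deriv (\<Sum>b\<in>Basis. (h \<bullet> b) *\<^sub>R b) f x" by (simp add: euclidean_representation)
  also have "\<dots> = (\<Sum>b\<in>Basis. of_real (h \<bullet> b) * partial_deriv b f x)"
    by (simp add: D.sum D.scaleR scaleR_conv_of_real)
  finally show ?thesis .
qed

lemma lower_gaussian: "lower b gaussian = (\<lambda>x. 0)"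
  by (auto simp: lower_def partial_deriv_gaussian)

lemma gaussian_eigen: "(gaussian :: 'a::euclidean_space \<Rightarrow> complex) \<in> H_eigenspace (DIM('a))"
proof (rule eigenspaceI[OF gaussian_schwartz])
  have "raise b (\<lambda>x::'a. 0) x = 0" for b x by (simp add: raise_def partial_deriv_zero)
  then show "harmonic_oscillator gaussian = (\<lambda>x::'a. complex_of_real (real DIM('a)) * gaussian x)"
    by (simp add: harmonic_oscillator_raise_lower[OF gaussian_schwartz] lower_gaussian fun_eq_iff)
qed

text \<open>
  All annihilation operators kill \<open>f\<close>, that is \<open>\<nabla>f = - x f\<close>; therefore \<open>f e\<^sup>|\<^sup>x\<^sup>|\<^sup>2\<^sup>/\<^sup>2\<close> is constant.
\<close>
lemma eigenspace_ground:
  fixes f :: "'a::euclidean_space \<Rightarrow> complex"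
  assumes f: "f \<in> H_eigenspace (DIM('a))"
  obtains c where "f = (\<lambda>x. c * gaussian x)"
proof -
  note S = eigenspaceD(1)[OF f]
  have "(\<Sum>b\<in>Basis. nsq (lower b f)) = 0" using eigenspace_nsq_lower[OF f] by simp
  then have "\<forall>b\<in>Basis. nsq (lower b f) = 0" by (subst (asm) sum_nonneg_eq_0_iff) auto
  then have "lower b f x = 0" if "b \<in> Basis" for b x using nsq_eq_0 schwartz_lower[OF S] that by blast
  then have d: "partial_deriv b f x = - (of_real (x \<bullet> b) * f x)" if "b \<in> Basis" for b x
    using that unfolding lower_def by (metis eq_neg_iff_add_eq_0 add.commute)
  have dh: "partial_deriv h f x = - (of_real (x \<bullet> h) * f x)" for h x
  proof -
    have "partial_deriv h f x = - ((\<Sum>b\<in>Basis. of_real (x \<bullet> b) * of_real (h \<bullet> b)) * f x)"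
      unfolding partial_deriv_inner_sum[OF S, of h] by (simp add: d sum_distrib_left sum_negf mult_ac)
    also have "(\<Sum>b\<in>Basis. complex_of_real (x \<bullet> b) * of_real (h \<bullet> b)) = of_real (x \<bullet> h)"
      by (subst (3) euclidean_inner) simp
    finally show ?thesis .
  qed
  have "((\<lambda>x. f x * of_real (exp ((x \<bullet> x) / 2))) has_derivative (\<lambda>h. 0)) (at x)" for x
  proof -
    have "((\<lambda>x::'a. exp ((x \<bullet> x) / 2)) has_derivative (\<lambda>h. (x \<bullet> h) * exp ((x \<bullet> x) / 2))) (at x)"
      by (auto intro!: derivative_eq_intros simp: inner_commute algebra_simps fun_eq_iff)
    from has_derivative_mult[OF schwartz_has_derivative[OF S] has_derivative_of_real[OF this]]
    show ?thesis by (simp add: dh algebra_simps)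
  qed
  then obtain c where c: "\<And>x. f x * of_real (exp ((x \<bullet> x) / 2)) = c"
    using has_derivative_zero_unique[OF convex_UNIV, of "\<lambda>x. f x * of_real (exp ((x \<bullet> x) / 2))" _ 0] by simp
  have "f x = c * gaussian x" for x
  proof -
    have "c * gaussian x = f x * of_real (exp ((x \<bullet> x) / 2) * exp (- (x \<bullet> x) / 2))"
      unfolding c[of x, symmetric] gaussian_def by (simp add: power2_norm_eq_inner)
    then show ?thesis by (simp add: exp_add[symmetric])
  qed
  then show ?thesis using that by blast
qed

lemma nsq_gaussian_pos: "nsq (gaussian :: 'a::euclidean_space \<Rightarrow> complex) > 0"
proof -
  have "gaussian (0::'a) \<noteq> 0" by (simp add: gaussian_def)
  then have "nsq (gaussian :: 'a \<Rightarrow> complex) \<noteq> 0" using nsq_eq_0[OF gaussian_schwartz] by blast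
  then show ?thesis using nsq_nonneg[of "gaussian :: 'a \<Rightarrow> complex"] by linarith
qed

definition level :: "'a::euclidean_space itself \<Rightarrow> nat \<Rightarrow> real" where
  "level _ n = real DIM('a) + 2 * real n"

definition eigen :: "nat \<Rightarrow> ('a::euclidean_space \<Rightarrow> complex) set" where
  "eigen n = H_eigenspace (level TYPE('a) n)"

text \<open>
  The factorisation of \<open>H\<close> solved for \<open>f\<close>: an eigenfunction above the ground state is recovered
  from its lowered versions, which supports induction along the ladder.
\<close>
lemma eigenspace_recover:
  fixes f :: "'a::euclidean_space \<Rightarrow> complex"
  assumes f: "f \<in> eigen (Suc n)"
  shows "f = (\<lambda>x. \<Sum>b\<in>Basis. of_real (1 / (2 * Suc n)) * raise b (lower b f) x)"
proof
  fix x
  have e: "f \<in> H_eigenspace (DIM('a) + 2 * Suc n)" using f by (simp add: eigen_def level_def add_ac)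
  have "of_real (DIM('a) + 2 * Suc n) * f x = (\<Sum>b\<in>Basis. raise b (lower b f) x) + of_nat DIM('a) * f x"
    using harmonic_oscillator_raise_lower[OF eigenspaceD(1)[OF e], of x] eigenspaceD(2)[OF e] by simp
  then have "(\<Sum>b\<in>Basis. raise b (lower b f) x) = of_real (2 * Suc n) * f x" by (simp add: algebra_simps)
  then show "f x = (\<Sum>b\<in>Basis. of_real (1 / (2 * Suc n)) * raise b (lower b f) x)"
    by (simp only: sum_distrib_left[symmetric]) (simp del: of_nat_Suc)
qed

lemma level_Suc: "level T (Suc n) = level T n + 2"
  by (simp add: level_def)

lemma eigen_lower:
  fixes f :: "'a::euclidean_space \<Rightarrow> complex"
  shows "f \<in> eigen (Suc n) \<Longrightarrow> b \<in> Basis \<Longrightarrow> lower b f \<in> eigen n"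
  using eigenspace_lower[of f "level TYPE('a) (Suc n)" b] by (simp add: eigen_def level_Suc)

lemma eigen_raise:
  fixes f :: "'a::euclidean_space \<Rightarrow> complex"
  shows "f \<in> eigen n \<Longrightarrow> b \<in> Basis \<Longrightarrow> raise b f \<in> eigen (Suc n)"
  using eigenspace_raise[of f "level TYPE('a) n" b] by (simp add: eigen_def level_Suc)

lemma eigen_schwartz: "f \<in> eigen n \<Longrightarrow> f \<in> schwartz"
  unfolding eigen_def by (rule eigenspaceD)

text \<open>
  A Riesz representation theorem on one eigenspace, which produces the spectral projections.
  If \<open>p\<^sub>b\<close> represents \<open>q \<mapsto> L (raise b q)\<close> one level below, then \<open>\<Sum> raise b p\<^sub>b / (2n + 2)\<close> represents
  \<open>L\<close>, because \<open>eigenspace_recover\<close> expresses \<open>q\<close> through the functions \<open>raise b (lower b q)\<close>.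
\<close>
lemma eigen_riesz:
  fixes L :: "('a::euclidean_space \<Rightarrow> complex) \<Rightarrow> complex"
  assumes add: "\<And>f g. f \<in> schwartz \<Longrightarrow> g \<in> schwartz \<Longrightarrow> L (\<lambda>x. f x + g x) = L f + L g"
    and scale: "\<And>c f. f \<in> schwartz \<Longrightarrow> L (\<lambda>x. c * f x) = cnj c * L f"
  shows "\<exists>p\<in>eigen n. \<forall>q\<in>eigen n. ip p q = L q"
  using assms
proof (induction n arbitrary: L)
  case 0
  let ?p = "\<lambda>x::'a. (L gaussian / of_real (nsq (gaussian :: 'a \<Rightarrow> complex))) * gaussian x"
  have "level TYPE('a) 0 = real DIM('a)" by (simp add: level_def)
  then have "?p \<in> eigen 0" unfolding eigen_def by (simp only:) (intro eigenspace_scale gaussian_eigen)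
  moreover have "ip ?p q = L q" if q: "q \<in> eigen 0" for q
  proof -
    have q': "q \<in> H_eigenspace (DIM('a))" using q by (simp add: eigen_def level_def)
    obtain c where c: "q = (\<lambda>x. c * gaussian x)" using eigenspace_ground[OF q'] by blast
    show ?thesis unfolding c using nsq_gaussian_pos[where 'a='a]
      by (simp only: ip_scale_left ip_scale_right ip_self 0(2)[OF gaussian_schwartz]) simp
  qed
  ultimately show ?case by blast
next
  case (Suc n)
  have "\<exists>p\<in>eigen n. \<forall>q\<in>eigen n. ip p q = L (raise b q)" if b: "b \<in> Basis" for b
  proof (rule Suc.IH[of "\<lambda>q. L (raise b q)"])
    show "L (raise b (\<lambda>x. f x + g x)) = L (raise b f) + L (raise b g)" if "f \<in> schwartz" "g \<in> schwartz" for f g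
      using that by (simp add: raise_add Suc.prems schwartz_raise b)
    show "L (raise b (\<lambda>x. c * f x)) = cnj c * L (raise b f)" if "f \<in> schwartz" for c f
      using that by (simp add: raise_scale Suc.prems schwartz_raise b)
  qed
  then obtain p where p: "\<And>b. b \<in> Basis \<Longrightarrow> p b \<in> eigen n" "\<And>b q. b \<in> Basis \<Longrightarrow> q \<in> eigen n \<Longrightarrow> ip (p b) q = L (raise b q)"
    by metis
  let ?P = "\<lambda>x. \<Sum>b\<in>Basis. of_real (1 / (2 * Suc n)) * raise b (p b) x"
  have P: "?P \<in> eigen (Suc n)"
    using eigen_raise p(1) unfolding eigen_def by (intro eigenspace_sum eigenspace_scale) (auto simp: eigen_def)
  have Lsum: "L (\<lambda>x. \<Sum>b\<in>I. f b x) = (\<Sum>b\<in>I. L (f b))" if "\<And>b. b \<in> I \<Longrightarrow> f b \<in> schwartz" for f :: "'a \<Rightarrow> 'a \<Rightarrow> complex" and I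
    using that
  proof (induction I rule: infinite_finite_induct)
    case (insert i I)
    then show ?case by (simp add: Suc.prems(1) schwartz_sum)
  qed (use Suc.prems(2)[OF gaussian_schwartz, of 0] in auto)
  have "ip ?P q = L q" if q: "q \<in> eigen (Suc n)" for q
  proof -
    have S: "q \<in> schwartz" by (rule eigen_schwartz[OF q])
    have Sp: "p b \<in> schwartz" if "b \<in> Basis" for b using eigen_schwartz p(1) that by blast
    have "ip ?P q = (\<Sum>b\<in>Basis. of_real (1 / (2 * Suc n)) * ip (p b) (lower b q))"
      by (subst ip_sum_left) (auto simp: schwartz_scale schwartz_raise Sp S ip_scale_left ip_raise_left simp del: of_real_divide of_nat_Suc)
    also have "\<dots> = (\<Sum>b\<in>Basis. of_real (1 / (2 * Suc n)) * L (raise b (lower b q)))"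
      by (intro sum.cong refl) (simp add: p(2) eigen_lower[OF q])
    also have "\<dots> = (\<Sum>b\<in>Basis. L (\<lambda>x. of_real (1 / (2 * Suc n)) * raise b (lower b q) x))"
      by (intro sum.cong refl, subst Suc.prems(2)) (auto intro: schwartz_raise schwartz_lower S)
    also have "\<dots> = L q"
      using arg_cong[OF eigenspace_recover[OF q], of L]
        Lsum[of Basis "\<lambda>b x. of_real (1 / (2 * Suc n)) * raise b (lower b q) x"]
      by (simp only: schwartz_scale schwartz_raise schwartz_lower S)
    finally show ?thesis .
  qed
  then show ?case using P by blast
qed

section \<open>The Fourier transform on eigenspaces\<close>

text \<open>
  Multiplication by a coordinate is a derivative on the Fourier side. Knowing that \<open>FT f\<close> is a
  multiple of a Schwartz function identifies this derivative as a partial derivative of it.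
\<close>
lemma FT_coord_of_differentiable:
  fixes f :: "'a::euclidean_space \<Rightarrow> complex"
  assumes f: "f \<in> schwartz" and g: "g \<in> schwartz" and eq: "FT f = (\<lambda>v. c * g v)"
  shows "FT (\<lambda>x. of_real (x \<bullet> b) * f x) v = - \<i> * c * partial_deriv b g v"
proof -
  have d1: "((\<lambda>t. FT f (v + t *\<^sub>R b)) has_vector_derivative FT (\<lambda>x. \<i> * (of_real (x \<bullet> b) * f x)) v) (at 0)"
    using FT_has_vector_derivative[OF f, of v b 0] by (simp add: mult.assoc)
  have "((\<lambda>t. v + t *\<^sub>R b) has_derivative (\<lambda>t. t *\<^sub>R b)) (at 0)"
    by (auto intro!: derivative_eq_intros)
  from has_derivative_compose[OF this, of g "\<lambda>h. partial_deriv h g v"] schwartz_has_derivative[OF g, of v]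
  have "((\<lambda>t. g (v + t *\<^sub>R b)) has_derivative (\<lambda>t. partial_deriv (t *\<^sub>R b) g v)) (at 0)" by simp
  moreover have "partial_deriv (t *\<^sub>R b) g v = t *\<^sub>R partial_deriv b g v" for t
    using bounded_linear.linear[OF has_derivative_bounded_linear[OF schwartz_has_derivative[OF g, of v]]] linear_scale by blast
  ultimately have "((\<lambda>t. g (v + t *\<^sub>R b)) has_vector_derivative partial_deriv b g v) (at 0)"
    by (simp add: has_vector_derivative_def)
  then have d2: "((\<lambda>t. FT f (v + t *\<^sub>R b)) has_vector_derivative c * partial_deriv b g v) (at 0)"
    unfolding eq by (rule has_vector_derivative_mult_right)
  have "FT (\<lambda>x. \<i> * (of_real (x \<bullet> b) * f x)) v = c * partial_deriv b g v"
    using vector_derivative_unique_at[OF d1 d2] .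
  then have "\<i> * FT (\<lambda>x. of_real (x \<bullet> b) * f x) v = c * partial_deriv b g v" by (simp only: FT_scale)
  then have "- \<i> * (\<i> * FT (\<lambda>x. of_real (x \<bullet> b) * f x) v) = - \<i> * (c * partial_deriv b g v)" by simp
  then show ?thesis by simp
qed

lemma FT_sum: "(\<And>i. i \<in> I \<Longrightarrow> f i \<in> schwartz) \<Longrightarrow> FT (\<lambda>x. \<Sum>i\<in>I. f i x) v = (\<Sum>i\<in>I. FT (f i) v)"
proof (induction I rule: infinite_finite_induct)
  case (insert i I)
  then show ?case by (simp add: FT_add schwartz_sum)
qed (auto simp: FT_def)

text \<open>
  The Fourier integral turns a creation operator into \<open>\<i>\<close> times itself, and the gaussian has
  eigenvalue \<open>gaussian_mass\<close>. Induction along the ladder gives one factor \<open>\<i>\<close> per step.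
\<close>
lemma FT_eigen:
  fixes f :: "'a::euclidean_space \<Rightarrow> complex"
  assumes "f \<in> eigen n"
  shows "FT f = (\<lambda>v. (of_real (gaussian_mass TYPE('a)) * \<i> ^ n) * f v)"
  using assms
proof (induction n arbitrary: f)
  case 0
  have q': "f \<in> H_eigenspace (DIM('a))" using 0 by (simp add: eigen_def level_def)
  obtain c where c: "f = (\<lambda>x. c * gaussian x)" using eigenspace_ground[OF q'] by blast
  show ?case unfolding c by (auto simp: FT_scale FT_gaussian)
next
  case (Suc n)
  let ?k = "of_real (gaussian_mass TYPE('a)) * \<i> ^ n :: complex"
  note S = eigen_schwartz[OF Suc.prems]
  have r: "FT (raise b (lower b f)) v = \<i> * ?k * raise b (lower b f) v" if b: "b \<in> Basis" for b v
  proof -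
    let ?g = "lower b f"
    have g: "?g \<in> schwartz" by (rule schwartz_lower[OF S b])
    have IH: "FT ?g = (\<lambda>v. ?k * ?g v)" by (rule Suc.IH[OF eigen_lower[OF Suc.prems b]])
    have "FT (raise b ?g) v = FT (\<lambda>x. of_real (x \<bullet> b) * ?g x + (-1) * partial_deriv b ?g x) v"
      by (simp add: raise_def[abs_def])
    also have "\<dots> = FT (\<lambda>x. of_real (x \<bullet> b) * ?g x) v + (-1) * FT (partial_deriv b ?g) v"
      by (simp only: FT_add[OF schwartz_coord[OF g] schwartz_scale[OF schwartz_partial_deriv[OF g b]]] FT_scale)
    also have "\<dots> = - \<i> * ?k * partial_deriv b ?g v + \<i> * of_real (v \<bullet> b) * (?k * ?g v)"
      using FT_coord_of_differentiable[OF g g IH] FT_partial_deriv[OF g b] by (simp add: IH)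
    also have "\<dots> = \<i> * ?k * raise b ?g v" by (simp add: raise_def algebra_simps)
    finally show ?thesis .
  qed
  show ?case
  proof
    fix v
    have "FT f v = (\<Sum>b\<in>Basis. of_real (1 / (2 * Suc n)) * FT (raise b (lower b f)) v)"
      using arg_cong[OF eigenspace_recover[OF Suc.prems], of "\<lambda>f. FT f v"]
        FT_sum[of Basis "\<lambda>b x. of_real (1 / (2 * Suc n)) * raise b (lower b f) x" v]
      by (simp only: FT_scale schwartz_scale schwartz_raise schwartz_lower S)
    also have "\<dots> = \<i> * ?k * (\<Sum>b\<in>Basis. of_real (1 / (2 * Suc n)) * raise b (lower b f) v)"
      by (simp add: r sum_distrib_left mult_ac del: of_real_divide of_nat_Suc)
    also have "(\<Sum>b\<in>Basis. of_real (1 / (2 * Suc n)) * raise b (lower b f) v) = f v"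
      using fun_cong[OF eigenspace_recover[OF Suc.prems], of v] by simp
    finally show "FT f v = of_real (gaussian_mass TYPE('a)) * \<i> ^ Suc n * f v" by simp
  qed
qed

section \<open>Square integrable functions and orthogonal series\<close>

definition square_integrable :: "'b measure \<Rightarrow> ('b \<Rightarrow> complex) set" where
  "square_integrable M = {u. u \<in> borel_measurable M \<and> integrable M (\<lambda>x. (cmod (u x))\<^sup>2)}"

definition l2sq :: "'b measure \<Rightarrow> ('b \<Rightarrow> complex) \<Rightarrow> real" where
  "l2sq M u = (\<integral>x. (cmod (u x))\<^sup>2 \<partial>M)"

lemma square_integrableD [dest]:
  assumes "u \<in> square_integrable M"
  shows "u \<in> borel_measurable M" "integrable M (\<lambda>x. (cmod (u x))\<^sup>2)"
  using assms by (auto simp: square_integrable_def)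

lemma l2sq_nonneg [simp]: "l2sq M u \<ge> 0" by (simp add: l2sq_def)

lemma nn_integral_l2sq:
  "u \<in> square_integrable M \<Longrightarrow> (\<integral>\<^sup>+x. ennreal ((cmod (u x))\<^sup>2) \<partial>M) = ennreal (l2sq M u)"
  unfolding l2sq_def by (intro nn_integral_eq_integral) auto

lemma square_integrableI_nn:
  assumes [measurable]: "u \<in> borel_measurable M" and le: "(\<integral>\<^sup>+x. ennreal ((cmod (u x))\<^sup>2) \<partial>M) \<le> ennreal B"
  shows "u \<in> square_integrable M" "B \<ge> 0 \<Longrightarrow> l2sq M u \<le> B"
proof -
  show u: "u \<in> square_integrable M"
  proof -
    have "integrable M (\<lambda>x. (cmod (u x))\<^sup>2)"
      by (rule integrableI_bounded) (use le_less_trans[OF le ennreal_less_top] in simp_all)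
    then show ?thesis by (simp add: square_integrable_def)
  qed
  show "l2sq M u \<le> B" if "B \<ge> 0"
    using le that unfolding nn_integral_l2sq[OF u] by (simp add: ennreal_le_iff)
qed

lemma square_integrable_mult:
  assumes "u \<in> square_integrable M" "v \<in> square_integrable M"
  shows "integrable M (\<lambda>x. u x * v x)"
proof (rule Bochner_Integration.integrable_bound)
  show "integrable M (\<lambda>x. (cmod (u x))\<^sup>2 + (cmod (v x))\<^sup>2)" using assms by auto
  show "AE x in M. norm (u x * v x) \<le> norm ((cmod (u x))\<^sup>2 + (cmod (v x))\<^sup>2)"
  proof (rule AE_I2)
    fix x
    have "2 * (cmod (u x) * cmod (v x)) \<le> (cmod (u x))\<^sup>2 + (cmod (v x))\<^sup>2"
      using sum_squares_bound[of "cmod (u x)" "cmod (v x)"] by simp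
    moreover have "0 \<le> cmod (u x) * cmod (v x)" by simp
    ultimately have "cmod (u x) * cmod (v x) \<le> (cmod (u x))\<^sup>2 + (cmod (v x))\<^sup>2" by linarith
    then show "norm (u x * v x) \<le> norm ((cmod (u x))\<^sup>2 + (cmod (v x))\<^sup>2)"
      by (simp add: norm_mult)
  qed
qed (intro borel_measurable_times square_integrableD(1) assms)

lemma square_integrable_cnj:
  assumes "u \<in> square_integrable M"
  shows "(\<lambda>x. cnj (u x)) \<in> square_integrable M"
proof -
  have "cnj \<in> borel_measurable borel"
    by (intro borel_measurable_continuous_onI linear_continuous_on bounded_linear_cnj)
  from measurable_compose[OF square_integrableD(1)[OF assms] this]
  show ?thesis using square_integrableD(2)[OF assms] by (simp only: square_integrable_def mem_Collect_eq complex_mod_cnj)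
qed

lemma square_integrable_scale: "u \<in> square_integrable M \<Longrightarrow> (\<lambda>x. c * u x) \<in> square_integrable M"
  unfolding square_integrable_def
  by (simp add: norm_mult power_mult_distrib borel_measurable_times)

lemma l2sq_scale: "l2sq M (\<lambda>x. c * u x) = (cmod c)\<^sup>2 * l2sq M u"
  unfolding l2sq_def by (simp add: norm_mult power_mult_distrib)

lemma cmod_add_sq_le: "(cmod (a + b))\<^sup>2 \<le> 2 * (cmod a)\<^sup>2 + 2 * (cmod b)\<^sup>2"
proof -
  have "(cmod (a + b))\<^sup>2 \<le> (cmod a + cmod b)\<^sup>2" by (intro power_mono norm_triangle_ineq) auto
  then show ?thesis using sum_squares_bound[of "cmod a" "cmod b"] by (simp add: power2_sum)
qed

lemma square_integrable_add:
  assumes "u \<in> square_integrable M" "v \<in> square_integrable M"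
  shows "(\<lambda>x. u x + v x) \<in> square_integrable M"
proof -
  have [measurable]: "u \<in> borel_measurable M" "v \<in> borel_measurable M" using assms by auto
  have "integrable M (\<lambda>x. (cmod (u x + v x))\<^sup>2)"
    by (rule Bochner_Integration.integrable_bound[of M "\<lambda>x. 2 * (cmod (u x))\<^sup>2 + 2 * (cmod (v x))\<^sup>2"])
      (use square_integrableD(2)[OF assms(1)] square_integrableD(2)[OF assms(2)] cmod_add_sq_le in auto)
  then show ?thesis by (simp add: square_integrable_def)
qed

lemma square_integrable_uminus: "u \<in> square_integrable M \<Longrightarrow> (\<lambda>x. - u x) \<in> square_integrable M"
  using square_integrable_scale[of u M "-1"] by simp

lemma square_integrable_diff: "u \<in> square_integrable M \<Longrightarrow> v \<in> square_integrable M \<Longrightarrow> (\<lambda>x. u x - v x) \<in> square_integrable M"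
  using square_integrable_add[OF _ square_integrable_uminus, of u M v] by simp

lemma square_integrable_zero: "(\<lambda>x. 0) \<in> square_integrable M" by (simp add: square_integrable_def)

lemma square_integrable_sum: "(\<And>i. i \<in> I \<Longrightarrow> u i \<in> square_integrable M) \<Longrightarrow> (\<lambda>x. \<Sum>i\<in>I. u i x) \<in> square_integrable M"
  by (induction I rule: infinite_finite_induct) (auto simp: square_integrable_zero square_integrable_add)

lemma l2_Cauchy_Schwarz_norm:
  assumes u: "u \<in> square_integrable M" and v: "v \<in> square_integrable M"
  shows "(\<integral>x. cmod (u x * v x) \<partial>M) \<le> sqrt (l2sq M u) * sqrt (l2sq M v)"
proof -
  define a b c where "a = l2sq M u" and "b = l2sq M v" and "c = (\<integral>x. cmod (u x * v x) \<partial>M)"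
  have c0: "c \<ge> 0" and b0: "b \<ge> 0" and a0: "a \<ge> 0" by (auto simp: a_def b_def c_def)
  have i: "integrable M (\<lambda>x. cmod (u x * v x))" using square_integrable_mult[OF u v] by auto
  have q: "0 \<le> a - 2 * t * c + t\<^sup>2 * b" for t
  proof -
    have "0 \<le> (\<integral>x. (cmod (u x) - t * cmod (v x))\<^sup>2 \<partial>M)" by simp
    also have "\<dots> = (\<integral>x. (cmod (u x))\<^sup>2 - 2 * t * cmod (u x * v x) + t\<^sup>2 * (cmod (v x))\<^sup>2 \<partial>M)"
      by (simp add: power2_diff power_mult_distrib norm_mult algebra_simps)
    also have "\<dots> = a - 2 * t * c + t\<^sup>2 * b"
      unfolding a_def b_def c_def l2sq_def using i u v by (simp add: square_integrable_def)
    finally show ?thesis .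
  qed
  have "c\<^sup>2 \<le> a * b"
  proof (cases "b = 0")
    case True
    have "c = 0"
    proof (rule ccontr)
      assume "c \<noteq> 0"
      then have "0 \<le> a - (a + 1)" using q[of "(a + 1) / (2 * c)"] True by simp
      then show False by simp
    qed
    then show ?thesis using a0 b0 by simp
  next
    case False
    then have "b > 0" using b0 by simp
    then show ?thesis using q[of "c / b"] by (simp add: power2_eq_square field_simps)
  qed
  then have "c \<le> sqrt (a * b)" using real_le_rsqrt by blast
  then show ?thesis by (simp add: a_def b_def c_def real_sqrt_mult)
qed

lemma l2_Cauchy_Schwarz:
  assumes u: "u \<in> square_integrable M" and v: "v \<in> square_integrable M"
  shows "cmod (\<integral>x. u x * v x \<partial>M) \<le> sqrt (l2sq M u) * sqrt (l2sq M v)"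
  by (rule order_trans[OF integral_norm_bound l2_Cauchy_Schwarz_norm[OF u v]])

lemma l2sq_inner: "complex_of_real (l2sq M u) = (\<integral>x. u x * cnj (u x) \<partial>M)"
proof -
  have "u x * cnj (u x) = of_real ((cmod (u x))\<^sup>2)" for x using complex_norm_square[of "u x"] by simp
  then show ?thesis unfolding l2sq_def by (simp only: integral_complex_of_real)
qed

lemma l2sq_orthogonal_sum:
  assumes \<phi>: "\<And>n. \<phi> n \<in> square_integrable M"
    and orth: "\<And>i j. i \<noteq> j \<Longrightarrow> (\<integral>x. \<phi> i x * cnj (\<phi> j x) \<partial>M) = 0"
    and I: "finite I"
  shows "l2sq M (\<lambda>x. \<Sum>n\<in>I. \<phi> n x) = (\<Sum>n\<in>I. l2sq M (\<phi> n))"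
proof -
  have i: "integrable M (\<lambda>x. \<phi> i x * cnj (\<phi> j x))" for i j
    by (intro square_integrable_mult square_integrable_cnj \<phi>)
  have "complex_of_real (l2sq M (\<lambda>x. \<Sum>n\<in>I. \<phi> n x)) = (\<integral>x. (\<Sum>i\<in>I. \<Sum>j\<in>I. \<phi> i x * cnj (\<phi> j x)) \<partial>M)"
    unfolding l2sq_inner by (simp add: sum_product)
  also have "\<dots> = (\<Sum>i\<in>I. \<Sum>j\<in>I. (\<integral>x. \<phi> i x * cnj (\<phi> j x) \<partial>M))"
    by (subst Bochner_Integration.integral_sum) (auto simp: i intro!: Bochner_Integration.integrable_sum)
  also have "\<dots> = (\<Sum>i\<in>I. \<Sum>j\<in>I. if i = j then of_real (l2sq M (\<phi> i)) else 0)"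
    by (intro sum.cong refl) (auto simp: orth l2sq_inner)
  also have "\<dots> = of_real (\<Sum>i\<in>I. l2sq M (\<phi> i))" using I by simp
  finally show ?thesis by (simp only: of_real_eq_iff)
qed

text \<open>
  The Riesz--Fischer theorem with control of the pointwise behaviour: along a subsequence the
  partial sums converge almost everywhere, with a geometric error whose constant is one integrable
  function \<open>G\<close>. On a product space \<open>G\<close> is integrable on almost every slice, so the partial sums
  converge in \<open>L\<^sup>2\<close> of almost every slice.
\<close>
lemma orthogonal_series:
  fixes \<phi> :: "nat \<Rightarrow> 'b \<Rightarrow> complex"
  assumes \<phi>: "\<And>n. \<phi> n \<in> square_integrable M"
    and orth: "\<And>i j. i \<noteq> j \<Longrightarrow> (\<integral>x. \<phi> i x * cnj (\<phi> j x) \<partial>M) = 0"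
    and summ: "summable (\<lambda>n. l2sq M (\<phi> n))"
  obtains g N G where "g \<in> square_integrable M" "l2sq M g \<le> (\<Sum>n. l2sq M (\<phi> n))"
    "\<And>n. l2sq M (\<lambda>x. g x - (\<Sum>i<n. \<phi> i x)) \<le> (\<Sum>i. l2sq M (\<phi> (i + n)))"
    "strict_mono (N :: nat \<Rightarrow> nat)" "integrable M G" "\<And>x. 0 \<le> G x"
    "AE x in M. \<forall>k. (cmod (g x - (\<Sum>i<N k. \<phi> i x)))\<^sup>2 \<le> 2 * (1 / 2) ^ k * G x"
proof -
  have [measurable]: "\<phi> n \<in> borel_measurable M" for n using \<phi> by auto
  define S where "S n x = (\<Sum>i<n. \<phi> i x)" for n x
  have [measurable]: "S n \<in> borel_measurable M" for n unfolding S_def[abs_def] by measurable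
  define tail where "tail n = (\<Sum>i. l2sq M (\<phi> (i + n)))" for n
  have st: "summable (\<lambda>i. l2sq M (\<phi> (i + n)))" for n using summ by (rule summable_ignore_initial_segment)
  have tail_eq: "tail n = (\<Sum>i. l2sq M (\<phi> i)) - (\<Sum>i<n. l2sq M (\<phi> i))" for n
    unfolding tail_def using suminf_minus_initial_segment[OF summ] by simp
  have tail0: "tail n \<ge> 0" for n unfolding tail_def by (intro suminf_nonneg st) simp
  have tail_mono: "tail n \<le> tail m" if "m \<le> n" for m n
    unfolding tail_eq using that by (intro diff_left_mono sum_mono2) auto
  have part: "(\<Sum>i\<in>{m..<n}. l2sq M (\<phi> i)) \<le> tail m" if "m \<le> n" for m n
  proof -
    have "(\<Sum>i<n. l2sq M (\<phi> i)) = (\<Sum>i<m. l2sq M (\<phi> i)) + (\<Sum>i\<in>{m..<n}. l2sq M (\<phi> i))"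
      using that by (metis atLeast0LessThan le0 sum.atLeastLessThan_concat)
    then show ?thesis using tail0[of n] unfolding tail_eq by simp
  qed
  have Sdiff: "S n x - S m x = (\<Sum>i\<in>{m..<n}. \<phi> i x)" if "m \<le> n" for m n x
    unfolding S_def using that by (metis add_diff_cancel_left' atLeast0LessThan le0 sum.atLeastLessThan_concat)
  have Sl2: "l2sq M (\<lambda>x. S n x - S m x) \<le> tail m" and Ssq: "(\<lambda>x. S n x - S m x) \<in> square_integrable M" if "m \<le> n" for m n
    using part[OF that] by (simp_all add: Sdiff[OF that] l2sq_orthogonal_sum[OF \<phi> orth] square_integrable_sum \<phi>)
  have tail_lim: "tail \<longlonglongrightarrow> 0"
    unfolding tail_eq using tendsto_diff[OF tendsto_const summable_LIMSEQ[OF summ], of "\<Sum>i. l2sq M (\<phi> i)"] by simp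
  have ex: "\<exists>m. tail m \<le> (1 / 4) ^ k" for k
  proof -
    have "eventually (\<lambda>m. tail m < (1 / 4) ^ k) sequentially" by (rule order_tendstoD(2)[OF tail_lim]) simp
    then show ?thesis by (metis eventually_sequentially less_imp_le order_refl)
  qed
  define K where "K k = (LEAST m. tail m \<le> (1 / 4) ^ k)" for k :: nat
  \<comment> \<open>Adding \<open>k\<close> makes the indices strictly increasing.\<close>
  define N where "N k = K k + k" for k
  have K: "tail (K k) \<le> (1 / 4) ^ k" for k unfolding K_def by (rule LeastI_ex[OF ex])
  have Kmono: "K k \<le> K (Suc k)" for k
  proof -
    have "tail (K (Suc k)) \<le> (1 / 4) ^ k" using K[of "Suc k"] tail0[of "K (Suc k)"] by simp
    then show ?thesis unfolding K_def[of k] by (rule Least_le)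
  qed
  have N: "strict_mono N" unfolding strict_mono_Suc_iff N_def using Kmono by (simp add: le_imp_less_Suc)
  have Nle: "N k \<le> N (Suc k)" for k using N by (simp add: strict_mono_leD)
  have NK: "tail (N k) \<le> (1 / 4) ^ k" for k using tail_mono[of "K k" "N k"] K[of k] by (simp add: N_def)
  define h where "h k x = S (N (Suc k)) x - S (N k) x" for k x
  have [measurable]: "h k \<in> borel_measurable M" for k unfolding h_def[abs_def] by measurable
  have hsq: "h k \<in> square_integrable M" and hl2: "l2sq M (h k) \<le> (1 / 4) ^ k" for k
    using Ssq[OF Nle[of k]] order_trans[OF Sl2[OF Nle[of k]] NK[of k]] unfolding h_def[abs_def] by auto
  \<comment> \<open>The increments along the subsequence have squared norm at most \<open>4\<^sup>-\<^sup>k\<close>. The weight \<open>2\<^sup>k\<close> keeps the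
    integral of the sum finite and leaves \<open>2\<^sup>-\<^sup>k\<close> for Cauchy--Schwarz in the pointwise bound.\<close>
  define E where "E x = (\<Sum>k. ennreal (2 ^ k * (cmod (h k x))\<^sup>2))" for x
  have [measurable]: "E \<in> borel_measurable M" unfolding E_def[abs_def] by measurable
  have gf: "(\<Sum>k. ennreal ((1 / 2) ^ k)) \<noteq> top"
    by (rule ennreal_suminf_neq_top) (simp_all add: summable_geometric)
  have "(\<integral>\<^sup>+x. E x \<partial>M) = (\<Sum>k. \<integral>\<^sup>+x. ennreal (2 ^ k * (cmod (h k x))\<^sup>2) \<partial>M)"
    unfolding E_def by (rule nn_integral_suminf) measurable
  also have "\<dots> \<le> (\<Sum>k. ennreal ((1 / 2) ^ k))"
  proof (intro suminf_le summableI)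
    fix k
    have "(\<integral>\<^sup>+x. ennreal (2 ^ k * (cmod (h k x))\<^sup>2) \<partial>M) = ennreal (2 ^ k) * ennreal (l2sq M (h k))"
      by (simp add: ennreal_mult nn_integral_cmult nn_integral_l2sq[OF hsq])
    also have "\<dots> \<le> ennreal (2 ^ k * (1 / 4) ^ k)"
      using hl2[of k] by (subst ennreal_mult[symmetric]) (auto intro!: ennreal_leI mult_left_mono)
    also have "2 ^ k * (1 / 4) ^ k = (1 / 2 :: real) ^ k" by (simp add: power_mult_distrib[symmetric])
    finally show "(\<integral>\<^sup>+x. ennreal (2 ^ k * (cmod (h k x))\<^sup>2) \<partial>M) \<le> ennreal ((1 / 2) ^ k)" .
  qed
  also have "\<dots> < \<infinity>" using gf by (simp only: infinity_ennreal_def less_top)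
  finally have Eint: "(\<integral>\<^sup>+x. E x \<partial>M) < \<infinity>" .
  then have Efin: "AE x in M. E x \<noteq> \<infinity>" by (intro nn_integral_PInf_AE) auto
  define G where "G x = enn2real (E x)" for x
  have G0: "0 \<le> G x" for x by (simp add: G_def)
  have Gint: "integrable M G"
  proof (rule integrableI_bounded)
    show "G \<in> borel_measurable M" unfolding G_def[abs_def] by measurable
    have "(\<integral>\<^sup>+x. ennreal (norm (G x)) \<partial>M) \<le> (\<integral>\<^sup>+x. E x \<partial>M)"
      by (intro nn_integral_mono) (simp add: G_def ennreal_enn2real_if)
    then show "(\<integral>\<^sup>+x. ennreal (norm (G x)) \<partial>M) < \<infinity>" using Eint by (rule le_less_trans)
  qed
  define g where "g x = lim (\<lambda>k. S (N k) x)" for x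
  have [measurable]: "g \<in> borel_measurable M" unfolding g_def[abs_def] by measurable
  have cau: "(cmod (S (N m) x - S (N k) x))\<^sup>2 \<le> 2 * (1 / 2) ^ k * G x" if x: "E x \<noteq> \<infinity>" and km: "k \<le> m" for k m x
  proof -
    have sG: "(\<Sum>j\<in>J. 2 ^ j * (cmod (h j x))\<^sup>2) \<le> G x" if "finite J" for J
    proof -
      have "summable (\<lambda>k. 2 ^ k * (cmod (h k x))\<^sup>2)" using x unfolding E_def by (intro summable_suminf_not_top) auto
      moreover from this have "G x = (\<Sum>k. 2 ^ k * (cmod (h k x))\<^sup>2)" unfolding G_def E_def
        by (subst suminf_ennreal2) (simp_all add: suminf_nonneg)
      ultimately show ?thesis using that by (simp add: sum_le_suminf)
    qed
    have tele: "S (N m) x - S (N k) x = (\<Sum>j\<in>{k..<m}. h j x)"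
      unfolding h_def using sum_Suc_diff'[OF km, of "\<lambda>j. S (N j) x"] by simp
    have "cmod (S (N m) x - S (N k) x) \<le> (\<Sum>j\<in>{k..<m}. cmod (h j x))" unfolding tele by (rule norm_sum)
    also have "\<dots> = (\<Sum>j\<in>{k..<m}. sqrt ((1 / 2) ^ j) * (sqrt (2 ^ j) * cmod (h j x)))"
      by (intro sum.cong refl) (simp add: real_sqrt_mult[symmetric] power_mult_distrib[symmetric] mult.assoc[symmetric])
    finally have "(cmod (S (N m) x - S (N k) x))\<^sup>2 \<le> (\<Sum>j\<in>{k..<m}. sqrt ((1 / 2) ^ j) * (sqrt (2 ^ j) * cmod (h j x)))\<^sup>2"
      by (intro power_mono) auto
    also have "\<dots> \<le> (\<Sum>j\<in>{k..<m}. (sqrt ((1 / 2) ^ j))\<^sup>2) * (\<Sum>j\<in>{k..<m}. (sqrt (2 ^ j) * cmod (h j x))\<^sup>2)"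
      by (rule Cauchy_Schwarz_ineq_sum)
    also have "\<dots> = (\<Sum>j\<in>{k..<m}. (1 / 2) ^ j) * (\<Sum>j\<in>{k..<m}. 2 ^ j * (cmod (h j x))\<^sup>2)"
      by (simp add: power_mult_distrib)
    also have "\<dots> \<le> (2 * (1 / 2) ^ k) * G x"
    proof (intro mult_mono sG)
      have "(\<Sum>j\<in>{k..<m}. (1 / 2 :: real) ^ j) = 2 * ((1 / 2) ^ k - (1 / 2) ^ m)"
        using km by (induction m rule: dec_induct) (auto simp: algebra_simps)
      then show "(\<Sum>j\<in>{k..<m}. (1 / 2 :: real) ^ j) \<le> 2 * (1 / 2) ^ k" by simp
    qed (auto intro: sum_nonneg)
    finally show ?thesis .
  qed
  have conv: "(\<lambda>k. S (N k) x) \<longlonglongrightarrow> g x" if x: "E x \<noteq> \<infinity>" for x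
  proof -
    have "Cauchy (\<lambda>k. S (N k) x)"
    proof (rule metric_CauchyI)
      fix e :: real assume e: "e > 0"
      have "(\<lambda>k. 2 * (1 / 2) ^ k * G x) \<longlonglongrightarrow> 2 * 0 * G x"
        by (intro tendsto_intros LIMSEQ_realpow_zero) auto
      then have "eventually (\<lambda>k. 2 * (1 / 2) ^ k * G x < (e / 2)\<^sup>2) sequentially"
        using e by (intro order_tendstoD(2)) auto
      then obtain k where k: "2 * (1 / 2) ^ k * G x < (e / 2)\<^sup>2" by (auto simp: eventually_sequentially)
      have "dist (S (N m) x) (S (N k) x) < e / 2" if "m \<ge> k" for m
      proof -
        have "(cmod (S (N m) x - S (N k) x))\<^sup>2 < (e / 2)\<^sup>2" using cau[OF x that] k by linarith
        then show ?thesis using e power2_less_imp_less unfolding dist_norm by fastforce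
      qed
      note near = this
      have "dist (S (N m) x) (S (N n) x) < e" if "m \<ge> k" "n \<ge> k" for m n
        by (rule dist_triangle_half_l[OF near[OF that(1)] near[OF that(2)]])
      then show "\<exists>k. \<forall>m\<ge>k. \<forall>n\<ge>k. dist (S (N m) x) (S (N n) x) < e" by blast
    qed
    then have "convergent (\<lambda>k. S (N k) x)" by (simp add: Cauchy_convergent_iff)
    then show ?thesis unfolding g_def by (simp add: convergent_LIMSEQ_iff)
  qed
  have bound: "AE x in M. \<forall>k. (cmod (g x - S (N k) x))\<^sup>2 \<le> 2 * (1 / 2) ^ k * G x"
    using Efin
  proof eventually_elim
    case (elim x)
    show ?case
    proof
      fix k
      have "(\<lambda>m. (cmod (S (N m) x - S (N k) x))\<^sup>2) \<longlonglongrightarrow> (cmod (g x - S (N k) x))\<^sup>2"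
        by (intro tendsto_intros conv elim)
      then show "(cmod (g x - S (N k) x))\<^sup>2 \<le> 2 * (1 / 2) ^ k * G x"
        by (rule LIMSEQ_le_const2) (use cau[OF elim] in blast)
    qed
  qed
  have fatou: "(\<integral>\<^sup>+x. ennreal ((cmod (g x - S n x))\<^sup>2) \<partial>M) \<le> ennreal (tail n)" for n
  proof -
    have "(\<integral>\<^sup>+x. ennreal ((cmod (g x - S n x))\<^sup>2) \<partial>M) = (\<integral>\<^sup>+x. liminf (\<lambda>k. ennreal ((cmod (S (N k) x - S n x))\<^sup>2)) \<partial>M)"
    proof (rule nn_integral_cong_AE)
      show "AE x in M. ennreal ((cmod (g x - S n x))\<^sup>2) = liminf (\<lambda>k. ennreal ((cmod (S (N k) x - S n x))\<^sup>2))"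
        using Efin
      proof eventually_elim
        case (elim x)
        have "(\<lambda>k. ennreal ((cmod (S (N k) x - S n x))\<^sup>2)) \<longlonglongrightarrow> ennreal ((cmod (g x - S n x))\<^sup>2)"
          by (intro tendsto_ennrealI tendsto_intros conv elim)
        then show ?case by (intro lim_imp_Liminf[symmetric]) auto
      qed
    qed
    also have "\<dots> \<le> liminf (\<lambda>k. \<integral>\<^sup>+x. ennreal ((cmod (S (N k) x - S n x))\<^sup>2) \<partial>M)"
      by (rule nn_integral_liminf) measurable
    also have "\<dots> \<le> ennreal (tail n)"
    proof (rule Liminf_le)
      have "(\<integral>\<^sup>+x. ennreal ((cmod (S (N k) x - S n x))\<^sup>2) \<partial>M) \<le> ennreal (tail n)" if "k \<ge> n" for k
      proof -
        have "n \<le> N k" using that by (simp add: N_def)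
        then show ?thesis using Sl2 by (simp add: nn_integral_l2sq[OF Ssq] ennreal_leI)
      qed
      then show "eventually (\<lambda>k. (\<integral>\<^sup>+x. ennreal ((cmod (S (N k) x - S n x))\<^sup>2) \<partial>M) \<le> ennreal (tail n)) sequentially"
        by (auto simp: eventually_sequentially)
    qed simp
    finally show ?thesis .
  qed
  show ?thesis
  proof (rule that[OF _ _ _ N Gint G0])
    show "g \<in> square_integrable M" "l2sq M g \<le> (\<Sum>n. l2sq M (\<phi> n))"
      using square_integrableI_nn[of g M "tail 0"] fatou[of 0] tail0[of 0] by (auto simp: S_def tail_def)
    show "l2sq M (\<lambda>x. g x - (\<Sum>i<n. \<phi> i x)) \<le> (\<Sum>i. l2sq M (\<phi> (i + n)))" for n
      using square_integrableI_nn(2)[of "\<lambda>x. g x - S n x" M "tail n"] fatou[of n] tail0[of n] by (simp add: S_def tail_def)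
    show "AE x in M. \<forall>k. (cmod (g x - (\<Sum>i<N k. \<phi> i x)))\<^sup>2 \<le> 2 * (1 / 2) ^ k * G x"
      using bound by (simp add: S_def)
  qed
qed

text \<open>
  Norm convergence tested against a fixed square integrable function.
\<close>
lemma orthogonal_series_weak:
  assumes \<phi>: "\<And>n. \<phi> n \<in> square_integrable M" and g: "g \<in> square_integrable M" and v: "v \<in> square_integrable M"
    and summ: "summable (\<lambda>n. l2sq M (\<phi> n))"
    and le: "\<And>n. l2sq M (\<lambda>x. g x - (\<Sum>i<n. \<phi> i x)) \<le> (\<Sum>i. l2sq M (\<phi> (i + n)))"
  shows "(\<lambda>n. \<integral>x. \<phi> n x * v x \<partial>M) sums (\<integral>x. g x * v x \<partial>M)"
proof -
  have "(\<lambda>n. \<Sum>i. l2sq M (\<phi> (i + n))) \<longlonglongrightarrow> 0"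
    using suminf_exist_split2[OF summ] .
  then have "(\<lambda>n. l2sq M (\<lambda>x. g x - (\<Sum>i<n. \<phi> i x))) \<longlonglongrightarrow> 0"
    by (rule tendsto_sandwich[OF _ _ tendsto_const, rotated 2]) (use le in auto)
  then have "(\<lambda>n. sqrt (l2sq M (\<lambda>x. g x - (\<Sum>i<n. \<phi> i x))) * sqrt (l2sq M v)) \<longlonglongrightarrow> sqrt 0 * sqrt (l2sq M v)"
    by (intro tendsto_intros)
  then have l: "(\<lambda>n. sqrt (l2sq M (\<lambda>x. g x - (\<Sum>i<n. \<phi> i x))) * sqrt (l2sq M v)) \<longlonglongrightarrow> 0" by simp
  have "(\<lambda>n. (\<integral>x. g x * v x \<partial>M) - (\<Sum>i<n. \<integral>x. \<phi> i x * v x \<partial>M)) \<longlonglongrightarrow> 0"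
  proof (rule Lim_null_comparison[OF _ l], rule always_eventually, rule allI)
    fix n
    have "(\<integral>x. g x * v x \<partial>M) - (\<Sum>i<n. \<integral>x. \<phi> i x * v x \<partial>M) = (\<integral>x. (g x - (\<Sum>i<n. \<phi> i x)) * v x \<partial>M)"
      using square_integrable_mult[OF g v] square_integrable_mult[OF \<phi> v]
      by (simp add: left_diff_distrib sum_distrib_right)
    then show "norm ((\<integral>x. g x * v x \<partial>M) - (\<Sum>i<n. \<integral>x. \<phi> i x * v x \<partial>M)) \<le> sqrt (l2sq M (\<lambda>x. g x - (\<Sum>i<n. \<phi> i x))) * sqrt (l2sq M v)"
      using l2_Cauchy_Schwarz[of "\<lambda>x. g x - (\<Sum>i<n. \<phi> i x)" M v] g v \<phi>
      by (simp add: square_integrable_diff square_integrable_sum)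
  qed
  from tendsto_diff[OF tendsto_const[of "\<integral>x. g x * v x \<partial>M"] this] show ?thesis by (simp add: sums_def)
qed

section \<open>Spectral projections\<close>

lemma schwartz_square_integrable: "f \<in> schwartz \<Longrightarrow> f \<in> square_integrable lborel"
  by (simp add: square_integrable_def schwartz_measurable schwartz_sq_integrable)

lemma l2sq_lborel: "l2sq lborel f = nsq f"
  by (simp add: l2sq_def nsq_def)

text \<open>
  The functions that pair absolutely with all Schwartz functions. This class contains \<open>L\<^sup>2\<close> and the
  Fourier transforms of Schwartz functions, and the spectral projections are defined on it.
\<close>
definition testable :: "('a::euclidean_space \<Rightarrow> complex) set" where
  "testable = {f. f \<in> borel_measurable borel \<and> (\<forall>q\<in>schwartz. integrable lborel (\<lambda>x. f x * q x))}"

lemma square_integrable_testable: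
  assumes f: "f \<in> square_integrable lborel"
  shows "f \<in> testable"
  unfolding testable_def
proof (intro CollectI conjI ballI)
  show "f \<in> borel_measurable borel" using square_integrableD(1)[OF f] by simp
  show "integrable lborel (\<lambda>x. f x * q x)" if "q \<in> schwartz" for q
    by (rule square_integrable_mult[OF f schwartz_square_integrable[OF that]])
qed

lemma schwartz_testable: "f \<in> schwartz \<Longrightarrow> f \<in> testable"
  by (intro square_integrable_testable schwartz_square_integrable)

lemma testable_ip_integrable:
  assumes "f \<in> testable" and q: "q \<in> schwartz"
  shows "integrable lborel (\<lambda>x. f x * cnj (q x))"
proof -
  have "\<forall>q\<in>schwartz. integrable lborel (\<lambda>x. f x * q x)" using assms(1) by (simp add: testable_def)
  from bspec[OF this schwartz_cnj[OF q]] show ?thesis .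
qed

definition proj :: "nat \<Rightarrow> ('a::euclidean_space \<Rightarrow> complex) \<Rightarrow> 'a \<Rightarrow> complex" where
  "proj n f = H_proj (level TYPE('a) n) f"

lemma eigen_cnj: "q \<in> eigen n \<Longrightarrow> (\<lambda>x. cnj (q x)) \<in> eigen n"
  unfolding eigen_def by (rule eigenspace_cnj)

text \<open>
  The difference of \<open>p\<close> and \<open>p'\<close> lies in the eigenspace and is orthogonal to itself.
\<close>
lemma eigen_ip_unique:
  fixes p p' :: "'a::euclidean_space \<Rightarrow> complex"
  assumes p: "p \<in> H_eigenspace l" and p': "p' \<in> H_eigenspace l" and eq: "\<And>q. q \<in> H_eigenspace l \<Longrightarrow> ip p q = ip p' q"
  shows "p = p'"
proof -
  let ?d = "\<lambda>x. p x + (-1) * p' x"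
  have d: "?d \<in> H_eigenspace l" by (intro eigenspace_add eigenspace_scale p p')
  have "ip ?d ?d = ip p ?d + (-1) * ip p' ?d"
    by (simp only: ip_add_left[OF eigenspaceD(1)[OF p] eigenspaceD(1)[OF eigenspace_scale[OF p']] eigenspaceD(1)[OF d]] ip_scale_left)
  also have "\<dots> = 0" using eq[OF d] by simp
  finally have "nsq ?d = 0" unfolding ip_self by simp
  from nsq_eq_0[OF eigenspaceD(1)[OF d] this] show ?thesis by (simp add: fun_eq_iff)
qed

text \<open>
  A representing element exists by assumption and is unique by \<open>eigen_ip_unique\<close>, so the definite
  description in the definition of the projection denotes it.
\<close>
lemma H_proj_characterization:
  fixes f :: "'a::euclidean_space \<Rightarrow> complex"
  assumes f: "f \<in> testable" and ex: "\<exists>p\<in>H_eigenspace l. \<forall>q\<in>H_eigenspace l. ip p q = ip f q"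
  shows "H_proj l f \<in> H_eigenspace l" "q \<in> H_eigenspace l \<Longrightarrow> ip (H_proj l f) q = ip f q"
proof -
  have eq: "(\<integral>x. (f x - p x) * cnj (q x) \<partial>lborel) = 0 \<longleftrightarrow> ip p q = ip f q"
    if "p \<in> H_eigenspace l" "q \<in> H_eigenspace l" for p q
  proof -
    have "(\<integral>x. (f x - p x) * cnj (q x) \<partial>lborel) = ip f q - ip p q"
      unfolding ip_def left_diff_distrib
      by (intro Bochner_Integration.integral_diff testable_ip_integrable f schwartz_testable eigenspaceD(1)[OF that(1)] eigenspaceD(1)[OF that(2)])
    then show ?thesis by auto
  qed
  obtain p where p: "p \<in> H_eigenspace l" "\<And>q. q \<in> H_eigenspace l \<Longrightarrow> ip p q = ip f q" using ex by blast
  have "H_proj l f \<in> H_eigenspace l \<and> (\<forall>q\<in>H_eigenspace l. (\<integral>x. (f x - H_proj l f x) * cnj (q x) \<partial>lborel) = 0)"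
    unfolding H_proj_def
  proof (rule theI[of _ p])
    show "p \<in> H_eigenspace l \<and> (\<forall>q\<in>H_eigenspace l. (\<integral>x. (f x - p x) * cnj (q x) \<partial>lborel) = 0)"
      using p eq by auto
    fix p' assume "p' \<in> H_eigenspace l \<and> (\<forall>q\<in>H_eigenspace l. (\<integral>x. (f x - p' x) * cnj (q x) \<partial>lborel) = 0)"
    then show "p' = p" using eq p by (intro eigen_ip_unique[of p' l p]) auto
  qed
  then show "H_proj l f \<in> H_eigenspace l" "q \<in> H_eigenspace l \<Longrightarrow> ip (H_proj l f) q = ip f q" using eq by auto
qed

lemma proj_eigen_ip:
  fixes f :: "'a::euclidean_space \<Rightarrow> complex"
  assumes f: "f \<in> testable"
  shows "proj n f \<in> eigen n" "q \<in> eigen n \<Longrightarrow> ip (proj n f) q = ip f q"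
proof -
  have "\<exists>p\<in>eigen n. \<forall>q\<in>eigen n. ip p q = ip f q"
  proof (rule eigen_riesz)
    fix g h :: "'a \<Rightarrow> complex" assume g: "g \<in> schwartz" and h: "h \<in> schwartz"
    then show "ip f (\<lambda>x. g x + h x) = ip f g + ip f h"
      unfolding ip_def by (simp add: distrib_left testable_ip_integrable f)
  qed (rule ip_scale_right)
  then have ex: "\<exists>p\<in>H_eigenspace (level TYPE('a) n). \<forall>q\<in>H_eigenspace (level TYPE('a) n). ip p q = ip f q" unfolding eigen_def .
  show "proj n f \<in> eigen n" "q \<in> eigen n \<Longrightarrow> ip (proj n f) q = ip f q"
    unfolding eigen_def proj_def using H_proj_characterization[OF f ex] by auto
qed

lemma proj_unique:
  fixes f p :: "'a::euclidean_space \<Rightarrow> complex"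
  assumes f: "f \<in> testable" and p: "p \<in> eigen n" and eq: "\<And>q. q \<in> eigen n \<Longrightarrow> ip p q = ip f q"
  shows "proj n f = p"
  using eigen_ip_unique[of "proj n f" "level TYPE('a) n" p] proj_eigen_ip[OF f] p eq by (auto simp: eigen_def)

lemma eigen_orthogonal:
  fixes f g :: "'a::euclidean_space \<Rightarrow> complex"
  shows "f \<in> eigen m \<Longrightarrow> g \<in> eigen n \<Longrightarrow> m \<noteq> n \<Longrightarrow> ip f g = 0"
  unfolding eigen_def by (rule eigenspace_orthogonal) (auto simp: level_def)

lemma proj_schwartz: "f \<in> testable \<Longrightarrow> proj n f \<in> schwartz"
  using proj_eigen_ip(1) eigen_schwartz by blast

text \<open>
  The projections are pairwise orthogonal, so subtracting finitely many of them from \<open>u\<close> decreases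
  the squared norm by the sum of theirs.
\<close>
lemma bessel:
  fixes u :: "'a::euclidean_space \<Rightarrow> complex"
  assumes u: "u \<in> square_integrable lborel"
  shows "(\<Sum>n<N. nsq (proj n u)) \<le> l2sq lborel u"
proof -
  have t: "u \<in> testable" by (rule square_integrable_testable[OF u])
  let ?S = "\<lambda>x. \<Sum>n<N. proj n u x"
  have p: "proj n u \<in> square_integrable lborel" for n by (intro schwartz_square_integrable proj_schwartz t)
  have S: "?S \<in> square_integrable lborel" by (intro square_integrable_sum p)
  have "l2sq lborel ?S = (\<Sum>n<N. l2sq lborel (proj n u))"
  proof (rule l2sq_orthogonal_sum[OF p])
    show "(\<integral>x. proj i u x * cnj (proj j u x) \<partial>lborel) = 0" if "i \<noteq> j" for i j
      using eigen_orthogonal[OF proj_eigen_ip(1)[OF t] proj_eigen_ip(1)[OF t] that] by (simp add: ip_def)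
  qed simp
  then have S1: "l2sq lborel ?S = (\<Sum>n<N. nsq (proj n u))" by (simp add: l2sq_lborel)
  have "(\<integral>x. u x * cnj (?S x) \<partial>lborel) = (\<Sum>n<N. ip u (proj n u))"
    unfolding ip_def cnj_sum sum_distrib_left
    by (intro Bochner_Integration.integral_sum square_integrable_mult square_integrable_cnj u p)
  also have "\<dots> = (\<Sum>n<N. of_real (nsq (proj n u)))"
    by (intro sum.cong refl) (simp add: proj_eigen_ip(2)[OF t proj_eigen_ip(1)[OF t], symmetric] ip_self)
  also have "\<dots> = of_real (l2sq lborel ?S)" unfolding S1 by simp
  finally have "cmod (of_real (l2sq lborel ?S)) \<le> sqrt (l2sq lborel u) * sqrt (l2sq lborel (\<lambda>x. cnj (?S x)))"
    using l2_Cauchy_Schwarz[OF u square_integrable_cnj[OF S]] by simp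
  moreover have "l2sq lborel (\<lambda>x. cnj (?S x)) = l2sq lborel ?S" unfolding l2sq_def complex_mod_cnj ..
  ultimately have le: "l2sq lborel ?S \<le> sqrt (l2sq lborel u) * sqrt (l2sq lborel ?S)"
    by (simp only: norm_of_real abs_of_nonneg[OF l2sq_nonneg])
  have "sqrt (l2sq lborel ?S) \<le> sqrt (l2sq lborel u)"
  proof (cases "l2sq lborel ?S = 0")
    case False
    then have pos: "sqrt (l2sq lborel ?S) > 0" using l2sq_nonneg[of lborel ?S] by (simp add: order_less_le del: l2sq_nonneg)
    have "sqrt (l2sq lborel ?S) * sqrt (l2sq lborel ?S) \<le> sqrt (l2sq lborel u) * sqrt (l2sq lborel ?S)"
      using le by (simp del: l2sq_nonneg add: l2sq_nonneg)
    then show ?thesis using pos by (simp only: mult_le_cancel_right_pos)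
  qed simp
  then show ?thesis using S1 by simp
qed

lemma bessel_summable:
  assumes u: "u \<in> square_integrable lborel"
  shows "summable (\<lambda>n. nsq (proj n u))" "(\<Sum>n. nsq (proj n u)) \<le> l2sq lborel u"
proof -
  show s: "summable (\<lambda>n. nsq (proj n u))"
    by (rule summableI_nonneg_bounded[OF _ bessel[OF u]]) simp
  show "(\<Sum>n. nsq (proj n u)) \<le> l2sq lborel u" by (rule suminf_le_const[OF s bessel[OF u]])
qed

lemma proj_harmonic_oscillator:
  fixes f :: "'a::euclidean_space \<Rightarrow> complex"
  assumes f: "f \<in> schwartz"
  shows "proj n (harmonic_oscillator f) = (\<lambda>x. of_real (level TYPE('a) n) * proj n f x)"
proof (rule proj_unique)
  have t: "f \<in> testable" by (rule schwartz_testable[OF f])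
  show "harmonic_oscillator f \<in> testable" by (intro schwartz_testable schwartz_harmonic_oscillator f)
  show "(\<lambda>x. of_real (level TYPE('a) n) * proj n f x) \<in> eigen n"
    using proj_eigen_ip(1)[OF t, of n] by (simp add: eigen_def eigenspace_scale)
  show "ip (\<lambda>x. of_real (level TYPE('a) n) * proj n f x) q = ip (harmonic_oscillator f) q" if q: "q \<in> eigen n" for q
  proof -
    have q': "q \<in> H_eigenspace (level TYPE('a) n)" using q by (simp add: eigen_def)
    have "ip (harmonic_oscillator f) q = ip f (harmonic_oscillator q)"
      by (rule ip_harmonic_oscillator_right[OF f eigen_schwartz[OF q]])
    also have "\<dots> = of_real (level TYPE('a) n) * ip f q"
      unfolding eigenspaceD(2)[OF q'] by (simp add: ip_scale_right)
    finally show ?thesis by (simp add: ip_scale_left proj_eigen_ip(2)[OF t q])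
  qed
qed

lemma level_pos: "level TYPE('a::euclidean_space) n \<ge> 1" "level TYPE('a) n \<ge> real n" "level TYPE('a) n > 0"
proof -
  have "DIM('a) \<ge> 1" using DIM_positive[where 'a='a] by linarith
  then have "real DIM('a) \<ge> 1" by simp
  then show "level TYPE('a::euclidean_space) n \<ge> 1" "level TYPE('a) n \<ge> real n" "level TYPE('a) n > 0"
    unfolding level_def using of_nat_0_le_iff[of n, where 'a=real] by linarith+
qed

text \<open>
  Projecting \<open>H\<^sup>k f\<close> instead of \<open>f\<close> multiplies the projection by the \<open>k\<close>-th power of the eigenvalue,
  and Bessel's inequality bounds the result by the norm of \<open>H\<^sup>k f\<close>.
\<close>
lemma proj_decay:
  fixes f :: "'a::euclidean_space \<Rightarrow> complex"
  assumes f: "f \<in> schwartz"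
  shows "\<exists>C\<ge>0. \<forall>n. level TYPE('a) n ^ k * sqrt (nsq (proj n f)) \<le> C"
proof (intro exI[of _ "sqrt (nsq ((harmonic_oscillator ^^ k) f))"] conjI allI)
  fix n
  have S: "(harmonic_oscillator ^^ k) f \<in> schwartz" for k
    by (induction k) (auto simp: f schwartz_harmonic_oscillator)
  have "proj n ((harmonic_oscillator ^^ k) f) = (\<lambda>x. of_real (level TYPE('a) n ^ k) * proj n f x)"
    by (induction k) (auto simp: proj_harmonic_oscillator S)
  then have "nsq (proj n ((harmonic_oscillator ^^ k) f)) = (level TYPE('a) n ^ k)\<^sup>2 * nsq (proj n f)"
    using l2sq_scale[of lborel "of_real (level TYPE('a) n ^ k)" "proj n f"] abs_of_pos[OF level_pos(3)[where 'a='a, of n]]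
    by (simp add: l2sq_lborel norm_power power_mult_distrib power2_eq_square)
  moreover have "nsq (proj n ((harmonic_oscillator ^^ k) f)) \<le> nsq ((harmonic_oscillator ^^ k) f)"
  proof -
    have "(\<Sum>m\<in>{n}. nsq (proj m ((harmonic_oscillator ^^ k) f))) \<le> (\<Sum>m<Suc n. nsq (proj m ((harmonic_oscillator ^^ k) f)))"
      by (intro sum_mono2) auto
    also have "\<dots> \<le> nsq ((harmonic_oscillator ^^ k) f)"
      using bessel[OF schwartz_square_integrable[OF S[of k]], of "Suc n"] by (simp only: l2sq_lborel)
    finally show ?thesis by simp
  qed
  ultimately have "sqrt ((level TYPE('a) n ^ k)\<^sup>2 * nsq (proj n f)) \<le> sqrt (nsq ((harmonic_oscillator ^^ k) f))" by simp
  then show "level TYPE('a) n ^ k * sqrt (nsq (proj n f)) \<le> sqrt (nsq ((harmonic_oscillator ^^ k) f))"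
    using level_pos(3)[where 'a='a, of n] by (simp add: real_sqrt_mult less_imp_le)
qed simp

text \<open>
  Eigenspaces are closed under conjugation, so the bilinear pairing of a projection with a function
  only sees the projection of the latter.
\<close>
lemma proj_symmetric:
  fixes u f :: "'a::euclidean_space \<Rightarrow> complex"
  assumes u: "u \<in> testable" and f: "f \<in> testable"
  shows "(\<integral>x. u x * proj n f x \<partial>lborel) = (\<integral>x. proj n u x * f x \<partial>lborel)"
proof -
  have "(\<integral>x. u x * proj n f x \<partial>lborel) = ip u (\<lambda>x. cnj (proj n f x))" by (simp add: ip_def)
  also have "\<dots> = ip (proj n u) (\<lambda>x. cnj (proj n f x))"
    by (rule proj_eigen_ip(2)[OF u eigen_cnj[OF proj_eigen_ip(1)[OF f]], symmetric])
  also have "\<dots> = ip (proj n f) (\<lambda>x. cnj (proj n u x))" by (simp add: ip_def mult.commute)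
  also have "\<dots> = ip f (\<lambda>x. cnj (proj n u x))"
    by (rule proj_eigen_ip(2)[OF f eigen_cnj[OF proj_eigen_ip(1)[OF u]]])
  finally show ?thesis by (simp add: ip_def mult.commute)
qed

section \<open>Functions of the harmonic oscillator\<close>

text \<open>
  The spectrum is contained in the set of levels, and a level outside the spectrum would contribute
  a projection that vanishes.
\<close>
lemma H_fun_eq_sum:
  fixes f :: "'a::euclidean_space \<Rightarrow> complex"
  assumes f: "f \<in> testable"
  shows "H_fun F f x = (\<Sum>\<^sub>\<infinity>n. F (level TYPE('a) n) * proj n f x)"
proof -
  have inj: "inj (level TYPE('a))" by (auto simp: inj_def level_def)
  have "H_fun F f x = (\<Sum>\<^sub>\<infinity>l\<in>range (level TYPE('a)). F l * H_proj l f x)"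
    unfolding H_fun_def
  proof (rule infsum_cong_neutral)
    fix l assume "l \<in> range (level TYPE('a)) - H_spectrum TYPE('a)"
    then obtain n where n: "l = level TYPE('a) n" "level TYPE('a) n \<notin> H_spectrum TYPE('a)" by auto
    have "H_proj l f \<in> H_eigenspace l" using proj_eigen_ip(1)[OF f, of n] by (simp add: proj_def n eigen_def)
    then show "F l * H_proj l f x = 0" using n by (auto simp: H_spectrum_def)
  next
    fix l assume l: "l \<in> H_spectrum TYPE('a) - range (level TYPE('a))"
    then obtain g :: "'a \<Rightarrow> complex" and y where g: "g \<in> H_eigenspace l" "g y \<noteq> 0" by (auto simp: H_spectrum_def)
    have "\<forall>n::nat. l \<noteq> DIM('a) + 2 * n" using l by (auto simp: level_def)
    from eigenspace_trivial[OF g(1) this] g(2) show "F l * H_proj l f x = 0" by simp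
  qed simp
  also have "\<dots> = (\<Sum>\<^sub>\<infinity>n. F (level TYPE('a) n) * proj n f x)"
    using infsum_reindex[OF inj, of "\<lambda>l. F l * H_proj l f x"] by (simp add: o_def proj_def)
  finally show ?thesis .
qed

text \<open>
  An unconditional sum of complex numbers has the default value \<open>0\<close> unless it converges absolutely,
  so this identity holds at every point, including the exceptional ones; it makes \<open>F(H) f\<close>
  measurable.
\<close>
lemma infsum_nat_eq_suminf:
  fixes f :: "nat \<Rightarrow> complex"
  shows "infsum f UNIV = (if summable (\<lambda>n. cmod (f n)) then suminf f else 0)"
proof (cases "summable (\<lambda>n. cmod (f n))")
  case True
  then show ?thesis
    using norm_summable_imp_has_sum[OF True summable_sums[OF summable_norm_cancel[OF True]]] by (simp add: infsumI)
next
  case False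
  have "\<not> f summable_on UNIV"
  proof
    assume "f summable_on UNIV"
    then have "(\<lambda>n. cmod (f n)) summable_on UNIV" unfolding summable_on_iff_abs_summable_on_complex .
    then show False using False by (simp add: summable_on_UNIV_nonneg_real_iff)
  qed
  then show ?thesis using False by (simp add: infsum_def)
qed

text \<open>
  Summability of the norms makes the series absolutely convergent after integration against any
  square integrable function. Integrated against the gaussian, which has no zeros, this gives absolute
  convergence almost everywhere. Fatou's lemma then bounds \<open>F(H) f\<close> in \<open>L\<^sup>2\<close>, and interchanging sum
  and integral gives its pairings, in particular its projections. The statement covers more than
  Schwartz functions because \<open>F(H)\<close> is applied twice in a row and to Fourier transforms.
\<close>
lemma H_fun_series:
  fixes f :: "'a::euclidean_space \<Rightarrow> complex"
  assumes f: "f \<in> testable" and s: "summable (\<lambda>n. cmod (F (level TYPE('a) n)) * sqrt (nsq (proj n f)))"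
  shows "H_fun F f \<in> square_integrable lborel"
    and "\<And>u. u \<in> square_integrable lborel \<Longrightarrow> (\<lambda>n. F (level TYPE('a) n) * (\<integral>x. u x * proj n f x \<partial>lborel)) sums (\<integral>x. u x * H_fun F f x \<partial>lborel)"
    and "\<And>n. proj n (H_fun F f) = (\<lambda>x. F (level TYPE('a) n) * proj n f x)"
proof -
  define p where "p n x = F (level TYPE('a) n) * proj n f x" for n x
  have pS: "p n \<in> schwartz" for n unfolding p_def[abs_def] by (intro schwartz_scale proj_schwartz f)
  have psq: "p n \<in> square_integrable lborel" for n by (rule schwartz_square_integrable[OF pS])
  note [measurable] = schwartz_measurable[OF pS]
  have pn: "sqrt (l2sq lborel (p n)) = cmod (F (level TYPE('a) n)) * sqrt (nsq (proj n f))" for n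
    unfolding p_def[abs_def] l2sq_scale l2sq_lborel by (simp add: real_sqrt_mult)
  have Hf: "H_fun F f x = (if summable (\<lambda>n. cmod (p n x)) then (\<Sum>n. p n x) else 0)" for x
    unfolding H_fun_eq_sum[OF f] p_def[symmetric] by (rule infsum_nat_eq_suminf)
  have abs_int: "summable (\<lambda>n. \<integral>x. cmod (u x * p n x) \<partial>lborel)" if u: "u \<in> square_integrable lborel" for u
  proof (rule summable_comparison_test')
    show "summable (\<lambda>n. sqrt (l2sq lborel u) * sqrt (l2sq lborel (p n)))" unfolding pn by (rule summable_mult[OF s])
    show "norm (\<integral>x. cmod (u x * p n x) \<partial>lborel) \<le> sqrt (l2sq lborel u) * sqrt (l2sq lborel (p n))" for n
      using l2_Cauchy_Schwarz_norm[OF u psq] by simp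
  qed
  have ae: "AE x in lborel. summable (\<lambda>n. cmod (p n x))"
  proof -
    let ?g = "gaussian :: 'a \<Rightarrow> complex"
    have gs: "?g \<in> square_integrable lborel" by (intro schwartz_square_integrable gaussian_schwartz)
    have "(\<integral>\<^sup>+x. (\<Sum>n. ennreal (cmod (?g x * p n x))) \<partial>lborel) = (\<Sum>n. \<integral>\<^sup>+x. ennreal (cmod (?g x * p n x)) \<partial>lborel)"
      by (rule nn_integral_suminf) measurable
    also have "\<dots> = (\<Sum>n. ennreal (\<integral>x. cmod (?g x * p n x) \<partial>lborel))"
      by (intro suminf_cong nn_integral_eq_integral integrable_norm square_integrable_mult gs psq) auto
    also have "\<dots> \<noteq> \<infinity>" unfolding infinity_ennreal_def by (rule ennreal_suminf_neq_top[OF abs_int[OF gs]]) simp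
    finally have "AE x in lborel. (\<Sum>n. ennreal (cmod (?g x * p n x))) \<noteq> \<infinity>"
      by (intro nn_integral_PInf_AE) auto
    then show ?thesis
    proof eventually_elim
      case (elim x)
      have "summable (\<lambda>n. cmod (?g x * p n x))" by (rule summable_suminf_not_top) (use elim in auto)
      moreover have "?g x \<noteq> 0" by (simp add: gaussian_def)
      ultimately show ?case by (simp add: norm_mult summable_cmult_iff)
    qed
  qed
  have meas [measurable]: "H_fun F f \<in> borel_measurable borel"
  proof -
    have "summable (\<lambda>n. cmod (p n x)) \<longleftrightarrow> (\<Sum>n. ennreal (cmod (p n x))) \<noteq> top" for x
    proof
      show "(\<Sum>n. ennreal (cmod (p n x))) \<noteq> top" if "summable (\<lambda>n. cmod (p n x))"
        by (rule ennreal_suminf_neq_top[OF that]) simp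
      show "summable (\<lambda>n. cmod (p n x))" if "(\<Sum>n. ennreal (cmod (p n x))) \<noteq> top"
        by (rule summable_suminf_not_top[OF _ that]) simp
    qed
    then have "H_fun F f = (\<lambda>x. if (\<Sum>n. ennreal (cmod (p n x))) \<noteq> top then (\<Sum>n. p n x) else 0)"
      using Hf by auto
    also have "\<dots> \<in> borel_measurable borel" by measurable
    finally show ?thesis .
  qed
  have orth: "(\<integral>x. p i x * cnj (p j x) \<partial>lborel) = 0" if "i \<noteq> j" for i j
  proof -
    have "ip (p i) (p j) = 0" unfolding p_def[abs_def] ip_scale_left ip_scale_right
      using eigen_orthogonal[OF proj_eigen_ip(1)[OF f] proj_eigen_ip(1)[OF f] that] by simp
    then show ?thesis by (simp add: ip_def)
  qed
  have sqs: "summable (\<lambda>n. l2sq lborel (p n))"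
  proof -
    have s': "summable (\<lambda>n. sqrt (l2sq lborel (p n)))" unfolding pn by (rule s)
    have "summable (\<lambda>n. (sqrt (l2sq lborel (p n)))\<^sup>2)"
    proof -
      have "eventually (\<lambda>n. sqrt (l2sq lborel (p n)) < 1) sequentially"
        using summable_LIMSEQ_zero[OF s'] by (rule order_tendstoD) simp
      then have "eventually (\<lambda>n. norm ((sqrt (l2sq lborel (p n)))\<^sup>2) \<le> sqrt (l2sq lborel (p n))) sequentially"
      proof eventually_elim
        case (elim n)
        have "sqrt (l2sq lborel (p n)) * sqrt (l2sq lborel (p n)) \<le> sqrt (l2sq lborel (p n))"
          by (rule mult_left_le) (use elim in simp_all)
        then show ?case by (simp add: power2_eq_square)
      qed
      then show ?thesis by (rule summable_comparison_test_ev[OF _ s'])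
    qed
    then show ?thesis by simp
  qed
  show sqH: "H_fun F f \<in> square_integrable lborel"
  proof (rule square_integrableI_nn)
    have "(\<integral>\<^sup>+x. ennreal ((cmod (H_fun F f x))\<^sup>2) \<partial>lborel) = (\<integral>\<^sup>+x. liminf (\<lambda>N. ennreal ((cmod (\<Sum>n<N. p n x))\<^sup>2)) \<partial>lborel)"
    proof (rule nn_integral_cong_AE)
      show "AE x in lborel. ennreal ((cmod (H_fun F f x))\<^sup>2) = liminf (\<lambda>N. ennreal ((cmod (\<Sum>n<N. p n x))\<^sup>2))"
        using ae
      proof eventually_elim
        case (elim x)
        have "(\<lambda>N. \<Sum>n<N. p n x) \<longlonglongrightarrow> H_fun F f x"
          using summable_LIMSEQ[OF summable_norm_cancel[OF elim]] elim by (simp add: Hf)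
        then have "(\<lambda>N. ennreal ((cmod (\<Sum>n<N. p n x))\<^sup>2)) \<longlonglongrightarrow> ennreal ((cmod (H_fun F f x))\<^sup>2)"
          by (intro tendsto_ennrealI tendsto_intros)
        then show ?case by (intro lim_imp_Liminf[symmetric]) auto
      qed
    qed
    also have "\<dots> \<le> liminf (\<lambda>N. \<integral>\<^sup>+x. ennreal ((cmod (\<Sum>n<N. p n x))\<^sup>2) \<partial>lborel)"
      by (rule nn_integral_liminf) measurable
    also have "\<dots> \<le> ennreal (\<Sum>n. l2sq lborel (p n))"
    proof (rule Liminf_le)
      have "(\<integral>\<^sup>+x. ennreal ((cmod (\<Sum>n<N. p n x))\<^sup>2) \<partial>lborel) \<le> ennreal (\<Sum>n. l2sq lborel (p n))" for N
      proof -
      have "(\<Sum>n<N. l2sq lborel (p n)) \<le> (\<Sum>n. l2sq lborel (p n))" by (rule sum_le_suminf[OF sqs]) auto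
      then show ?thesis
        by (subst nn_integral_l2sq[OF square_integrable_sum[OF psq]])
          (simp add: l2sq_orthogonal_sum[OF psq orth] ennreal_leI)
      qed
      then show "eventually (\<lambda>N. (\<integral>\<^sup>+x. ennreal ((cmod (\<Sum>n<N. p n x))\<^sup>2) \<partial>lborel) \<le> ennreal (\<Sum>n. l2sq lborel (p n))) sequentially"
        by simp
    qed simp
    finally show "(\<integral>\<^sup>+x. ennreal ((cmod (H_fun F f x))\<^sup>2) \<partial>lborel) \<le> ennreal (\<Sum>n. l2sq lborel (p n))" .
  qed measurable
  show sm: "(\<lambda>n. F (level TYPE('a) n) * (\<integral>x. u x * proj n f x \<partial>lborel)) sums (\<integral>x. u x * H_fun F f x \<partial>lborel)"
    if u: "u \<in> square_integrable lborel" for u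
  proof -
    have [measurable]: "u \<in> borel_measurable borel" using u by auto
    have "(\<lambda>n. \<integral>x. u x * p n x \<partial>lborel) sums (\<integral>x. (\<Sum>n. u x * p n x) \<partial>lborel)"
    proof (rule sums_integral)
      show "integrable lborel (\<lambda>x. u x * p n x)" for n by (rule square_integrable_mult[OF u psq])
      show "AE x in lborel. summable (\<lambda>n. norm (u x * p n x))"
        using ae by eventually_elim (simp add: norm_mult summable_mult)
    qed (rule abs_int[OF u])
    moreover have "(\<integral>x. (\<Sum>n. u x * p n x) \<partial>lborel) = (\<integral>x. u x * H_fun F f x \<partial>lborel)"
    proof (rule integral_cong_AE)
      show "AE x in lborel. (\<Sum>n. u x * p n x) = u x * H_fun F f x"
        using ae by eventually_elim (simp add: Hf suminf_mult summable_norm_cancel)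
    qed measurable
    moreover have "(\<integral>x. u x * p n x \<partial>lborel) = F (level TYPE('a) n) * (\<integral>x. u x * proj n f x \<partial>lborel)" for n
      unfolding p_def by (subst integral_mult_right_zero[symmetric]) (simp add: mult_ac)
    ultimately show ?thesis by simp
  qed
  show "proj n (H_fun F f) = (\<lambda>x. F (level TYPE('a) n) * proj n f x)" for n
  proof (rule proj_unique)
    show "H_fun F f \<in> testable" by (rule square_integrable_testable[OF sqH])
    show "(\<lambda>x. F (level TYPE('a) n) * proj n f x) \<in> eigen n"
      using proj_eigen_ip(1)[OF f, of n] by (simp add: eigen_def eigenspace_scale)
    fix q :: "'a \<Rightarrow> complex" assume q: "q \<in> eigen n"
    have qs: "(\<lambda>x. cnj (q x)) \<in> square_integrable lborel"
      by (intro square_integrable_cnj schwartz_square_integrable eigen_schwartz[OF q])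
    have "(\<lambda>m. F (level TYPE('a) m) * ip (proj m f) q) sums ip (H_fun F f) q"
      using sm[OF qs] by (simp add: ip_def mult.commute)
    moreover have "(\<lambda>m. F (level TYPE('a) m) * ip (proj m f) q) = (\<lambda>m. if m = n then F (level TYPE('a) n) * ip (proj n f) q else 0)"
      using eigen_orthogonal[OF proj_eigen_ip(1)[OF f] q] by auto
    ultimately have "(\<lambda>m. if m = n then F (level TYPE('a) n) * ip (proj n f) q else 0) sums ip (H_fun F f) q" by simp
    moreover have "(\<lambda>m. if m = n then F (level TYPE('a) n) * ip (proj n f) q else 0) sums (F (level TYPE('a) n) * ip (proj n f) q)"
      by (rule sums_single)
    ultimately show "ip (\<lambda>x. F (level TYPE('a) n) * proj n f x) q = ip (H_fun F f) q"
      unfolding ip_scale_left by (rule sums_unique2[symmetric])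
  qed
qed

lemma summable_level: "summable (\<lambda>n. 1 / (level TYPE('a::euclidean_space) n) ^ 2)"
proof -
  have "summable (\<lambda>n. 1 / (real (Suc n)) ^ 2)"
    using inverse_power_summable[of 2, where 'a=real] summable_Suc_iff[of "\<lambda>n. inverse (real n ^ 2)"] by (simp add: inverse_eq_divide)
  then show ?thesis
  proof (rule summable_comparison_test')
    fix n
    have "real (Suc n) \<le> level TYPE('a) n" using DIM_positive[where 'a='a] unfolding level_def by linarith
    then have "(real (Suc n))\<^sup>2 \<le> (level TYPE('a) n)\<^sup>2" by (intro power_mono) auto
    then show "norm (1 / (level TYPE('a) n)\<^sup>2) \<le> 1 / (real (Suc n))\<^sup>2"
      by (auto intro!: divide_left_mono mult_pos_pos simp: level_pos)
  qed
qed

text \<open>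
  Rapid decay of the projections beats polynomial growth of \<open>F\<close>; two extra powers of the level make
  the series converge.
\<close>
lemma schwartz_coefficients_summable:
  fixes f :: "'a::euclidean_space \<Rightarrow> complex"
  assumes f: "f \<in> schwartz" and F: "\<And>n. cmod (F (level TYPE('a) n)) \<le> A * level TYPE('a) n ^ k"
  shows "summable (\<lambda>n. cmod (F (level TYPE('a) n)) * sqrt (nsq (proj n f)))"
proof -
  obtain C where C: "C \<ge> 0" "\<And>n. level TYPE('a) n ^ (k + 2) * sqrt (nsq (proj n f)) \<le> C"
    using proj_decay[OF f] by metis
  have "0 \<le> A * level TYPE('a) 0 ^ k" by (rule order_trans[OF norm_ge_zero F])
  moreover have "level TYPE('a) 0 ^ k > 0" using level_pos(3)[where 'a='a, of 0] by simp
  ultimately have A: "A \<ge> 0" by (simp add: zero_le_mult_iff)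
  show ?thesis
  proof (rule summable_comparison_test')
    show "summable (\<lambda>n. A * C * (1 / (level TYPE('a) n) ^ 2))" by (intro summable_mult summable_level)
    fix n
    have l: "level TYPE('a) n > 0" by (rule level_pos)
    have "cmod (F (level TYPE('a) n)) * sqrt (nsq (proj n f)) \<le> A * level TYPE('a) n ^ k * sqrt (nsq (proj n f))"
      by (intro mult_right_mono F) simp
    also have "\<dots> = A * (level TYPE('a) n ^ (k + 2) * sqrt (nsq (proj n f))) / (level TYPE('a) n) ^ 2"
      using l by (simp add: power_add field_simps power2_eq_square)
    also have "\<dots> \<le> A * C / (level TYPE('a) n) ^ 2"
      by (intro divide_right_mono mult_left_mono C A) auto
    finally show "norm (cmod (F (level TYPE('a) n)) * sqrt (nsq (proj n f))) \<le> A * C * (1 / (level TYPE('a) n) ^ 2)"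
      by simp
  qed
qed

section \<open>The Fourier transform commutes with the spectral projections\<close>

lemma FT_measurable:
  fixes f :: "'a::euclidean_space \<Rightarrow> complex"
  assumes [measurable]: "f \<in> borel_measurable borel"
  shows "FT f \<in> borel_measurable borel"
proof -
  have "(\<lambda>v. \<integral>x. exp (\<i> * of_real (x \<bullet> v)) * f x \<partial>lborel) \<in> borel_measurable (borel :: 'a measure)"
    by (rule lborel.borel_measurable_lebesgue_integral) measurable
  then show ?thesis by (simp add: FT_def[abs_def])
qed

lemma FT_bounded:
  fixes f :: "'a::euclidean_space \<Rightarrow> complex"
  shows "cmod (FT f v) \<le> (\<integral>x. cmod (f x) \<partial>lborel)"
  unfolding FT_def by (rule order_trans[OF integral_norm_bound]) (simp add: norm_mult)

lemma bounded_testable: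
  fixes f :: "'a::euclidean_space \<Rightarrow> complex"
  assumes m[measurable]: "f \<in> borel_measurable borel" and b: "\<And>x. cmod (f x) \<le> B"
  shows "f \<in> testable"
  unfolding testable_def
proof (intro CollectI conjI ballI m)
  fix q :: "'a \<Rightarrow> complex" assume q: "q \<in> schwartz"
  note [measurable] = schwartz_measurable[OF q]
  show "integrable lborel (\<lambda>x. f x * q x)"
    by (rule Bochner_Integration.integrable_bound[of lborel "\<lambda>x. of_real B * q x"])
      (use schwartz_integrable[OF q] b order_trans[OF norm_ge_zero b] in \<open>auto simp: norm_mult intro!: mult_right_mono\<close>)
qed

lemma fourier_testable:
  fixes f :: "'a::euclidean_space \<Rightarrow> complex"
  assumes f: "f \<in> schwartz"
  shows "fourier f \<in> testable"
proof (rule bounded_testable)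
  have [measurable]: "FT f \<in> borel_measurable borel" by (rule FT_measurable[OF schwartz_measurable[OF f]])
  show "fourier f \<in> borel_measurable borel" unfolding fourier_eq_FT[abs_def] by measurable
  show "cmod (fourier f v) \<le> (\<integral>x. cmod (f x) \<partial>lborel)" for v unfolding fourier_eq_FT by (rule FT_bounded)
qed

text \<open>
  Fubini, the kernel \<open>e\<^sup>i\<^sup>x\<^sup>\<cdot>\<^sup>v\<close> being symmetric and bounded.
\<close>
lemma FT_exchange:
  fixes f g :: "'a::euclidean_space \<Rightarrow> complex"
  assumes f: "integrable lborel f" and g: "integrable lborel g"
  shows "(\<integral>v. FT f v * g v \<partial>lborel) = (\<integral>x. f x * FT g x \<partial>lborel)"
proof -
  have [measurable]: "f \<in> borel_measurable borel" "g \<in> borel_measurable borel" using f g by auto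
  have "(\<integral>v. FT f v * g v \<partial>lborel) = (\<integral>v. \<integral>x. exp (\<i> * of_real (x \<bullet> v)) * f x * g v \<partial>lborel \<partial>lborel)"
    unfolding FT_def by simp
  also have "\<dots> = (\<integral>x. \<integral>v. exp (\<i> * of_real (x \<bullet> v)) * f x * g v \<partial>lborel \<partial>lborel)"
    by (rule Fubini_bound[OF g f]) (auto simp: norm_mult)
  also have "\<dots> = (\<integral>x. f x * FT g x \<partial>lborel)"
    unfolding FT_def
    by (intro Bochner_Integration.integral_cong refl, subst integral_mult_right_zero[symmetric])
      (simp add: mult_ac inner_commute)
  finally show ?thesis .
qed

lemma FT_cnj: "cnj (FT g v) = FT (\<lambda>x. cnj (g x)) (- v)"
  unfolding FT_def by (subst Bochner_Integration.integral_cnj[symmetric]) (simp add: exp_cnj)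

text \<open>
  Moving the Fourier integral to the eigenfunction \<open>q\<close>, on which it is the scalar of \<open>FT_eigen\<close>; the
  conjugation in the inner product turns \<open>\<i>\<close> into \<open>-\<i>\<close>.
\<close>
lemma proj_fourier:
  fixes f :: "'a::euclidean_space \<Rightarrow> complex"
  assumes f: "f \<in> schwartz"
  shows "proj n (fourier f) = (\<lambda>x. (of_real (gaussian_mass TYPE('a)) * (- \<i>) ^ n) * proj n f x)"
proof (rule proj_unique[OF fourier_testable[OF f]])
  let ?c = "of_real (gaussian_mass TYPE('a)) * (- \<i>) ^ n"
  have t: "f \<in> testable" by (rule schwartz_testable[OF f])
  show "(\<lambda>x. ?c * proj n f x) \<in> eigen n"
    using proj_eigen_ip(1)[OF t, of n] by (simp add: eigen_def eigenspace_scale)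
  fix q :: "'a \<Rightarrow> complex" assume q: "q \<in> eigen n"
  note qs = eigen_schwartz[OF q]
  have refl: "(\<integral>v. h (- v) \<partial>lborel) = (\<integral>v. h v \<partial>lborel)" if "h \<in> borel_measurable borel" for h :: "'a \<Rightarrow> complex"
    using lborel_integral_affine[OF that, of "-1" 0] by simp
  have [measurable]: "FT f \<in> borel_measurable borel" by (rule FT_measurable[OF schwartz_measurable[OF f]])
  note [measurable] = schwartz_measurable[OF qs]
  have qm [measurable]: "(\<lambda>v. cnj (q (- v))) \<in> borel_measurable borel"
    by (rule measurable_compose[OF _ schwartz_measurable[OF schwartz_cnj[OF qs]], of uminus]) simp
  have qi: "integrable lborel (\<lambda>v. cnj (q (- v)))"
  proof (rule rapidly_decreasing_integrable[OF _ qm])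
    show "rapidly_decreasing (\<lambda>v. cnj (q (- v)))"
      unfolding rapidly_decreasing_def
    proof
      fix k
      obtain C where C: "\<And>x. (1 + norm x) ^ k * cmod (q x) \<le> C"
        using rapidly_decreasingD[OF schwartz_rapid[OF qs]] by metis
      show "\<exists>C. \<forall>x. (1 + norm x) ^ k * cmod (cnj (q (- x))) \<le> C"
        using C[of "- _"] by (intro exI[of _ C]) simp
    qed
  qed
  have "ip (fourier f) q = (\<integral>v. FT f (- v) * cnj (q v) \<partial>lborel)"
    unfolding ip_def fourier_eq_FT ..
  also have "\<dots> = (\<integral>v. FT f v * cnj (q (- v)) \<partial>lborel)"
    using refl[OF borel_measurable_times[OF \<open>FT f \<in> borel_measurable borel\<close> qm]] by simp
  also have "\<dots> = (\<integral>x. f x * FT (\<lambda>v. cnj (q (- v))) x \<partial>lborel)"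
    by (rule FT_exchange[OF schwartz_integrable[OF f] qi])
  also have "(\<lambda>x. FT (\<lambda>v. cnj (q (- v))) x) = (\<lambda>x. cnj (FT q x))"
  proof
    fix x
    have "FT (\<lambda>v. cnj (q (- v))) x = (\<integral>v. exp (\<i> * of_real ((- v) \<bullet> x)) * cnj (q v) \<partial>lborel)"
      unfolding FT_def
      using refl[of "\<lambda>v. exp (\<i> * of_real ((- v) \<bullet> x)) * cnj (q v)"] schwartz_measurable[OF schwartz_cnj[OF qs]] by simp
    then show "FT (\<lambda>v. cnj (q (- v))) x = cnj (FT q x)" unfolding FT_cnj unfolding FT_def by simp
  qed
  also have "(\<integral>x. f x * cnj (FT q x) \<partial>lborel) = ?c * ip f q"
    unfolding FT_eigen[OF q] ip_def by (subst integral_mult_right_zero[symmetric]) (simp add: mult_ac)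
  finally show "ip (\<lambda>x. ?c * proj n f x) q = ip (fourier f) q"
    by (simp add: ip_scale_left proj_eigen_ip(2)[OF t q])
qed

section \<open>Eigenfunctions in weighted spaces: the virial identity\<close>

lemma japanese_bracket_nonzero [simp]: "japanese_bracket x \<noteq> 0"
  using japanese_bracket_pos[of x] by linarith

definition brk :: "real \<Rightarrow> ('a::euclidean_space \<Rightarrow> complex) \<Rightarrow> 'a \<Rightarrow> complex" where
  "brk t f x = of_real (japanese_bracket x powr t) * f x"

definition weighted :: "real \<Rightarrow> ('a::euclidean_space \<Rightarrow> complex) \<Rightarrow> real" where
  "weighted t f = (\<integral>x. japanese_bracket x powr t * (cmod (f x))\<^sup>2 \<partial>lborel)"

text \<open>
  The operator \<open>x \<cdot> \<nabla>\<close>, which generates the dilations.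
\<close>
definition radial :: "('a::euclidean_space \<Rightarrow> complex) \<Rightarrow> 'a \<Rightarrow> complex" where
  "radial f x = (\<Sum>b\<in>Basis. of_real (x \<bullet> b) * partial_deriv b f x)"

lemma schwartz_brk: "f \<in> schwartz \<Longrightarrow> brk t f \<in> schwartz"
  unfolding brk_def[abs_def] by (rule schwartz_bracket)

lemma schwartz_radial: "f \<in> schwartz \<Longrightarrow> radial f \<in> schwartz"
  unfolding radial_def[abs_def] by (intro schwartz_sum schwartz_coord schwartz_partial_deriv)

lemma brk_brk: "brk s (brk t f) = brk (s + t) f"
  by (rule ext) (simp add: brk_def powr_add mult.assoc[symmetric])

lemma norm_sq_eq_bracket: "(norm x)\<^sup>2 = (japanese_bracket x)\<^sup>2 - 1"
  by (simp add: japanese_bracket_sq)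

lemma bracket_powr_2: "japanese_bracket x powr (t + 2) = (japanese_bracket x)\<^sup>2 * japanese_bracket x powr t"
  by (simp add: powr_add powr_numeral)

lemma partial_deriv_brk:
  assumes f: "f \<in> schwartz"
  shows "partial_deriv b (brk t f) x = brk t (partial_deriv b f) x + of_real t * (of_real (x \<bullet> b) * brk (t - 2) f x)"
  unfolding brk_def
  by (subst partial_deriv_eq[OF has_derivative_mult[OF has_derivative_of_real[OF has_derivative_japanese_powr] schwartz_has_derivative[OF f]]])
    (simp add: algebra_simps)

lemma ip_brk_self: "ip (brk t f) f = of_real (weighted t f)"
proof -
  have "brk t f x * cnj (f x) = of_real (japanese_bracket x powr t * (cmod (f x))\<^sup>2)" for x
    unfolding brk_def using complex_norm_square[of "f x"] by (simp add: mult.assoc)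
  then show ?thesis unfolding ip_def weighted_def by (simp only: integral_complex_of_real)
qed

lemma weighted_integrable:
  assumes f: "f \<in> schwartz"
  shows "integrable lborel (\<lambda>x. japanese_bracket x powr t * (cmod (f x))\<^sup>2)"
proof -
  have "integrable lborel (\<lambda>x. cmod (brk t f x * cnj (f x)))" by (intro integrable_norm schwartz_ip_integrable schwartz_brk f)
  then show ?thesis by (simp add: brk_def norm_mult power2_eq_square mult.assoc)
qed

lemma weighted_nonneg [simp]: "0 \<le> weighted t f" by (simp add: weighted_def)

lemma weighted_mono: "f \<in> schwartz \<Longrightarrow> s \<le> t \<Longrightarrow> weighted s f \<le> weighted t f"
  unfolding weighted_def
  by (intro integral_mono weighted_integrable mult_right_mono powr_mono japanese_bracket_ge_1) auto

lemma weighted_0: "weighted 0 f = nsq f"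
  unfolding weighted_def nsq_def by simp

lemma ip_brk_commute: "ip (brk t f) g = ip f (brk t g)"
  unfolding ip_def brk_def by (simp add: mult_ac)

text \<open>
  Integration of the divergence of \<open>\<langle>x\<rangle>\<^sup>t |u|\<^sup>2 x\<close>.
\<close>
lemma Re_ip_radial:
  fixes u :: "'a::euclidean_space \<Rightarrow> complex"
  assumes u: "u \<in> schwartz"
  shows "2 * Re (ip (brk t (radial u)) u) = - (real DIM('a) + t) * weighted t u + t * weighted (t - 2) u"
proof -
  let ?h = "\<lambda>x. brk t u x * cnj (u x)"
  have cu: "(\<lambda>x. cnj (u x)) \<in> schwartz" by (rule schwartz_cnj[OF u])
  have h: "?h \<in> schwartz" by (intro schwartz_mult schwartz_brk u cu)
  have dh: "partial_deriv b ?h x = brk t u x * cnj (partial_deriv b u x) + brk t (partial_deriv b u) x * cnj (u x)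
      + of_real t * (of_real (x \<bullet> b) * (brk (t - 2) u x * cnj (u x)))" for b x
    unfolding partial_deriv_mult[OF schwartz_brk[OF u] cu] partial_deriv_brk[OF u] partial_deriv_cnj[OF u]
    by (simp add: algebra_simps)
  have z: "(\<integral>x. of_real (x \<bullet> b) * partial_deriv b ?h x \<partial>lborel) = - (\<integral>x. ?h x \<partial>lborel)" if b: "b \<in> Basis" for b
  proof -
    have "0 = (\<integral>x. partial_deriv b (\<lambda>x. of_real (x \<bullet> b) * ?h x) x \<partial>lborel)"
      by (intro integral_partial_deriv_zero[symmetric] schwartz_coord h b)
    also have "\<dots> = (\<integral>x. of_real (x \<bullet> b) * partial_deriv b ?h x + ?h x \<partial>lborel)"
      using b by (simp only: partial_deriv_coord[OF h] inner_same_Basis of_real_1 mult_1)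
    also have "\<dots> = (\<integral>x. of_real (x \<bullet> b) * partial_deriv b ?h x \<partial>lborel) + (\<integral>x. ?h x \<partial>lborel)"
      by (intro Bochner_Integration.integral_add schwartz_integrable schwartz_coord schwartz_partial_deriv h b)
    finally show ?thesis by (simp add: eq_neg_iff_add_eq_0)
  qed
  have "- of_nat DIM('a) * (\<integral>x. ?h x \<partial>lborel) = (\<Sum>b\<in>(Basis::'a set). (\<integral>x. of_real (x \<bullet> b) * partial_deriv b ?h x \<partial>lborel))"
    by (simp add: z sum_negf)
  also have "\<dots> = (\<integral>x. (\<Sum>b\<in>Basis. of_real (x \<bullet> b) * partial_deriv b ?h x) \<partial>lborel)"
    by (intro Bochner_Integration.integral_sum[symmetric] schwartz_integrable schwartz_coord schwartz_partial_deriv h)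
  also have "(\<lambda>x. \<Sum>b\<in>Basis. of_real (x \<bullet> b) * partial_deriv b ?h x) =
     (\<lambda>x. u x * cnj (brk t (radial u) x) + brk t (radial u) x * cnj (u x) + of_real t * (?h x - brk (t - 2) u x * cnj (u x)))"
  proof
    fix x :: 'a
    have n: "(\<Sum>b\<in>Basis. complex_of_real (x \<bullet> b) * of_real (x \<bullet> b)) = of_real ((norm x)\<^sup>2)"
      unfolding power2_norm_eq_inner by (subst (3) euclidean_inner) simp
    have "(\<Sum>b\<in>Basis. of_real (x \<bullet> b) * partial_deriv b ?h x) =
       brk t u x * (\<Sum>b\<in>Basis. of_real (x \<bullet> b) * cnj (partial_deriv b u x))
       + of_real (japanese_bracket x powr t) * (\<Sum>b\<in>Basis. of_real (x \<bullet> b) * partial_deriv b u x) * cnj (u x)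
       + of_real t * ((\<Sum>b\<in>Basis. of_real (x \<bullet> b) * of_real (x \<bullet> b)) * (brk (t - 2) u x * cnj (u x)))"
      unfolding dh by (simp add: brk_def distrib_left sum.distrib sum_distrib_left sum_distrib_right mult_ac)
    also have "(\<Sum>b\<in>Basis. of_real (x \<bullet> b) * cnj (partial_deriv b u x)) = cnj (radial u x)"
      by (simp add: radial_def)
    also have "of_real (japanese_bracket x powr t) * (\<Sum>b\<in>Basis. of_real (x \<bullet> b) * partial_deriv b u x) = brk t (radial u) x"
      by (simp add: radial_def brk_def)
    also have "(\<Sum>b\<in>Basis. complex_of_real (x \<bullet> b) * of_real (x \<bullet> b)) * (brk (t - 2) u x * cnj (u x)) = ?h x - brk (t - 2) u x * cnj (u x)"
    proof -
      have "of_real ((norm x)\<^sup>2) * brk (t - 2) u x = brk t u x - brk (t - 2) u x"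
        using bracket_powr_2[of x "t - 2"] unfolding norm_sq_eq_bracket by (simp add: brk_def algebra_simps)
      then show ?thesis unfolding n by (simp add: mult.assoc[symmetric] left_diff_distrib)
    qed
    finally show "(\<Sum>b\<in>Basis. of_real (x \<bullet> b) * partial_deriv b ?h x) =
      u x * cnj (brk t (radial u) x) + brk t (radial u) x * cnj (u x) + of_real t * (?h x - brk (t - 2) u x * cnj (u x))"
      by (simp add: brk_def mult_ac)
  qed
  also have "(\<integral>x. u x * cnj (brk t (radial u) x) + brk t (radial u) x * cnj (u x) + of_real t * (?h x - brk (t - 2) u x * cnj (u x)) \<partial>lborel)
    = ip u (brk t (radial u)) + ip (brk t (radial u)) u + of_real t * (ip (brk t u) u - ip (brk (t - 2) u) u)"
    unfolding ip_def
    using schwartz_ip_integrable[OF u schwartz_brk[OF schwartz_radial[OF u]], of t] schwartz_ip_integrable[OF schwartz_brk[OF schwartz_radial[OF u]] u, of t]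
      schwartz_ip_integrable[OF schwartz_brk[OF u] u, of t] schwartz_ip_integrable[OF schwartz_brk[OF u] u, of "t - 2"]
    by simp
  finally have "- of_nat DIM('a) * ip (brk t u) u = ip u (brk t (radial u)) + ip (brk t (radial u)) u + of_real t * (ip (brk t u) u - ip (brk (t - 2) u) u)"
    by (simp add: ip_def)
  from arg_cong[OF this, of Re]
  have "- real DIM('a) * weighted t u = Re (ip u (brk t (radial u))) + Re (ip (brk t (radial u)) u) + t * (weighted t u - weighted (t - 2) u)"
    unfolding ip_brk_self by simp
  moreover have "Re (ip u (brk t (radial u))) = Re (ip (brk t (radial u)) u)"
    by (subst ip_commute) simp
  ultimately show ?thesis by (simp add: algebra_simps)
qed

text \<open>
  One integration by parts in each direction; \<open>|x|\<^sup>2\<close> is written as \<open>\<langle>x\<rangle>\<^sup>2 - 1\<close>.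
\<close>
lemma ip_harmonic_oscillator_gradient:
  fixes f g :: "'a::euclidean_space \<Rightarrow> complex"
  assumes f: "f \<in> schwartz" and g: "g \<in> schwartz"
  shows "ip (harmonic_oscillator g) f = (\<Sum>b\<in>Basis. ip (partial_deriv b g) (partial_deriv b f)) + ip (brk 2 g) f - ip g f"
proof -
  have cf: "(\<lambda>x. cnj (f x)) \<in> schwartz" by (rule schwartz_cnj[OF f])
  have S: "partial_deriv b (partial_deriv b g) \<in> schwartz" if "b \<in> Basis" for b
    using that by (intro schwartz_partial_deriv g)
  have "harmonic_oscillator g = (\<lambda>x. (\<Sum>b\<in>Basis. (-1) * partial_deriv b (partial_deriv b g) x) + (brk 2 g x + (-1) * g x))"
  proof
    fix x
    show "harmonic_oscillator g x = (\<Sum>b\<in>Basis. (-1) * partial_deriv b (partial_deriv b g) x) + (brk 2 g x + (-1) * g x)"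
      unfolding harmonic_oscillator_def laplacian_def brk_def norm_sq_eq_bracket
      by (simp add: sum_negf powr_numeral algebra_simps)
  qed
  then have "ip (harmonic_oscillator g) f = ip (\<lambda>x. (\<Sum>b\<in>Basis. (-1) * partial_deriv b (partial_deriv b g) x) + (brk 2 g x + (-1) * g x)) f" by simp
  also have "\<dots> = ip (\<lambda>x. \<Sum>b\<in>Basis. (-1) * partial_deriv b (partial_deriv b g) x) f + ip (\<lambda>x. brk 2 g x + (-1) * g x) f"
    by (rule ip_add_left[OF schwartz_sum[OF schwartz_scale[OF S]] schwartz_add[OF schwartz_brk[OF g] schwartz_scale[OF g]] f])
  also have "ip (\<lambda>x. brk 2 g x + (-1) * g x) f = ip (brk 2 g) f + (-1) * ip g f"
    by (simp only: ip_add_left[OF schwartz_brk[OF g] schwartz_scale[OF g] f] ip_scale_left)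
  also have "ip (\<lambda>x. \<Sum>b\<in>Basis. (-1) * partial_deriv b (partial_deriv b g) x) f = (\<Sum>b\<in>Basis. (-1) * ip (partial_deriv b (partial_deriv b g)) f)"
    by (subst ip_sum_left[OF schwartz_scale[OF S] f]) (simp_all only: ip_scale_left)
  also have "\<dots> = (\<Sum>b\<in>Basis. ip (partial_deriv b g) (partial_deriv b f))"
  proof (rule sum.cong[OF refl])
    fix b :: 'a assume b: "b \<in> Basis"
    show "(-1) * ip (partial_deriv b (partial_deriv b g)) f = ip (partial_deriv b g) (partial_deriv b f)"
      unfolding ip_def using integration_by_parts[OF schwartz_partial_deriv[OF g b] cf b] partial_deriv_cnj[OF f] by simp
  qed
  finally show ?thesis by simp
qed

lemma partial_deriv_radial:
  fixes f :: "'a::euclidean_space \<Rightarrow> complex"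
  assumes f: "f \<in> schwartz" and b: "b \<in> Basis"
  shows "partial_deriv b (radial f) = (\<lambda>x. partial_deriv b f x + radial (partial_deriv b f) x)"
proof
  fix x
  have "partial_deriv b (radial f) x = (\<Sum>c\<in>Basis. partial_deriv b (\<lambda>x. of_real (x \<bullet> c) * partial_deriv c f x) x)"
    unfolding radial_def[abs_def] by (intro partial_deriv_sum schwartz_coord schwartz_partial_deriv f)
  also have "\<dots> = (\<Sum>c\<in>Basis. of_real (x \<bullet> c) * partial_deriv c (partial_deriv b f) x + (if c = b then partial_deriv b f x else 0))"
    by (intro sum.cong refl) (auto simp: partial_deriv_coord schwartz_partial_deriv f b partial_deriv_commute[OF f b] inner_Basis)
  finally show "partial_deriv b (radial f) x = partial_deriv b f x + radial (partial_deriv b f) x"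
    using b by (simp add: sum.distrib radial_def add.commute)
qed

definition grad_weighted :: "real \<Rightarrow> ('a::euclidean_space \<Rightarrow> complex) \<Rightarrow> real" where
  "grad_weighted t f = (\<Sum>b\<in>Basis. weighted t (partial_deriv b f))"

lemma grad_weighted_nonneg [simp]: "0 \<le> grad_weighted t f" by (simp add: grad_weighted_def sum_nonneg)

lemma sum_ip_coord_radial:
  fixes f g :: "'a::euclidean_space \<Rightarrow> complex"
  assumes f: "f \<in> schwartz" and g: "g \<in> schwartz"
  shows "(\<Sum>b\<in>Basis. ip (\<lambda>x. of_real (x \<bullet> b) * g x) (partial_deriv b f)) = ip g (radial f)"
proof -
  have "(\<Sum>b\<in>Basis. ip (\<lambda>x. of_real (x \<bullet> b) * g x) (partial_deriv b f)) =
     (\<integral>x. (\<Sum>b\<in>Basis. of_real (x \<bullet> b) * g x * cnj (partial_deriv b f x)) \<partial>lborel)"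
    unfolding ip_def by (intro Bochner_Integration.integral_sum[symmetric] schwartz_ip_integrable schwartz_coord schwartz_partial_deriv f g)
  then show ?thesis unfolding ip_def radial_def by (simp add: sum_distrib_left mult_ac)
qed

text \<open>
  The eigenvalue equation paired with \<open>\<langle>x\<rangle>\<^sup>t f\<close>: weighted kinetic plus potential energy equals the
  eigenvalue times the weighted mass, up to terms of lower order from derivatives of the weight.
\<close>
lemma energy_identity:
  fixes f :: "'a::euclidean_space \<Rightarrow> complex"
  assumes f: "f \<in> H_eigenspace l"
  shows "grad_weighted t f + t / 2 * (- (real DIM('a) + t - 2) * weighted (t - 2) f + (t - 2) * weighted (t - 4) f) + weighted (t + 2) f
    = (l + 1) * weighted t f"
proof -
  note S = eigenspaceD(1)[OF f]
  let ?g = "brk t f"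
  have g: "?g \<in> schwartz" by (rule schwartz_brk[OF S])
  have "of_real l * ip f ?g = ip f (harmonic_oscillator ?g)" using eigenspace_ip[OF f g] by simp
  also have "\<dots> = cnj (ip (harmonic_oscillator ?g) f)" by (rule ip_commute)
  finally have "ip (harmonic_oscillator ?g) f = of_real l * ip ?g f"
    by (metis complex_cnj_cnj complex_cnj_complex_of_real complex_cnj_mult ip_commute)
  moreover have "ip (partial_deriv b ?g) (partial_deriv b f) = of_real (weighted t (partial_deriv b f)) +
     of_real t * ip (\<lambda>x. of_real (x \<bullet> b) * brk (t - 2) f x) (partial_deriv b f)" if b: "b \<in> Basis" for b
  proof -
    have pS: "partial_deriv b f \<in> schwartz" by (rule schwartz_partial_deriv[OF S b])
    have "partial_deriv b ?g = (\<lambda>x. brk t (partial_deriv b f) x + of_real t * (of_real (x \<bullet> b) * brk (t - 2) f x))"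
      by (rule ext) (rule partial_deriv_brk[OF S])
    then show ?thesis
      by (simp only: ip_add_left[OF schwartz_brk[OF pS] schwartz_scale[OF schwartz_coord[OF schwartz_brk[OF S]]] pS] ip_scale_left ip_brk_self)
  qed
  ultimately have "of_real l * ip ?g f = (\<Sum>b\<in>Basis. of_real (weighted t (partial_deriv b f)) +
     of_real t * ip (\<lambda>x. of_real (x \<bullet> b) * brk (t - 2) f x) (partial_deriv b f)) + ip (brk 2 ?g) f - ip ?g f"
    unfolding ip_harmonic_oscillator_gradient[OF S g] by simp
  also have "\<dots> = of_real (grad_weighted t f) + of_real t * ip (brk (t - 2) f) (radial f) + ip (brk (2 + t) f) f - ip ?g f"
    by (simp only: sum.distrib sum_distrib_left[symmetric] sum_ip_coord_radial[OF S schwartz_brk[OF S]] brk_brk grad_weighted_def of_real_sum)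
  finally have "of_real l * of_real (weighted t f) = of_real (grad_weighted t f) + of_real t * ip (brk (t - 2) f) (radial f)
     + of_real (weighted (2 + t) f) - of_real (weighted t f)"
    unfolding ip_brk_self .
  from arg_cong[OF this, of Re]
  have "l * weighted t f = grad_weighted t f + t * Re (ip (brk (t - 2) f) (radial f)) + weighted (t + 2) f - weighted t f"
    by (simp add: add.commute)
  moreover have r: "Re (ip (brk (t - 2) f) (radial f)) = Re (ip (brk (t - 2) (radial f)) f)"
  proof -
    have "ip (brk (t - 2) f) (radial f) = cnj (ip (radial f) (brk (t - 2) f))" by (rule ip_commute)
    also have "ip (radial f) (brk (t - 2) f) = ip (brk (t - 2) (radial f)) f" by (rule ip_brk_commute[symmetric])
    finally show ?thesis by simp
  qed
  moreover have "t * Re (ip (brk (t - 2) f) (radial f)) = t / 2 * (- (real DIM('a) + t - 2) * weighted (t - 2) f + (t - 2) * weighted (t - 4) f)"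
  proof -
    have "- (real DIM('a) + t - 2) * weighted (t - 2) f + (t - 2) * weighted (t - 4) f = 2 * Re (ip (brk (t - 2) (radial f)) f)"
      using Re_ip_radial[OF S, of "t - 2"] by simp
    then show ?thesis unfolding r by simp
  qed
  moreover have "(l + 1) * weighted t f = l * weighted t f + weighted t f" by (simp add: algebra_simps)
  ultimately show ?thesis by linarith
qed

text \<open>
  The eigenvalue equation paired with \<open>\<langle>x\<rangle>\<^sup>t (x \<cdot> \<nabla>) f\<close>, real parts. Dilations change kinetic and
  potential energy in opposite directions, so together with \<open>energy_identity\<close> this determines how
  weighted mass and weighted potential energy are related.
\<close>
lemma virial_identity:
  fixes f :: "'a::euclidean_space \<Rightarrow> complex"
  assumes f: "f \<in> H_eigenspace l"
  defines "d \<equiv> real DIM('a)"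
  shows "2 * t * weighted (t - 2) (radial f) + 2 * grad_weighted t f - (d + t) * grad_weighted t f + t * grad_weighted (t - 2) f
     - (d + t + 2) * weighted (t + 2) f + (t + 2) * weighted t f
     = (l + 1) * (- (d + t) * weighted t f + t * weighted (t - 2) f)"
proof -
  note S = eigenspaceD(1)[OF f]
  note R = schwartz_radial[OF S]
  let ?g = "brk t (radial f)"
  have g: "?g \<in> schwartz" by (rule schwartz_brk[OF R])
  have "of_real l * ip f ?g = ip f (harmonic_oscillator ?g)" using eigenspace_ip[OF f g] by simp
  also have "\<dots> = cnj (ip (harmonic_oscillator ?g) f)" by (rule ip_commute)
  finally have "ip (harmonic_oscillator ?g) f = of_real l * ip ?g f"
    by (metis complex_cnj_cnj complex_cnj_complex_of_real complex_cnj_mult ip_commute)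
  moreover have "ip (partial_deriv b ?g) (partial_deriv b f) = of_real (weighted t (partial_deriv b f)) + ip (brk t (radial (partial_deriv b f))) (partial_deriv b f) +
     of_real t * ip (\<lambda>x. of_real (x \<bullet> b) * brk (t - 2) (radial f) x) (partial_deriv b f)" if b: "b \<in> Basis" for b
  proof -
    have pS: "partial_deriv b f \<in> schwartz" by (rule schwartz_partial_deriv[OF S b])
    have "partial_deriv b ?g = (\<lambda>x. (brk t (partial_deriv b f) x + brk t (radial (partial_deriv b f)) x) + of_real t * (of_real (x \<bullet> b) * brk (t - 2) (radial f) x))"
      by (rule ext) (simp only: partial_deriv_brk[OF R] partial_deriv_radial[OF S b], simp only: brk_def distrib_left)
    then show ?thesis
      by (simp only: ip_add_left[OF schwartz_add[OF schwartz_brk[OF pS] schwartz_brk[OF schwartz_radial[OF pS]]] schwartz_scale[OF schwartz_coord[OF schwartz_brk[OF R]]] pS]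
         ip_add_left[OF schwartz_brk[OF pS] schwartz_brk[OF schwartz_radial[OF pS]] pS] ip_scale_left ip_brk_self)
  qed
  ultimately have "of_real l * ip ?g f = (\<Sum>b\<in>Basis. of_real (weighted t (partial_deriv b f)) + ip (brk t (radial (partial_deriv b f))) (partial_deriv b f) +
     of_real t * ip (\<lambda>x. of_real (x \<bullet> b) * brk (t - 2) (radial f) x) (partial_deriv b f)) + ip (brk 2 ?g) f - ip ?g f"
    unfolding ip_harmonic_oscillator_gradient[OF S g] by simp
  also have "\<dots> = of_real (grad_weighted t f) + (\<Sum>b\<in>Basis. ip (brk t (radial (partial_deriv b f))) (partial_deriv b f)) + of_real t * ip (brk (t - 2) (radial f)) (radial f)
       + ip (brk (2 + t) (radial f)) f - ip ?g f"
    by (simp only: sum.distrib sum_distrib_left[symmetric] sum_ip_coord_radial[OF S schwartz_brk[OF R]] brk_brk grad_weighted_def of_real_sum)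
  finally have eq: "of_real l * ip ?g f = of_real (grad_weighted t f) + (\<Sum>b\<in>Basis. ip (brk t (radial (partial_deriv b f))) (partial_deriv b f))
     + of_real t * of_real (weighted (t - 2) (radial f)) + ip (brk (2 + t) (radial f)) f - ip ?g f"
    unfolding ip_brk_self .
  have "2 * (l * Re (ip ?g f)) = 2 * grad_weighted t f + (\<Sum>b\<in>Basis. 2 * Re (ip (brk t (radial (partial_deriv b f))) (partial_deriv b f)))
     + 2 * (t * weighted (t - 2) (radial f)) + 2 * Re (ip (brk (2 + t) (radial f)) f) - 2 * Re (ip ?g f)"
    using arg_cong[OF eq, of Re] by (simp add: sum_distrib_left[symmetric])
  moreover have "(\<Sum>b\<in>Basis. 2 * Re (ip (brk t (radial (partial_deriv b f))) (partial_deriv b f))) = - (d + t) * grad_weighted t f + t * grad_weighted (t - 2) f"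
    unfolding grad_weighted_def d_def sum_distrib_left sum.distrib[symmetric]
    by (intro sum.cong refl Re_ip_radial schwartz_partial_deriv S)
  moreover have "2 * Re (ip ?g f) = - (d + t) * weighted t f + t * weighted (t - 2) f"
    using Re_ip_radial[OF S, of t] by (simp add: d_def)
  moreover have "2 * Re (ip (brk (2 + t) (radial f)) f) = - (d + t + 2) * weighted (t + 2) f + (t + 2) * weighted t f"
    using Re_ip_radial[OF S, of "2 + t"] by (simp add: d_def add_ac)
  ultimately show ?thesis by (simp add: algebra_simps)
qed

text \<open>
  Cauchy--Schwarz gives \<open>|x \<cdot> \<nabla>f| \<le> |x| |\<nabla>f| \<le> \<langle>x\<rangle> |\<nabla>f|\<close>.
\<close>
lemma weighted_radial_le:
  fixes f :: "'a::euclidean_space \<Rightarrow> complex"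
  assumes f: "f \<in> schwartz"
  shows "weighted (t - 2) (radial f) \<le> grad_weighted t f"
proof -
  have "weighted (t - 2) (radial f) \<le> (\<integral>x. (\<Sum>b\<in>Basis. japanese_bracket x powr t * (cmod (partial_deriv b f x))\<^sup>2) \<partial>lborel)"
    unfolding weighted_def
  proof (intro integral_mono weighted_integrable schwartz_radial f Bochner_Integration.integrable_sum schwartz_partial_deriv)
    fix x :: 'a
    have "cmod (radial f x) \<le> (\<Sum>b\<in>Basis. \<bar>x \<bullet> b\<bar> * cmod (partial_deriv b f x))"
      unfolding radial_def by (rule order_trans[OF norm_sum]) (simp add: norm_mult)
    then have "(cmod (radial f x))\<^sup>2 \<le> (\<Sum>b\<in>Basis. \<bar>x \<bullet> b\<bar> * cmod (partial_deriv b f x))\<^sup>2" by (rule power_mono) simp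
    also have "\<dots> \<le> (\<Sum>b\<in>Basis. \<bar>x \<bullet> b\<bar>\<^sup>2) * (\<Sum>b\<in>Basis. (cmod (partial_deriv b f x))\<^sup>2)"
      by (rule Cauchy_Schwarz_ineq_sum)
    also have "(\<Sum>b\<in>Basis. \<bar>x \<bullet> b\<bar>\<^sup>2) = (norm x)\<^sup>2"
      unfolding power2_norm_eq_inner by (subst euclidean_inner) (simp add: power2_eq_square)
    also have "\<dots> * (\<Sum>b\<in>Basis. (cmod (partial_deriv b f x))\<^sup>2) \<le> (japanese_bracket x)\<^sup>2 * (\<Sum>b\<in>Basis. (cmod (partial_deriv b f x))\<^sup>2)"
      by (intro mult_right_mono sum_nonneg) (auto simp: japanese_bracket_sq)
    finally have "japanese_bracket x powr (t - 2) * (cmod (radial f x))\<^sup>2 \<le>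
        japanese_bracket x powr (t - 2) * ((japanese_bracket x)\<^sup>2 * (\<Sum>b\<in>Basis. (cmod (partial_deriv b f x))\<^sup>2))"
      by (rule mult_left_mono) simp
    also have "\<dots> = (\<Sum>b\<in>Basis. japanese_bracket x powr t * (cmod (partial_deriv b f x))\<^sup>2)"
      using bracket_powr_2[of x "t - 2"] by (simp add: sum_distrib_left mult_ac)
    finally show "japanese_bracket x powr (t - 2) * (cmod (radial f x))\<^sup>2 \<le> (\<Sum>b\<in>Basis. japanese_bracket x powr t * (cmod (partial_deriv b f x))\<^sup>2)" .
  qed
  also have "\<dots> = grad_weighted t f"
    unfolding grad_weighted_def weighted_def by (intro Bochner_Integration.integral_sum weighted_integrable schwartz_partial_deriv f)
  finally show ?thesis .
qed

lemma weighted_2_le: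
  assumes f: "f \<in> H_eigenspace l"
  shows "weighted 2 f \<le> (l + 1) * nsq f"
proof -
  have "grad_weighted 0 f + weighted 2 f = (l + 1) * nsq f"
    using energy_identity[OF f, of 0] by (simp add: weighted_0)
  then show ?thesis using grad_weighted_nonneg[of 0 f] by linarith
qed

text \<open>
  Elimination of the gradient terms between the virial identity for \<open>t = -p\<close> and the energy
  identities for \<open>t = -p\<close> and \<open>t = -p-2\<close>. The virial identity contributes \<open>2l\<close> times the weighted mass and
  loses at most \<open>2p l\<close> times it to the radial derivative, which leaves \<open>2(1-p)l\<close>. The
  factor \<open>(d+10)\<^sup>2\<close> is a crude bound for the coefficients of all remaining terms, which carry weights
  between \<open>\<langle>x\<rangle>\<^sup>-\<^sup>p\<^sup>-\<^sup>6\<close> and \<open>\<langle>x\<rangle>\<^sup>2\<^sup>-\<^sup>p\<close>.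
\<close>
lemma eigenfunction_weighted_bound_aux:
  fixes f :: "'a::euclidean_space \<Rightarrow> complex"
  assumes f: "f \<in> H_eigenspace l" and p: "0 < p" "p < 1"
  defines "d \<equiv> real DIM('a)"
  shows "2 * (1 - p) * l * weighted (- p) f \<le> (d + 10)\<^sup>2 * weighted (2 - p) f"
proof -
  note S = eigenspaceD(1)[OF f]
  define A B1 B2 B3 W2 N N2 R where "A = weighted (- p) f" and "B1 = weighted (- p - 2) f" and "B2 = weighted (- p - 4) f"
    and "B3 = weighted (- p - 6) f" and "W2 = weighted (2 - p) f" and "N = grad_weighted (- p) f" and "N2 = grad_weighted (- p - 2) f"
    and "R = weighted (- p - 2) (radial f)"
  have d: "d \<ge> 1" using DIM_positive[where 'a='a] unfolding d_def by linarith
  have e1: "N - p / 2 * (- (d - p - 2) * B1 - (p + 2) * B2) + W2 = (l + 1) * A"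
    using energy_identity[OF f, of "- p"] by (simp add: A_def B1_def B2_def W2_def N_def d_def algebra_simps)
  have e2: "N2 - (p + 2) / 2 * (- (d - p - 4) * B2 - (p + 4) * B3) + A = (l + 1) * B1"
    using energy_identity[OF f, of "- p - 2"] by (simp add: A_def B1_def B2_def B3_def N2_def d_def field_simps)
  have v: "- 2 * p * R + 2 * N - (d - p) * N - p * N2 - (d - p + 2) * W2 + (2 - p) * A = (l + 1) * (- (d - p) * A - p * B1)"
    using virial_identity[OF f, of "- p"] by (simp add: A_def B1_def R_def N_def N2_def W2_def d_def algebra_simps)
  have R: "R \<le> N" using weighted_radial_le[OF S, of "- p"] by (simp add: R_def N_def)
  have ord: "0 \<le> B3" "B3 \<le> B2" "B2 \<le> B1" "B1 \<le> A" "A \<le> W2"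
    unfolding A_def B1_def B2_def B3_def W2_def by (auto intro!: weighted_mono S)
  define E1 E2 where "E1 = p / 2 * (- (d - p - 2) * B1 - (p + 2) * B2)" and "E2 = (p + 2) / 2 * (- (d - p - 4) * B2 - (p + 4) * B3)"
  have bd: "\<bar>c * X\<bar> \<le> K * W2" if "\<bar>c\<bar> \<le> K" "0 \<le> X" "X \<le> W2" for c K X
    unfolding abs_mult using that by (intro mult_mono) auto
  have b1: "\<bar>(d - p - 2) * B1\<bar> \<le> (d + 3) * W2" "\<bar>(p + 2) * B2\<bar> \<le> 3 * W2"
     "\<bar>(d - p - 4) * B2\<bar> \<le> (d + 5) * W2" "\<bar>(p + 4) * B3\<bar> \<le> 5 * W2"
    by (intro bd; use p d ord in linarith)+
  have pp: "\<bar>p / 2 * Y\<bar> \<le> \<bar>Y\<bar>" "\<bar>(p + 2) / 2 * Y\<bar> \<le> 2 * \<bar>Y\<bar>" for Y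
    using p mult_right_mono[of "p / 2" 1 "\<bar>Y\<bar>"] mult_right_mono[of "(p + 2) / 2" 2 "\<bar>Y\<bar>"] by (auto simp: abs_mult)
  have E1: "\<bar>E1\<bar> \<le> (d + 6) * W2"
    using pp(1)[of "- (d - p - 2) * B1 - (p + 2) * B2"] b1 unfolding E1_def by (simp add: algebra_simps)
  have "\<bar>- (d - p - 4) * B2 - (p + 4) * B3\<bar> \<le> \<bar>(d - p - 4) * B2\<bar> + \<bar>(p + 4) * B3\<bar>"
    unfolding mult_minus_left by arith
  also have "\<dots> \<le> (d + 5) * W2 + 5 * W2" by (intro add_mono b1)
  also have "\<dots> = (d + 10) * W2" by (simp add: algebra_simps)
  finally have "2 * \<bar>- (d - p - 4) * B2 - (p + 4) * B3\<bar> \<le> 2 * ((d + 10) * W2)" by simp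
  with pp(2)[of "- (d - p - 4) * B2 - (p + 4) * B3"] have "\<bar>E2\<bar> \<le> 2 * ((d + 10) * W2)"
    unfolding E2_def by (rule order_trans)
  then have E2: "\<bar>E2\<bar> \<le> 2 * (d + 10) * W2" by (simp only: mult.assoc)
  have N: "N = (l + 1) * A - W2 + E1" and N2: "N2 = (l + 1) * B1 - A + E2" using e1 e2 unfolding E1_def E2_def by linarith+
  have key: "2 * l * A = 2 * p * R + 4 * W2 + (d - 2 - p) * E1 + p * E2 - 4 * A"
    using v unfolding N N2 by (simp add: algebra_simps)
  have "2 * p * R \<le> 2 * p * N" using R p by simp
  then have "2 * l * A \<le> 2 * p * N + 4 * W2 + (d - 2 - p) * E1 + p * E2 - 4 * A" using key by linarith
  then have k2: "2 * (1 - p) * l * A \<le> (2 * p * A - 4 * A) + (4 * W2 - 2 * p * W2) + (d - 2 + p) * E1 + p * E2"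
    unfolding N by (simp add: algebra_simps)
  have "2 * p * A \<le> 4 * A" using p ord by (intro mult_right_mono) auto
  moreover have "0 \<le> 2 * p * W2" using p ord by simp
  moreover have "(d - 2 + p) * E1 \<le> (d + 1) * ((d + 6) * W2)"
  proof -
    have "(d - 2 + p) * E1 \<le> \<bar>d - 2 + p\<bar> * \<bar>E1\<bar>" by (simp add: abs_mult[symmetric])
    also have "\<dots> \<le> (d + 1) * ((d + 6) * W2)" using E1 p d by (intro mult_mono) auto
    finally show ?thesis .
  qed
  moreover have "p * E2 \<le> 1 * (2 * (d + 10) * W2)"
  proof -
    have "p * E2 \<le> p * \<bar>E2\<bar>" using p by simp
    also have "\<dots> \<le> 1 * (2 * (d + 10) * W2)" using E2 p by (intro mult_mono) auto
    finally show ?thesis .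
  qed
  ultimately have "2 * (1 - p) * l * A \<le> 4 * W2 + (d + 1) * ((d + 6) * W2) + 1 * (2 * (d + 10) * W2)"
    using k2 by linarith
  also have "\<dots> = (d\<^sup>2 + 9 * d + 30) * W2" by (simp add: power2_eq_square algebra_simps)
  also have "\<dots> \<le> (d + 10)\<^sup>2 * W2" using d ord by (intro mult_right_mono) (auto simp: power2_eq_square algebra_simps)
  finally show ?thesis by (simp add: A_def W2_def)
qed

text \<open>
  Split at \<open>\<langle>x\<rangle>\<^sup>2 = l\<close>, essentially the edge of the classically allowed region.
\<close>
lemma weighted_interpolate:
  fixes f :: "'a::euclidean_space \<Rightarrow> complex"
  assumes f: "f \<in> schwartz" and p: "0 < p" "p < 1" and l: "l \<ge> 1"
  shows "weighted (2 - p) f \<le> l powr (- p / 2) * weighted 2 f + l powr (1 - p / 2) * nsq f"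
proof -
  have le: "japanese_bracket x powr (2 - p) \<le> l powr (- p / 2) * japanese_bracket x powr 2 + l powr (1 - p / 2) * japanese_bracket x powr 0" for x :: 'a
  proof -
    let ?J = "(japanese_bracket x)\<^sup>2"
    have J: "?J > 0" by (simp add: zero_less_power)
    have half: "japanese_bracket x powr s = ?J powr (s / 2)" for s
    proof -
      have "?J = japanese_bracket x powr 2" by (rule powr_numeral[symmetric]) simp
      then show ?thesis by (simp only: powr_powr) simp
    qed
    show ?thesis
    proof (cases "?J \<le> l")
      case True
      then have "?J powr ((2 - p) / 2) \<le> l powr ((2 - p) / 2)" using p J by (intro powr_mono2) auto
      then have "japanese_bracket x powr (2 - p) \<le> l powr (1 - p / 2)" unfolding half[of "2 - p"] by (simp add: diff_divide_distrib)
      moreover have "japanese_bracket x powr 0 = 1" by simp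
      ultimately show ?thesis using powr_ge_zero[of l "- p / 2"] by (simp add: add_increasing)
    next
      case False
      then have "?J powr (- p / 2) \<le> l powr (- p / 2)" using p l by (intro powr_mono2') auto
      then have "japanese_bracket x powr (- p) * japanese_bracket x powr 2 \<le> l powr (- p / 2) * japanese_bracket x powr 2"
        unfolding half[of "- p"] by (intro mult_right_mono) auto
      moreover have "japanese_bracket x powr (2 - p) = japanese_bracket x powr (- p) * japanese_bracket x powr 2"
        by (simp only: powr_add[symmetric]) simp
      ultimately have "japanese_bracket x powr (2 - p) \<le> l powr (- p / 2) * japanese_bracket x powr 2" by (simp only:)
      moreover have "0 \<le> l powr (1 - p / 2) * japanese_bracket x powr 0" by simp
      ultimately show ?thesis by linarith
    qed
  qed
  have "weighted (2 - p) f \<le> (\<integral>x. l powr (- p / 2) * (japanese_bracket x powr 2 * (cmod (f x))\<^sup>2) + l powr (1 - p / 2) * (japanese_bracket x powr 0 * (cmod (f x))\<^sup>2) \<partial>lborel)"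
    unfolding weighted_def
  proof (rule integral_mono)
    fix x :: 'a
    show "japanese_bracket x powr (2 - p) * (cmod (f x))\<^sup>2 \<le> l powr (- p / 2) * (japanese_bracket x powr 2 * (cmod (f x))\<^sup>2) + l powr (1 - p / 2) * (japanese_bracket x powr 0 * (cmod (f x))\<^sup>2)"
      using mult_right_mono[OF le[of x], of "(cmod (f x))\<^sup>2"] by (simp only: distrib_right mult.assoc zero_le_power2)
  qed (intro weighted_integrable f Bochner_Integration.integrable_add integrable_mult_right)+
  also have "\<dots> = l powr (- p / 2) * weighted 2 f + l powr (1 - p / 2) * weighted 0 f"
    unfolding weighted_def using weighted_integrable[OF f, of 2] weighted_integrable[OF f, of 0] by simp
  finally show ?thesis by (simp only: weighted_0)
qed

text \<open>
  The virial estimate trades a factor \<open>l\<close> for two powers of \<open>\<langle>x\<rangle>\<close>. Interpolating the resulting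
  \<open>\<langle>x\<rangle>\<^sup>2\<^sup>-\<^sup>p\<close> between mass and second moment, which is at most \<open>(l+1)\<close> times the mass, costs only
  \<open>l\<^sup>1\<^sup>-\<^sup>p\<^sup>/\<^sup>2\<close>. Dividing by \<open>l\<close> leaves the gain \<open>l\<^sup>-\<^sup>p\<^sup>/\<^sup>2\<close>.
\<close>
lemma eigen_weighted_bound:
  assumes p: "0 < p" "p < 1"
  shows "\<exists>C>0. \<forall>n. \<forall>f\<in>(eigen n :: ('a::euclidean_space \<Rightarrow> complex) set). weighted (- p) f \<le> C * level TYPE('a) n powr (- p / 2) * nsq f"
proof (intro exI[of _ "(real DIM('a) + 10)\<^sup>2 * 3 / (2 * (1 - p))"] conjI allI ballI)
  show "0 < (real DIM('a) + 10)\<^sup>2 * 3 / (2 * (1 - p))" using p by (simp add: add_nonneg_pos)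
  fix n and f :: "'a \<Rightarrow> complex" assume fe: "f \<in> eigen n"
  define l where "l = level TYPE('a) n"
  have f: "f \<in> H_eigenspace l" using fe by (simp add: eigen_def l_def)
  note S = eigenspaceD(1)[OF f]
  have l: "l \<ge> 1" "l > 0" unfolding l_def by (rule level_pos)+
  define D q L where "D = (real DIM('a) + 10)\<^sup>2" and "q = 1 - p" and "L = l powr (- p / 2)"
  have q: "q > 0" using p by (simp add: q_def)
  have lL: "l powr (1 - p / 2) = l * L" using powr_add[of l 1 "- p / 2"] l by (simp add: L_def)
  have "weighted 2 f \<le> (l + 1) * nsq f" by (rule weighted_2_le[OF f])
  also have "\<dots> \<le> (2 * l) * nsq f" using l by (intro mult_right_mono) auto
  finally have "L * weighted 2 f \<le> L * ((2 * l) * nsq f)" unfolding L_def by (intro mult_left_mono) auto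
  also have "\<dots> = 2 * (l * L * nsq f)" by simp
  finally have "weighted (2 - p) f \<le> 3 * (l * L * nsq f)"
    using weighted_interpolate[OF S p l(1)] unfolding lL L_def[symmetric] by linarith
  then have "D * weighted (2 - p) f \<le> D * (3 * (l * L * nsq f))"
    by (intro mult_left_mono) (auto simp: D_def)
  with eigenfunction_weighted_bound_aux[OF f p]
  have "2 * q * l * weighted (- p) f \<le> D * (3 * (l * L * nsq f))" unfolding D_def q_def by linarith
  also have "\<dots> = (2 * q * l) * (D * 3 / (2 * q) * L * nsq f)" using q by (simp add: field_simps)
  finally have "weighted (- p) f \<le> D * 3 / (2 * q) * L * nsq f"
    using q l by (subst (asm) mult_le_cancel_left_pos) auto
  then show "weighted (- p) f \<le> (real DIM('a) + 10)\<^sup>2 * 3 / (2 * (1 - p)) * level TYPE('a) n powr (- p / 2) * nsq f"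
    unfolding D_def q_def L_def l_def[symmetric] .
qed

section \<open>Convolutions in weighted spaces\<close>

text \<open>
  The square of a weighted \<open>L\<^sup>2\<close> norm, with values in the extended reals so that estimates can be
  chained before finiteness is known.
\<close>
definition wnorm2 :: "('a::euclidean_space \<Rightarrow> real) \<Rightarrow> ('a \<Rightarrow> complex) \<Rightarrow> ennreal" where
  "wnorm2 \<omega> g = (\<integral>\<^sup>+x. ennreal (\<omega> x * (cmod (g x))\<^sup>2) \<partial>lborel)"

text \<open>
  Peetre's inequality, uniformly for dilations by \<open>r \<in> [0, 2]\<close>.
\<close>
lemma bracket_peetre:
  fixes x z :: "'a::euclidean_space"
  assumes r: "0 \<le> r" "r \<le> 2"
  shows "japanese_bracket (x - r *\<^sub>R z) \<le> 3 * japanese_bracket x * japanese_bracket z"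
proof (rule power2_le_imp_le)
  have "norm (x - r *\<^sub>R z) \<le> norm x + norm (r *\<^sub>R z)" by (rule norm_triangle_ineq4)
  also have "\<dots> \<le> norm x + 2 * norm z" using r by (auto intro!: mult_right_mono)
  finally have "(norm (x - r *\<^sub>R z))\<^sup>2 \<le> (norm x + 2 * norm z)\<^sup>2" by (rule power_mono) simp
  also have "\<dots> \<le> 2 * (norm x)\<^sup>2 + 8 * (norm z)\<^sup>2"
    using sum_squares_bound[of "norm x" "2 * norm z"] by (simp add: power2_sum power_mult_distrib)
  finally have n1: "(norm (x - r *\<^sub>R z))\<^sup>2 \<le> 2 * (norm x)\<^sup>2 + 8 * (norm z)\<^sup>2" .
  have "1 + (norm (x - r *\<^sub>R z))\<^sup>2 \<le> 9 * (1 + (norm x)\<^sup>2) * (1 + (norm z)\<^sup>2)"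
  proof -
    have "9 * (1 + (norm x)\<^sup>2) * (1 + (norm z)\<^sup>2) = 9 + 9 * (norm x)\<^sup>2 + 9 * (norm z)\<^sup>2 + 9 * ((norm x)\<^sup>2 * (norm z)\<^sup>2)"
      by (simp add: algebra_simps)
    moreover have "0 \<le> (norm x)\<^sup>2 * (norm z)\<^sup>2" "0 \<le> (norm x)\<^sup>2" "0 \<le> (norm z)\<^sup>2" by simp_all
    ultimately show ?thesis using n1 by linarith
  qed
  then show "(japanese_bracket (x - r *\<^sub>R z))\<^sup>2 \<le> (3 * japanese_bracket x * japanese_bracket z)\<^sup>2"
    by (simp add: japanese_bracket_sq power_mult_distrib)
qed simp

lemma bracket_powr_shift:
  fixes x z :: "'a::euclidean_space"
  assumes r: "0 \<le> r" "r \<le> 2" and p: "0 \<le> p" "p \<le> 1"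
  shows "japanese_bracket x powr (- p) \<le> (3 * japanese_bracket z) * japanese_bracket (x - r *\<^sub>R z) powr (- p)"
proof -
  let ?y = "x - r *\<^sub>R z"
  have "japanese_bracket ?y powr p \<le> (3 * japanese_bracket x * japanese_bracket z) powr p"
    using p by (intro powr_mono2 bracket_peetre r) auto
  also have "\<dots> = japanese_bracket x powr p * (3 * japanese_bracket z) powr p"
    by (simp add: powr_mult[symmetric] mult_ac)
  also have "\<dots> \<le> japanese_bracket x powr p * (3 * japanese_bracket z) powr 1"
    using p japanese_bracket_ge_1[of z] by (intro mult_left_mono powr_mono) auto
  finally have "japanese_bracket ?y powr p \<le> japanese_bracket x powr p * (3 * japanese_bracket z)"
    by (simp add: less_imp_le)
  then have "japanese_bracket ?y powr p * (japanese_bracket x powr (- p) * japanese_bracket ?y powr (- p)) \<le>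
    (japanese_bracket x powr p * (3 * japanese_bracket z)) * (japanese_bracket x powr (- p) * japanese_bracket ?y powr (- p))"
    by (intro mult_right_mono) auto
  moreover have "japanese_bracket ?y powr p * japanese_bracket ?y powr (- p) = 1" "japanese_bracket x powr p * japanese_bracket x powr (- p) = 1"
    by (simp_all add: powr_add[symmetric])
  moreover have "japanese_bracket ?y powr p * (japanese_bracket x powr (- p) * japanese_bracket ?y powr (- p)) =
      japanese_bracket x powr (- p) * (japanese_bracket ?y powr p * japanese_bracket ?y powr (- p))"
    "(japanese_bracket x powr p * (3 * japanese_bracket z)) * (japanese_bracket x powr (- p) * japanese_bracket ?y powr (- p)) =
      (3 * japanese_bracket z) * japanese_bracket ?y powr (- p) * (japanese_bracket x powr p * japanese_bracket x powr (- p))"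
    by (simp_all only: mult_ac)
  ultimately show ?thesis by (simp only: mult_1_right)
qed

text \<open>
  Cauchy--Schwarz with respect to the measure with density \<open>k\<close>.
\<close>
lemma ennreal_Cauchy_Schwarz_weight:
  assumes [measurable]: "k \<in> borel_measurable M" "f \<in> borel_measurable M" and k: "\<And>x. 0 \<le> k x" and f: "\<And>x. 0 \<le> f x"
  shows "(\<integral>\<^sup>+x. ennreal (k x * f x) \<partial>M)\<^sup>2 \<le> (\<integral>\<^sup>+x. ennreal (k x) \<partial>M) * (\<integral>\<^sup>+x. ennreal (k x * (f x)\<^sup>2) \<partial>M)"
proof -
  have "(\<integral>\<^sup>+x. ennreal (sqrt (k x)) * ennreal (sqrt (k x) * f x) \<partial>M)\<^sup>2 \<le> (\<integral>\<^sup>+x. (ennreal (sqrt (k x)))^2 \<partial>M) * (\<integral>\<^sup>+x. (ennreal (sqrt (k x) * f x))^2 \<partial>M)"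
    by (rule Cauchy_Schwarz_nn_integral) measurable
  also have "(\<lambda>x. ennreal (sqrt (k x)) * ennreal (sqrt (k x) * f x)) = (\<lambda>x. ennreal (k x * f x))"
    using k f by (simp add: ennreal_mult[symmetric] mult.assoc[symmetric])
  also have "(\<lambda>x. (ennreal (sqrt (k x)))^2) = (\<lambda>x. ennreal (k x))" using k by (simp add: ennreal_power)
  also have "(\<lambda>x. (ennreal (sqrt (k x) * f x))^2) = (\<lambda>x. ennreal (k x * (f x)\<^sup>2))"
    using k f by (simp add: ennreal_power power_mult_distrib)
  finally show ?thesis .
qed

text \<open>
  A form of Young's inequality: Cauchy--Schwarz with respect to \<open>|K(z)| dz\<close>, then Fubini and
  translation invariance. The assumption \<open>shift\<close> moves the weight to the translated point at the price
  of \<open>\<kappa>(z)\<close>, which the kernel absorbs.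
\<close>
lemma weighted_convolution:
  fixes K f :: "'a::euclidean_space \<Rightarrow> complex"
  assumes [measurable]: "K \<in> borel_measurable borel" "f \<in> borel_measurable borel" "\<omega> \<in> borel_measurable borel" "\<kappa> \<in> borel_measurable borel"
    and \<omega>: "\<And>x. 0 \<le> \<omega> x" and \<kappa>: "\<And>z. 0 \<le> \<kappa> z"
    and shift: "\<And>x z. \<omega> x \<le> \<kappa> z * \<omega> (x - r *\<^sub>R z)"
    and i: "\<And>x. integrable lborel (\<lambda>z. K z * f (x - r *\<^sub>R z))"
  shows "wnorm2 \<omega> (\<lambda>x. \<integral>z. K z * f (x - r *\<^sub>R z) \<partial>lborel) \<le>
    (\<integral>\<^sup>+z. ennreal (cmod (K z)) \<partial>lborel) * (\<integral>\<^sup>+z. ennreal (cmod (K z) * \<kappa> z) \<partial>lborel) * wnorm2 \<omega> f"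
proof -
  let ?A = "\<integral>\<^sup>+z. ennreal (cmod (K z)) \<partial>lborel"
  have pt: "ennreal (\<omega> x * (cmod (\<integral>z. K z * f (x - r *\<^sub>R z) \<partial>lborel))\<^sup>2) \<le>
     ?A * (\<integral>\<^sup>+z. ennreal ((cmod (K z) * \<kappa> z) * (\<omega> (x - r *\<^sub>R z) * (cmod (f (x - r *\<^sub>R z)))\<^sup>2)) \<partial>lborel)" for x
  proof -
    have "ennreal (cmod (\<integral>z. K z * f (x - r *\<^sub>R z) \<partial>lborel)) \<le> (\<integral>\<^sup>+z. ennreal (cmod (K z) * cmod (f (x - r *\<^sub>R z))) \<partial>lborel)"
      using integral_norm_bound_ennreal[OF i[of x]] by (simp add: norm_mult)
    then have "(ennreal (cmod (\<integral>z. K z * f (x - r *\<^sub>R z) \<partial>lborel)))\<^sup>2 \<le> (\<integral>\<^sup>+z. ennreal (cmod (K z) * cmod (f (x - r *\<^sub>R z))) \<partial>lborel)\<^sup>2"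
      by (rule power_mono) simp
    also have "\<dots> \<le> ?A * (\<integral>\<^sup>+z. ennreal (cmod (K z) * (cmod (f (x - r *\<^sub>R z)))\<^sup>2) \<partial>lborel)"
      by (rule ennreal_Cauchy_Schwarz_weight) auto
    finally have "ennreal ((cmod (\<integral>z. K z * f (x - r *\<^sub>R z) \<partial>lborel))\<^sup>2) \<le> ?A * (\<integral>\<^sup>+z. ennreal (cmod (K z) * (cmod (f (x - r *\<^sub>R z)))\<^sup>2) \<partial>lborel)"
      by (simp add: ennreal_power)
    then have "ennreal (\<omega> x) * ennreal ((cmod (\<integral>z. K z * f (x - r *\<^sub>R z) \<partial>lborel))\<^sup>2) \<le> ennreal (\<omega> x) * (?A * (\<integral>\<^sup>+z. ennreal (cmod (K z) * (cmod (f (x - r *\<^sub>R z)))\<^sup>2) \<partial>lborel))"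
      by (rule mult_left_mono) simp
    also have "\<dots> = ?A * (\<integral>\<^sup>+z. ennreal (\<omega> x) * ennreal (cmod (K z) * (cmod (f (x - r *\<^sub>R z)))\<^sup>2) \<partial>lborel)"
      by (subst nn_integral_cmult) (auto simp: mult_ac)
    also have "\<dots> \<le> ?A * (\<integral>\<^sup>+z. ennreal ((cmod (K z) * \<kappa> z) * (\<omega> (x - r *\<^sub>R z) * (cmod (f (x - r *\<^sub>R z)))\<^sup>2)) \<partial>lborel)"
    proof (intro mult_left_mono nn_integral_mono)
      fix z
      have "\<omega> x * (cmod (K z) * (cmod (f (x - r *\<^sub>R z)))\<^sup>2) \<le> \<kappa> z * \<omega> (x - r *\<^sub>R z) * (cmod (K z) * (cmod (f (x - r *\<^sub>R z)))\<^sup>2)"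
        by (intro mult_right_mono shift) auto
      then show "ennreal (\<omega> x) * ennreal (cmod (K z) * (cmod (f (x - r *\<^sub>R z)))\<^sup>2) \<le> ennreal ((cmod (K z) * \<kappa> z) * (\<omega> (x - r *\<^sub>R z) * (cmod (f (x - r *\<^sub>R z)))\<^sup>2))"
        using \<omega> by (simp add: ennreal_mult[symmetric] mult_ac ennreal_leI)
    qed simp
    finally show ?thesis using \<omega> by (simp add: ennreal_mult)
  qed
  have "wnorm2 \<omega> (\<lambda>x. \<integral>z. K z * f (x - r *\<^sub>R z) \<partial>lborel) \<le>
    (\<integral>\<^sup>+x. ?A * (\<integral>\<^sup>+z. ennreal ((cmod (K z) * \<kappa> z) * (\<omega> (x - r *\<^sub>R z) * (cmod (f (x - r *\<^sub>R z)))\<^sup>2)) \<partial>lborel) \<partial>lborel)"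
    unfolding wnorm2_def by (intro nn_integral_mono pt)
  also have "\<dots> = ?A * (\<integral>\<^sup>+x. (\<integral>\<^sup>+z. ennreal ((cmod (K z) * \<kappa> z) * (\<omega> (x - r *\<^sub>R z) * (cmod (f (x - r *\<^sub>R z)))\<^sup>2)) \<partial>lborel) \<partial>lborel)"
    by (rule nn_integral_cmult) measurable
  also have "(\<integral>\<^sup>+x. (\<integral>\<^sup>+z. ennreal ((cmod (K z) * \<kappa> z) * (\<omega> (x - r *\<^sub>R z) * (cmod (f (x - r *\<^sub>R z)))\<^sup>2)) \<partial>lborel) \<partial>lborel) =
     (\<integral>\<^sup>+z. (\<integral>\<^sup>+x. ennreal ((cmod (K z) * \<kappa> z) * (\<omega> (x - r *\<^sub>R z) * (cmod (f (x - r *\<^sub>R z)))\<^sup>2)) \<partial>lborel) \<partial>lborel)"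
    by (rule lborel_pair.Fubini') measurable
  also have "\<dots> = (\<integral>\<^sup>+z. ennreal (cmod (K z) * \<kappa> z) * wnorm2 \<omega> f \<partial>lborel)"
  proof (rule nn_integral_cong)
    fix z
    have "(\<integral>\<^sup>+x. ennreal ((cmod (K z) * \<kappa> z) * (\<omega> (x - r *\<^sub>R z) * (cmod (f (x - r *\<^sub>R z)))\<^sup>2)) \<partial>lborel) =
      (\<integral>\<^sup>+x. ennreal (cmod (K z) * \<kappa> z) * ennreal (\<omega> (x - r *\<^sub>R z) * (cmod (f (x - r *\<^sub>R z)))\<^sup>2) \<partial>lborel)"
      using \<kappa> \<omega> by (simp add: ennreal_mult)
    also have "\<dots> = ennreal (cmod (K z) * \<kappa> z) * (\<integral>\<^sup>+x. ennreal (\<omega> (x - r *\<^sub>R z) * (cmod (f (x - r *\<^sub>R z)))\<^sup>2) \<partial>lborel)"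
      by (rule nn_integral_cmult) measurable
    also have "(\<integral>\<^sup>+x. ennreal (\<omega> (x - r *\<^sub>R z) * (cmod (f (x - r *\<^sub>R z)))\<^sup>2) \<partial>lborel) = wnorm2 \<omega> f"
      unfolding wnorm2_def
      using lborel_nn_integral_translate[of "\<lambda>x. ennreal (\<omega> x * (cmod (f x))\<^sup>2)" "- r *\<^sub>R z"] by simp
    finally show "(\<integral>\<^sup>+x. ennreal ((cmod (K z) * \<kappa> z) * (\<omega> (x - r *\<^sub>R z) * (cmod (f (x - r *\<^sub>R z)))\<^sup>2)) \<partial>lborel) = ennreal (cmod (K z) * \<kappa> z) * wnorm2 \<omega> f" .
  qed
  also have "\<dots> = (\<integral>\<^sup>+z. ennreal (cmod (K z) * \<kappa> z) \<partial>lborel) * wnorm2 \<omega> f"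
    by (rule nn_integral_multc) measurable
  finally show ?thesis by (simp add: mult.assoc)
qed

section \<open>Dilated Fourier multipliers on eigenfunctions\<close>

lemma FT_multiplier_convolution:
  fixes K f :: "'a::euclidean_space \<Rightarrow> complex"
  assumes K: "K \<in> schwartz" and f: "f \<in> schwartz"
  shows "FT (\<lambda>\<xi>. FT K (- (r *\<^sub>R \<xi>)) * f \<xi>) x = (\<integral>z. K z * FT f (x - r *\<^sub>R z) \<partial>lborel)"
proof -
  note [measurable] = schwartz_measurable[OF K] schwartz_measurable[OF f]
  have "FT (\<lambda>\<xi>. FT K (- (r *\<^sub>R \<xi>)) * f \<xi>) x =
     (\<integral>\<xi>. \<integral>z. exp (\<i> * of_real (\<xi> \<bullet> x)) * (exp (\<i> * of_real (z \<bullet> (- (r *\<^sub>R \<xi>)))) * K z * f \<xi>) \<partial>lborel \<partial>lborel)"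
    unfolding FT_def by simp
  also have "\<dots> = (\<integral>z. \<integral>\<xi>. exp (\<i> * of_real (\<xi> \<bullet> x)) * (exp (\<i> * of_real (z \<bullet> (- (r *\<^sub>R \<xi>)))) * K z * f \<xi>) \<partial>lborel \<partial>lborel)"
    by (rule Fubini_bound[OF schwartz_integrable[OF f] schwartz_integrable[OF K]]) (auto simp: norm_mult)
  also have "\<dots> = (\<integral>z. K z * FT f (x - r *\<^sub>R z) \<partial>lborel)"
  proof (intro Bochner_Integration.integral_cong refl)
    fix z
    have "exp (\<i> * of_real (\<xi> \<bullet> x)) * (exp (\<i> * of_real (z \<bullet> (- (r *\<^sub>R \<xi>)))) * K z * f \<xi>) = K z * (exp (\<i> * of_real (\<xi> \<bullet> (x - r *\<^sub>R z))) * f \<xi>)" (is "?L \<xi> = ?R \<xi>") for \<xi>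
    proof -
      have "exp (\<i> * of_real (\<xi> \<bullet> (x - r *\<^sub>R z))) = exp (\<i> * of_real (\<xi> \<bullet> x)) * exp (\<i> * of_real (z \<bullet> (- (r *\<^sub>R \<xi>))))"
        by (simp add: exp_add[symmetric] inner_simps inner_commute algebra_simps)
      then show ?thesis by (simp add: mult_ac)
    qed
    then show "(\<integral>\<xi>. exp (\<i> * of_real (\<xi> \<bullet> x)) * (exp (\<i> * of_real (z \<bullet> (- (r *\<^sub>R \<xi>)))) * K z * f \<xi>) \<partial>lborel) = K z * FT f (x - r *\<^sub>R z)"
      unfolding FT_def by (subst integral_mult_right_zero[symmetric]) (simp only:)
  qed
  finally show ?thesis .
qed

text \<open>
  By \<open>FT_eigen\<close> the multiplier \<open>FT K (-r\<xi>)\<close> acts on an eigenfunction as convolution with the kernel \<open>K\<close>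
  dilated by \<open>r\<close>. The constant depends on \<open>K\<close> only. The weight is compatible with the dilation for
  bounded \<open>r\<close>; in the unweighted norm every \<open>r\<close> is allowed.
\<close>
lemma multiplier_bound:
  fixes K :: "'a::euclidean_space \<Rightarrow> complex"
  assumes K: "K \<in> schwartz"
  shows "\<exists>C>0. \<forall>n. \<forall>f\<in>eigen n. \<forall>r. (0 \<le> r \<longrightarrow> r \<le> 2 \<longrightarrow> (\<forall>p. 0 \<le> p \<longrightarrow> p \<le> 1 \<longrightarrow>
       wnorm2 (\<lambda>x. japanese_bracket x powr (- p)) (FT (\<lambda>\<xi>. FT K (- (r *\<^sub>R \<xi>)) * f \<xi>)) \<le> ennreal (C * weighted (- p) f))) \<and>
     wnorm2 (\<lambda>x. 1) (FT (\<lambda>\<xi>. FT K (- (r *\<^sub>R \<xi>)) * f \<xi>)) \<le> ennreal (C * nsq f)"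
proof -
  note mK [measurable] = schwartz_measurable[OF K]
  let ?m = "gaussian_mass TYPE('a)"
  define A B where "A = (\<integral>z. cmod (K z) \<partial>lborel)" and "B = (\<integral>z. cmod (K z) * (3 * japanese_bracket z) \<partial>lborel)"
  have iA: "integrable lborel (\<lambda>z. cmod (K z))" by (intro integrable_norm schwartz_integrable K)
  have iB: "integrable lborel (\<lambda>z. cmod (K z) * (3 * japanese_bracket z))"
  proof -
    have "integrable lborel (\<lambda>z. 3 * cmod (brk 1 K z))" by (intro integrable_mult_right integrable_norm schwartz_integrable schwartz_brk K)
    then show ?thesis by (simp add: brk_def norm_mult mult_ac)
  qed
  have A: "(\<integral>\<^sup>+z. ennreal (cmod (K z)) \<partial>lborel) = ennreal A" unfolding A_def by (intro nn_integral_eq_integral iA) simp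
  have B: "(\<integral>\<^sup>+z. ennreal (cmod (K z) * (3 * japanese_bracket z)) \<partial>lborel) = ennreal B" unfolding B_def by (intro nn_integral_eq_integral iB) simp
  have A0: "A \<ge> 0" and B0: "B \<ge> 0" unfolding A_def B_def by (auto intro!: Bochner_Integration.integral_nonneg)
  define C where "C = (A * B + A * A) * ?m\<^sup>2 + 1"
  have "0 \<le> A * B * ?m\<^sup>2" "0 \<le> A * A * ?m\<^sup>2" using A0 B0 by simp_all
  then have C: "C > 0" "A * B * ?m\<^sup>2 \<le> C" "A * A * ?m\<^sup>2 \<le> C"
    unfolding C_def distrib_right by linarith+
  have main: "wnorm2 \<omega> (FT (\<lambda>\<xi>. FT K (- (r *\<^sub>R \<xi>)) * f \<xi>)) \<le> (\<integral>\<^sup>+z. ennreal (cmod (K z)) \<partial>lborel) * (\<integral>\<^sup>+z. ennreal (cmod (K z) * \<kappa> z) \<partial>lborel) * (ennreal (?m\<^sup>2) * wnorm2 \<omega> f)"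
    if f: "f \<in> eigen n" and [measurable]: "\<omega> \<in> borel_measurable borel" "\<kappa> \<in> borel_measurable borel" and \<omega>: "\<And>x. 0 \<le> \<omega> x" and \<kappa>: "\<And>z. 0 \<le> \<kappa> z"
      and shift: "\<And>x z. \<omega> x \<le> \<kappa> z * \<omega> (x - r *\<^sub>R z)" for n f r \<omega> \<kappa>
  proof -
    note S = eigen_schwartz[OF f]
    note [measurable] = schwartz_measurable[OF S]
    let ?F = "\<lambda>v. of_real ?m * \<i> ^ n * f v"
    have Fm [measurable]: "?F \<in> borel_measurable borel" by measurable
    have i: "integrable lborel (\<lambda>z. K z * ?F (x - r *\<^sub>R z))" for x
    proof -
      obtain D where D: "\<And>x. (1 + norm x) ^ 0 * cmod (f x) \<le> D" using rapidly_decreasingD[OF schwartz_rapid[OF S]] by metis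
      have "norm (K z * ?F (x - r *\<^sub>R z)) \<le> norm (of_real (?m * D) * K z)" for z
      proof -
        have "cmod (f (x - r *\<^sub>R z)) \<le> \<bar>D\<bar>" using D[of "x - r *\<^sub>R z"] by simp
        then have "cmod (K z) * (\<bar>?m\<bar> * cmod (f (x - r *\<^sub>R z))) \<le> cmod (K z) * (\<bar>?m\<bar> * \<bar>D\<bar>)" by (intro mult_left_mono) auto
        then show ?thesis by (simp add: norm_mult norm_power abs_mult mult_ac)
      qed
      then have ae: "AE z in lborel. norm (K z * ?F (x - r *\<^sub>R z)) \<le> norm (of_real (?m * D) * K z)" by (rule AE_I2)
      have "(\<lambda>z. K z * ?F (x - r *\<^sub>R z)) \<in> borel_measurable lborel" by measurable
      from Bochner_Integration.integrable_bound[OF integrable_mult_right[OF schwartz_integrable[OF K]] this ae]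
      show ?thesis .
    qed
    have eq: "FT (\<lambda>\<xi>. FT K (- (r *\<^sub>R \<xi>)) * f \<xi>) = (\<lambda>x. \<integral>z. K z * ?F (x - r *\<^sub>R z) \<partial>lborel)"
      by (rule ext) (simp only: FT_multiplier_convolution[OF K S] FT_eigen[OF f])
    have "wnorm2 \<omega> (FT (\<lambda>\<xi>. FT K (- (r *\<^sub>R \<xi>)) * f \<xi>)) \<le> (\<integral>\<^sup>+z. ennreal (cmod (K z)) \<partial>lborel) * (\<integral>\<^sup>+z. ennreal (cmod (K z) * \<kappa> z) \<partial>lborel) * wnorm2 \<omega> ?F"
      unfolding eq by (rule weighted_convolution[OF mK Fm that(2,3) \<omega> \<kappa> shift i])
    also have "wnorm2 \<omega> ?F = ennreal (?m\<^sup>2) * wnorm2 \<omega> f"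
      unfolding wnorm2_def using \<omega>
      by (subst nn_integral_cmult[symmetric]) (auto simp: norm_mult norm_power power_mult_distrib ennreal_mult[symmetric] mult_ac intro!: nn_integral_cong)
    finally show ?thesis .
  qed
  have wn: "wnorm2 (\<lambda>x. japanese_bracket x powr t) f = ennreal (weighted t f)" if "f \<in> schwartz" for t and f :: "'a \<Rightarrow> complex"
    unfolding wnorm2_def weighted_def by (intro nn_integral_eq_integral weighted_integrable that) simp
  have mb [measurable]: "japanese_bracket \<in> borel_measurable (borel :: 'a measure)"
    unfolding japanese_bracket_def[abs_def] by measurable
  show ?thesis
  proof (intro exI[of _ C] conjI C allI ballI impI)
    fix r p :: real and n :: nat and f :: "'a \<Rightarrow> complex"
    assume f: "f \<in> eigen n" and r: "0 \<le> r" "r \<le> 2" and p: "0 \<le> p" "p \<le> 1"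
    have "wnorm2 (\<lambda>x. japanese_bracket x powr (- p)) (FT (\<lambda>\<xi>. FT K (- (r *\<^sub>R \<xi>)) * f \<xi>)) \<le> ennreal A * ennreal B * (ennreal (?m\<^sup>2) * ennreal (weighted (- p) f))"
      using main[OF f _ _ _ _ bracket_powr_shift[OF r p]] by (simp add: A B wn eigen_schwartz[OF f])
    also have "\<dots> = ennreal ((A * B * ?m\<^sup>2) * weighted (- p) f)" using A0 B0 by (simp add: ennreal_mult[symmetric] mult.assoc)
    also have "\<dots> \<le> ennreal (C * weighted (- p) f)" by (intro ennreal_leI mult_right_mono C) simp
    finally show "wnorm2 (\<lambda>x. japanese_bracket x powr (- p)) (FT (\<lambda>\<xi>. FT K (- (r *\<^sub>R \<xi>)) * f \<xi>)) \<le> ennreal (C * weighted (- p) f)" .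
  next
    fix r :: real and n :: nat and f :: "'a \<Rightarrow> complex"
    assume f: "f \<in> eigen n"
    have "wnorm2 (\<lambda>x. 1) (FT (\<lambda>\<xi>. FT K (- (r *\<^sub>R \<xi>)) * f \<xi>)) \<le> ennreal A * ennreal A * (ennreal (?m\<^sup>2) * wnorm2 (\<lambda>x. 1) f)"
      using main[OF f, of "\<lambda>x. 1" "\<lambda>x. 1" r] by (simp add: A)
    also have "wnorm2 (\<lambda>x. 1) f = ennreal (nsq f)"
      unfolding wnorm2_def nsq_def using nn_integral_eq_integral[OF schwartz_sq_integrable[OF eigen_schwartz[OF f]]] by simp
    also have "ennreal A * ennreal A * (ennreal (?m\<^sup>2) * ennreal (nsq f)) = ennreal ((A * A * ?m\<^sup>2) * nsq f)" using A0 by (simp add: ennreal_mult[symmetric] mult.assoc)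
    also have "\<dots> \<le> ennreal (C * nsq f)" by (intro ennreal_leI mult_right_mono C) simp
    finally show "wnorm2 (\<lambda>x. 1) (FT (\<lambda>\<xi>. FT K (- (r *\<^sub>R \<xi>)) * f \<xi>)) \<le> ennreal (C * nsq f)" .
  qed
qed

section \<open>Moments of eigenfunctions as sums of eigenfunctions\<close>

text \<open>
  \<open>eigen_sum c u B h\<close>: a decomposition of \<open>h\<close> into eigenfunctions with eigenvalues in \<open>[c, u]\<close> whose norms
  add up to at most \<open>B\<close>. This keeps track of what multiplication by polynomials does to a
  frequency-localised function, with explicit constants.
\<close>
inductive eigen_sum :: "real \<Rightarrow> real \<Rightarrow> real \<Rightarrow> ('a::euclidean_space \<Rightarrow> complex) \<Rightarrow> bool" where
  single: "g \<in> eigen m \<Longrightarrow> c \<le> level TYPE('a) m \<Longrightarrow> level TYPE('a) m \<le> u \<Longrightarrow> 0 < B \<Longrightarrow> sqrt (nsq g) \<le> B \<Longrightarrow> eigen_sum c u B (g :: 'a \<Rightarrow> complex)"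
| add: "eigen_sum c u B1 g \<Longrightarrow> eigen_sum c u B2 h \<Longrightarrow> eigen_sum c u (B1 + B2) (\<lambda>x. g x + h x)"

lemma eigen_sum_pos: "eigen_sum c u B h \<Longrightarrow> 0 < B"
  by (induction rule: eigen_sum.induct) auto

lemma eigen_sum_schwartz: "eigen_sum c u B h \<Longrightarrow> h \<in> schwartz"
  by (induction rule: eigen_sum.induct) (auto simp: eigen_schwartz schwartz_add)

lemma eigen_sum_upper: "eigen_sum c u B (h :: 'a::euclidean_space \<Rightarrow> complex) \<Longrightarrow> 1 \<le> u"
proof (induction rule: eigen_sum.induct)
  case (single g m c u B)
  then show ?case using level_pos(1)[where 'a='a, of m] by linarith
qed

lemma eigen_sum_mono:
  assumes "eigen_sum c u B h" "B \<le> B'"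
  shows "eigen_sum c u B' h"
  using assms
proof (induction arbitrary: B' rule: eigen_sum.induct)
  case (single g m c u B)
  then show ?case by (intro eigen_sum.single[of g m]) auto
next
  case (add c u B1 g B2 h)
  have "eigen_sum c u (B' - B2) g" using add by simp
  from eigen_sum.add[OF this add.hyps(2)] show ?case by simp
qed

lemma nsq_scale: "nsq (\<lambda>x. c * f x) = (cmod c)\<^sup>2 * nsq f"
  using l2sq_scale[of lborel c f] by (simp add: l2sq_lborel)

text \<open>
  The coordinate \<open>x\<^sub>b\<close> is half the sum of creation and annihilation operator. Both shift the level by
  \<open>2\<close>, which the factors \<open>3\<close> absorb since levels are at least \<open>1\<close>, and both have norm at most
  \<open>\<surd>(3u)\<close> on the eigenspaces that occur, hence at most \<open>\<surd>u\<close> after halving.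
\<close>
lemma eigen_sum_coord:
  fixes h :: "'a::euclidean_space \<Rightarrow> complex"
  assumes "eigen_sum c u B h" and b: "b \<in> Basis"
  shows "eigen_sum (c / 3) (3 * u) (2 * sqrt u * B) (\<lambda>x. of_real (x \<bullet> b) * h x)"
  using assms(1)
proof (induction rule: eigen_sum.induct)
  case (single g m c u B)
  let ?l = "level TYPE('a) m"
  note S = eigen_schwartz[OF single(1)]
  have l: "?l \<ge> 1" by (rule level_pos)
  have u: "u \<ge> 1" using l single by linarith
  have nsqg: "nsq g \<le> B\<^sup>2" using single(4,5) by (metis abs_le_square_iff abs_of_nonneg less_imp_le nsq_nonneg real_sqrt_ge_zero real_sqrt_pow2)
  have low: "nsq (lower b g) \<le> ?l * nsq g"
  proof -
    have "nsq (lower b g) \<le> (\<Sum>b\<in>Basis. nsq (lower b g))" using b by (intro member_le_sum) auto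
    also have "\<dots> = (?l - DIM('a)) * nsq g" using single(1) by (intro eigenspace_nsq_lower) (simp add: eigen_def)
    also have "\<dots> \<le> ?l * nsq g" by (intro mult_right_mono) auto
    finally show ?thesis .
  qed
  have "nsq (raise b g) \<le> (?l + 2) * nsq g" using nsq_raise[OF S b] low by (simp add: algebra_simps)
  also have "\<dots> \<le> (3 * ?l) * nsq g" using l by (intro mult_right_mono) auto
  finally have up: "nsq (raise b g) \<le> 3 * ?l * nsq g" by simp
  have bound: "sqrt (nsq (\<lambda>x. (1/2) * f x)) \<le> sqrt u * B" if "nsq f \<le> 3 * ?l * nsq g" for f
  proof -
    have "nsq (\<lambda>x. (1/2) * f x) = nsq f / 4" by (subst nsq_scale) (simp add: power2_eq_square)
    also have "\<dots> \<le> ?l * nsq g" using that l nsq_nonneg[of g] mult_nonneg_nonneg[of ?l "nsq g"] by linarith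
    also have "\<dots> \<le> u * B\<^sup>2" using single nsqg l by (intro mult_mono) auto
    finally have "sqrt (nsq (\<lambda>x. (1/2) * f x)) \<le> sqrt (u * B\<^sup>2)" by simp
    then show ?thesis using single(4) by (simp add: real_sqrt_mult)
  qed
  have pos: "0 < sqrt u * B" using u single(4) by simp
  have E1: "eigen_sum (c / 3) (3 * u) (sqrt u * B) (\<lambda>x. (1/2) * raise b g x)"
  proof (rule eigen_sum.single[OF _ _ _ pos bound[OF up]])
    show "(\<lambda>x. (1/2) * raise b g x) \<in> eigen (Suc m)" using eigen_raise[OF single(1) b] unfolding eigen_def by (rule eigenspace_scale)
    show "c / 3 \<le> level TYPE('a) (Suc m)" "level TYPE('a) (Suc m) \<le> 3 * u" using single(2,3) l unfolding level_Suc by linarith+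
  qed
  have E2: "eigen_sum (c / 3) (3 * u) (sqrt u * B) (\<lambda>x. (1/2) * lower b g x)"
  proof (cases m)
    case 0
    have "g \<in> H_eigenspace (DIM('a))" using single(1) by (simp add: 0 eigen_def level_def)
    from eigenspace_below[OF eigenspace_lower[OF this b]] have z: "lower b g = (\<lambda>x. 0)" by simp
    have "(\<lambda>x. 0) \<in> eigen m" unfolding eigen_def by (rule eigenspace_zero)
    then show ?thesis unfolding z
      by (intro eigen_sum.single[of _ m]) (use single(2,3) l pos in \<open>auto simp: nsq_def\<close>)
  next
    case (Suc k)
    have "nsq (lower b g) \<le> 3 * ?l * nsq g" using low l nsq_nonneg[of g] mult_nonneg_nonneg[of ?l "nsq g"] by linarith
    note bd = bound[OF this]
    show ?thesis
    proof (rule eigen_sum.single[OF _ _ _ pos bd])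
      show "(\<lambda>x. (1/2) * lower b g x) \<in> eigen k" using eigen_lower[OF single(1)[unfolded Suc] b] unfolding eigen_def by (rule eigenspace_scale)
      have "level TYPE('a) m = level TYPE('a) k + 2" by (simp add: Suc level_Suc)
      then show "c / 3 \<le> level TYPE('a) k" "level TYPE('a) k \<le> 3 * u" using single(2,3) l level_pos(1)[where 'a='a, of k] u by linarith+
    qed
  qed
  have "(\<lambda>x. of_real (x \<bullet> b) * g x) = (\<lambda>x. (1/2) * raise b g x + (1/2) * lower b g x)"
    by (auto simp: raise_def lower_def field_simps)
  moreover have "2 * sqrt u * B = sqrt u * B + sqrt u * B" by simp
  ultimately show ?case using eigen_sum.add[OF E1 E2] by (simp only:)
next
  case (add c u B1 g B2 h)
  show ?case using eigen_sum.add[OF add.IH] by (simp add: distrib_left)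
qed

lemma eigen_sum_sum:
  assumes "finite I" "I \<noteq> {}" "\<And>i. i \<in> I \<Longrightarrow> eigen_sum c u B (f i)"
  shows "eigen_sum c u (real (card I) * B) (\<lambda>x. \<Sum>i\<in>I. f i x)"
  using assms
proof (induction rule: finite_ne_induct)
  case (insert i I)
  have "eigen_sum c u (B + real (card I) * B) (\<lambda>x. f i x + (\<Sum>i\<in>I. f i x))" using insert by (intro eigen_sum.add) auto
  then show ?case using insert by (simp add: algebra_simps)
qed simp

text \<open>
  Applying \<open>eigen_sum_coord\<close> twice for each factor \<open>|x|\<^sup>2 = \<Sum> x\<^sub>b\<^sup>2\<close>, whence \<open>9 = 3\<^sup>2\<close>. The norm grows by at
  most a constant times \<open>u\<close> per factor.
\<close>
lemma eigen_sum_moment: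
  "\<exists>M>0. \<forall>c u B h. eigen_sum c u B (h :: 'a::euclidean_space \<Rightarrow> complex) \<longrightarrow>
    eigen_sum (c / 9 ^ k) (9 ^ k * u) (M * u ^ k * B) (\<lambda>x. of_real (((norm x)\<^sup>2) ^ k) * h x)"
proof (induction k)
  case 0
  show ?case by (intro exI[of _ 1]) auto
next
  case (Suc k)
  then obtain M where M: "M > 0" and IH: "\<And>c u B h. eigen_sum c u B (h :: 'a \<Rightarrow> complex) \<Longrightarrow>
    eigen_sum (c / 9 ^ k) (9 ^ k * u) (M * u ^ k * B) (\<lambda>x. of_real (((norm x)\<^sup>2) ^ k) * h x)" by blast
  let ?M = "real DIM('a) * (7 * 9 ^ k * M)"
  show ?case
  proof (intro exI[of _ ?M] conjI allI impI)
    show "0 < ?M" using M by simp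
    fix c u B and h :: "'a \<Rightarrow> complex" assume h: "eigen_sum c u B h"
    let ?h = "\<lambda>x. of_real (((norm x)\<^sup>2) ^ k) * h x"
    let ?u = "9 ^ k * u" and ?B = "M * u ^ k * B"
    have u: "u \<ge> 1" by (rule eigen_sum_upper[OF h])
    have B: "0 < ?B" using eigen_sum_pos[OF IH[OF h]] .
    have e: "c / 9 ^ k / 3 / 3 = c / 9 ^ Suc k" "3 * (3 * ?u) = 9 ^ Suc k * u" by simp_all
    have a: "eigen_sum (c / 9 ^ k / 3 / 3) (3 * (3 * ?u)) (2 * sqrt (3 * ?u) * (2 * sqrt ?u * ?B)) (\<lambda>x. of_real (x \<bullet> b) * (of_real (x \<bullet> b) * ?h x))"
      if "b \<in> Basis" for b by (intro eigen_sum_coord IH h that)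
    \<comment> \<open>The factor \<open>7\<close> is a round upper bound for \<open>4 \<surd>3\<close>.\<close>
    have le: "2 * sqrt (3 * ?u) * (2 * sqrt ?u * ?B) \<le> 7 * 9 ^ k * M * u ^ Suc k * B"
    proof -
      have "2 * sqrt (3 * ?u) * (2 * sqrt ?u * ?B) = 4 * sqrt 3 * (sqrt ?u * sqrt ?u) * ?B" by (simp add: real_sqrt_mult)
      also have "\<dots> = 4 * sqrt 3 * ?u * ?B" using u by simp
      also have "\<dots> \<le> 7 * ?u * ?B"
      proof (intro mult_right_mono)
        show "4 * sqrt 3 \<le> (7::real)" by (rule power2_le_imp_le) (simp_all add: power_mult_distrib)
      qed (use u B in auto)
      finally show ?thesis by (simp add: mult_ac)
    qed
    have "eigen_sum (c / 9 ^ Suc k) (9 ^ Suc k * u) (7 * 9 ^ k * M * u ^ Suc k * B) (\<lambda>x. of_real (x \<bullet> b) * (of_real (x \<bullet> b) * ?h x))"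
      if "b \<in> Basis" for b using eigen_sum_mono[OF a[OF that] le] unfolding e .
    from eigen_sum_sum[OF finite_Basis nonempty_Basis this]
    have "eigen_sum (c / 9 ^ Suc k) (9 ^ Suc k * u) (?M * u ^ Suc k * B) (\<lambda>x. \<Sum>b\<in>Basis. of_real (x \<bullet> b) * (of_real (x \<bullet> b) * ?h x))"
      by (simp add: mult.assoc)
    also have "(\<lambda>x. \<Sum>b\<in>Basis. of_real (x \<bullet> b) * (of_real (x \<bullet> b) * ?h x)) = (\<lambda>x. of_real (((norm x)\<^sup>2) ^ Suc k) * h x)"
    proof
      fix x :: 'a
      have "complex_of_real ((norm x)\<^sup>2) = (\<Sum>b\<in>Basis. of_real (x \<bullet> b) * of_real (x \<bullet> b))"
        unfolding power2_norm_eq_inner by (subst euclidean_inner) simp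
      then show "(\<Sum>b\<in>Basis. of_real (x \<bullet> b) * (of_real (x \<bullet> b) * ?h x)) = of_real (((norm x)\<^sup>2) ^ Suc k) * h x"
        by (simp add: sum_distrib_right mult.assoc)
    qed
    finally show "eigen_sum (c / 9 ^ Suc k) (9 ^ Suc k * u) (?M * u ^ Suc k * B) (\<lambda>x. of_real (((norm x)\<^sup>2) ^ Suc k) * h x)" .
  qed
qed

text \<open>
  On each eigenspace the Fourier integral is a nonzero scalar, so it can be inverted termwise.
\<close>
lemma eigen_sum_FT:
  fixes h :: "'a::euclidean_space \<Rightarrow> complex"
  assumes "eigen_sum c u B h"
  shows "\<exists>K\<in>schwartz. \<forall>\<xi>. FT K (- \<xi>) = h \<xi>"
  using assms
proof (induction rule: eigen_sum.induct)
  case (single g m c u B)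
  let ?c = "of_real (gaussian_mass TYPE('a)) * \<i> ^ m :: complex"
  have c: "cnj ?c \<noteq> 0" using gaussian_mass_pos[where 'a='a] by simp
  have "FT g (- \<xi>) = cnj ?c * g \<xi>" for \<xi>
    using FT_cnj[of "\<lambda>x. cnj (g x)" \<xi>] FT_eigen[OF eigen_cnj[OF single(1)]] by (simp add: mult_ac)
  then have "FT (\<lambda>x. (1 / cnj ?c) * g x) (- \<xi>) = g \<xi>" for \<xi> unfolding FT_scale using c by simp
  moreover have "(\<lambda>x. (1 / cnj ?c) * g x) \<in> schwartz" by (rule schwartz_scale[OF eigen_schwartz[OF single(1)]])
  ultimately show ?case by blast
next
  case (add c u B1 g B2 h)
  then obtain K L where "K \<in> schwartz" "\<forall>\<xi>. FT K (- \<xi>) = g \<xi>" "L \<in> schwartz" "\<forall>\<xi>. FT L (- \<xi>) = h \<xi>" by blast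
  then show ?case by (intro bexI[of _ "\<lambda>x. K x + L x"]) (auto simp: FT_add schwartz_add)
qed

text \<open>
  Minkowski's inequality from \<open>(a + b)\<^sup>2 \<le> (1 + B/A) a\<^sup>2 + (1 + A/B) b\<^sup>2\<close>, which is sharp when the two
  norms are \<open>A\<close> and \<open>B\<close>.
\<close>
lemma wnorm2_triangle:
  assumes [measurable]: "f \<in> borel_measurable borel" "g \<in> borel_measurable borel" "\<omega> \<in> borel_measurable borel" and \<omega>: "\<And>x. 0 \<le> \<omega> x"
    and A: "A > 0" "wnorm2 \<omega> f \<le> ennreal (A\<^sup>2)" and B: "B > 0" "wnorm2 \<omega> g \<le> ennreal (B\<^sup>2)"
  shows "wnorm2 \<omega> (\<lambda>x. f x + g x) \<le> ennreal ((A + B)\<^sup>2)"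
proof -
  have pt: "ennreal (\<omega> x * (cmod (f x + g x))\<^sup>2) \<le> ennreal (1 + B / A) * ennreal (\<omega> x * (cmod (f x))\<^sup>2) + ennreal (1 + A / B) * ennreal (\<omega> x * (cmod (g x))\<^sup>2)" for x
  proof -
    let ?a = "cmod (f x)" and ?b = "cmod (g x)"
    have "(cmod (f x + g x))\<^sup>2 \<le> (?a + ?b)\<^sup>2" by (intro power_mono norm_triangle_ineq) auto
    also have "\<dots> \<le> (1 + B / A) * ?a\<^sup>2 + (1 + A / B) * ?b\<^sup>2"
    proof -
      have "0 \<le> (B * ?a - A * ?b)\<^sup>2 / (A * B)" using A B by simp
      also have "\<dots> = B / A * ?a\<^sup>2 + A / B * ?b\<^sup>2 - 2 * ?a * ?b" using A B by (simp add: power2_eq_square field_simps)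
      finally show ?thesis by (simp add: power2_sum algebra_simps)
    qed
    finally have "\<omega> x * (cmod (f x + g x))\<^sup>2 \<le> \<omega> x * ((1 + B / A) * ?a\<^sup>2 + (1 + A / B) * ?b\<^sup>2)" using \<omega> by (intro mult_left_mono) auto
    also have "\<dots> = (1 + B / A) * (\<omega> x * ?a\<^sup>2) + (1 + A / B) * (\<omega> x * ?b\<^sup>2)" by (simp add: algebra_simps)
    finally have "ennreal (\<omega> x * (cmod (f x + g x))\<^sup>2) \<le> ennreal ((1 + B / A) * (\<omega> x * ?a\<^sup>2) + (1 + A / B) * (\<omega> x * ?b\<^sup>2))" by (rule ennreal_leI)
    also have "\<dots> = ennreal (1 + B / A) * ennreal (\<omega> x * ?a\<^sup>2) + ennreal (1 + A / B) * ennreal (\<omega> x * ?b\<^sup>2)"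
      using A B \<omega> by (simp add: ennreal_plus ennreal_mult)
    finally show ?thesis .
  qed
  have "wnorm2 \<omega> (\<lambda>x. f x + g x) \<le> (\<integral>\<^sup>+x. ennreal (1 + B / A) * ennreal (\<omega> x * (cmod (f x))\<^sup>2) + ennreal (1 + A / B) * ennreal (\<omega> x * (cmod (g x))\<^sup>2) \<partial>lborel)"
    unfolding wnorm2_def by (intro nn_integral_mono pt)
  also have "\<dots> = ennreal (1 + B / A) * wnorm2 \<omega> f + ennreal (1 + A / B) * wnorm2 \<omega> g"
    unfolding wnorm2_def by (subst nn_integral_add) (auto simp: nn_integral_cmult)
  also have "\<dots> \<le> ennreal (1 + B / A) * ennreal (A\<^sup>2) + ennreal (1 + A / B) * ennreal (B\<^sup>2)"
    by (intro add_mono mult_left_mono A B) auto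
  also have "\<dots> = ennreal ((1 + B / A) * A\<^sup>2 + (1 + A / B) * B\<^sup>2)" using A B by (simp add: ennreal_plus ennreal_mult)
  also have "(1 + B / A) * A\<^sup>2 + (1 + A / B) * B\<^sup>2 = (A + B)\<^sup>2" using A B by (simp add: power2_eq_square field_simps)
  finally show ?thesis .
qed

section \<open>Fractional powers of the Laplacian on eigenfunctions\<close>

lemma japanese_bracket_measurable [measurable]: "japanese_bracket \<in> borel_measurable (borel :: 'a::euclidean_space measure)"
  unfolding japanese_bracket_def[abs_def] by measurable

lemma FT_add_integrable:
  assumes "integrable lborel f" "integrable lborel g"
  shows "FT (\<lambda>x. f x + g x) v = FT f v + FT g v"
  unfolding FT_def using assms by (simp add: distrib_left integrable_char_mult)

lemma bounded_multiplier_integrable: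
  fixes K h :: "'a::euclidean_space \<Rightarrow> complex"
  assumes K: "K \<in> schwartz" and h: "h \<in> schwartz"
  shows "integrable lborel (\<lambda>\<xi>. FT K (- (r *\<^sub>R \<xi>)) * h \<xi>)"
proof -
  have [measurable]: "FT K \<in> borel_measurable borel" by (rule FT_measurable[OF schwartz_measurable[OF K]])
  have "(\<lambda>\<xi>. FT K (- (r *\<^sub>R \<xi>))) \<in> testable"
    by (rule bounded_testable[of _ "\<integral>x. cmod (K x) \<partial>lborel"]) (simp_all add: FT_bounded)
  then show ?thesis using h by (simp add: testable_def)
qed

text \<open>
  Termwise application of \<open>multiplier_bound\<close> and of the virial bound \<open>eigen_weighted_bound\<close>, whose
  gain \<open>c\<^sup>-\<^sup>p\<^sup>/\<^sup>2\<close> for the square becomes \<open>c\<^sup>-\<^sup>p\<^sup>/\<^sup>4\<close> for the norm.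
\<close>
lemma eigen_sum_multiplier_bound:
  fixes K :: "'a::euclidean_space \<Rightarrow> complex"
  assumes K: "K \<in> schwartz" and p: "0 < p" "p < 1"
  shows "\<exists>Q>0. \<forall>c u B h r. eigen_sum c u B h \<longrightarrow> 0 < c \<longrightarrow> 0 \<le> r \<longrightarrow> r \<le> 2 \<longrightarrow>
    wnorm2 (\<lambda>x. japanese_bracket x powr (- p)) (FT (\<lambda>\<xi>. FT K (- (r *\<^sub>R \<xi>)) * h \<xi>)) \<le> ennreal ((Q * c powr (- p / 4) * B)\<^sup>2)"
proof -
  obtain C1 where mb: "C1 > 0 \<and> (\<forall>n. \<forall>f\<in>eigen n. \<forall>r. (0 \<le> r \<longrightarrow> r \<le> 2 \<longrightarrow> (\<forall>p. 0 \<le> p \<longrightarrow> p \<le> 1 \<longrightarrow>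
       wnorm2 (\<lambda>x. japanese_bracket x powr (- p)) (FT (\<lambda>\<xi>. FT K (- (r *\<^sub>R \<xi>)) * f \<xi>)) \<le> ennreal (C1 * weighted (- p) f))) \<and>
     wnorm2 (\<lambda>x. 1) (FT (\<lambda>\<xi>. FT K (- (r *\<^sub>R \<xi>)) * f \<xi>)) \<le> ennreal (C1 * nsq f))"
    using multiplier_bound[OF K] by (rule exE)
  note C1 = conjunct1[OF mb] mb[THEN conjunct2, rule_format, THEN conjunct1, rule_format, OF _ _ _ less_imp_le[OF p(1)] less_imp_le[OF p(2)]]
  obtain C2 where C2: "C2 > 0" "\<And>n f. f \<in> eigen n \<Longrightarrow> weighted (- p) (f :: 'a \<Rightarrow> complex) \<le> C2 * level TYPE('a) n powr (- p / 2) * nsq f"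
    using eigen_weighted_bound[OF p, where 'a='a] by metis
  define Q where "Q = sqrt (C1 * C2)"
  have Q: "Q > 0" "Q\<^sup>2 = C1 * C2" using C1(1) C2(1) by (simp_all add: Q_def)
  have [measurable]: "FT K \<in> borel_measurable borel" by (rule FT_measurable[OF schwartz_measurable[OF K]])
  have meas: "FT (\<lambda>\<xi>. FT K (- (r *\<^sub>R \<xi>)) * h \<xi>) \<in> borel_measurable borel" if "h \<in> schwartz" for r h
    using schwartz_measurable[OF that] by (intro FT_measurable) measurable
  show ?thesis
  proof (intro exI[of _ Q] conjI Q allI impI)
    fix c u B r :: real and h :: "'a \<Rightarrow> complex"
    assume "eigen_sum c u B h" and "0 < c" and r: "0 \<le> r" "r \<le> 2"
    then show "wnorm2 (\<lambda>x. japanese_bracket x powr (- p)) (FT (\<lambda>\<xi>. FT K (- (r *\<^sub>R \<xi>)) * h \<xi>)) \<le> ennreal ((Q * c powr (- p / 4) * B)\<^sup>2)"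
    proof (induction rule: eigen_sum.induct)
      case (single g m c u B)
      have nsqg: "nsq g \<le> B\<^sup>2" using single(4,5) by (metis abs_le_square_iff abs_of_nonneg less_imp_le nsq_nonneg real_sqrt_ge_zero real_sqrt_pow2)
      have "level TYPE('a) m powr (- p / 2) \<le> c powr (- p / 2)" using single p by (intro powr_mono2') auto
      then have "C2 * level TYPE('a) m powr (- p / 2) * nsq g \<le> C2 * c powr (- p / 2) * B\<^sup>2"
        using C2(1) nsqg by (intro mult_mono) auto
      then have "weighted (- p) g \<le> C2 * c powr (- p / 2) * B\<^sup>2" using C2(2)[OF single(1)] by linarith
      then have "C1 * weighted (- p) g \<le> C1 * (C2 * c powr (- p / 2) * B\<^sup>2)" using C1(1) by (intro mult_left_mono) auto
      also have "\<dots> = (Q * c powr (- p / 4) * B)\<^sup>2"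
      proof -
        have "(c powr (- p / 4))\<^sup>2 = c powr (- p / 2)" by (simp add: power2_eq_square powr_add[symmetric])
        then show ?thesis by (simp add: power_mult_distrib Q(2))
      qed
      finally have "ennreal (C1 * weighted (- p) g) \<le> ennreal ((Q * c powr (- p / 4) * B)\<^sup>2)" by (rule ennreal_leI)
      then show ?case using C1(2)[OF single(1) r] by (rule order_trans[rotated])
    next
      case (add c u B1 g B2 h)
      note S = eigen_sum_schwartz[OF add.hyps(1)] eigen_sum_schwartz[OF add.hyps(2)]
      have cp: "c powr (- p / 4) > 0" using add.prems by simp
      have eq: "FT (\<lambda>\<xi>. FT K (- (r *\<^sub>R \<xi>)) * (g \<xi> + h \<xi>)) = (\<lambda>x. FT (\<lambda>\<xi>. FT K (- (r *\<^sub>R \<xi>)) * g \<xi>) x + FT (\<lambda>\<xi>. FT K (- (r *\<^sub>R \<xi>)) * h \<xi>) x)"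
        by (rule ext) (simp add: distrib_left FT_add_integrable bounded_multiplier_integrable[OF K] S)
      have "wnorm2 (\<lambda>x. japanese_bracket x powr (- p)) (FT (\<lambda>\<xi>. FT K (- (r *\<^sub>R \<xi>)) * (g \<xi> + h \<xi>))) \<le>
         ennreal ((Q * c powr (- p / 4) * B1 + Q * c powr (- p / 4) * B2)\<^sup>2)"
        unfolding eq
        by (rule wnorm2_triangle[OF meas[OF S(1)] meas[OF S(2)] _ _ _ add.IH(1) _ add.IH(2)])
          (use add.prems r Q(1) cp eigen_sum_pos[OF add.hyps(1)] eigen_sum_pos[OF add.hyps(2)] in auto)
      then show ?case by (simp add: distrib_left)
    qed
  qed
qed

text \<open>
  Minkowski's integral inequality when a majorant \<open>\<theta>(s)\<close> of the norms of the slices is known: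
  Cauchy--Schwarz with respect to \<open>\<theta>(s) ds\<close>, then Fubini. The assumption \<open>z\<close> justifies dividing by \<open>\<theta>\<close>.
\<close>
lemma minkowski_time:
  fixes \<Phi> :: "real \<Rightarrow> 'a::euclidean_space \<Rightarrow> real" and \<theta> :: "real \<Rightarrow> real"
  assumes m[measurable]: "(\<lambda>(s, x). \<Phi> s x) \<in> borel_measurable (lborel \<Otimes>\<^sub>M lborel)" "\<theta> \<in> borel_measurable borel"
    and \<Phi>: "\<And>s x. 0 \<le> \<Phi> s x" and \<theta>: "\<And>s. 0 \<le> \<theta> s"
    and le: "\<And>s. (\<integral>\<^sup>+x. ennreal ((\<Phi> s x)\<^sup>2) \<partial>lborel) \<le> ennreal ((\<theta> s)\<^sup>2)" and z: "\<And>s x. \<theta> s = 0 \<Longrightarrow> \<Phi> s x = 0"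
  shows "(\<integral>\<^sup>+x. (\<integral>\<^sup>+s. ennreal (\<Phi> s x) \<partial>lborel)\<^sup>2 \<partial>lborel) \<le> (\<integral>\<^sup>+s. ennreal (\<theta> s) \<partial>lborel)\<^sup>2"
proof -
  let ?I = "\<integral>\<^sup>+s. ennreal (\<theta> s) \<partial>lborel"
  have pt: "(\<integral>\<^sup>+s. ennreal (\<Phi> s x) \<partial>lborel)\<^sup>2 \<le> ?I * (\<integral>\<^sup>+s. ennreal (\<theta> s * (\<Phi> s x / \<theta> s)\<^sup>2) \<partial>lborel)" for x
  proof -
    have [measurable]: "(\<lambda>s. \<Phi> s x) \<in> borel_measurable borel" using measurable_compose[OF measurable_Pair2'[of x lborel lborel] m(1)] by simp
    have "\<Phi> s x = \<theta> s * (\<Phi> s x / \<theta> s)" for s using z[of s x] by (cases "\<theta> s = 0") auto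
    then have "(\<integral>\<^sup>+s. ennreal (\<Phi> s x) \<partial>lborel) = (\<integral>\<^sup>+s. ennreal (\<theta> s * (\<Phi> s x / \<theta> s)) \<partial>lborel)" by simp
    also have "\<dots>\<^sup>2 \<le> ?I * (\<integral>\<^sup>+s. ennreal (\<theta> s * (\<Phi> s x / \<theta> s)\<^sup>2) \<partial>lborel)"
      by (rule ennreal_Cauchy_Schwarz_weight) (use \<Phi> \<theta> in auto)
    finally show ?thesis .
  qed
  have "(\<integral>\<^sup>+x. (\<integral>\<^sup>+s. ennreal (\<Phi> s x) \<partial>lborel)\<^sup>2 \<partial>lborel) \<le> (\<integral>\<^sup>+x. ?I * (\<integral>\<^sup>+s. ennreal (\<theta> s * (\<Phi> s x / \<theta> s)\<^sup>2) \<partial>lborel) \<partial>lborel)"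
    by (intro nn_integral_mono pt)
  also have "\<dots> = ?I * (\<integral>\<^sup>+x. (\<integral>\<^sup>+s. ennreal (\<theta> s * (\<Phi> s x / \<theta> s)\<^sup>2) \<partial>lborel) \<partial>lborel)"
    by (rule nn_integral_cmult) measurable
  also have "(\<integral>\<^sup>+x. (\<integral>\<^sup>+s. ennreal (\<theta> s * (\<Phi> s x / \<theta> s)\<^sup>2) \<partial>lborel) \<partial>lborel) = (\<integral>\<^sup>+s. (\<integral>\<^sup>+x. ennreal (\<theta> s * (\<Phi> s x / \<theta> s)\<^sup>2) \<partial>lborel) \<partial>lborel)"
    by (rule lborel_pair.Fubini'[symmetric]) measurable
  also have "\<dots> \<le> ?I"
  proof (rule nn_integral_mono)
    fix s
    have [measurable]: "\<Phi> s \<in> borel_measurable borel" using measurable_compose[OF measurable_Pair1'[of s lborel lborel] m(1)] by simp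
    show "(\<integral>\<^sup>+x. ennreal (\<theta> s * (\<Phi> s x / \<theta> s)\<^sup>2) \<partial>lborel) \<le> ennreal (\<theta> s)"
    proof (cases "\<theta> s = 0")
      case False
      then have t: "\<theta> s > 0" using \<theta>[of s] by simp
      have "(\<integral>\<^sup>+x. ennreal (\<theta> s * (\<Phi> s x / \<theta> s)\<^sup>2) \<partial>lborel) = (\<integral>\<^sup>+x. ennreal (1 / \<theta> s) * ennreal ((\<Phi> s x)\<^sup>2) \<partial>lborel)"
        using t by (intro nn_integral_cong) (simp add: ennreal_mult[symmetric] power2_eq_square)
      also have "\<dots> = ennreal (1 / \<theta> s) * (\<integral>\<^sup>+x. ennreal ((\<Phi> s x)\<^sup>2) \<partial>lborel)" by (rule nn_integral_cmult) measurable
      also have "\<dots> \<le> ennreal (1 / \<theta> s) * ennreal ((\<theta> s)\<^sup>2)" by (intro mult_left_mono le) simp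
      also have "\<dots> = ennreal (\<theta> s)" using t by (simp add: ennreal_mult[symmetric] power2_eq_square)
      finally show ?thesis .
    qed simp
  qed
  finally show ?thesis by (simp add: power2_eq_square mult_left_mono)
qed

text \<open>
  Substitution \<open>t = q s\<close> in Euler's integral.
\<close>
lemma Gamma_scaled_integral:
  assumes \<beta>: "\<beta> > 0" and q: "q > (0::real)"
  shows "integrable lborel (\<lambda>s. indicator {0..} s * (s powr (\<beta> - 1) * exp (- s * q)))"
    "(\<integral>s. indicator {0..} s * (s powr (\<beta> - 1) * exp (- s * q)) \<partial>lborel) = Gamma \<beta> * q powr (- \<beta>)"
proof -
  have "ennreal (Gamma \<beta>) = (\<integral>\<^sup>+t. ennreal (indicator {0..} t * t powr (\<beta> - 1) / exp t) \<partial>lborel)"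
    using Gamma_conv_nn_integral_real[OF \<beta>] .
  also have "\<dots> = \<bar>q\<bar> * (\<integral>\<^sup>+s. ennreal (indicator {0..} (0 + q * s) * (0 + q * s) powr (\<beta> - 1) / exp (0 + q * s)) \<partial>lborel)"
    by (rule nn_integral_real_affine) (use q in auto)
  also have "(\<integral>\<^sup>+s. ennreal (indicator {0..} (0 + q * s) * (0 + q * s) powr (\<beta> - 1) / exp (0 + q * s)) \<partial>lborel) =
     (\<integral>\<^sup>+s. ennreal (q powr (\<beta> - 1)) * ennreal (indicator {0..} s * (s powr (\<beta> - 1) * exp (- s * q))) \<partial>lborel)"
  proof (rule nn_integral_cong)
    fix s :: real
    show "ennreal (indicator {0..} (0 + q * s) * (0 + q * s) powr (\<beta> - 1) / exp (0 + q * s)) = ennreal (q powr (\<beta> - 1)) * ennreal (indicator {0..} s * (s powr (\<beta> - 1) * exp (- s * q)))"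
    proof (cases "s \<ge> 0")
      case True
      then show ?thesis using q by (simp add: powr_mult exp_minus divide_inverse ennreal_mult[symmetric] mult_ac)
    next
      case False
      then show ?thesis using q by (simp add: zero_le_mult_iff)
    qed
  qed
  also have "\<dots> = ennreal (q powr (\<beta> - 1)) * (\<integral>\<^sup>+s. ennreal (indicator {0..} s * (s powr (\<beta> - 1) * exp (- s * q))) \<partial>lborel)"
    by (rule nn_integral_cmult) measurable
  finally have G: "ennreal (Gamma \<beta>) = ennreal q * (ennreal (q powr (\<beta> - 1)) * (\<integral>\<^sup>+s. ennreal (indicator {0..} s * (s powr (\<beta> - 1) * exp (- s * q))) \<partial>lborel))"
    using q by simp
  have "ennreal (q powr (- \<beta>)) * ennreal (Gamma \<beta>) = (ennreal (q powr (- \<beta>)) * ennreal q * ennreal (q powr (\<beta> - 1))) * (\<integral>\<^sup>+s. ennreal (indicator {0..} s * (s powr (\<beta> - 1) * exp (- s * q))) \<partial>lborel)"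
    unfolding G by (simp add: mult_ac)
  also have "ennreal (q powr (- \<beta>)) * ennreal q * ennreal (q powr (\<beta> - 1)) = 1"
  proof -
    have "q powr (- \<beta>) * q * q powr (\<beta> - 1) = q powr (- \<beta> + 1 + (\<beta> - 1))" using q by (simp only: powr_add powr_one less_imp_le)
    also have "\<dots> = 1" using q by simp
    finally show ?thesis using q by (simp add: ennreal_mult[symmetric])
  qed
  finally have "(\<integral>\<^sup>+s. ennreal (indicator {0..} s * (s powr (\<beta> - 1) * exp (- s * q))) \<partial>lborel) = ennreal (Gamma \<beta> * q powr (- \<beta>))"
    using Gamma_real_pos[OF \<beta>] by (simp add: ennreal_mult mult.commute)
  then have "integrable lborel (\<lambda>s. indicator {0..} s * (s powr (\<beta> - 1) * exp (- s * q))) \<and> (\<integral>s. indicator {0..} s * (s powr (\<beta> - 1) * exp (- s * q)) \<partial>lborel) = Gamma \<beta> * q powr (- \<beta>)"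
    using Gamma_real_pos[OF \<beta>] by (subst (asm) nn_integral_eq_integrable) auto
  then show "integrable lborel (\<lambda>s. indicator {0..} s * (s powr (\<beta> - 1) * exp (- s * q)))"
    "(\<integral>s. indicator {0..} s * (s powr (\<beta> - 1) * exp (- s * q)) \<partial>lborel) = Gamma \<beta> * q powr (- \<beta>)" by auto
qed

text \<open>
  The Fourier integral of \<open>|\<xi>|\<^sup>2\<^sup>N e\<^sup>-\<^sup>s\<^sup>|\<^sup>\<xi>\<^sup>|\<^sup>2 f(\<xi>)\<close>: a Laplacian power combined with the heat semigroup,
  with the Schwartz function \<open>f\<close> playing the role of a Fourier transform.
\<close>
definition heat_moment :: "nat \<Rightarrow> real \<Rightarrow> ('a::euclidean_space \<Rightarrow> complex) \<Rightarrow> 'a \<Rightarrow> complex" where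
  "heat_moment N s f = FT (\<lambda>\<xi>. of_real (((norm \<xi>)\<^sup>2) ^ N * exp (- s * (norm \<xi>)\<^sup>2)) * f \<xi>)"

text \<open>
  The symbol is dominated by the smooth weight \<open>\<langle>\<xi>\<rangle>\<^sup>a\<close>.
\<close>
lemma schwartz_norm_powr_integrable:
  fixes f :: "'a::euclidean_space \<Rightarrow> complex"
  assumes f: "f \<in> schwartz" and a: "a \<ge> 0"
  shows "integrable lborel (\<lambda>\<xi>. of_real (norm \<xi> powr a) * f \<xi>)"
    "(\<lambda>\<xi>. of_real (norm \<xi> powr a) * f \<xi>) \<in> square_integrable lborel"
proof -
  note [measurable] = schwartz_measurable[OF f]
  have le: "norm (of_real (norm \<xi> powr a) * f \<xi>) \<le> norm (brk a f \<xi>)" for \<xi>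
    using a by (auto simp: norm_mult brk_def intro!: mult_right_mono powr_mono2 norm_le_japanese_bracket)
  have m [measurable]: "(\<lambda>\<xi>. of_real (norm \<xi> powr a) * f \<xi>) \<in> borel_measurable lborel" by measurable
  show "integrable lborel (\<lambda>\<xi>. of_real (norm \<xi> powr a) * f \<xi>)"
    by (rule Bochner_Integration.integrable_bound[OF schwartz_integrable[OF schwartz_brk[OF f]] m AE_I2[OF le]])
  have le2: "norm ((cmod (of_real (norm \<xi> powr a) * f \<xi>))\<^sup>2) \<le> norm ((cmod (brk a f \<xi>))\<^sup>2)" for \<xi>
    using power_mono[OF le, of \<xi> 2] by simp
  have "integrable lborel (\<lambda>\<xi>. (cmod (of_real (norm \<xi> powr a) * f \<xi>))\<^sup>2)"
    by (rule Bochner_Integration.integrable_bound[OF schwartz_sq_integrable[OF schwartz_brk[OF f]] _ AE_I2[OF le2]]) measurable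
  then show "(\<lambda>\<xi>. of_real (norm \<xi> powr a) * f \<xi>) \<in> square_integrable lborel" by (simp add: square_integrable_def)
qed

lemma heat_moment_measurable:
  fixes f :: "'a::euclidean_space \<Rightarrow> complex"
  assumes [measurable]: "f \<in> borel_measurable borel"
  shows "(\<lambda>(s, x). heat_moment N s f x) \<in> borel_measurable (lborel \<Otimes>\<^sub>M lborel)"
proof -
  have "(\<lambda>w. \<integral>\<xi>. exp (\<i> * of_real (\<xi> \<bullet> snd w)) * (of_real (((norm \<xi>)\<^sup>2) ^ N * exp (- fst w * (norm \<xi>)\<^sup>2)) * f \<xi>) \<partial>lborel)
     \<in> borel_measurable ((lborel :: real measure) \<Otimes>\<^sub>M (lborel :: 'a measure))"
    by (rule lborel.borel_measurable_lebesgue_integral) measurable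
  then show ?thesis by (simp add: heat_moment_def FT_def split_def)
qed

text \<open>
  Insert \<open>\<Gamma>(\<beta>) |\<xi>|\<^sup>a = \<integral> s\<^sup>\<beta>\<^sup>-\<^sup>1 |\<xi>|\<^sup>2\<^sup>N e\<^sup>-\<^sup>s\<^sup>|\<^sup>\<xi>\<^sup>|\<^sup>2 ds\<close> under the Fourier integral and exchange the order of
  integration. The nonsmooth symbol is thereby replaced by Schwartz multipliers.
\<close>
lemma fractional_subordination:
  fixes f :: "'a::euclidean_space \<Rightarrow> complex"
  assumes f: "f \<in> schwartz" and a: "0 < a" "a < 2 * real N"
  defines "\<beta> \<equiv> real N - a / 2"
  shows "ennreal (Gamma \<beta> * cmod (FT (\<lambda>\<xi>. of_real (norm \<xi> powr a) * f \<xi>) x)) \<le> (\<integral>\<^sup>+s. ennreal (indicator {0..} s * (s powr (\<beta> - 1) * cmod (heat_moment N s f x))) \<partial>lborel)"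
proof -
  note [measurable] = schwartz_measurable[OF f]
  have \<beta>: "\<beta> > 0" using a by (simp add: \<beta>_def)
  have N: "N > 0" using a by (cases N) auto
  let ?w = "\<lambda>s. indicator {0..} s * s powr (\<beta> - 1) :: real"
  let ?m = "\<lambda>\<xi> s. exp (\<i> * of_real (\<xi> \<bullet> x)) * (of_real (((norm \<xi>)\<^sup>2) ^ N) * f \<xi>) * of_real (indicator {0..} s * (s powr (\<beta> - 1) * exp (- s * (norm \<xi>)\<^sup>2)))"
  have pow: "((norm \<xi>)\<^sup>2) ^ N * (Gamma \<beta> * ((norm \<xi>)\<^sup>2) powr (- \<beta>)) = Gamma \<beta> * norm \<xi> powr a" for \<xi> :: 'a
  proof (cases "\<xi> = 0")
    case False
    then have n: "norm \<xi> > 0" by simp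
    have "((norm \<xi>)\<^sup>2) ^ N = norm \<xi> powr (2 * real N)"
      using powr_realpow[OF n, of "2 * N"] by (simp add: power_mult)
    moreover have "((norm \<xi>)\<^sup>2) powr (- \<beta>) = norm \<xi> powr (- 2 * \<beta>)"
    proof -
      have "(norm \<xi>)\<^sup>2 = norm \<xi> powr 2" using n by (simp add: powr_numeral)
      then show ?thesis by (simp only: powr_powr) simp
    qed
    ultimately have "((norm \<xi>)\<^sup>2) ^ N * ((norm \<xi>)\<^sup>2) powr (- \<beta>) = norm \<xi> powr a"
      by (simp only: powr_add[symmetric]) (simp add: \<beta>_def)
    then show ?thesis by (simp add: mult.left_commute)
  qed (use N a in simp)
  have inner: "integrable lborel (\<lambda>s. ((norm \<xi>)\<^sup>2) ^ N * (indicator {0..} s * (s powr (\<beta> - 1) * exp (- s * (norm \<xi>)\<^sup>2))))"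
    "(\<integral>s. ((norm \<xi>)\<^sup>2) ^ N * (indicator {0..} s * (s powr (\<beta> - 1) * exp (- s * (norm \<xi>)\<^sup>2))) \<partial>lborel) = Gamma \<beta> * norm \<xi> powr a" for \<xi> :: 'a
  proof -
    have "integrable lborel (\<lambda>s. ((norm \<xi>)\<^sup>2) ^ N * (indicator {0..} s * (s powr (\<beta> - 1) * exp (- s * (norm \<xi>)\<^sup>2)))) \<and>
    (\<integral>s. ((norm \<xi>)\<^sup>2) ^ N * (indicator {0..} s * (s powr (\<beta> - 1) * exp (- s * (norm \<xi>)\<^sup>2))) \<partial>lborel) = Gamma \<beta> * norm \<xi> powr a"
    proof (cases "\<xi> = 0")
      case True
      then show ?thesis using N a by simp
    next
      case False
      then have "(norm \<xi>)\<^sup>2 > 0" by simp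
      note G = Gamma_scaled_integral[OF \<beta> this]
      show ?thesis using integrable_mult_right[OF G(1), of "((norm \<xi>)\<^sup>2) ^ N"]
        unfolding integral_mult_right_zero G(2) pow by simp
    qed
    then show "integrable lborel (\<lambda>s. ((norm \<xi>)\<^sup>2) ^ N * (indicator {0..} s * (s powr (\<beta> - 1) * exp (- s * (norm \<xi>)\<^sup>2))))"
      "(\<integral>s. ((norm \<xi>)\<^sup>2) ^ N * (indicator {0..} s * (s powr (\<beta> - 1) * exp (- s * (norm \<xi>)\<^sup>2))) \<partial>lborel) = Gamma \<beta> * norm \<xi> powr a" by auto
  qed
  have msplit: "?m \<xi> s = (exp (\<i> * of_real (\<xi> \<bullet> x)) * f \<xi>) * of_real (((norm \<xi>)\<^sup>2) ^ N * (indicator {0..} s * (s powr (\<beta> - 1) * exp (- s * (norm \<xi>)\<^sup>2))))" for \<xi> s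
    by simp
  have innerm: "integrable lborel (\<lambda>s. ?m \<xi> s)" for \<xi>
    unfolding msplit by (rule integrable_mult_right[OF integrable_of_real[OF inner(1)]])
  have innerv: "(\<integral>s. ?m \<xi> s \<partial>lborel) = exp (\<i> * of_real (\<xi> \<bullet> x)) * (of_real (norm \<xi> powr a) * f \<xi>) * of_real (Gamma \<beta>)" for \<xi>
    unfolding msplit by (subst integral_mult_right_zero, subst integral_complex_of_real, subst inner(2)) simp
  have innern: "(\<integral>s. norm (?m \<xi> s) \<partial>lborel) = Gamma \<beta> * cmod (of_real (norm \<xi> powr a) * f \<xi>)" for \<xi>
  proof -
    have "norm (?m \<xi> s) = cmod (f \<xi>) * (((norm \<xi>)\<^sup>2) ^ N * (indicator {0..} s * (s powr (\<beta> - 1) * exp (- s * (norm \<xi>)\<^sup>2))))" for s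
      unfolding msplit norm_mult norm_of_real by (simp add: abs_mult)
    then have "(\<integral>s. norm (?m \<xi> s) \<partial>lborel) = (\<integral>s. cmod (f \<xi>) * (((norm \<xi>)\<^sup>2) ^ N * (indicator {0..} s * (s powr (\<beta> - 1) * exp (- s * (norm \<xi>)\<^sup>2)))) \<partial>lborel)"
      by (simp only:)
    also have "\<dots> = cmod (f \<xi>) * (Gamma \<beta> * norm \<xi> powr a)"
      by (subst integral_mult_right_zero, subst inner(2)) (rule refl)
    finally show ?thesis by (simp add: norm_mult)
  qed
  have prodint: "integrable (lborel \<Otimes>\<^sub>M lborel) (\<lambda>(\<xi>, s). ?m \<xi> s)"
  proof (rule lborel_pair.Fubini_integrable)
    show "(\<lambda>(\<xi>, s). ?m \<xi> s) \<in> borel_measurable (lborel \<Otimes>\<^sub>M lborel)" by measurable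
    show "integrable lborel (\<lambda>\<xi>. \<integral>s. norm (case (\<xi>, s) of (\<xi>, s) \<Rightarrow> ?m \<xi> s) \<partial>lborel)"
      unfolding prod.case innern using schwartz_norm_powr_integrable(1)[OF f, of a] a by (intro integrable_mult_right integrable_norm) auto
    show "AE \<xi> in lborel. integrable lborel (\<lambda>s. case (\<xi>, s) of (\<xi>, s) \<Rightarrow> ?m \<xi> s)" unfolding prod.case using innerm by simp
  qed
  have "(\<integral>s. \<integral>\<xi>. ?m \<xi> s \<partial>lborel \<partial>lborel) = (\<integral>\<xi>. \<integral>s. ?m \<xi> s \<partial>lborel \<partial>lborel)"
    by (rule lborel_pair.Fubini_integral[OF prodint])
  also have "\<dots> = of_real (Gamma \<beta>) * FT (\<lambda>\<xi>. of_real (norm \<xi> powr a) * f \<xi>) x"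
    unfolding innerv FT_def by (simp add: mult.commute)
  finally have eq: "of_real (Gamma \<beta>) * FT (\<lambda>\<xi>. of_real (norm \<xi> powr a) * f \<xi>) x = (\<integral>s. \<integral>\<xi>. ?m \<xi> s \<partial>lborel \<partial>lborel)" ..
  have outer: "(\<integral>\<xi>. ?m \<xi> s \<partial>lborel) = of_real (indicator {0..} s * s powr (\<beta> - 1)) * heat_moment N s f x" for s
    unfolding heat_moment_def FT_def by (subst integral_mult_right_zero[symmetric]) (simp add: mult_ac)
  have "ennreal (Gamma \<beta> * cmod (FT (\<lambda>\<xi>. of_real (norm \<xi> powr a) * f \<xi>) x)) = ennreal (cmod (\<integral>s. \<integral>\<xi>. ?m \<xi> s \<partial>lborel \<partial>lborel))"
    unfolding eq[symmetric] using Gamma_real_pos[OF \<beta>] by (simp add: norm_mult)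
  also have "\<dots> \<le> (\<integral>\<^sup>+s. ennreal (cmod (\<integral>\<xi>. ?m \<xi> s \<partial>lborel)) \<partial>lborel)"
    by (rule integral_norm_bound_ennreal[OF lborel_pair.integrable_snd[OF prodint]])
  also have "\<dots> = (\<integral>\<^sup>+s. ennreal (indicator {0..} s * (s powr (\<beta> - 1) * cmod (heat_moment N s f x))) \<partial>lborel)"
    unfolding outer by (intro nn_integral_cong) (simp add: norm_mult abs_mult mult.assoc)
  finally show ?thesis .
qed

lemma wnorm2_scale:
  assumes [measurable]: "g \<in> borel_measurable borel" "\<omega> \<in> borel_measurable borel" and \<omega>: "\<And>x. 0 \<le> \<omega> x"
  shows "wnorm2 \<omega> (\<lambda>x. c * g x) = ennreal ((cmod c)\<^sup>2) * wnorm2 \<omega> g"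
  unfolding wnorm2_def using \<omega>
  by (subst nn_integral_cmult[symmetric]) (auto simp: norm_mult power_mult_distrib ennreal_mult[symmetric] mult_ac intro!: nn_integral_cong)

text \<open>
  The three bounds use the heat multiplier in different ways. In the first, \<open>|\<xi>|\<^sup>2\<^sup>N\<close> acts on \<open>f\<close> as a sum of
  eigenfunctions and costs \<open>l\<^sup>N\<close>, and the gaussian is the multiplier. In the second,
  \<open>|\<xi>|\<^sup>2\<^sup>N e\<^sup>-\<^sup>s\<^sup>|\<^sup>\<xi>\<^sup>|\<^sup>2\<close> is \<open>(2s)\<^sup>-\<^sup>N\<close> times a dilation of a fixed Schwartz function. The third is the second without
  the weight, since for large \<open>s\<close> the dilation factor is unbounded.
\<close>
lemma heat_moment_bounds:
  assumes p: "0 < p" "p < 1"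
  shows "\<exists>D>0. \<forall>n. \<forall>f\<in>(eigen n :: ('a::euclidean_space \<Rightarrow> complex) set). \<forall>s>0. 0 < nsq f \<longrightarrow>
     (s \<le> 1 \<longrightarrow> wnorm2 (\<lambda>x. japanese_bracket x powr (- p)) (heat_moment N s f) \<le> ennreal ((D * level TYPE('a) n powr (real N - p / 4) * sqrt (nsq f))\<^sup>2)) \<and>
     (s \<le> 1 \<longrightarrow> wnorm2 (\<lambda>x. japanese_bracket x powr (- p)) (heat_moment N s f) \<le> ennreal ((D * s powr (- real N) * level TYPE('a) n powr (- p / 4) * sqrt (nsq f))\<^sup>2)) \<and>
     wnorm2 (\<lambda>x. japanese_bracket x powr (- p)) (heat_moment N s f) \<le> ennreal ((D * s powr (- real N) * sqrt (nsq f))\<^sup>2)"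
proof -
  let ?w = "\<lambda>x::'a. japanese_bracket x powr (- p)"
  let ?m = "gaussian_mass TYPE('a)"
  define Kg :: "'a \<Rightarrow> complex" where "Kg = (\<lambda>x. (1 / of_real ?m) * gaussian x)"
  have Kg: "Kg \<in> schwartz" unfolding Kg_def by (rule schwartz_scale[OF gaussian_schwartz])
  have Kg_FT: "FT Kg (- \<xi>) = gaussian \<xi>" for \<xi>
    unfolding Kg_def FT_scale FT_gaussian gaussian_even using gaussian_mass_pos[where 'a='a] by simp
  have g0: "gaussian \<in> (eigen 0 :: ('a \<Rightarrow> complex) set)" using gaussian_eigen[where 'a='a] by (simp add: eigen_def level_def)
  have es0: "eigen_sum (level TYPE('a) 0) (level TYPE('a) 0) (sqrt (nsq (gaussian :: 'a \<Rightarrow> complex))) (gaussian :: 'a \<Rightarrow> complex)"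
    using nsq_gaussian_pos[where 'a='a] by (intro eigen_sum.single[OF g0]) auto
  obtain M where bdM: "M > 0 \<and> (\<forall>c u B h. eigen_sum c u B (h :: 'a \<Rightarrow> complex) \<longrightarrow>
    eigen_sum (c / 9 ^ N) (9 ^ N * u) (M * u ^ N * B) (\<lambda>x. of_real (((norm x)\<^sup>2) ^ N) * h x))"
    using eigen_sum_moment[of N, where 'a='a] by (rule exE)
  note M = conjunct1[OF bdM] bdM[THEN conjunct2, rule_format]
  obtain K0 :: "'a \<Rightarrow> complex" where K0: "K0 \<in> schwartz" "\<And>\<xi>. FT K0 (- \<xi>) = of_real (((norm \<xi>)\<^sup>2) ^ N) * gaussian \<xi>"
    using eigen_sum_FT[OF M(2)[OF es0]] by blast
  obtain Q where bdQ: "Q > 0 \<and> (\<forall>c u B h r. eigen_sum c u B h \<longrightarrow> 0 < c \<longrightarrow> 0 \<le> r \<longrightarrow> r \<le> 2 \<longrightarrow>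
    wnorm2 ?w (FT (\<lambda>\<xi>. FT Kg (- (r *\<^sub>R \<xi>)) * h \<xi>)) \<le> ennreal ((Q * c powr (- p / 4) * B)\<^sup>2))"
    using eigen_sum_multiplier_bound[OF Kg p] by (rule exE)
  note Q = conjunct1[OF bdQ] bdQ[THEN conjunct2, rule_format]
  obtain Q0 where bdQ0: "Q0 > 0 \<and> (\<forall>c u B h r. eigen_sum c u B h \<longrightarrow> 0 < c \<longrightarrow> 0 \<le> r \<longrightarrow> r \<le> 2 \<longrightarrow>
    wnorm2 ?w (FT (\<lambda>\<xi>. FT K0 (- (r *\<^sub>R \<xi>)) * h \<xi>)) \<le> ennreal ((Q0 * c powr (- p / 4) * B)\<^sup>2))"
    using eigen_sum_multiplier_bound[OF K0(1) p] by (rule exE)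
  note Q0 = conjunct1[OF bdQ0] bdQ0[THEN conjunct2, rule_format]
  obtain C0 where bdC0: "C0 > 0 \<and> (\<forall>n. \<forall>f\<in>eigen n. \<forall>r. (0 \<le> r \<longrightarrow> r \<le> 2 \<longrightarrow> (\<forall>p. 0 \<le> p \<longrightarrow> p \<le> 1 \<longrightarrow>
       wnorm2 (\<lambda>x. japanese_bracket x powr (- p)) (FT (\<lambda>\<xi>. FT K0 (- (r *\<^sub>R \<xi>)) * f \<xi>)) \<le> ennreal (C0 * weighted (- p) f))) \<and>
     wnorm2 (\<lambda>x. 1) (FT (\<lambda>\<xi>. FT K0 (- (r *\<^sub>R \<xi>)) * f \<xi>)) \<le> ennreal (C0 * nsq f))"
    using multiplier_bound[OF K0(1)] by (rule exE)
  note C0 = conjunct1[OF bdC0] bdC0[THEN conjunct2, rule_format, THEN conjunct2]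
  define D where "D = Q * (1 / 9 ^ N) powr (- p / 4) * M + Q0 + sqrt C0"
  have D: "D > 0" "Q * (1 / 9 ^ N) powr (- p / 4) * M \<le> D" "Q0 \<le> D" "sqrt C0 \<le> D"
    unfolding D_def using Q(1) Q0(1) C0(1) M(1) by (auto simp: add_pos_pos)
  have mono: "ennreal (X\<^sup>2) \<le> ennreal (Y\<^sup>2)" if "0 \<le> X" "X \<le> Y" for X Y :: real
    using that by (intro ennreal_leI power_mono)
  show ?thesis
  proof (intro exI[of _ D] conjI D(1) allI ballI impI)
    fix n and s :: real and f :: "'a \<Rightarrow> complex" assume f: "f \<in> eigen n" and s: "0 < s" and nf: "0 < nsq f" and s1: "s \<le> 1"
    let ?l = "level TYPE('a) n"
    have l: "?l > 0" by (rule level_pos)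
    \<comment> \<open>The dilation for which \<open>gaussian (r \<xi>) = e\<^sup>-\<^sup>s\<^sup>|\<^sup>\<xi>\<^sup>|\<^sup>2\<close>; for \<open>s \<le> 1\<close> it is at most \<open>2\<close>.\<close>
    define r where "r = sqrt (2 * s)"
    have r: "0 \<le> r" "r \<le> 2" "r\<^sup>2 = 2 * s" using s s1 by (auto simp: r_def intro: real_le_lsqrt)
    have g: "gaussian (r *\<^sub>R \<xi>) = of_real (exp (- s * (norm \<xi>)\<^sup>2))" for \<xi> :: 'a
      unfolding gaussian_def by (simp add: power_mult_distrib r(3))
    have es: "eigen_sum ?l ?l (sqrt (nsq f)) f" using nf by (intro eigen_sum.single[OF f]) auto
    have "heat_moment N s f = FT (\<lambda>\<xi>. FT Kg (- (r *\<^sub>R \<xi>)) * (of_real (((norm \<xi>)\<^sup>2) ^ N) * f \<xi>))"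
      unfolding heat_moment_def Kg_FT g by (simp add: mult_ac)
    then have "wnorm2 ?w (heat_moment N s f) \<le> ennreal ((Q * (?l / 9 ^ N) powr (- p / 4) * (M * ?l ^ N * sqrt (nsq f)))\<^sup>2)"
      using Q(2)[OF M(2)[OF es] _ r(1,2)] l by simp
    also have "Q * (?l / 9 ^ N) powr (- p / 4) * (M * ?l ^ N * sqrt (nsq f)) = (Q * (1 / 9 ^ N) powr (- p / 4) * M) * ?l powr (real N - p / 4) * sqrt (nsq f)"
    proof -
      have "(?l / 9 ^ N) powr (- p / 4) = ?l powr (- p / 4) * (1 / 9 ^ N) powr (- p / 4)"
        using l powr_mult[of ?l "1 / 9 ^ N" "- p / 4"] by simp
      moreover have "?l powr (real N - p / 4) = ?l ^ N * ?l powr (- p / 4)"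
        using l powr_add[of ?l "real N" "- p / 4"] by (simp add: powr_realpow)
      ultimately show ?thesis by (simp only: mult_ac)
    qed
    also have "ennreal (((Q * (1 / 9 ^ N) powr (- p / 4) * M) * ?l powr (real N - p / 4) * sqrt (nsq f))\<^sup>2) \<le> ennreal ((D * ?l powr (real N - p / 4) * sqrt (nsq f))\<^sup>2)"
      using Q(1) M(1) by (intro mono mult_right_mono D) auto
    finally show "wnorm2 ?w (heat_moment N s f) \<le> ennreal ((D * ?l powr (real N - p / 4) * sqrt (nsq f))\<^sup>2)" .
  next
    fix n and s :: real and f :: "'a \<Rightarrow> complex" assume f: "f \<in> eigen n" and s: "0 < s" and nf: "0 < nsq f"
    let ?l = "level TYPE('a) n"
    have l: "?l > 0" by (rule level_pos)
    define r where "r = sqrt (2 * s)"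
    have r: "0 \<le> r" "r\<^sup>2 = 2 * s" using s by (auto simp: r_def)
    have g: "gaussian (r *\<^sub>R \<xi>) = of_real (exp (- s * (norm \<xi>)\<^sup>2))" for \<xi> :: 'a
      unfolding gaussian_def by (simp add: power_mult_distrib r(2))
    have K0r: "FT K0 (- (r *\<^sub>R \<xi>)) = of_real ((2 * s) ^ N) * of_real (((norm \<xi>)\<^sup>2) ^ N * exp (- s * (norm \<xi>)\<^sup>2))" for \<xi>
      unfolding K0(2) g using r by (simp add: power_mult_distrib)
    let ?G = "FT (\<lambda>\<xi>. FT K0 (- (r *\<^sub>R \<xi>)) * f \<xi>)"
    note [measurable] = schwartz_measurable[OF eigen_schwartz[OF f]] FT_measurable[OF schwartz_measurable[OF K0(1)]]
    have Gm [measurable]: "?G \<in> borel_measurable borel" by (rule FT_measurable) measurable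
    have "?G = (\<lambda>x. of_real ((2 * s) ^ N) * heat_moment N s f x)"
      unfolding heat_moment_def FT_scale[symmetric] K0r by (simp only: mult.assoc)
    then have hm: "heat_moment N s f = (\<lambda>x. of_real (1 / (2 * s) ^ N) * ?G x)" using s by (simp add: fun_eq_iff)
    have c: "1 / (2 * s) ^ N \<le> s powr (- real N)"
    proof -
      have "s ^ N \<le> (2 * s) ^ N" using s by (intro power_mono) auto
      then have "1 / (2 * s) ^ N \<le> 1 / s ^ N" using s by (intro divide_left_mono) auto
      then show ?thesis using s by (simp add: powr_minus powr_realpow inverse_eq_divide)
    qed
    have sc: "wnorm2 \<omega> (heat_moment N s f) \<le> ennreal ((s powr (- real N) * X)\<^sup>2)"
      if "wnorm2 \<omega> ?G \<le> ennreal (X\<^sup>2)" "0 \<le> X" "\<omega> \<in> borel_measurable borel" "\<And>x. 0 \<le> \<omega> x" for \<omega> X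
    proof -
      have "wnorm2 \<omega> (heat_moment N s f) = ennreal ((1 / (2 * s) ^ N)\<^sup>2) * wnorm2 \<omega> ?G"
        unfolding hm by (subst wnorm2_scale[OF Gm that(3,4)]) (use s in \<open>simp only: norm_of_real power2_abs\<close>)
      also have "\<dots> \<le> ennreal ((1 / (2 * s) ^ N)\<^sup>2) * ennreal (X\<^sup>2)" by (intro mult_left_mono that) simp
      also have "\<dots> = ennreal ((1 / (2 * s) ^ N * X)\<^sup>2)" using s by (simp only: ennreal_mult[symmetric] zero_le_power2 power_mult_distrib)
      also have "\<dots> \<le> ennreal ((s powr (- real N) * X)\<^sup>2)" using s that(2) by (intro mono mult_right_mono c) auto
      finally show ?thesis .
    qed
    {
      assume s1: "s \<le> 1"
      have r2: "r \<le> 2" using s s1 by (auto simp: r_def intro: real_le_lsqrt)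
      have es: "eigen_sum ?l ?l (sqrt (nsq f)) f" using nf by (intro eigen_sum.single[OF f]) auto
      have "wnorm2 ?w (heat_moment N s f) \<le> ennreal ((s powr (- real N) * (Q0 * ?l powr (- p / 4) * sqrt (nsq f)))\<^sup>2)"
        by (rule sc[OF Q0(2)[OF es l r(1) r2]]) (use Q0(1) in auto)
      also have "\<dots> \<le> ennreal ((D * s powr (- real N) * ?l powr (- p / 4) * sqrt (nsq f))\<^sup>2)"
      proof (rule mono)
        have "Q0 * (s powr (- real N) * ?l powr (- p / 4) * sqrt (nsq f)) \<le> D * (s powr (- real N) * ?l powr (- p / 4) * sqrt (nsq f))"
          by (intro mult_right_mono D) auto
        then show "s powr (- real N) * (Q0 * ?l powr (- p / 4) * sqrt (nsq f)) \<le> D * s powr (- real N) * ?l powr (- p / 4) * sqrt (nsq f)"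
          by (simp only: mult_ac)
      qed (use Q0(1) in auto)
      finally show "wnorm2 ?w (heat_moment N s f) \<le> ennreal ((D * s powr (- real N) * ?l powr (- p / 4) * sqrt (nsq f))\<^sup>2)" .
    }
    have "wnorm2 ?w ?G \<le> wnorm2 (\<lambda>x. 1) ?G"
    proof -
      have "japanese_bracket x powr (- p) \<le> 1" for x :: 'a
        using powr_mono[of "- p" 0 "japanese_bracket x"] p japanese_bracket_ge_1[of x] by simp
      then show ?thesis unfolding wnorm2_def by (intro nn_integral_mono ennreal_leI mult_right_mono) auto
    qed
    also have "\<dots> \<le> ennreal ((sqrt C0 * sqrt (nsq f))\<^sup>2)" using C0(2)[OF f] C0(1) by (simp add: power_mult_distrib)
    finally have "wnorm2 ?w (heat_moment N s f) \<le> ennreal ((s powr (- real N) * (sqrt C0 * sqrt (nsq f)))\<^sup>2)"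
      by (rule sc) (use C0(1) in auto)
    also have "\<dots> \<le> ennreal ((D * s powr (- real N) * sqrt (nsq f))\<^sup>2)"
    proof (rule mono)
      have "sqrt C0 * (s powr (- real N) * sqrt (nsq f)) \<le> D * (s powr (- real N) * sqrt (nsq f))" by (intro mult_right_mono D) auto
      then show "s powr (- real N) * (sqrt C0 * sqrt (nsq f)) \<le> D * s powr (- real N) * sqrt (nsq f)" by (simp only: mult_ac)
    qed (use C0(1) in auto)
    finally show "wnorm2 ?w (heat_moment N s f) \<le> ennreal ((D * s powr (- real N) * sqrt (nsq f))\<^sup>2)" .
  qed
qed

lemma nn_integral_powr_from_0:
  assumes "a > -1" "c \<ge> (0::real)"
  shows "(\<integral>\<^sup>+s. ennreal (indicator {0..c} s * s powr a) \<partial>lborel) = ennreal (c powr (a + 1) / (a + 1))"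
  by (rule nn_integral_has_integral_lebesgue[OF _ has_integral_powr_from_0[OF assms]]) simp

lemma nn_integral_powr_to_inf:
  assumes "e < -1" "c > (0::real)"
  shows "(\<integral>\<^sup>+s. ennreal (indicator {c..} s * s powr e) \<partial>lborel) = ennreal (- (c powr (e + 1)) / (e + 1))"
  by (rule nn_integral_has_integral_lebesgue[OF _ has_integral_powr_to_inf[OF assms]]) simp

text \<open>
  The three regimes of \<open>heat_moment_bounds\<close> are integrated against \<open>s\<^sup>\<beta>\<^sup>-\<^sup>1 ds\<close>. The first is used up to
  \<open>s = 1/l\<close>, the second up to \<open>1\<close>, the third beyond. The first two balance at \<open>s = 1/l\<close> and each
  contributes \<open>l\<^sup>a\<^sup>/\<^sup>2\<^sup>-\<^sup>p\<^sup>/\<^sup>4\<close>; the third contributes a constant.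
\<close>
lemma fractional_laplacian_bound:
  fixes a p :: real and N :: nat
  assumes a: "0 < a" "a < 2 * real N" and p: "0 < p" "p < 1"
  shows "\<exists>C>0. \<forall>n. \<forall>f\<in>(eigen n :: ('a::euclidean_space \<Rightarrow> complex) set).
    wnorm2 (\<lambda>x. japanese_bracket x powr (- p)) (FT (\<lambda>\<xi>. of_real (norm \<xi> powr a) * f \<xi>))
      \<le> ennreal ((C * (level TYPE('a) n powr (a / 2 - p / 4) + 1) * sqrt (nsq f))\<^sup>2)"
proof -
  obtain D where bdD: "D > 0 \<and> (\<forall>n. \<forall>f\<in>(eigen n :: ('a \<Rightarrow> complex) set). \<forall>s>0. 0 < nsq f \<longrightarrow>
     (s \<le> 1 \<longrightarrow> wnorm2 (\<lambda>x. japanese_bracket x powr (- p)) (heat_moment N s f) \<le> ennreal ((D * level TYPE('a) n powr (real N - p / 4) * sqrt (nsq f))\<^sup>2)) \<and>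
     (s \<le> 1 \<longrightarrow> wnorm2 (\<lambda>x. japanese_bracket x powr (- p)) (heat_moment N s f) \<le> ennreal ((D * s powr (- real N) * level TYPE('a) n powr (- p / 4) * sqrt (nsq f))\<^sup>2)) \<and>
     wnorm2 (\<lambda>x. japanese_bracket x powr (- p)) (heat_moment N s f) \<le> ennreal ((D * s powr (- real N) * sqrt (nsq f))\<^sup>2))"
    using heat_moment_bounds[OF p] by (rule exE)
  note D = conjunct1[OF bdD]
  note Dall = bdD[THEN conjunct2, rule_format]
  define \<beta> where "\<beta> = real N - a / 2"
  have \<beta>: "\<beta> > 0" using a by (simp add: \<beta>_def)
  have \<Gamma>: "Gamma \<beta> > 0" by (rule Gamma_real_pos[OF \<beta>])
  \<comment> \<open>The values of the integrals of \<open>s\<^sup>\<beta>\<^sup>-\<^sup>1\<close> near \<open>0\<close> and of \<open>s\<^sup>-\<^sup>a\<^sup>/\<^sup>2\<^sup>-\<^sup>1\<close> near infinity, up to powers of \<open>l\<close>.\<close>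
  define K where "K = 1 / \<beta> + 2 / a"
  have K: "K > 0" "2 / a \<le> K" using \<beta> a by (auto simp: K_def add_pos_pos)
  define C where "C = D * K / Gamma \<beta>"
  have C: "C > 0" using D K \<Gamma> by (simp add: C_def)
  show ?thesis
  proof (intro exI[of _ C] conjI C allI ballI)
    fix n and f :: "'a \<Rightarrow> complex" assume f: "f \<in> eigen n"
    note S = eigen_schwartz[OF f]
    note [measurable] = schwartz_measurable[OF S]
    define l where "l = level TYPE('a) n"
    have l: "l > 0" "l \<ge> 1" unfolding l_def by (rule level_pos)+
    define g where "g = FT (\<lambda>\<xi>. of_real (norm \<xi> powr a) * f \<xi>)"
    let ?w = "\<lambda>x::'a. japanese_bracket x powr (- p)"
    have "wnorm2 ?w g \<le> ennreal ((C * (l powr (a / 2 - p / 4) + 1) * sqrt (nsq f))\<^sup>2)"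
    proof (cases "nsq f = 0")
      case True
      then have "f = (\<lambda>x. 0)" using nsq_eq_0[OF S] by auto
      then have "g = (\<lambda>x. 0)" by (simp add: g_def FT_def fun_eq_iff)
      then show ?thesis by (simp add: wnorm2_def)
    next
      case False
      then have nf: "0 < nsq f" using nsq_nonneg[of f] by linarith
      define F where "F = sqrt (nsq f)"
      have F: "F > 0" using nf by (simp add: F_def)
      note DD = Dall[OF f _ nf, folded F_def l_def]
      define \<Phi> where "\<Phi> s x = japanese_bracket x powr (- (p / 2)) * (indicator {0..} s * (s powr (\<beta> - 1) * cmod (heat_moment N s f x)))" for s and x :: 'a
      \<comment> \<open>One function majorises all three regimes: its terms are nonnegative, so the ranges of the second and
        third may overlap.\<close>
      define \<theta> where "\<theta> s = D * F * (l powr (real N - p / 4) * (indicator {0..1/l} s * s powr (\<beta> - 1)) + l powr (- p / 4) * (indicator {1/l..} s * s powr (- (a / 2) - 1)) + indicator {1..} s * s powr (- (a / 2) - 1))" for s :: real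
      have hm [measurable]: "(\<lambda>(s, x). heat_moment N s f x) \<in> borel_measurable (lborel \<Otimes>\<^sub>M lborel)"
        by (rule heat_moment_measurable) measurable
      have hmx [measurable]: "(\<lambda>s. heat_moment N s f x) \<in> borel_measurable borel" for x
        using measurable_compose[OF measurable_Pair2'[of x lborel lborel] hm] by simp
      have hms [measurable]: "heat_moment N s f \<in> borel_measurable borel" for s
        using measurable_compose[OF measurable_Pair1'[of s lborel lborel] hm] by simp
      have \<Phi>m: "(\<lambda>(s, x). \<Phi> s x) \<in> borel_measurable (lborel \<Otimes>\<^sub>M lborel)"
        unfolding \<Phi>_def by measurable
      have \<theta>m [measurable]: "\<theta> \<in> borel_measurable borel" unfolding \<theta>_def[abs_def] by measurable
      have \<Phi>0: "0 \<le> \<Phi> s x" for s x by (simp add: \<Phi>_def)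
      have \<theta>0: "0 \<le> \<theta> s" for s using D F by (simp add: \<theta>_def)
      have \<Phi>neg: "\<Phi> s x = 0" if "s \<le> 0" for s x using that by (cases "s = 0") (auto simp: \<Phi>_def)
      have \<theta>bd: "D * F * (l powr (real N - p / 4) * s powr (\<beta> - 1)) \<le> \<theta> s" if "0 < s" "s \<le> 1 / l" for s
        unfolding \<theta>_def using that D F by (intro mult_left_mono) auto
      have \<theta>bd2: "D * F * (l powr (- p / 4) * s powr (- (a / 2) - 1)) \<le> \<theta> s" if "0 < s" "1 / l \<le> s" for s
        unfolding \<theta>_def using that D F by (intro mult_left_mono) auto
      have \<theta>bd3: "D * F * s powr (- (a / 2) - 1) \<le> \<theta> s" if "1 \<le> s" for s
        unfolding \<theta>_def using that D F by (intro mult_left_mono) auto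
      have z: "\<Phi> s x = 0" if "\<theta> s = 0" for s x
      proof (rule \<Phi>neg, rule ccontr)
        assume s: "\<not> s \<le> 0"
        have "0 < D * F * (l powr (real N - p / 4) * s powr (\<beta> - 1))" "0 < D * F * (l powr (- p / 4) * s powr (- (a / 2) - 1))" using D F l s by auto
        then show False using \<theta>bd[of s] \<theta>bd2[of s] that s by (cases "s \<le> 1 / l") auto
      qed
      have le: "(\<integral>\<^sup>+x. ennreal ((\<Phi> s x)\<^sup>2) \<partial>lborel) \<le> ennreal ((\<theta> s)\<^sup>2)" for s
      proof (cases "s \<le> 0")
        case True
        then show ?thesis using \<Phi>neg[OF True] by simp
      next
        case False
        then have s: "0 < s" by simp
        have sN: "s powr (\<beta> - 1) * s powr (- real N) = s powr (- (a / 2) - 1)"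
          by (simp only: powr_add[symmetric]) (simp add: \<beta>_def)
        have J: "(japanese_bracket x powr (- (p / 2)))\<^sup>2 = japanese_bracket x powr (- p)" for x :: 'a
          by (simp add: power2_eq_square powr_add[symmetric])
        have "(\<integral>\<^sup>+x. ennreal ((\<Phi> s x)\<^sup>2) \<partial>lborel) = (\<integral>\<^sup>+x. ennreal ((s powr (\<beta> - 1))\<^sup>2) * ennreal (?w x * (cmod (heat_moment N s f x))\<^sup>2) \<partial>lborel)"
          using s by (intro nn_integral_cong) (simp add: \<Phi>_def power_mult_distrib J ennreal_mult[symmetric] mult_ac)
        also have "\<dots> = ennreal ((s powr (\<beta> - 1))\<^sup>2) * wnorm2 ?w (heat_moment N s f)"
          unfolding wnorm2_def by (rule nn_integral_cmult) measurable
        finally have eq: "(\<integral>\<^sup>+x. ennreal ((\<Phi> s x)\<^sup>2) \<partial>lborel) = ennreal ((s powr (\<beta> - 1))\<^sup>2) * wnorm2 ?w (heat_moment N s f)" .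
        have fin: "?thesis" if "wnorm2 ?w (heat_moment N s f) \<le> ennreal (X\<^sup>2)" "0 \<le> X" "s powr (\<beta> - 1) * X \<le> \<theta> s" for X
        proof -
          have "ennreal ((s powr (\<beta> - 1))\<^sup>2) * wnorm2 ?w (heat_moment N s f) \<le> ennreal ((s powr (\<beta> - 1))\<^sup>2) * ennreal (X\<^sup>2)"
            by (intro mult_left_mono that) simp
          also have "\<dots> = ennreal ((s powr (\<beta> - 1) * X)\<^sup>2)" by (simp only: ennreal_mult[symmetric] zero_le_power2 power_mult_distrib)
          also have "\<dots> \<le> ennreal ((\<theta> s)\<^sup>2)" using that by (intro ennreal_leI power_mono) auto
          finally show ?thesis unfolding eq .
        qed
        consider "s \<le> 1 / l" | "1 / l \<le> s" "s \<le> 1" | "1 \<le> s" by linarith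
        then show ?thesis
        proof cases
          case 1
          have "1 / l \<le> 1" using l by simp
          then have s1: "s \<le> 1" using 1 by linarith
          have "s powr (\<beta> - 1) * (D * l powr (real N - p / 4) * F) = D * F * (l powr (real N - p / 4) * s powr (\<beta> - 1))" by (simp only: mult_ac)
          then have "s powr (\<beta> - 1) * (D * l powr (real N - p / 4) * F) \<le> \<theta> s" by (rule ord_eq_le_trans) (rule \<theta>bd[OF s 1])
          then show ?thesis using DD[OF s] s1 D F by (intro fin[of "D * l powr (real N - p / 4) * F"]) auto
        next
          case 2
          have "s powr (\<beta> - 1) * (D * s powr (- real N) * l powr (- p / 4) * F) = D * F * (l powr (- p / 4) * (s powr (\<beta> - 1) * s powr (- real N)))" by (simp only: mult_ac)
          then have "s powr (\<beta> - 1) * (D * s powr (- real N) * l powr (- p / 4) * F) \<le> \<theta> s" unfolding sN by (rule ord_eq_le_trans) (rule \<theta>bd2[OF s 2(1)])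
          then show ?thesis using DD[OF s] 2 D F by (intro fin[of "D * s powr (- real N) * l powr (- p / 4) * F"]) auto
        next
          case 3
          have "s powr (\<beta> - 1) * (D * s powr (- real N) * F) = D * F * (s powr (\<beta> - 1) * s powr (- real N))" by (simp only: mult_ac)
          then have "s powr (\<beta> - 1) * (D * s powr (- real N) * F) \<le> \<theta> s" unfolding sN by (rule ord_eq_le_trans) (rule \<theta>bd3[OF 3])
          then show ?thesis using DD[OF s] D F by (intro fin[of "D * s powr (- real N) * F"]) auto
        qed
      qed
      let ?E = "D * F * (K * (l powr (a / 2 - p / 4) + 1))"
      have \<theta>int: "(\<integral>\<^sup>+s. ennreal (\<theta> s) \<partial>lborel) \<le> ennreal ?E"
      proof -
        let ?P = "\<lambda>s. indicator {0..1/l} s * s powr (\<beta> - 1) :: real" and ?Q = "\<lambda>s. indicator {1/l..} s * s powr (- (a / 2) - 1) :: real" and ?R = "\<lambda>s. indicator {1..} s * s powr (- (a / 2) - 1) :: real"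
        have iP: "(\<integral>\<^sup>+s. ennreal (?P s) \<partial>lborel) = ennreal ((1 / l) powr \<beta> / \<beta>)"
          using nn_integral_powr_from_0[of "\<beta> - 1" "1 / l"] \<beta> l by simp
        have iQ: "(\<integral>\<^sup>+s. ennreal (?Q s) \<partial>lborel) = ennreal (2 / a * (1 / l) powr (- (a / 2)))"
          using nn_integral_powr_to_inf[of "- (a / 2) - 1" "1 / l"] a l by (simp add: mult.commute)
        have iR: "(\<integral>\<^sup>+s. ennreal (?R s) \<partial>lborel) = ennreal (2 / a)"
          using nn_integral_powr_to_inf[of "- (a / 2) - 1" 1] a by simp
        have "(\<integral>\<^sup>+s. ennreal (\<theta> s) \<partial>lborel) = (\<integral>\<^sup>+s. ennreal (D * F) * (ennreal (l powr (real N - p / 4)) * ennreal (?P s) + ennreal (l powr (- p / 4)) * ennreal (?Q s) + ennreal (?R s)) \<partial>lborel)"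
          unfolding \<theta>_def using D F by (intro nn_integral_cong) (simp add: ennreal_mult ennreal_plus)
        also have "\<dots> = ennreal (D * F) * (ennreal (l powr (real N - p / 4)) * ennreal ((1 / l) powr \<beta> / \<beta>) + ennreal (l powr (- p / 4)) * ennreal (2 / a * (1 / l) powr (- (a / 2))) + ennreal (2 / a))"
          by (simp add: nn_integral_cmult nn_integral_add iP iQ iR)
        also have "\<dots> = ennreal (D * F * (l powr (real N - p / 4) * ((1 / l) powr \<beta> / \<beta>) + l powr (- p / 4) * (2 / a * (1 / l) powr (- (a / 2))) + 2 / a))"
          proof -
          have nn: "0 \<le> D * F" "0 \<le> (1 / l) powr \<beta> / \<beta>" "0 \<le> 2 / a" using D F \<beta> a by auto
          show ?thesis by (simp only: ennreal_mult'[OF powr_ge_zero, symmetric] ennreal_plus[symmetric] ennreal_mult'[OF nn(1), symmetric] mult_nonneg_nonneg add_nonneg_nonneg powr_ge_zero nn)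
        qed
        also have "\<dots> \<le> ennreal ?E"
        proof (intro ennreal_leI mult_left_mono)
          have e1: "l powr (real N - p / 4) * (1 / l) powr \<beta> = l powr (a / 2 - p / 4)"
          proof -
            have "(1 / l) powr \<beta> = l powr (- \<beta>)" using l by (simp add: powr_divide powr_minus_divide)
            then have "l powr (real N - p / 4) * (1 / l) powr \<beta> = l powr (real N - p / 4 + - \<beta>)" by (simp only: powr_add)
            then show ?thesis by (simp add: \<beta>_def)
          qed
          have e2: "l powr (- p / 4) * (1 / l) powr (- (a / 2)) = l powr (a / 2 - p / 4)"
          proof -
            have "(1 / l) powr (- (a / 2)) = l powr (a / 2)" using l by (simp add: powr_divide powr_minus_divide)
            then have "l powr (- p / 4) * (1 / l) powr (- (a / 2)) = l powr (- p / 4 + a / 2)" by (simp only: powr_add)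
            then show ?thesis by simp
          qed
          have "l powr (real N - p / 4) * ((1 / l) powr \<beta> / \<beta>) + l powr (- p / 4) * (2 / a * (1 / l) powr (- (a / 2))) + 2 / a =
            (l powr (real N - p / 4) * (1 / l) powr \<beta>) * (1 / \<beta>) + (l powr (- p / 4) * (1 / l) powr (- (a / 2))) * (2 / a) + 2 / a" by simp
          also have "\<dots> = l powr (a / 2 - p / 4) * K + 2 / a" unfolding e1 e2 K_def by (simp add: distrib_left)
          also have "\<dots> \<le> K * (l powr (a / 2 - p / 4) + 1)" using K by (simp add: algebra_simps)
          finally show "l powr (real N - p / 4) * ((1 / l) powr \<beta> / \<beta>) + l powr (- p / 4) * (2 / a * (1 / l) powr (- (a / 2))) + 2 / a \<le> K * (l powr (a / 2 - p / 4) + 1)" .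
        qed (use D F in auto)
        finally show ?thesis .
      qed
      have pt: "ennreal (?w x * (cmod (g x))\<^sup>2) \<le> ennreal ((1 / Gamma \<beta>)\<^sup>2) * (\<integral>\<^sup>+s. ennreal (\<Phi> s x) \<partial>lborel)\<^sup>2" for x
      proof -
        have J: "(japanese_bracket x powr (- (p / 2)))\<^sup>2 = japanese_bracket x powr (- p)"
          by (simp add: power2_eq_square powr_add[symmetric])
        have "ennreal (japanese_bracket x powr (- (p / 2))) * ennreal (Gamma \<beta> * cmod (g x)) \<le>
           ennreal (japanese_bracket x powr (- (p / 2))) * (\<integral>\<^sup>+s. ennreal (indicator {0..} s * (s powr (\<beta> - 1) * cmod (heat_moment N s f x))) \<partial>lborel)"
          unfolding g_def \<beta>_def by (intro mult_left_mono fractional_subordination[OF S a]) simp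
        also have "\<dots> = (\<integral>\<^sup>+s. ennreal (\<Phi> s x) \<partial>lborel)"
          unfolding \<Phi>_def by (subst nn_integral_cmult[symmetric]) (auto simp: ennreal_mult)
        finally have "(ennreal (japanese_bracket x powr (- (p / 2)) * (Gamma \<beta> * cmod (g x))))\<^sup>2 \<le> (\<integral>\<^sup>+s. ennreal (\<Phi> s x) \<partial>lborel)\<^sup>2"
          using \<Gamma> by (intro power_mono) (simp_all add: ennreal_mult)
        then have "ennreal ((1 / Gamma \<beta>)\<^sup>2) * (ennreal (japanese_bracket x powr (- (p / 2)) * (Gamma \<beta> * cmod (g x))))\<^sup>2 \<le> ennreal ((1 / Gamma \<beta>)\<^sup>2) * (\<integral>\<^sup>+s. ennreal (\<Phi> s x) \<partial>lborel)\<^sup>2"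
          by (rule mult_left_mono) simp
        moreover have "ennreal ((1 / Gamma \<beta>)\<^sup>2) * (ennreal (japanese_bracket x powr (- (p / 2)) * (Gamma \<beta> * cmod (g x))))\<^sup>2 = ennreal (?w x * (cmod (g x))\<^sup>2)"
        proof -
          have "(1 / Gamma \<beta>)\<^sup>2 * (japanese_bracket x powr (- (p / 2)) * (Gamma \<beta> * cmod (g x)))\<^sup>2 = ?w x * (cmod (g x))\<^sup>2"
            using \<Gamma> by (simp add: power_mult_distrib J power_one_over)
          then show ?thesis using \<Gamma> by (simp add: ennreal_power ennreal_mult[symmetric] del: power_mult_distrib)
        qed
        ultimately show ?thesis by simp
      qed
      have "wnorm2 ?w g \<le> (\<integral>\<^sup>+x. ennreal ((1 / Gamma \<beta>)\<^sup>2) * (\<integral>\<^sup>+s. ennreal (\<Phi> s x) \<partial>lborel)\<^sup>2 \<partial>lborel)"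
        unfolding wnorm2_def by (intro nn_integral_mono pt)
      also have "\<dots> = ennreal ((1 / Gamma \<beta>)\<^sup>2) * (\<integral>\<^sup>+x. (\<integral>\<^sup>+s. ennreal (\<Phi> s x) \<partial>lborel)\<^sup>2 \<partial>lborel)"
      proof (rule nn_integral_cmult)
        have "(\<lambda>x. \<integral>\<^sup>+s. ennreal (\<Phi> s x) \<partial>lborel) \<in> borel_measurable lborel"
          unfolding \<Phi>_def by measurable
        then show "(\<lambda>x. (\<integral>\<^sup>+s. ennreal (\<Phi> s x) \<partial>lborel)\<^sup>2) \<in> borel_measurable lborel" by measurable
      qed
      also have "\<dots> \<le> ennreal ((1 / Gamma \<beta>)\<^sup>2) * (ennreal ?E)\<^sup>2"
        by (intro mult_left_mono order_trans[OF minkowski_time[OF \<Phi>m \<theta>m \<Phi>0 \<theta>0 le z] power_mono[OF \<theta>int]]) auto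
      also have "\<dots> = ennreal ((1 / Gamma \<beta> * ?E)\<^sup>2)"
        using D F K by (simp only: ennreal_power[OF _] ennreal_mult[symmetric] zero_le_power2 power_mult_distrib mult_nonneg_nonneg less_imp_le add_nonneg_nonneg powr_ge_zero zero_le_one)
      also have "1 / Gamma \<beta> * ?E = C * (l powr (a / 2 - p / 4) + 1) * F" by (simp add: C_def)
      finally show ?thesis unfolding F_def .
    qed
    then show "wnorm2 ?w (FT (\<lambda>\<xi>. of_real (norm \<xi> powr a) * f \<xi>)) \<le> ennreal ((C * (level TYPE('a) n powr (a / 2 - p / 4) + 1) * sqrt (nsq f))\<^sup>2)"
      by (simp add: g_def l_def)
  qed
qed

section \<open>Decay of Fourier integrals\<close>

text \<open>
  On the Fourier side \<open>1 - \<Delta>\<close> is multiplication by \<open>1 + |v|\<^sup>2\<close>; iterating this converts smoothness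
  into decay.
\<close>
lemma FT_one_minus_laplacian:
  fixes f :: "'a::euclidean_space \<Rightarrow> complex"
  assumes f: "f \<in> schwartz"
  shows "FT (\<lambda>x. f x + (\<Sum>b\<in>Basis. (-1) * partial_deriv b (partial_deriv b f) x)) v = of_real (1 + (norm v)\<^sup>2) * FT f v"
proof -
  have S: "partial_deriv b f \<in> schwartz" "partial_deriv b (partial_deriv b f) \<in> schwartz" if "b \<in> Basis" for b
  proof -
    show 1: "partial_deriv b f \<in> schwartz" by (rule schwartz_partial_deriv[OF f that])
    show "partial_deriv b (partial_deriv b f) \<in> schwartz" by (rule schwartz_partial_deriv[OF 1 that])
  qed
  have n: "complex_of_real ((norm v)\<^sup>2) = (\<Sum>b\<in>Basis. of_real (v \<bullet> b) * of_real (v \<bullet> b))"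
    unfolding power2_norm_eq_inner by (subst euclidean_inner) simp
  have "FT (\<lambda>x. f x + (\<Sum>b\<in>Basis. (-1) * partial_deriv b (partial_deriv b f) x)) v = FT f v + (\<Sum>b\<in>Basis. (-1) * FT (partial_deriv b (partial_deriv b f)) v)"
    by (simp only: FT_add[OF f schwartz_sum[OF schwartz_scale[OF S(2)]]] FT_sum[OF schwartz_scale[OF S(2)]] FT_scale)
  also have "\<dots> = FT f v + (\<Sum>b\<in>Basis. of_real (v \<bullet> b) * of_real (v \<bullet> b) * FT f v)"
  proof -
    have "(-1) * FT (partial_deriv b (partial_deriv b f)) v = of_real (v \<bullet> b) * of_real (v \<bullet> b) * FT f v" if b: "b \<in> Basis" for b
      unfolding FT_partial_deriv[OF S(1)[OF b] b] FT_partial_deriv[OF f b] by (simp add: algebra_simps)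
    then show ?thesis by (simp cong: sum.cong)
  qed
  finally show ?thesis unfolding of_real_add of_real_1 n by (simp add: distrib_right sum_distrib_right)
qed

lemma FT_rapidly_decreasing:
  fixes f :: "'a::euclidean_space \<Rightarrow> complex"
  assumes "f \<in> schwartz"
  shows "rapidly_decreasing (FT f)"
proof -
  have bd: "\<exists>C. \<forall>v. (1 + (norm v)\<^sup>2) ^ k * cmod (FT f v) \<le> C" for k
    using assms
  proof (induction k arbitrary: f)
    case 0
    then show ?case using FT_bounded[of f] by auto
  next
    case (Suc k)
    let ?g = "\<lambda>x. f x + (\<Sum>b\<in>Basis. (-1) * partial_deriv b (partial_deriv b f) x)"
    have "?g \<in> schwartz" by (intro schwartz_add schwartz_sum schwartz_scale schwartz_partial_deriv Suc.prems)
    from Suc.IH[OF this] obtain C where C: "\<And>v. (1 + (norm v)\<^sup>2) ^ k * cmod (FT ?g v) \<le> C" by blast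
    have "(1 + (norm v)\<^sup>2) ^ Suc k * cmod (FT f v) \<le> C" for v
    proof -
      have "cmod (FT ?g v) = (1 + (norm v)\<^sup>2) * cmod (FT f v)"
        unfolding FT_one_minus_laplacian[OF Suc.prems] norm_mult norm_of_real by (simp add: add_nonneg_nonneg)
      then show ?thesis using C[of v] by (simp add: mult_ac)
    qed
    then show ?case by blast
  qed
  show ?thesis unfolding rapidly_decreasing_def
  proof
    fix k
    obtain C where C: "\<And>v. (1 + (norm v)\<^sup>2) ^ k * cmod (FT f v) \<le> C" using bd by blast
    have "(1 + norm v) ^ k * cmod (FT f v) \<le> 2 ^ k * C" for v :: 'a
    proof -
      have "1 + norm v \<le> 2 * (1 + (norm v)\<^sup>2)"
      proof -
        have "norm v + norm v \<le> 1 + (norm v)\<^sup>2" using sum_squares_bound[of 1 "norm v"] by simp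
        moreover have "0 \<le> (norm v)\<^sup>2" "0 \<le> norm v" by simp_all
        ultimately show ?thesis unfolding mult_2 by argo
      qed
      then have "(1 + norm v) ^ k \<le> 2 ^ k * (1 + (norm v)\<^sup>2) ^ k"
        unfolding power_mult_distrib[symmetric] by (intro power_mono) auto
      then have "(1 + norm v) ^ k * cmod (FT f v) \<le> 2 ^ k * (1 + (norm v)\<^sup>2) ^ k * cmod (FT f v)" by (rule mult_right_mono) simp
      also have "\<dots> = 2 ^ k * ((1 + (norm v)\<^sup>2) ^ k * cmod (FT f v))" by (simp only: mult.assoc)
      also have "\<dots> \<le> 2 ^ k * C" by (intro mult_left_mono C) simp
      finally show ?thesis .
    qed
    then show "\<exists>C. \<forall>v. (1 + norm v) ^ k * cmod (FT f v) \<le> C" by blast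
  qed
qed

lemma rapidly_decreasing_square_integrable:
  fixes f :: "'a::euclidean_space \<Rightarrow> complex"
  assumes f: "rapidly_decreasing f" and m[measurable]: "f \<in> borel_measurable borel"
  shows "f \<in> square_integrable lborel"
proof -
  obtain C where C: "\<And>x. (1 + norm x) ^ 0 * cmod (f x) \<le> C" using rapidly_decreasingD[OF f] by metis
  have "rapidly_decreasing (\<lambda>x. f x * f x)"
    by (rule rapidly_decreasing_mult_poly[OF f, of _ C 0]) (use C in simp)
  then have "integrable lborel (\<lambda>x. cmod (f x * f x))" by (intro integrable_norm rapidly_decreasing_integrable) auto
  then show ?thesis by (simp add: square_integrable_def norm_mult power2_eq_square)
qed

lemma FT_norm_powr_square_integrable:
  fixes f :: "'a::euclidean_space \<Rightarrow> complex"
  assumes f: "f \<in> schwartz" and a: "a \<ge> 0"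
  shows "(\<lambda>\<xi>. of_real (norm \<xi> powr a) * FT f \<xi>) \<in> square_integrable lborel"
proof (rule rapidly_decreasing_square_integrable)
  have [measurable]: "FT f \<in> borel_measurable borel" by (rule FT_measurable[OF schwartz_measurable[OF f]])
  show "(\<lambda>\<xi>. of_real (norm \<xi> powr a) * FT f \<xi>) \<in> borel_measurable borel" by measurable
  show "rapidly_decreasing (\<lambda>\<xi>. of_real (norm \<xi> powr a) * FT f \<xi>)"
  proof (rule rapidly_decreasing_mult_poly[OF FT_rapidly_decreasing[OF f], of _ 1 "nat \<lceil>\<bar>a\<bar>\<rceil>"])
    fix \<xi> :: 'a
    have "norm \<xi> powr a \<le> japanese_bracket \<xi> powr a" using a by (intro powr_mono2 norm_le_japanese_bracket) auto
    also have "\<dots> \<le> (1 + norm \<xi>) ^ nat \<lceil>\<bar>a\<bar>\<rceil>" by (rule japanese_bracket_powr_le)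
    finally show "cmod (of_real (norm \<xi> powr a)) \<le> 1 * (1 + norm \<xi>) ^ nat \<lceil>\<bar>a\<bar>\<rceil>" by simp
  qed
qed

section \<open>Space-time series\<close>

abbreviation period_measure :: "real measure" where
  "period_measure \<equiv> restrict_space lborel {-pi..pi}"

abbreviation phase :: "real \<Rightarrow> real \<Rightarrow> complex" where
  "phase t l \<equiv> exp (\<i> * of_real (t * l))"

lemma period_sigma_finite: "pair_sigma_finite period_measure (lborel :: 'a::euclidean_space measure)"
proof -
  have "sigma_finite_measure period_measure" by (rule sigma_finite_measure_restrict_space[OF lborel.sigma_finite_measure_axioms]) simp
  then show ?thesis by (simp add: pair_sigma_finite_def lborel.sigma_finite_measure_axioms)
qed

text \<open>
  The interval \<open>[-\<pi>, \<pi>]\<close> contains a whole number of periods.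
\<close>
lemma phase_integral_zero:
  assumes k: "k \<noteq> (0::int)"
  shows "(\<integral>t. phase t (2 * of_int k) \<partial>period_measure) = 0"
proof -
  define c where "c = complex_of_real (2 * of_int k)"
  have c: "c \<noteq> 0" using k by (simp add: c_def)
  have "(\<integral>t. phase t (2 * of_int k) \<partial>period_measure) = (\<integral>t. indicator {-pi..pi} t *\<^sub>R exp (\<i> * (of_real t * c)) \<partial>lborel)"
    by (subst integral_restrict_space) (simp_all add: c_def)
  also have "\<dots> = exp (\<i> * (of_real pi * c)) / (\<i> * c) - exp (\<i> * (of_real (-pi) * c)) / (\<i> * c)"
  proof (rule integral_FTC_Icc)
    fix t :: real
    have cancel: "- (\<i> * (z * \<i>)) = z" for z by (simp add: mult.commute[of z])
    have "((\<lambda>z. exp (\<i> * (z * c)) / (\<i> * c)) has_field_derivative exp (\<i> * (of_real t * c))) (at (of_real t))"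
      using c by (auto intro!: derivative_eq_intros simp: cancel)
    then show "((\<lambda>t. exp (\<i> * (of_real t * c)) / (\<i> * c)) has_vector_derivative exp (\<i> * (of_real t * c))) (at t within {-pi..pi})"
      by (rule has_vector_derivative_real_field)
  qed (auto intro!: continuous_intros)
  also have "exp (\<i> * (of_real pi * c)) = exp (\<i> * (of_real (-pi) * c))"
    unfolding exp_eq by (rule exI[of _ "2 * k"]) (simp add: c_def)
  finally show ?thesis by simp
qed

text \<open>
  The products \<open>e\<^sup>i\<^sup>t\<^sup>l \<psi>(x)\<close> are orthogonal in space-time because of the time factor, for arbitrary
  \<open>\<psi>\<close>. By \<open>orthogonal_series\<close> the sum of the series is, for almost every \<open>t\<close>, the limit in \<open>L\<^sup>2\<close> of a
  subsequence of partial sums at time \<open>t\<close>. Hence its pairing with \<open>v\<close> is the sum of the pairings,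
  whenever that series converges.
\<close>
lemma spacetime_series:
  fixes \<psi> :: "nat \<Rightarrow> 'a::euclidean_space \<Rightarrow> complex" and l :: "nat \<Rightarrow> real"
  assumes \<psi>: "\<And>n. \<psi> n \<in> square_integrable lborel" and summ: "summable (\<lambda>n. l2sq lborel (\<psi> n))"
    and l: "\<And>i j. i \<noteq> j \<Longrightarrow> \<exists>k::int. k \<noteq> 0 \<and> l i - l j = 2 * of_int k"
  shows "\<exists>g. g \<in> square_integrable (period_measure \<Otimes>\<^sub>M lborel) \<and>
    l2sq (period_measure \<Otimes>\<^sub>M lborel) g \<le> 2 * pi * (\<Sum>n. l2sq lborel (\<psi> n)) \<and>
    (AE t in period_measure. (\<lambda>x. g (t, x)) \<in> square_integrable lborel \<and>
      (\<forall>v\<in>square_integrable lborel. \<forall>z. (\<lambda>n. phase t (l n) * (\<integral>x. \<psi> n x * v x \<partial>lborel)) sums z \<longrightarrow> (\<integral>x. g (t, x) * v x \<partial>lborel) = z))"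
proof -
  interpret P: pair_sigma_finite period_measure "lborel :: 'a measure" by (rule period_sigma_finite)
  let ?M = "period_measure \<Otimes>\<^sub>M (lborel :: 'a measure)"
  define \<phi> where "\<phi> n = (\<lambda>(t, x). phase t (l n) * \<psi> n x)" for n
  have ph [measurable]: "(\<lambda>t. phase t r) \<in> borel_measurable period_measure" for r
    by (rule measurable_restrict_space1) measurable
  have [measurable]: "\<psi> n \<in> borel_measurable lborel" for n using \<psi> by blast
  have \<phi>m [measurable]: "\<phi> n \<in> borel_measurable ?M" for n
    unfolding \<phi>_def by measurable
  have cphi: "cmod (\<phi> n (t, x)) = cmod (\<psi> n x)" for n t x by (simp add: \<phi>_def norm_mult)
  have "(\<integral>\<^sup>+z. ennreal ((cmod (\<phi> n z))\<^sup>2) \<partial>?M) = ennreal (2 * pi * l2sq lborel (\<psi> n))" for n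
  proof -
    have "(\<integral>\<^sup>+z. ennreal ((cmod (\<phi> n z))\<^sup>2) \<partial>?M) = (\<integral>\<^sup>+t. (\<integral>\<^sup>+x. ennreal ((cmod (\<phi> n (t, x)))\<^sup>2) \<partial>lborel) \<partial>period_measure)"
      by (rule lborel.nn_integral_fst[symmetric]) measurable
    also have "\<dots> = (\<integral>\<^sup>+t. ennreal (l2sq lborel (\<psi> n)) \<partial>period_measure)" unfolding cphi nn_integral_l2sq[OF \<psi>] ..
    also have "\<dots> = ennreal (l2sq lborel (\<psi> n)) * emeasure period_measure (space period_measure)" by simp
    also have "emeasure period_measure (space period_measure) = ennreal (2 * pi)"
      by (simp add: emeasure_restrict_space space_restrict_space)
    finally show ?thesis by (simp add: ennreal_mult[symmetric] mult_ac)
  qed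
  then have \<phi>s: "\<phi> n \<in> square_integrable ?M" and le: "l2sq ?M (\<phi> n) \<le> 2 * pi * l2sq lborel (\<psi> n)" for n
    by (auto intro!: square_integrableI_nn[of "\<phi> n" ?M "2 * pi * l2sq lborel (\<psi> n)"])
  have orth: "(\<integral>z. \<phi> i z * cnj (\<phi> j z) \<partial>?M) = 0" if ij: "i \<noteq> j" for i j
  proof -
    obtain k :: int where k: "k \<noteq> 0" "l i - l j = 2 * of_int k" using l[OF ij] by blast
    have ph2: "phase t (l i) * cnj (phase t (l j)) = phase t (2 * of_int k)" for t
      unfolding k(2)[symmetric] exp_cnj exp_add[symmetric] by (simp add: algebra_simps)
    have "(\<integral>z. \<phi> i z * cnj (\<phi> j z) \<partial>?M) = (\<integral>t. (\<integral>x. \<phi> i (t, x) * cnj (\<phi> j (t, x)) \<partial>lborel) \<partial>period_measure)"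
      by (rule P.integral_fst'[symmetric]) (rule square_integrable_mult[OF \<phi>s square_integrable_cnj[OF \<phi>s]])
    also have "\<dots> = (\<integral>t. phase t (2 * of_int k) * (\<integral>x. \<psi> i x * cnj (\<psi> j x) \<partial>lborel) \<partial>period_measure)"
    proof (rule Bochner_Integration.integral_cong[OF refl])
      fix t
      have "(\<integral>x. \<phi> i (t, x) * cnj (\<phi> j (t, x)) \<partial>lborel) = (\<integral>x. phase t (2 * of_int k) * (\<psi> i x * cnj (\<psi> j x)) \<partial>lborel)"
        unfolding ph2[symmetric] by (simp add: \<phi>_def mult_ac)
      then show "(\<integral>x. \<phi> i (t, x) * cnj (\<phi> j (t, x)) \<partial>lborel) = phase t (2 * of_int k) * (\<integral>x. \<psi> i x * cnj (\<psi> j x) \<partial>lborel)" by simp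
    qed
    also have "\<dots> = 0" by (simp only: integral_mult_left_zero phase_integral_zero[OF k(1)] mult_zero_left)
    finally show ?thesis .
  qed
  have summ2: "summable (\<lambda>n. l2sq ?M (\<phi> n))"
    by (rule summable_comparison_test'[OF summable_mult[OF summ, of "2 * pi"], of 0]) (use le in simp)
  obtain g N G where g: "g \<in> square_integrable ?M" "l2sq ?M g \<le> (\<Sum>n. l2sq ?M (\<phi> n))"
    and N: "strict_mono (N :: nat \<Rightarrow> nat)" and G: "integrable ?M G" "\<And>x. 0 \<le> G x"
    and ae: "AE z in ?M. \<forall>k. (cmod (g z - (\<Sum>i<N k. \<phi> i z)))\<^sup>2 \<le> 2 * (1 / 2) ^ k * G z"
    by (rule orthogonal_series[OF \<phi>s orth summ2], assumption, rule that; (assumption | blast))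
  have gm [measurable]: "g \<in> borel_measurable ?M" using g by blast
  have "l2sq ?M g \<le> (\<Sum>n. 2 * pi * l2sq lborel (\<psi> n))"
    using g(2) suminf_le[OF le summ2 summable_mult[OF summ]] by linarith
  then have bound: "l2sq ?M g \<le> 2 * pi * (\<Sum>n. l2sq lborel (\<psi> n))" using suminf_mult[OF summ, of "2 * pi"] by simp
  have "AE t in period_measure. (\<lambda>x. g (t, x)) \<in> square_integrable lborel \<and>
      (\<forall>v\<in>square_integrable lborel. \<forall>z. (\<lambda>n. phase t (l n) * (\<integral>x. \<psi> n x * v x \<partial>lborel)) sums z \<longrightarrow> (\<integral>x. g (t, x) * v x \<partial>lborel) = z)"
    using P.AE_pair[OF ae] P.AE_integrable_fst'[OF G(1)] AE_space
  proof eventually_elim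
    case (elim t)
    then have a: "AE x in lborel. \<forall>k. (cmod (g (t, x) - (\<Sum>i<N k. \<phi> i (t, x))))\<^sup>2 \<le> 2 * (1 / 2) ^ k * G (t, x)"
      and Gi: "integrable lborel (\<lambda>x. G (t, x))" and t: "t \<in> space period_measure" by auto
    have gt [measurable]: "(\<lambda>x. g (t, x)) \<in> borel_measurable lborel" using measurable_compose[OF measurable_Pair1'[OF t] gm] .
    define S where "S k x = (\<Sum>i<N k. phase t (l i) * \<psi> i x)" for k x
    have S: "S k \<in> square_integrable lborel" for k unfolding S_def[abs_def] by (intro square_integrable_sum square_integrable_scale \<psi>)
    have [measurable]: "S k \<in> borel_measurable lborel" for k using S by blast
    define B where "B = (\<integral>x. G (t, x) \<partial>lborel)"
    have B: "B \<ge> 0" unfolding B_def by (intro integral_nonneg_AE) (simp add: G)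
    have nn: "(\<integral>\<^sup>+x. ennreal ((cmod (g (t, x) - S k x))\<^sup>2) \<partial>lborel) \<le> ennreal (2 * (1 / 2) ^ k * B)" for k
    proof -
      have "(\<integral>\<^sup>+x. ennreal ((cmod (g (t, x) - S k x))\<^sup>2) \<partial>lborel) \<le> (\<integral>\<^sup>+x. ennreal (2 * (1 / 2) ^ k * G (t, x)) \<partial>lborel)"
        using a by (intro nn_integral_mono_AE) (auto simp: S_def \<phi>_def intro: ennreal_leI)
      also have "\<dots> = ennreal (\<integral>x. 2 * (1 / 2) ^ k * G (t, x) \<partial>lborel)"
        by (rule nn_integral_eq_integral) (use Gi G in auto)
      finally show ?thesis by (simp add: B_def)
    qed
    have D: "(\<lambda>x. g (t, x) - S k x) \<in> square_integrable lborel" "l2sq lborel (\<lambda>x. g (t, x) - S k x) \<le> 2 * (1 / 2) ^ k * B" for k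
    proof -
      have m: "(\<lambda>x. g (t, x) - S k x) \<in> borel_measurable lborel" by measurable
      show "(\<lambda>x. g (t, x) - S k x) \<in> square_integrable lborel" by (rule square_integrableI_nn(1)[OF m nn])
      show "l2sq lborel (\<lambda>x. g (t, x) - S k x) \<le> 2 * (1 / 2) ^ k * B" by (rule square_integrableI_nn(2)[OF m nn]) (use B in simp)
    qed
    have gs: "(\<lambda>x. g (t, x)) \<in> square_integrable lborel" using square_integrable_add[OF D(1)[of 0] S[of 0]] by simp
    have "(\<integral>x. g (t, x) * v x \<partial>lborel) = z"
      if v: "v \<in> square_integrable lborel" and z: "(\<lambda>n. phase t (l n) * (\<integral>x. \<psi> n x * v x \<partial>lborel)) sums z" for v z
    proof (rule LIMSEQ_unique)
      have eq: "(\<integral>x. S k x * v x \<partial>lborel) = (\<Sum>i<N k. phase t (l i) * (\<integral>x. \<psi> i x * v x \<partial>lborel))" for k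
        unfolding S_def sum_distrib_right mult.assoc
        by (subst Bochner_Integration.integral_sum) (use square_integrable_mult[OF \<psi> v] in auto)
      show "(\<lambda>k. \<integral>x. S k x * v x \<partial>lborel) \<longlonglongrightarrow> z"
        unfolding eq using LIMSEQ_subseq_LIMSEQ[OF z[unfolded sums_def] N] by (simp add: o_def)
      have "(\<lambda>k. (\<integral>x. g (t, x) * v x \<partial>lborel) - (\<integral>x. S k x * v x \<partial>lborel)) \<longlonglongrightarrow> 0"
      proof (rule Lim_null_comparison)
        have b: "norm ((\<integral>x. g (t, x) * v x \<partial>lborel) - (\<integral>x. S k x * v x \<partial>lborel)) \<le> sqrt (2 * (1 / 2) ^ k * B) * sqrt (l2sq lborel v)" for k
        proof -
          have "(\<integral>x. g (t, x) * v x \<partial>lborel) - (\<integral>x. S k x * v x \<partial>lborel) = (\<integral>x. (g (t, x) - S k x) * v x \<partial>lborel)"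
            unfolding left_diff_distrib by (rule Bochner_Integration.integral_diff[symmetric]) (rule square_integrable_mult[OF gs v], rule square_integrable_mult[OF S v])
          also have "norm \<dots> \<le> sqrt (l2sq lborel (\<lambda>x. g (t, x) - S k x)) * sqrt (l2sq lborel v)" by (rule l2_Cauchy_Schwarz[OF D(1) v])
          also have "\<dots> \<le> sqrt (2 * (1 / 2) ^ k * B) * sqrt (l2sq lborel v)" by (intro mult_right_mono real_sqrt_le_mono D(2)) simp
          finally show ?thesis .
        qed
        show "\<forall>\<^sub>F k in sequentially. norm ((\<integral>x. g (t, x) * v x \<partial>lborel) - (\<integral>x. S k x * v x \<partial>lborel)) \<le> sqrt (2 * (1 / 2) ^ k * B) * sqrt (l2sq lborel v)"
          using b by (intro always_eventually allI)
        have "(\<lambda>k. sqrt (2 * (1 / 2) ^ k * B) * sqrt (l2sq lborel v)) \<longlonglongrightarrow> sqrt (2 * 0 * B) * sqrt (l2sq lborel v)"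
          by (intro tendsto_intros LIMSEQ_power_zero) simp
        then show "(\<lambda>k. sqrt (2 * (1 / 2) ^ k * B) * sqrt (l2sq lborel v)) \<longlonglongrightarrow> 0" by simp
      qed
      from tendsto_diff[OF tendsto_const[of "\<integral>x. g (t, x) * v x \<partial>lborel"] this]
      show "(\<lambda>k. \<integral>x. S k x * v x \<partial>lborel) \<longlonglongrightarrow> (\<integral>x. g (t, x) * v x \<partial>lborel)" by simp
    qed
    then show ?case using gs by blast
  qed
  then show ?thesis using g(1) bound by blast
qed

lemma L2_norm_eq: "L2_norm M u = (if u \<in> square_integrable M then ennreal (sqrt (l2sq M u)) else \<infinity>)"
  by (simp add: L2_norm_def square_integrable_def l2sq_def)

lemma L2_eq: "L2 = square_integrable lborel"
  by (auto simp: L2_def L2_norm_eq)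

lemma level_diff:
  assumes "i \<noteq> j"
  shows "\<exists>k::int. k \<noteq> 0 \<and> level T i - level T j = 2 * of_int k"
  using assms by (intro exI[of _ "int i - int j"]) (auto simp: level_def)

text \<open>
  A distribution that depends on time and is given by a series of phases on all test functions is
  represented by the function of \<open>spacetime_series\<close>, since a convergent series has the same limit along
  every subsequence of partial sums.
\<close>
lemma spacetime_norm_le:
  fixes \<psi> :: "nat \<Rightarrow> 'a::euclidean_space \<Rightarrow> complex"
  assumes \<psi>: "\<And>n. \<psi> n \<in> square_integrable lborel"
    and le: "\<And>n. l2sq lborel (\<psi> n) \<le> b n" and b: "summable b" "suminf b \<le> B"
    and T: "\<And>t \<phi>. \<phi> \<in> schwartz \<Longrightarrow> (\<lambda>n. phase t (level TYPE('a) n) * (\<integral>x. \<psi> n x * \<phi> x \<partial>lborel)) sums T t \<phi>"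
  shows "spacetime_L2_norm {-pi..pi} T \<le> ennreal (sqrt (2 * pi * B))"
proof -
  have s: "summable (\<lambda>n. l2sq lborel (\<psi> n))"
    by (rule summable_comparison_test'[OF b(1), of 0]) (use le in simp)
  obtain g where bd: "g \<in> square_integrable (period_measure \<Otimes>\<^sub>M lborel) \<and>
    l2sq (period_measure \<Otimes>\<^sub>M lborel) g \<le> 2 * pi * (\<Sum>n. l2sq lborel (\<psi> n)) \<and>
    (AE t in period_measure. (\<lambda>x. g (t, x)) \<in> square_integrable lborel \<and>
      (\<forall>v\<in>square_integrable lborel. \<forall>z. (\<lambda>n. phase t (level TYPE('a) n) * (\<integral>x. \<psi> n x * v x \<partial>lborel)) sums z \<longrightarrow> (\<integral>x. g (t, x) * v x \<partial>lborel) = z))"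
    using spacetime_series[OF \<psi> s level_diff[where T = "TYPE('a)"]] by (rule exE)
  note g = conjunct1[OF bd] conjunct1[OF conjunct2[OF bd]] and ae = conjunct2[OF conjunct2[OF bd]]
  have "AE t in period_measure. represents (\<lambda>x. g (t, x)) (T t)"
    using ae
  proof eventually_elim
    case (elim t)
    then have gs: "(\<lambda>x. g (t, x)) \<in> square_integrable lborel" by (rule conjunct1)
    show ?case unfolding represents_def distr_of_def
    proof (intro conjI ballI)
      show "(\<lambda>x. g (t, x)) \<in> borel_measurable lborel" using gs by (rule square_integrableD(1))
      fix \<phi> :: "'a \<Rightarrow> complex" assume \<phi>: "\<phi> \<in> schwartz"
      note \<phi>s = schwartz_square_integrable[OF \<phi>]
      show "integrable lborel (\<lambda>x. g (t, x) * \<phi> x)" by (rule square_integrable_mult[OF gs \<phi>s])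
      show "T t \<phi> = (\<integral>x. g (t, x) * \<phi> x \<partial>lborel)"
        using elim[THEN conjunct2, rule_format, OF \<phi>s T[OF \<phi>]] by (rule sym)
    qed
  qed
  then have "spacetime_L2_norm {-pi..pi} T \<le> L2_norm (period_measure \<Otimes>\<^sub>M lborel) g"
    unfolding spacetime_L2_norm_def using square_integrableD(1)[OF g(1)] by (intro Inf_lower CollectI exI[of _ g] conjI refl)
  also have "\<dots> \<le> ennreal (sqrt (2 * pi * B))"
  proof -
    have "(\<Sum>n. l2sq lborel (\<psi> n)) \<le> B" using suminf_le[OF le s b(1)] b(2) by linarith
    then have "l2sq (period_measure \<Otimes>\<^sub>M lborel) g \<le> 2 * pi * B" using g(2) by (meson mult_left_mono order_trans pi_ge_zero mult_nonneg_nonneg zero_le_numeral)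
    then show ?thesis using g(1) by (simp add: L2_norm_eq ennreal_leI)
  qed
  finally show ?thesis .
qed

section \<open>The two smoothing estimates\<close>

lemma l2sq_brk:
  fixes f :: "'a::euclidean_space \<Rightarrow> complex"
  shows "l2sq lborel (brk t f) = weighted (2 * t) f"
  unfolding l2sq_def weighted_def
proof (rule Bochner_Integration.integral_cong[OF refl])
  fix x :: 'a
  have "(japanese_bracket x powr t)\<^sup>2 = japanese_bracket x powr (2 * t)" unfolding power2_eq_square powr_add[symmetric] by simp
  then show "(cmod (brk t f x))\<^sup>2 = japanese_bracket x powr (2 * t) * (cmod (f x))\<^sup>2"
    unfolding brk_def norm_mult power_mult_distrib by simp
qed

lemma brk_pairing: "(\<integral>x. f x * brk t g x \<partial>lborel) = (\<integral>x. brk t f x * g x \<partial>lborel)"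
  by (simp add: brk_def mult_ac)

lemma distr_mult_bracket: "distr_mult (\<lambda>x. 1 / japanese_bracket x powr t) S \<phi> = S (brk (- t) \<phi>)"
  unfolding distr_mult_def brk_def[abs_def] by (simp add: powr_minus_divide)

lemma proj_summable_const:
  fixes u :: "'a::euclidean_space \<Rightarrow> complex"
  assumes u: "u \<in> square_integrable lborel" and C: "C \<ge> 0"
  shows "summable (\<lambda>n. C * nsq (proj n u))" "(\<Sum>n. C * nsq (proj n u)) \<le> C * l2sq lborel u"
  using bessel_summable[OF u] by (auto simp: suminf_mult C intro: summable_mult mult_left_mono)

text \<open>
  The functional calculus is moved to the test function by duality, expanded there, and the
  projections are moved back to \<open>u\<close>.
\<close>
lemma sqrt_H_pow_exp_itH_series:
  fixes u \<eta> :: "'a::euclidean_space \<Rightarrow> complex"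
  assumes u: "u \<in> square_integrable lborel" and \<eta>: "\<eta> \<in> schwartz" and b: "b \<le> 2"
  shows "(\<lambda>n. phase t (level TYPE('a) n) * (of_real (level TYPE('a) n powr (b / 2)) * (\<integral>x. proj n u x * \<eta> x \<partial>lborel)))
    sums sqrt_H_pow b (exp_itH t (distr_of u)) \<eta>"
proof -
  let ?G = "\<lambda>l. complex_of_real (l powr (b / 2))" and ?E = "\<lambda>l. phase t l"
  note ut = square_integrable_testable[OF u] and \<eta>t = schwartz_testable[OF \<eta>]
  have G: "summable (\<lambda>n. cmod (?G (level TYPE('a) n)) * sqrt (nsq (proj n \<eta>)))"
  proof (rule schwartz_coefficients_summable[OF \<eta>, of _ 1 1])
    fix n
    have "level TYPE('a) n powr (b / 2) \<le> level TYPE('a) n powr 1" using b level_pos(1)[where 'a='a, of n] by (intro powr_mono) auto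
    then show "cmod (?G (level TYPE('a) n)) \<le> 1 * level TYPE('a) n ^ 1" using level_pos(3)[where 'a='a, of n] by simp
  qed
  define \<zeta> where "\<zeta> = H_fun ?G \<eta>"
  note \<zeta> = H_fun_series(1,3)[OF \<eta>t, of ?G, OF G, folded \<zeta>_def]
  have E: "summable (\<lambda>n. cmod (?E (level TYPE('a) n)) * sqrt (nsq (proj n \<zeta>)))"
    using G unfolding \<zeta>(2) nsq_scale by (simp add: real_sqrt_mult)
  have "(\<lambda>n. ?E (level TYPE('a) n) * (\<integral>x. u x * proj n \<zeta> x \<partial>lborel)) sums (\<integral>x. u x * H_fun ?E \<zeta> x \<partial>lborel)"
    by (rule H_fun_series(2)[OF square_integrable_testable[OF \<zeta>(1)] E u])
  moreover have "(\<integral>x. u x * proj n \<zeta> x \<partial>lborel) = ?G (level TYPE('a) n) * (\<integral>x. proj n u x * \<eta> x \<partial>lborel)" for n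
  proof -
    have "(\<integral>x. u x * proj n \<zeta> x \<partial>lborel) = (\<integral>x. ?G (level TYPE('a) n) * (u x * proj n \<eta> x) \<partial>lborel)" unfolding \<zeta>(2) by (simp only: mult_ac)
    then show ?thesis by (simp add: proj_symmetric[OF ut \<eta>t])
  qed
  ultimately show ?thesis by (simp add: sqrt_H_pow_def exp_itH_def H_fun_distr_def distr_of_def \<zeta>_def)
qed

text \<open>
  In the squared norm the power of the level is \<open>1/2 - 2\<epsilon>\<close> from the operator and \<open>-(1/2 - \<epsilon>)\<close> from the virial bound, in
  total \<open>-\<epsilon> \<le> 0\<close>.
\<close>
lemma smoothing_estimate:
  fixes \<epsilon> :: real
  assumes \<epsilon>: "0 < \<epsilon>" "\<epsilon> < 1 / 2"
  shows "\<exists>C>0. \<forall>u \<in> (square_integrable lborel :: ('a::euclidean_space \<Rightarrow> complex) set).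
      spacetime_L2_norm {-pi..pi}
        (\<lambda>t. distr_mult (\<lambda>x. 1 / japanese_bracket x powr (1/2 - \<epsilon>))
               (sqrt_H_pow (1/2 - 2 * \<epsilon>) (exp_itH t (distr_of u))))
      \<le> ennreal C * L2_norm lborel u"
proof -
  obtain D where D: "D > 0 \<and> (\<forall>n. \<forall>f\<in>(eigen n :: ('a \<Rightarrow> complex) set). weighted (- (1 - 2 * \<epsilon>)) f \<le> D * level TYPE('a) n powr (- (1 - 2 * \<epsilon>) / 2) * nsq f)"
    using eigen_weighted_bound[of "1 - 2 * \<epsilon>"] \<epsilon> by (auto simp del: minus_diff_eq)
  show ?thesis
  proof (intro exI[of _ "sqrt (2 * pi * D)"] conjI ballI)
    show "0 < sqrt (2 * pi * D)" using D by simp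
    fix u :: "'a \<Rightarrow> complex" assume u: "u \<in> square_integrable lborel"
    let ?b = "1/2 - 2 * \<epsilon>" and ?s = "1/2 - \<epsilon>"
    have P: "proj n u \<in> eigen n" for n by (rule proj_eigen_ip(1)[OF square_integrable_testable[OF u]])
    define \<psi> where "\<psi> n = (\<lambda>x. of_real (level TYPE('a) n powr (?b / 2)) * brk (- ?s) (proj n u) x)" for n
    have "spacetime_L2_norm {-pi..pi} (\<lambda>t. distr_mult (\<lambda>x. 1 / japanese_bracket x powr ?s) (sqrt_H_pow ?b (exp_itH t (distr_of u))))
      \<le> ennreal (sqrt (2 * pi * (D * l2sq lborel u)))"
    proof (rule spacetime_norm_le[of \<psi> "\<lambda>n. D * nsq (proj n u)"])
      show "\<psi> n \<in> square_integrable lborel" for n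
        unfolding \<psi>_def by (intro square_integrable_scale schwartz_square_integrable schwartz_brk eigen_schwartz[OF P])
      show "l2sq lborel (\<psi> n) \<le> D * nsq (proj n u)" for n
      proof -
        define l where "l = level TYPE('a) n"
        have l: "l \<ge> 1" unfolding l_def by (rule level_pos)
        have sq: "(cmod (of_real (l powr (?b / 2))))\<^sup>2 = l powr ?b"
          by (simp add: power2_eq_square powr_add[symmetric])
        have "l2sq lborel (\<psi> n) = l powr ?b * weighted (- (1 - 2 * \<epsilon>)) (proj n u)"
          unfolding \<psi>_def l2sq_scale l2sq_brk l_def[symmetric] sq by simp
        also have "\<dots> \<le> l powr ?b * (D * l powr (- (1 - 2 * \<epsilon>) / 2) * nsq (proj n u))"
          unfolding l_def using D P by (intro mult_left_mono) auto
        also have "\<dots> = l powr (?b + - (1 - 2 * \<epsilon>) / 2) * (D * nsq (proj n u))" unfolding powr_add by (simp only: mult_ac)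
        also have "\<dots> \<le> l powr 0 * (D * nsq (proj n u))"
          using l \<epsilon> D by (intro mult_right_mono powr_mono) (auto simp: field_simps)
        finally show ?thesis using l by simp
      qed
      show "summable (\<lambda>n. D * nsq (proj n u))" "(\<Sum>n. D * nsq (proj n u)) \<le> D * l2sq lborel u"
        using proj_summable_const[OF u, of D] D by auto
      fix t and \<phi> :: "'a \<Rightarrow> complex" assume \<phi>: "\<phi> \<in> schwartz"
      have "(\<integral>x. \<psi> n x * \<phi> x \<partial>lborel) = of_real (level TYPE('a) n powr (?b / 2)) * (\<integral>x. proj n u x * brk (- ?s) \<phi> x \<partial>lborel)" for n
        unfolding brk_pairing by (simp add: \<psi>_def mult.assoc)
      then show "(\<lambda>n. phase t (level TYPE('a) n) * (\<integral>x. \<psi> n x * \<phi> x \<partial>lborel)) sums distr_mult (\<lambda>x. 1 / japanese_bracket x powr ?s) (sqrt_H_pow ?b (exp_itH t (distr_of u))) \<phi>"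
        using sqrt_H_pow_exp_itH_series[OF u schwartz_brk[OF \<phi>, of "- ?s"], of ?b t] \<epsilon> by (simp add: distr_mult_bracket)
    qed
    also have "\<dots> = ennreal (sqrt (2 * pi * D)) * L2_norm lborel u"
      using u D by (simp add: L2_norm_eq real_sqrt_mult ennreal_mult[symmetric] mult_ac)
    finally show "spacetime_L2_norm {-pi..pi} (\<lambda>t. distr_mult (\<lambda>x. 1 / japanese_bracket x powr ?s) (sqrt_H_pow ?b (exp_itH t (distr_of u))))
      \<le> ennreal (sqrt (2 * pi * D)) * L2_norm lborel u" .
  qed
qed

lemma proj_eigen:
  fixes q :: "'a::euclidean_space \<Rightarrow> complex"
  assumes q: "q \<in> eigen n"
  shows "proj m q = (if m = n then q else (\<lambda>x. 0))"
proof (rule proj_unique[OF schwartz_testable[OF eigen_schwartz[OF q]]])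
  show "(if m = n then q else (\<lambda>x. 0)) \<in> eigen m" using q by (simp add: eigen_def eigenspace_zero)
  fix r :: "'a \<Rightarrow> complex" assume "r \<in> eigen m"
  then show "ip (if m = n then q else (\<lambda>x. 0)) r = ip q r" using eigen_orthogonal[OF q, of r m] by (auto simp: ip_def)
qed

text \<open>
  Test the representing function with conjugates of eigenfunctions, on which \<open>H\<^sup>s\<^sup>/\<^sup>2\<close> is a scalar.
  Bessel's inequality for \<open>g\<close> then bounds \<open>\<Sum> \<lambda>\<^sup>s \<parallel>P\<^sub>\<lambda> u\<parallel>\<^sup>2\<close> by the square of the Sobolev norm.
\<close>
lemma harmonic_sobolev_projections:
  fixes u g :: "'a::euclidean_space \<Rightarrow> complex"
  assumes u: "u \<in> square_integrable lborel" and g: "g \<in> square_integrable lborel"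
    and r: "represents g (sqrt_H_pow s (distr_of u))"
  shows "proj n g = (\<lambda>x. of_real (level TYPE('a) n powr (s / 2)) * proj n u x)"
proof (rule proj_unique[OF square_integrable_testable[OF g]])
  let ?G = "\<lambda>l. complex_of_real (l powr (s / 2))"
  note P = proj_eigen_ip(1)[OF square_integrable_testable[OF u], of n]
    proj_eigen_ip(2)[where n = n, OF square_integrable_testable[OF u]]
  show "(\<lambda>x. ?G (level TYPE('a) n) * proj n u x) \<in> eigen n" using P(1) unfolding eigen_def by (rule eigenspace_scale)
  fix q :: "'a \<Rightarrow> complex" assume q: "q \<in> eigen n"
  define q' where "q' = (\<lambda>x. cnj (q x))"
  have q': "q' \<in> eigen n" unfolding q'_def by (rule eigen_cnj[OF q])
  note S = eigen_schwartz[OF q']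
  have "summable (\<lambda>m. cmod (?G (level TYPE('a) m)) * sqrt (nsq (proj m q')))"
    by (rule summable_finite[of "{n}"]) (auto simp: proj_eigen[OF q'] nsq_def)
  from H_fun_series(2)[OF schwartz_testable[OF S] this u]
  have "(\<lambda>m. ?G (level TYPE('a) m) * (\<integral>x. u x * proj m q' x \<partial>lborel)) sums (\<integral>x. u x * H_fun ?G q' x \<partial>lborel)" .
  moreover have "(\<lambda>m. ?G (level TYPE('a) m) * (\<integral>x. u x * proj m q' x \<partial>lborel)) sums (?G (level TYPE('a) n) * (\<integral>x. u x * proj n q' x \<partial>lborel))"
    using sums_finite[of "{n}" "\<lambda>m. ?G (level TYPE('a) m) * (\<integral>x. u x * proj m q' x \<partial>lborel)"] by (simp add: proj_eigen[OF q'])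
  ultimately have "(\<integral>x. u x * H_fun ?G q' x \<partial>lborel) = ?G (level TYPE('a) n) * (\<integral>x. u x * proj n q' x \<partial>lborel)" by (rule sums_unique2)
  also have "proj n q' = q'" by (simp add: proj_eigen[OF q'])
  finally have "(\<integral>x. u x * H_fun ?G q' x \<partial>lborel) = ?G (level TYPE('a) n) * ip u q" by (simp add: ip_def q'_def)
  moreover have "ip g q = (\<integral>x. u x * H_fun ?G q' x \<partial>lborel)"
    using r S by (auto simp: represents_def ip_def q'_def distr_of_def sqrt_H_pow_def H_fun_distr_def)
  ultimately show "ip (\<lambda>x. ?G (level TYPE('a) n) * proj n u x) q = ip g q" by (simp add: ip_scale_left P(2)[OF q])
qed

lemma represents_unique:
  fixes m m' :: "'a::euclidean_space \<Rightarrow> complex"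
  assumes m: "represents m T" and m': "represents m' T"
  shows "AE x in lborel. m x = m' x"
proof -
  have [measurable]: "m \<in> borel_measurable borel" "m' \<in> borel_measurable borel" using m m' by (auto simp: represents_def)
  have i: "integrable lborel (\<lambda>x. m x * \<phi> x)" "integrable lborel (\<lambda>x. m' x * \<phi> x)" "(\<integral>x. m x * \<phi> x \<partial>lborel) = (\<integral>x. m' x * \<phi> x \<partial>lborel)" if "\<phi> \<in> schwartz" for \<phi>
    using m m' that by (auto simp: represents_def distr_of_def)
  have "AE x in lborel. m x - m' x = 0"
  proof (rule test_function_uniqueness)
    show "integrable lborel (\<lambda>x. (m x - m' x) * gaussian x)" using i[OF gaussian_schwartz] by (simp add: left_diff_distrib)
    fix v
    have "(\<lambda>x::'a. exp (\<i> * of_real (x \<bullet> v)) * gaussian x) \<in> schwartz" by (rule schwartz_char[OF gaussian_schwartz])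
    from i[OF this] show "(\<integral>x. (m x - m' x) * (exp (\<i> * of_real (x \<bullet> v)) * gaussian x) \<partial>lborel) = 0" by (simp add: left_diff_distrib)
  qed measurable
  then show ?thesis by simp
qed

text \<open>
  The eigenvalue of \<open>fourier\<close> on the \<open>n\<close>-th eigenspace.
\<close>
definition fourier_const :: "'a::euclidean_space itself \<Rightarrow> nat \<Rightarrow> complex" where
  "fourier_const _ n = of_real (gaussian_mass TYPE('a)) * (- \<i>) ^ n"

text \<open>
  The Fourier transform of \<open>e\<^sup>i\<^sup>t\<^sup>H u\<close> is the \<open>L\<^sup>2\<close> sum of the projections of \<open>u\<close> multiplied by the
  phases and the Fourier eigenvalues, all of constant modulus.
\<close>
lemma fourier_exp_itH_series:
  fixes u :: "'a::euclidean_space \<Rightarrow> complex"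
  assumes u: "u \<in> square_integrable lborel"
  obtains m where "m \<in> square_integrable lborel" "represents m (fourier_distr (exp_itH t (distr_of u)))"
    "\<And>v. v \<in> square_integrable lborel \<Longrightarrow>
       (\<lambda>n. phase t (level TYPE('a) n) * (fourier_const TYPE('a) n * (\<integral>x. proj n u x * v x \<partial>lborel))) sums (\<integral>x. m x * v x \<partial>lborel)"
proof -
  let ?E = "\<lambda>l. phase t l" and ?l = "level TYPE('a)" and ?c = "fourier_const TYPE('a)"
  note ut = square_integrable_testable[OF u]
  have P: "proj n u \<in> eigen n" for n by (rule proj_eigen_ip(1)[OF ut])
  define \<phi> where "\<phi> n = (\<lambda>x. (?E (?l n) * ?c n) * proj n u x)" for n
  have \<phi>e: "\<phi> n \<in> eigen n" for n using P unfolding \<phi>_def eigen_def by (rule eigenspace_scale)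
  have \<phi>s: "\<phi> n \<in> square_integrable lborel" for n by (rule schwartz_square_integrable[OF eigen_schwartz[OF \<phi>e]])
  have orth: "(\<integral>x. \<phi> i x * cnj (\<phi> j x) \<partial>lborel) = 0" if "i \<noteq> j" for i j
    using eigen_orthogonal[OF \<phi>e \<phi>e that] by (simp add: ip_def)
  have "l2sq lborel (\<phi> n) = (gaussian_mass TYPE('a))\<^sup>2 * nsq (proj n u)" for n
    unfolding \<phi>_def l2sq_scale l2sq_lborel by (simp add: fourier_const_def norm_mult norm_power)
  then have summ: "summable (\<lambda>n. l2sq lborel (\<phi> n))" using proj_summable_const(1)[OF u, of "(gaussian_mass TYPE('a))\<^sup>2"] by simp
  obtain m where m: "m \<in> square_integrable lborel" and le: "\<And>n. l2sq lborel (\<lambda>x. m x - (\<Sum>i<n. \<phi> i x)) \<le> (\<Sum>i. l2sq lborel (\<phi> (i + n)))"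
    by (rule orthogonal_series[OF \<phi>s orth summ], assumption, rule that; (assumption | blast))
  have weak: "(\<lambda>n. ?E (?l n) * (?c n * (\<integral>x. proj n u x * v x \<partial>lborel))) sums (\<integral>x. m x * v x \<partial>lborel)"
    if v: "v \<in> square_integrable lborel" for v
  proof -
    have "(\<integral>x. \<phi> n x * v x \<partial>lborel) = ?E (?l n) * (?c n * (\<integral>x. proj n u x * v x \<partial>lborel))" for n
      unfolding \<phi>_def mult.assoc by simp
    then show ?thesis using orthogonal_series_weak[OF \<phi>s m v summ le] by simp
  qed
  have "represents m (fourier_distr (exp_itH t (distr_of u)))"
    unfolding represents_def
  proof (intro conjI ballI)
    show "m \<in> borel_measurable lborel" using m by blast
    fix w :: "'a \<Rightarrow> complex" assume w: "w \<in> schwartz"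
    note ws = schwartz_square_integrable[OF w]
    show "integrable lborel (\<lambda>x. m x * w x)" by (rule square_integrable_mult[OF m ws])
    have pf: "proj n (fourier w) = (\<lambda>x. ?c n * proj n w x)" for n unfolding fourier_const_def by (rule proj_fourier[OF w])
    have "cmod (?E (?l n)) * sqrt (nsq (proj n (fourier w))) = gaussian_mass TYPE('a) * (cmod 1 * sqrt (nsq (proj n w)))" for n
      unfolding pf nsq_scale using gaussian_mass_pos[where 'a='a] by (simp add: fourier_const_def norm_mult norm_power real_sqrt_mult)
    moreover have "summable (\<lambda>n. cmod 1 * sqrt (nsq (proj n w)))"
      by (rule schwartz_coefficients_summable[OF w, of "\<lambda>_. 1" 1 0]) simp
    ultimately have "summable (\<lambda>n. cmod (?E (?l n)) * sqrt (nsq (proj n (fourier w))))" by (simp add: summable_mult)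
    from H_fun_series(2)[OF fourier_testable[OF w] this u]
    have "(\<lambda>n. ?E (?l n) * (\<integral>x. u x * proj n (fourier w) x \<partial>lborel)) sums (\<integral>x. u x * H_fun ?E (fourier w) x \<partial>lborel)" .
    moreover have "(\<integral>x. u x * proj n (fourier w) x \<partial>lborel) = ?c n * (\<integral>x. proj n u x * w x \<partial>lborel)" for n
    proof -
      have "(\<integral>x. u x * proj n (fourier w) x \<partial>lborel) = (\<integral>x. ?c n * (u x * proj n w x) \<partial>lborel)" unfolding pf by (simp only: mult_ac)
      then show ?thesis by (simp add: proj_symmetric[OF ut schwartz_testable[OF w]])
    qed
    ultimately show "fourier_distr (exp_itH t (distr_of u)) w = distr_of m w"
      using weak[OF ws] by (simp add: fourier_distr_def exp_itH_def H_fun_distr_def distr_of_def sums_unique2)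
  qed
  then show thesis using that m weak by blast
qed

text \<open>
  The function that the definition chooses to represent the Fourier transform agrees almost everywhere
  with the series of \<open>fourier_exp_itH_series\<close>. The symbol \<open>|\<xi>|\<^sup>a\<close> is moved to the test function, whose
  Fourier integral decays rapidly, so that the series can be integrated termwise; \<open>FT_exchange\<close> then
  moves the Fourier integral to the eigenfunctions.
\<close>
lemma sqrt_neg_laplacian_exp_itH_series:
  fixes u \<eta> :: "'a::euclidean_space \<Rightarrow> complex"
  assumes u: "u \<in> square_integrable lborel" and \<eta>: "\<eta> \<in> schwartz" and a: "a \<ge> 0"
  shows "(\<lambda>n. phase t (level TYPE('a) n) * (fourier_const TYPE('a) n / of_real ((2 * pi) ^ DIM('a)) *
      (\<integral>x. FT (\<lambda>\<xi>. of_real (norm \<xi> powr a) * proj n u \<xi>) x * \<eta> x \<partial>lborel)))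
    sums sqrt_neg_laplacian_pow a (exp_itH t (distr_of u)) \<eta>"
proof -
  let ?K = "complex_of_real ((2 * pi) ^ DIM('a))" and ?c = "fourier_const TYPE('a)"
  obtain m where m: "m \<in> square_integrable lborel" "represents m (fourier_distr (exp_itH t (distr_of u)))"
    and weak: "\<And>v. v \<in> square_integrable lborel \<Longrightarrow>
       (\<lambda>n. phase t (level TYPE('a) n) * (?c n * (\<integral>x. proj n u x * v x \<partial>lborel))) sums (\<integral>x. m x * v x \<partial>lborel)"
    using fourier_exp_itH_series[OF u] by blast
  define m' where "m' = (SOME m. represents m (fourier_distr (exp_itH t (distr_of u))))"
  have m': "represents m' (fourier_distr (exp_itH t (distr_of u)))" unfolding m'_def by (rule someI[of "\<lambda>m. represents m (fourier_distr (exp_itH t (distr_of u)))", OF m(2)])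
  have [measurable]: "m \<in> borel_measurable borel" "m' \<in> borel_measurable borel" using m m' by (auto simp: represents_def)
  have [measurable]: "FT \<eta> \<in> borel_measurable borel" by (rule FT_measurable[OF schwartz_measurable[OF \<eta>]])
  define v where "v = (\<lambda>\<xi>. (1 / ?K) * (of_real (norm \<xi> powr a) * FT \<eta> \<xi>))"
  have v: "v \<in> square_integrable lborel" unfolding v_def by (intro square_integrable_scale FT_norm_powr_square_integrable \<eta> a)
  have "sqrt_neg_laplacian_pow a (exp_itH t (distr_of u)) \<eta> = (\<integral>\<xi>. (of_real (norm \<xi> powr a) * m' \<xi>) * inv_fourier \<eta> \<xi> \<partial>lborel)"
    by (simp add: sqrt_neg_laplacian_pow_def inv_fourier_distr_def distr_of_def m'_def)
  also have "\<dots> = (\<integral>\<xi>. m' \<xi> * v \<xi> \<partial>lborel)" unfolding inv_fourier_eq_FT v_def by (simp add: mult_ac)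
  also have "\<dots> = (\<integral>\<xi>. m \<xi> * v \<xi> \<partial>lborel)"
    by (rule integral_cong_AE) (use represents_unique[OF m' m(2)] in \<open>auto simp: v_def\<close>)
  finally have "sqrt_neg_laplacian_pow a (exp_itH t (distr_of u)) \<eta> = (\<integral>\<xi>. m \<xi> * v \<xi> \<partial>lborel)" .
  moreover have "(\<integral>x. proj n u x * v x \<partial>lborel) = (1 / ?K) * (\<integral>x. FT (\<lambda>\<xi>. of_real (norm \<xi> powr a) * proj n u \<xi>) x * \<eta> x \<partial>lborel)" for n
  proof -
    have S: "proj n u \<in> schwartz" by (rule proj_schwartz[OF square_integrable_testable[OF u]])
    have "(\<integral>x. proj n u x * v x \<partial>lborel) = (\<integral>x. (1 / ?K) * ((of_real (norm x powr a) * proj n u x) * FT \<eta> x) \<partial>lborel)"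
      unfolding v_def by (simp only: mult_ac)
    also have "\<dots> = (1 / ?K) * (\<integral>x. (of_real (norm x powr a) * proj n u x) * FT \<eta> x \<partial>lborel)" by (rule integral_mult_right_zero)
    also have "(\<integral>x. (of_real (norm x powr a) * proj n u x) * FT \<eta> x \<partial>lborel) = (\<integral>x. FT (\<lambda>\<xi>. of_real (norm \<xi> powr a) * proj n u \<xi>) x * \<eta> x \<partial>lborel)"
      by (rule FT_exchange[OF schwartz_norm_powr_integrable(1)[OF S a] schwartz_integrable[OF \<eta>], symmetric])
    finally show ?thesis .
  qed
  ultimately show ?thesis using weak[OF v] by simp
qed

lemma brk_wnorm2:
  assumes m: "h \<in> borel_measurable borel" and le: "wnorm2 (\<lambda>x. japanese_bracket x powr (- p)) h \<le> ennreal B" and B: "B \<ge> 0"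
  shows "brk (- (p / 2)) h \<in> square_integrable lborel" "l2sq lborel (brk (- (p / 2)) h) \<le> B"
proof -
  have [measurable]: "h \<in> borel_measurable borel" by fact
  have bm: "brk (- (p / 2)) h \<in> borel_measurable lborel" unfolding brk_def[abs_def] by measurable
  have "(cmod (brk (- (p / 2)) h x))\<^sup>2 = japanese_bracket x powr (- p) * (cmod (h x))\<^sup>2" for x
  proof -
    have "(japanese_bracket x powr (- (p / 2)))\<^sup>2 = japanese_bracket x powr (- p)" unfolding power2_eq_square powr_add[symmetric] by simp
    then show ?thesis unfolding brk_def norm_mult power_mult_distrib by simp
  qed
  then have "(\<integral>\<^sup>+x. ennreal ((cmod (brk (- (p / 2)) h x))\<^sup>2) \<partial>lborel) \<le> ennreal B" using le by (simp add: wnorm2_def)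
  from square_integrableI_nn[OF bm this] B
  show "brk (- (p / 2)) h \<in> square_integrable lborel" "l2sq lborel (brk (- (p / 2)) h) \<le> B" by auto
qed

text \<open>
  For each eigenfunction \<open>fractional_laplacian_bound\<close> gives the power \<open>(d-1)/4 - \<epsilon>/2\<close> of the level, at most
  half of the Sobolev exponent \<open>(d-1)/2\<close>. The squares are summed by Bessel's inequality for \<open>g\<close>.
\<close>
lemma fractional_smoothing_estimate:
  fixes \<epsilon> :: real
  assumes d: "DIM('a::euclidean_space) \<ge> 2" and \<epsilon>: "0 < \<epsilon>" "\<epsilon> < 1 / 2"
  shows "\<exists>C>0. \<forall>u \<in> (square_integrable lborel :: ('a \<Rightarrow> complex) set). \<forall>g.
      represents g (sqrt_H_pow ((real DIM('a) - 1) / 2) (distr_of u)) \<longrightarrow>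
      spacetime_L2_norm {-pi..pi}
        (\<lambda>t. distr_mult (\<lambda>x. 1 / japanese_bracket x powr (1/2 - \<epsilon>))
               (sqrt_neg_laplacian_pow (real DIM('a) / 2 - 2 * \<epsilon>) (exp_itH t (distr_of u))))
      \<le> ennreal C * L2_norm lborel g"
proof -
  define p where "p = 1 - 2 * \<epsilon>"
  define a where "a = real DIM('a) / 2 - 2 * \<epsilon>"
  define s where "s = (real DIM('a) - 1) / 2"
  have p: "0 < p" "p < 1" using \<epsilon> by (auto simp: p_def)
  have a: "0 < a" "a < 2 * real DIM('a)" using d \<epsilon> by (auto simp: a_def)
  have s: "s \<ge> 0" using d by (simp add: s_def)
  obtain D where D: "D > 0 \<and> (\<forall>n. \<forall>f\<in>(eigen n :: ('a \<Rightarrow> complex) set).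
    wnorm2 (\<lambda>x. japanese_bracket x powr (- p)) (FT (\<lambda>\<xi>. of_real (norm \<xi> powr a) * f \<xi>))
      \<le> ennreal ((D * (level TYPE('a) n powr (a / 2 - p / 4) + 1) * sqrt (nsq f))\<^sup>2))"
    using fractional_laplacian_bound[OF a p] by (rule exE)
  note bd = D[THEN conjunct2, rule_format]
  let ?K = "(2 * pi) ^ DIM('a)" and ?gm = "gaussian_mass TYPE('a)"
  define A where "A = (?gm / ?K)\<^sup>2 * (2 * D)\<^sup>2"
  have A: "A > 0" using D gaussian_mass_pos[where 'a='a] by (simp add: A_def)
  show ?thesis
  proof (intro exI[of _ "sqrt (2 * pi * A)"] conjI ballI allI impI)
    show "0 < sqrt (2 * pi * A)" using A by simp
    fix u g :: "'a \<Rightarrow> complex" assume u: "u \<in> square_integrable lborel"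
      and r: "represents g (sqrt_H_pow ((real DIM('a) - 1) / 2) (distr_of u))"
    let ?L = "spacetime_L2_norm {-pi..pi} (\<lambda>t. distr_mult (\<lambda>x. 1 / japanese_bracket x powr (1/2 - \<epsilon>)) (sqrt_neg_laplacian_pow (real DIM('a) / 2 - 2 * \<epsilon>) (exp_itH t (distr_of u))))"
    show "?L \<le> ennreal (sqrt (2 * pi * A)) * L2_norm lborel g"
    proof (cases "g \<in> square_integrable lborel")
      case False
      then show ?thesis using A by (simp add: L2_norm_eq ennreal_mult_top)
    next
      case g: True
      have P: "proj n u \<in> eigen n" for n by (rule proj_eigen_ip(1)[OF square_integrable_testable[OF u]])
      define h where "h n = FT (\<lambda>\<xi>. of_real (norm \<xi> powr a) * proj n u \<xi>)" for n
      define \<psi> where "\<psi> n = (\<lambda>x. (fourier_const TYPE('a) n / of_real ?K) * brk (- (p / 2)) (h n) x)" for n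
      have hm: "h n \<in> borel_measurable borel" for n
      proof -
        have [measurable]: "proj n u \<in> borel_measurable borel" by (rule schwartz_measurable[OF eigen_schwartz[OF P]])
        show ?thesis unfolding h_def by (rule FT_measurable) measurable
      qed
      have nu: "level TYPE('a) n powr s * nsq (proj n u) = nsq (proj n g)" for n
      proof -
        have "(level TYPE('a) n powr (s / 2))\<^sup>2 = level TYPE('a) n powr s" unfolding power2_eq_square powr_add[symmetric] by simp
        then show ?thesis unfolding harmonic_sobolev_projections[OF u g r[folded s_def]] nsq_scale by simp
      qed
      have hb: "wnorm2 (\<lambda>x. japanese_bracket x powr (- p)) (h n) \<le> ennreal ((2 * D)\<^sup>2 * nsq (proj n g))" for n
      proof -
        define l where "l = level TYPE('a) n"
        have l: "l \<ge> 1" unfolding l_def by (rule level_pos)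
        have "l powr (a / 2 - p / 4) \<le> l powr (s / 2)" using l \<epsilon> by (intro powr_mono) (auto simp: a_def p_def s_def field_simps)
        moreover have "1 \<le> l powr (s / 2)" using l s by (intro ge_one_powr_ge_zero) auto
        ultimately have "D * (l powr (a / 2 - p / 4) + 1) * sqrt (nsq (proj n u)) \<le> D * (2 * l powr (s / 2)) * sqrt (nsq (proj n u))"
          using D by (intro mult_right_mono mult_left_mono) auto
        then have "(D * (l powr (a / 2 - p / 4) + 1) * sqrt (nsq (proj n u)))\<^sup>2 \<le> (D * (2 * l powr (s / 2)) * sqrt (nsq (proj n u)))\<^sup>2"
          using D by (intro power_mono) auto
        also have "\<dots> = (2 * D)\<^sup>2 * ((l powr (s / 2))\<^sup>2 * nsq (proj n u))" by (simp add: power_mult_distrib)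
        also have "(l powr (s / 2))\<^sup>2 = l powr s" unfolding power2_eq_square powr_add[symmetric] by simp
        finally have "ennreal ((D * (l powr (a / 2 - p / 4) + 1) * sqrt (nsq (proj n u)))\<^sup>2) \<le> ennreal ((2 * D)\<^sup>2 * nsq (proj n g))"
          unfolding l_def nu by (rule ennreal_leI)
        then show ?thesis using bd[OF P] unfolding h_def l_def by (rule order_trans[rotated])
      qed
      note hB = brk_wnorm2[OF hm hb]
      have "?L \<le> ennreal (sqrt (2 * pi * (A * l2sq lborel g)))"
      proof (rule spacetime_norm_le[of \<psi> "\<lambda>n. A * nsq (proj n g)"])
        show "\<psi> n \<in> square_integrable lborel" for n
          unfolding \<psi>_def by (intro square_integrable_scale hB) simp
        show "l2sq lborel (\<psi> n) \<le> A * nsq (proj n g)" for n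
        proof -
          have c: "cmod (fourier_const TYPE('a) n / of_real ?K) = ?gm / ?K"
            using gaussian_mass_pos[where 'a='a] by (simp add: fourier_const_def norm_mult norm_divide norm_power)
          have "l2sq lborel (\<psi> n) \<le> (?gm / ?K)\<^sup>2 * ((2 * D)\<^sup>2 * nsq (proj n g))"
            unfolding \<psi>_def l2sq_scale c by (intro mult_left_mono hB) simp_all
          then show ?thesis by (simp only: A_def mult.assoc)
        qed
        show "summable (\<lambda>n. A * nsq (proj n g))" "(\<Sum>n. A * nsq (proj n g)) \<le> A * l2sq lborel g"
          using proj_summable_const[OF g, of A] A by auto
        fix t and \<phi> :: "'a \<Rightarrow> complex" assume \<phi>: "\<phi> \<in> schwartz"
        have "(\<integral>x. \<psi> n x * \<phi> x \<partial>lborel) = fourier_const TYPE('a) n / of_real ?K * (\<integral>x. h n x * brk (- (p / 2)) \<phi> x \<partial>lborel)" for n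
          unfolding brk_pairing by (simp add: \<psi>_def mult.assoc)
        moreover have "1 / 2 - \<epsilon> = p / 2" by (simp add: p_def)
        ultimately show "(\<lambda>n. phase t (level TYPE('a) n) * (\<integral>x. \<psi> n x * \<phi> x \<partial>lborel)) sums
          distr_mult (\<lambda>x. 1 / japanese_bracket x powr (1/2 - \<epsilon>)) (sqrt_neg_laplacian_pow (real DIM('a) / 2 - 2 * \<epsilon>) (exp_itH t (distr_of u))) \<phi>"
          using sqrt_neg_laplacian_exp_itH_series[OF u schwartz_brk[OF \<phi>, of "- (p / 2)"], of a t, folded h_def] a
          by (simp only: distr_mult_bracket a_def[symmetric] less_imp_le)
      qed
      also have "\<dots> = ennreal (sqrt (2 * pi * A)) * L2_norm lborel g"
        using g A by (simp add: L2_norm_eq real_sqrt_mult ennreal_mult[symmetric] mult_ac)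
      finally show ?thesis .
    qed
  qed
qed

text \<open>
  The norm of a distribution is an infimum over representing functions, which is infinite if there are
  none; dividing by the finite constant turns an estimate for each of them into one for the infimum.
\<close>
lemma le_mult_distr_L2_norm:
  fixes T :: "'a::euclidean_space distr"
  assumes C: "C > 0" and le: "\<And>g. represents g T \<Longrightarrow> L \<le> ennreal C * L2_norm lborel g"
  shows "L \<le> ennreal C * distr_L2_norm T"
proof -
  have one: "ennreal C * ennreal (1 / C) = 1" using C by (simp add: ennreal_mult[symmetric])
  have "ennreal (1 / C) * L \<le> L2_norm lborel g" if "represents g T" for g
  proof -
    have "ennreal (1 / C) * L \<le> ennreal (1 / C) * (ennreal C * L2_norm lborel g)" by (intro mult_left_mono le that) simp
    also have "\<dots> = L2_norm lborel g" using one by (simp add: mult.assoc[symmetric] mult.commute)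
    finally show ?thesis .
  qed
  then have "ennreal (1 / C) * L \<le> distr_L2_norm T" unfolding distr_L2_norm_def by (intro Inf_greatest) auto
  then have "ennreal C * (ennreal (1 / C) * L) \<le> ennreal C * distr_L2_norm T" by (rule mult_left_mono) simp
  then show ?thesis using one by (simp add: mult.assoc[symmetric])
qed

theorem theorem1p5:
  fixes \<epsilon> :: real
  assumes "DIM('a::euclidean_space) \<ge> 2" and "0 < \<epsilon>" and "\<epsilon> < 1 / 2"
  shows "\<exists>C>0.
    (\<forall>u\<^sub>0 \<in> (L2 :: ('a \<Rightarrow> complex) set).
      spacetime_L2_norm {-pi..pi}
        (\<lambda>t. distr_mult (\<lambda>x. 1 / japanese_bracket x powr (1/2 - \<epsilon>))
               (sqrt_H_pow (1/2 - 2 * \<epsilon>) (exp_itH t (distr_of u\<^sub>0))))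
      \<le> ennreal C * L2_norm lborel u\<^sub>0) \<and>
    (\<forall>u\<^sub>0 \<in> (harmonic_sobolev ((real DIM('a) - 1) / 2) :: ('a \<Rightarrow> complex) set).
      spacetime_L2_norm {-pi..pi}
        (\<lambda>t. distr_mult (\<lambda>x. 1 / japanese_bracket x powr (1/2 - \<epsilon>))
               (sqrt_neg_laplacian_pow (real DIM('a) / 2 - 2 * \<epsilon>) (exp_itH t (distr_of u\<^sub>0))))
      \<le> ennreal C * harmonic_sobolev_norm ((real DIM('a) - 1) / 2) u\<^sub>0)"
proof -
  let ?L1 = "\<lambda>u. spacetime_L2_norm {-pi..pi} (\<lambda>t. distr_mult (\<lambda>x::'a. 1 / japanese_bracket x powr (1/2 - \<epsilon>)) (sqrt_H_pow (1/2 - 2 * \<epsilon>) (exp_itH t (distr_of u))))"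
  let ?L2 = "\<lambda>u. spacetime_L2_norm {-pi..pi} (\<lambda>t. distr_mult (\<lambda>x::'a. 1 / japanese_bracket x powr (1/2 - \<epsilon>)) (sqrt_neg_laplacian_pow (real DIM('a) / 2 - 2 * \<epsilon>) (exp_itH t (distr_of u))))"
  let ?s = "(real DIM('a) - 1) / 2"
  obtain C1 where C1: "C1 > 0 \<and> (\<forall>u\<in>(square_integrable lborel :: ('a \<Rightarrow> complex) set). ?L1 u \<le> ennreal C1 * L2_norm lborel u)"
    using smoothing_estimate[OF assms(2,3)] by (rule exE)
  obtain C2 where C2: "C2 > 0 \<and> (\<forall>u\<in>(square_integrable lborel :: ('a \<Rightarrow> complex) set). \<forall>g. represents g (sqrt_H_pow ?s (distr_of u)) \<longrightarrow> ?L2 u \<le> ennreal C2 * L2_norm lborel g)"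
    using fractional_smoothing_estimate[OF assms] by (rule exE)
  show ?thesis
  proof (intro exI[of _ "max C1 C2"] conjI ballI)
    show "0 < max C1 C2" by (rule less_le_trans[OF conjunct1[OF C1]]) simp
    fix u :: "'a \<Rightarrow> complex"
    {
      assume "u \<in> L2"
      then have "?L1 u \<le> ennreal C1 * L2_norm lborel u" using C1 unfolding L2_eq by blast
      also have "\<dots> \<le> ennreal (max C1 C2) * L2_norm lborel u" by (intro mult_right_mono ennreal_leI) auto
      finally show "?L1 u \<le> ennreal (max C1 C2) * L2_norm lborel u" .
    }
    assume "u \<in> harmonic_sobolev ?s"
    then have u: "u \<in> square_integrable lborel" by (simp add: harmonic_sobolev_def L2_eq)
    have "?L2 u \<le> ennreal C2 * harmonic_sobolev_norm ?s u"
      unfolding harmonic_sobolev_norm_def using C2 u by (intro le_mult_distr_L2_norm) blast+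
    also have "\<dots> \<le> ennreal (max C1 C2) * harmonic_sobolev_norm ?s u" by (intro mult_right_mono ennreal_leI) auto
    finally show "?L2 u \<le> ennreal (max C1 C2) * harmonic_sobolev_norm ?s u" .
  qed
qed

end
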